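(* Let $s>0$, $1\le p\le\infty$, $1\le q\le\infty$. Let $f=f^1\cdots f^d$, i.e. $f(x)=\prod_{\ell=1}^d f^\ell(x^\ell)$, be a probability density on $\mathbb{R}^d$ that is the product of its marginals $f^\ell$, let $A$ be an invertible $d\times d$ real matrix, and let $f_A(x)=|\det A^{-1}|\,f(A^{-1}x)$. Denote by $f_A^{\star\ell}$ the $\ell$-th one-dimensional marginal of $f_A$. (a) If $f\in L_p(\mathbb{R}^d)$, or if each $f^\ell$ belongs to $L_p(\mathbb{R})$, then $f_A$ and the product of its marginals $x\mapsto\prod_{\ell=1}^d f_A^{\star\ell}(x^\ell)$ belong to $L_p(\mathbb{R}^d)$. (b) $f$ and $f_A$ have the same Besov semi-norm up to a constant (which may depend on $A$ and on the Besov parameters, but not on $f$); that is, each of the two semi-norms is bounded by a constant times the other. Hence $f$ and $f_A$ belong to the same (inhomogeneous) Besov space: $f\in B_{spq}(\mathbb{R}^d)$ if and only if $f_A\in B_{spq}(\mathbb{R}^d)$.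
   Context: The marginal in dimension $\ell$ of a density $g$ on $\mathbb{R}^d$ is $g^{\star\ell}(x^\ell)=\int_{\mathbb{R}^{d-1}}g(x^1,\ldots,x^d)\,dx^1\cdots dx^{\ell-1}dx^{\ell+1}\cdots dx^d$. Besov spaces. For $f\in L_p(\mathbb{R}^d)$ and $h\in\mathbb{R}^d$ let $\Delta_hf(x)=f(x+h)-f(x)$ and $\Delta_h^kf=\Delta_h\Delta_h^{k-1}f$, $\Delta_h^0f=f$. For $|h|=1$ and $\delta\ge0$ let $\omega_h^k(f,\delta)_p=\sup_{|t|\le\delta}\|\Delta^k_{th}f\|_p$, and let $\Omega^k_{\mathbb{R}^d}(f,\delta)_p=\sup_{|h|=1,\,h\in\mathbb{R}^d}\omega_h^k(f,\delta)_p$. Let $(\varrho,k)$ be an admissible pair of nonnegative integers, i.e. $k>s-\varrho>0$. A function $f\in L_p(\mathbb{R}^d)$ belongs to $B_{spq}(\mathbb{R}^d)$ if it has generalized partial derivatives $f^{(n)}$ for all multi-indices $|n|\le\varrho$ and one of the following (equivalent) Besov semi-norms is finite: $$J'_{spq}(f)=\sum_{|n|=\varrho}\Bigl(\int_0^\infty\bigl|t^{-(s-\varrho)}\,\Omega^k_{\mathbb{R}^d}(f^{(n)},t)_p\bigr|^q\frac{dt}{t}\Bigr)^{1/q},\qquad J''_{spq}(f)=\Bigl(\int_0^\infty\bigl|t^{-(s-\varrho)}\,\Omega^k_{\mathbb{R}^d}(f^{(\varrho)},t)_p\bigr|^q\frac{dt}{t}\Bigr)^{1/q}$$ (with the usual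 supremum modification when $q=\infty$), where $\Omega^k_{\mathbb{R}^d}(f^{(\varrho)},t)_p=\sup_{|h|=1}\omega_h^k(f_h^{(\varrho)},t)_p$ and $f_h^{(\varrho)}=\sum_{|n|=\varrho}f^{(n)}h^n$. The space does not depend on the choice of admissible pair. *)

theory Defs
  imports "HOL-Analysis.Analysis" "HOL-Probability.Essential_Supremum"
begin

section \<open>Densities and marginals\<close>

definition prob_density :: "(real ^ 'n \<Rightarrow> real) \<Rightarrow> bool" where
  "prob_density f \<longleftrightarrow>
     f \<in> borel_measurable borel \<and> (\<forall>x. 0 \<le> f x) \<and> (\<integral>\<^sup>+ x. ennreal (f x) \<partial>lborel) = 1"

text \<open>The integral over the remaining coordinates is taken with respect to the product
  Lebesgue measure indexed by \<open>- {l}\<close>. In dimension one this index set is empty, the product measure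
  is a point mass, and the marginal is the function itself. As for every Bochner integral, the value
  is 0 where the slice is not integrable; for a density this concerns a null set of \<open>t\<close> only.\<close>

definition marginal :: "'n \<Rightarrow> (real ^ 'n \<Rightarrow> real) \<Rightarrow> real \<Rightarrow> real" where
  "marginal l g t =
     (\<integral> y. g (\<chi> i. if i = l then t else y i) \<partial>(\<Pi>\<^sub>M i\<in>- {l}. (lborel :: real measure)))"

definition marginal_product :: "(real ^ 'n \<Rightarrow> real) \<Rightarrow> real ^ 'n \<Rightarrow> real" where
  "marginal_product g x = (\<Prod>l\<in>UNIV. marginal l g (x $ l))"

definition product_density :: "(real ^ 'n \<Rightarrow> real) \<Rightarrow> bool" where
  "product_density f \<longleftrightarrow> prob_density f \<and> (\<forall>x. f x = marginal_product f x)"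

definition mixed_density :: "real ^ 'n ^ 'n \<Rightarrow> (real ^ 'n \<Rightarrow> real) \<Rightarrow> real ^ 'n \<Rightarrow> real" where
  "mixed_density A f x = \<bar>det (matrix_inv A)\<bar> * f (matrix_inv A *v x)"

section \<open>Lebesgue spaces\<close>

text \<open>Power of an extended nonnegative number, intended for exponents \<open>a > 0\<close>.\<close>

definition epowr :: "ennreal \<Rightarrow> real \<Rightarrow> ennreal" where
  "epowr x a = (if x = \<infinity> then \<infinity> else ennreal (enn2real x powr a))"

definition Lp_norm :: "ennreal \<Rightarrow> ('a::euclidean_space \<Rightarrow> real) \<Rightarrow> ennreal" where
  "Lp_norm p f =
     (if p = \<infinity> then esssup lborel (\<lambda>x. ennreal \<bar>f x\<bar>)
      else epowr (\<integral>\<^sup>+ x. ennreal (\<bar>f x\<bar> powr enn2real p) \<partial>lborel) (1 / enn2real p))"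

definition Lp_space :: "ennreal \<Rightarrow> ('a::euclidean_space \<Rightarrow> real) set" where
  "Lp_space p = {f. f \<in> borel_measurable borel \<and> Lp_norm p f < \<infinity>}"

section \<open>Generalized partial derivatives\<close>

definition partial_deriv :: "'n \<Rightarrow> (real ^ 'n \<Rightarrow> real) \<Rightarrow> real ^ 'n \<Rightarrow> real" where
  "partial_deriv i f x = frechet_derivative f (at x) (axis i 1)"

definition iter_partial :: "'n list \<Rightarrow> (real ^ 'n \<Rightarrow> real) \<Rightarrow> real ^ 'n \<Rightarrow> real" where
  "iter_partial is f = foldr partial_deriv is f"

definition test_function :: "(real ^ 'n \<Rightarrow> real) \<Rightarrow> bool" where
  "test_function \<phi> \<longleftrightarrow>
     (\<forall>is. iter_partial is \<phi> differentiable_on UNIV) \<and> compact (closure {x. \<phi> x \<noteq> 0})"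

definition locally_integrable :: "(real ^ 'n \<Rightarrow> real) \<Rightarrow> bool" where
  "locally_integrable f \<longleftrightarrow> (\<forall>K. compact K \<longrightarrow> set_integrable lborel K f)"

text \<open>A multi-index is a function \<open>n :: 'n \<Rightarrow> nat\<close>.\<close>

definition mi_order :: "('n::finite \<Rightarrow> nat) \<Rightarrow> nat" where
  "mi_order n = (\<Sum>i\<in>UNIV. n i)"

text \<open>The index type carries no order, so the classical derivative of a test function along the
  multi-index \<open>n\<close> is taken along any list of directions in which each \<open>i\<close> occurs \<open>n i\<close> times; mixed
  partial derivatives of smooth functions do not depend on the order of differentiation.\<close>

definition is_weak_deriv ::
    "('n \<Rightarrow> nat) \<Rightarrow> (real ^ 'n \<Rightarrow> real) \<Rightarrow> (real ^ 'n \<Rightarrow> real) \<Rightarrow> bool" where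
  "is_weak_deriv n f g \<longleftrightarrow>
     locally_integrable f \<and> locally_integrable g \<and>
     (\<forall>\<phi> is. test_function \<phi> \<and> (\<forall>i. count_list is i = n i) \<longrightarrow>
        (\<integral> x. f x * iter_partial is \<phi> x \<partial>lborel) = (-1) ^ mi_order n * (\<integral> x. g x * \<phi> x \<partial>lborel))"

text \<open>Generalized derivatives are unique up to null sets, and everything below depends on the chosen
  representative only through \<open>L\<^sub>p\<close> norms.\<close>

definition weak_deriv :: "('n \<Rightarrow> nat) \<Rightarrow> (real ^ 'n \<Rightarrow> real) \<Rightarrow> real ^ 'n \<Rightarrow> real" where
  "weak_deriv n f = (SOME g. is_weak_deriv n f g)"

definition has_weak_derivs :: "nat \<Rightarrow> (real ^ 'n \<Rightarrow> real) \<Rightarrow> bool" where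
  "has_weak_derivs r f \<longleftrightarrow> (\<forall>n. mi_order n \<le> r \<longrightarrow> (\<exists>g. is_weak_deriv n f g))"

text \<open>The plain sum of \<open>f\<^sup>(\<^sup>n\<^sup>) h\<^sup>n\<close> over the multi-indices of order \<open>r\<close>. There are no multinomial
  coefficients, so for \<open>r \<ge> 2\<close> this is not the iterated derivative in the direction \<open>h\<close>.\<close>

definition dir_weak_deriv :: "nat \<Rightarrow> real ^ 'n \<Rightarrow> (real ^ 'n \<Rightarrow> real) \<Rightarrow> real ^ 'n \<Rightarrow> real" where
  "dir_weak_deriv r h f x =
     (\<Sum>n | mi_order n = r. weak_deriv n f x * (\<Prod>i\<in>UNIV. (h $ i) ^ n i))"

section \<open>Besov spaces\<close>

definition fdiff :: "real ^ 'n \<Rightarrow> (real ^ 'n \<Rightarrow> real) \<Rightarrow> real ^ 'n \<Rightarrow> real" where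
  "fdiff h f x = f (x + h) - f x"

definition dir_modulus ::
    "nat \<Rightarrow> ennreal \<Rightarrow> real ^ 'n \<Rightarrow> (real ^ 'n \<Rightarrow> real) \<Rightarrow> real \<Rightarrow> ennreal" where
  "dir_modulus k p h f \<delta> = (SUP t\<in>{t. \<bar>t\<bar> \<le> \<delta>}. Lp_norm p ((fdiff (t *\<^sub>R h) ^^ k) f))"

definition modulus :: "nat \<Rightarrow> ennreal \<Rightarrow> (real ^ 'n \<Rightarrow> real) \<Rightarrow> real \<Rightarrow> ennreal" where
  "modulus k p f \<delta> = (SUP h\<in>{h. norm h = 1}. dir_modulus k p h f \<delta>)"

definition dir_deriv_modulus ::
    "nat \<Rightarrow> nat \<Rightarrow> ennreal \<Rightarrow> (real ^ 'n \<Rightarrow> real) \<Rightarrow> real \<Rightarrow> ennreal" where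
  "dir_deriv_modulus r k p f \<delta> =
     (SUP h\<in>{h. norm h = 1}. dir_modulus k p h (dir_weak_deriv r h f) \<delta>)"

definition besov_integral :: "real \<Rightarrow> ennreal \<Rightarrow> (real \<Rightarrow> ennreal) \<Rightarrow> ennreal" where
  "besov_integral \<sigma> q w =
     (if q = \<infinity> then (SUP t\<in>{0<..}. ennreal (t powr - \<sigma>) * w t)
      else epowr (\<integral>\<^sup>+ t\<in>{0<..}. epowr (ennreal (t powr - \<sigma>) * w t) (enn2real q) * ennreal (1 / t) \<partial>lborel)
             (1 / enn2real q))"

definition admissible :: "real \<Rightarrow> nat \<Rightarrow> nat \<Rightarrow> bool" where
  "admissible s r k \<longleftrightarrow> real k > s - real r \<and> s - real r > 0"

text \<open>The two semi-norms are meaningful for functions with generalized derivatives up to order \<open>r\<close>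
  (otherwise \<^const>\<open>weak_deriv\<close> is an arbitrary function).\<close>

definition besov_J1 ::
    "nat \<Rightarrow> nat \<Rightarrow> real \<Rightarrow> ennreal \<Rightarrow> ennreal \<Rightarrow> (real ^ 'n \<Rightarrow> real) \<Rightarrow> ennreal" where
  "besov_J1 r k s p q f =
     (\<Sum>n | mi_order n = r. besov_integral (s - real r) q (modulus k p (weak_deriv n f)))"

definition besov_J2 ::
    "nat \<Rightarrow> nat \<Rightarrow> real \<Rightarrow> ennreal \<Rightarrow> ennreal \<Rightarrow> (real ^ 'n \<Rightarrow> real) \<Rightarrow> ennreal" where
  "besov_J2 r k s p q f = besov_integral (s - real r) q (dir_deriv_modulus r k p f)"

definition besov_space ::
    "nat \<Rightarrow> nat \<Rightarrow> real \<Rightarrow> ennreal \<Rightarrow> ennreal \<Rightarrow> (real ^ 'n \<Rightarrow> real) set" where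
  "besov_space r k s p q =
     {f. f \<in> Lp_space p \<and> has_weak_derivs r f \<and>
         (besov_J1 r k s p q f < \<infinity> \<or> besov_J2 r k s p q f < \<infinity>)}"

end

theory Submission
  imports Defs "HOL-Computational_Algebra.Polynomial"
begin

text \<open>Everything except the comparison of \<open>J''\<close> with \<open>J'\<close> is a change of variables: generalized derivatives
  of \<open>x \<mapsto> f (B x)\<close> are linear combinations of the derivatives of \<open>f\<close> of the same order, so \<open>J'\<close>
  changes by at most a constant, and \<open>J''\<close> is at most a multiple of \<open>J'\<close>.

  For the bound of \<open>J'\<close> by \<open>J''\<close>, the functions \<open>f\<^sup>(\<^sup>n\<^sup>)\<close> are paired by duality with translates of a bump
  combination \<open>\<psi>\<close>. The correlations \<open>F n y = \<integral> f\<^sup>(\<^sup>n\<^sup>) (x + y) \<psi> x dx\<close> are the derivatives of one bounded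
  smooth function, and the norms become suprema. Let \<open>F\<close> be averaged over boxes of side about
  \<open>\<eta> t\<close>. Its \<open>k\<close>-fold oscillation is controlled by differences at scale \<open>\<eta> t\<close>. For the averaged
  part, Taylor's formula in all directions \<open>u\<close> compares the directional differences with the
  polynomial \<open>\<Sum>\<^sub>N c\<^sub>N u\<^sup>N F N\<close>, \<open>|N| = r + k\<close>, whose coefficients \<open>c\<^sub>N\<close> are positive; so every derivative of
  order \<open>r + k\<close> can be recovered by interpolation. Iterating over the scales \<open>\<eta>\<^sup>i t\<close> bounds the modulus
  entering \<open>J'\<close> by a geometric series of moduli entering \<open>J''\<close>, which a Hardy inequality sums.

  For the marginals, fixing all coordinates but one shows that a factor of a density in \<open>L\<^sub>p\<close> is in
  \<open>L\<^sub>p\<close>, and a marginal of the mixed density is an average of translated and rescaled copies of one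
  factor.\<close>

section \<open>Jets of bounded smooth functions\<close>

text \<open>A finite \<open>J''\<close> gives no a priori control of \<open>J'\<close>: the
  derivatives need not lie in any \<open>L\<^sub>p\<close> space, and a recursion that bounds the
  modulus at scale \<open>t\<close> by \<open>C1 * \<omega> + C0\<close> times the modulus at scale
  \<open>\<eta> * t\<close> says nothing while its last term may be infinite. This is the reason for
  the pairing. A density is integrable, so its correlation with a smooth function of compact support
  has bounded derivatives of every order, and the remainder left after \<open>m\<close> scales tends
  to 0 however large those bounds are. \<open>C0\<close> and \<open>C1\<close> see neither the
  density nor the test function, so the estimate survives the supremum over test functions. The same
  device treats all exponents alike, the end points included. The averaging step
  \<open>\<delta>\<close> and the Taylor step \<open>\<tau>\<close> are kept apart. Making
  \<open>\<tau>\<close> smaller by a factor of order \<open>\<eta> ^ k\<close> frees the Taylor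
  error of \<open>\<eta>\<close>. The price is a large constant in front of the directional modulus,
  which is harmless there.\<close>

definition inc :: "'n \<Rightarrow> ('n \<Rightarrow> nat) \<Rightarrow> 'n \<Rightarrow> nat" where
  "inc i n = n(i := Suc (n i))"

text \<open>Models the family of all partial derivatives of one smooth function. Indexing by multi-indices
  makes the mixed derivatives symmetric by construction.\<close>

definition jet :: "(('n::finite \<Rightarrow> nat) \<Rightarrow> real ^ 'n \<Rightarrow> real) \<Rightarrow> bool" where
  "jet F \<longleftrightarrow>
     (\<forall>n i y. ((\<lambda>t. F n (y + t *\<^sub>R axis i 1)) has_real_derivative F (inc i n) y) (at 0)) \<and>
     (\<forall>n. bounded (range (F n)))"

section \<open>Mean value and Taylor estimates along coordinate axes\<close>

lemma jet_deriv:
  assumes "jet F"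
  shows "((\<lambda>t. F n (y + t *\<^sub>R axis i 1)) has_real_derivative
            F (inc i n) (y + t *\<^sub>R axis i 1)) (at t)"
proof -
  have *: "((\<lambda>s. F n (y + t *\<^sub>R axis i 1 + s *\<^sub>R axis i 1)) has_real_derivative
            F (inc i n) (y + t *\<^sub>R axis i 1)) (at (t - t))"
    using assms unfolding jet_def by simp
  have "((\<lambda>s. s - t) has_real_derivative 1) (at t)"
    by (auto intro!: derivative_eq_intros)
  from DERIV_chain2[OF * this] show ?thesis
    by (simp add: algebra_simps)
qed

lemma jet_bounded: "jet F \<Longrightarrow> bounded (range (F n))"
  unfolding jet_def by blast

lemma jet_bound: "jet F \<Longrightarrow> \<exists>B. \<forall>z. \<bar>F n z\<bar> \<le> B"
  using jet_bounded[of F n] unfolding bounded_iff by auto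

text \<open>Mean value inequality for \<open>F n (y + t *\<^sub>R axis i 1) - t * c\<close>. The
  free slope \<open>c\<close> covers two uses: 0 gives a Lipschitz bound, the derivative at
  \<open>y\<close> or at a nearby point gives a first-order remainder.\<close>

lemma jet_step:
  assumes F: "jet F" and B: "\<And>s. \<bar>s\<bar> \<le> \<bar>t\<bar> \<Longrightarrow> \<bar>F (inc i n) (y + s *\<^sub>R axis i 1) - c\<bar> \<le> B"
  shows "\<bar>F n (y + t *\<^sub>R axis i 1) - F n y - t * c\<bar> \<le> \<bar>t\<bar> * B"
proof -
  have "norm ((F n (y + t *\<^sub>R axis i 1) - t * c) - (F n (y + 0 *\<^sub>R axis i 1) - 0 * c)) \<le> B * norm (t - 0)"
  proof (rule field_differentiable_bound[where S = "{-\<bar>t\<bar>..\<bar>t\<bar>}" and f = "\<lambda>t. F n (y + t *\<^sub>R axis i 1) - t * c"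
          and f' = "\<lambda>s. F (inc i n) (y + s *\<^sub>R axis i 1) - c"])
    fix s assume "s \<in> {-\<bar>t\<bar>..\<bar>t\<bar>}"
    then show "norm (F (inc i n) (y + s *\<^sub>R axis i 1) - c) \<le> B" using B[of s] by auto
    show "((\<lambda>t. F n (y + t *\<^sub>R axis i 1) - t * c) has_field_derivative F (inc i n) (y + s *\<^sub>R axis i 1) - c)
          (at s within {-\<bar>t\<bar>..\<bar>t\<bar>})"
      by (rule DERIV_subset[of _ _ _ UNIV]) (auto intro!: derivative_eq_intros jet_deriv[OF F])
  qed auto
  then show ?thesis by (simp add: mult.commute)
qed

lemma vec_expand: "(h :: real ^ 'n) = (\<Sum>i\<in>UNIV. (h $ i) *\<^sub>R axis i 1)"
  using basis_expansion[of h] by (simp add: scalar_mult_eq_scaleR)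

text \<open>Only derivatives along the axes are available, so the increment is telescoped along
  axis-parallel edges from \<open>y\<close> to \<open>y + v\<close>; hence the l1 norm of
  \<open>v\<close>.\<close>

lemma jet_path:
  fixes y :: "real ^ 'n"
  assumes F: "jet F" and B: "\<And>i z. \<bar>F (inc i n) z\<bar> \<le> B"
  shows "\<bar>F n (y + v) - F n y\<bar> \<le> (\<Sum>i\<in>UNIV. \<bar>v $ i\<bar>) * B"
proof -
  have "\<bar>F n (y + (\<Sum>i\<in>S. (v $ i) *\<^sub>R axis i 1)) - F n y\<bar> \<le> (\<Sum>i\<in>S. \<bar>v $ i\<bar>) * B" if "finite S" for S :: "'n set"
    using that
  proof (induction S rule: finite_induct)
    case (insert i S)
    define z where "z = y + (\<Sum>i\<in>S. (v $ i) *\<^sub>R axis i 1)"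
    have eq: "y + (\<Sum>i\<in>insert i S. (v $ i) *\<^sub>R axis i 1) = z + (v $ i) *\<^sub>R axis i 1"
      using insert by (simp add: z_def algebra_simps)
    have "\<bar>F n (z + (v $ i) *\<^sub>R axis i 1) - F n z - (v $ i) * 0\<bar> \<le> \<bar>v $ i\<bar> * B"
      by (rule jet_step[OF F]) (use B in auto)
    then show ?case unfolding eq using insert unfolding z_def[symmetric] by (simp add: algebra_simps)
  qed simp
  from this[of UNIV] show ?thesis using vec_expand[of v] by simp
qed

lemma sum_abs_vec_le: "(\<Sum>i\<in>UNIV. \<bar>(v :: real ^ 'n) $ i\<bar>) \<le> real CARD('n) * norm v"
  using sum_bounded_above[of UNIV "\<lambda>i. \<bar>v $ i\<bar>" "norm v"] component_le_norm_cart[of v] by simp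

lemma jet_fdiff_le:
  fixes y :: "real ^ 'n"
  assumes "jet F" and "\<And>i z. \<bar>F (inc i n) z\<bar> \<le> B"
  shows "\<bar>fdiff h (F n) y\<bar> \<le> real CARD('n) * norm h * B"
proof -
  have "0 \<le> B" using assms(2)[of undefined undefined] by linarith
  then have "(\<Sum>i\<in>UNIV. \<bar>h $ i\<bar>) * B \<le> real CARD('n) * norm h * B"
    by (intro mult_right_mono sum_abs_vec_le)
  then show ?thesis using jet_path[OF assms, of y h] by (simp add: fdiff_def)
qed

text \<open>The derivative along \<open>u\<close>, acting on whole families so that its powers are
  plain iterates and expand formally into the \<open>F N\<close>.\<close>

definition djet :: "real ^ 'n \<Rightarrow> (('n \<Rightarrow> nat) \<Rightarrow> real ^ 'n \<Rightarrow> real) \<Rightarrow> ('n \<Rightarrow> nat) \<Rightarrow> real ^ 'n \<Rightarrow> real" where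
  "djet u F n y = (\<Sum>i\<in>UNIV. u $ i * F (inc i n) y)"

text \<open>Along an axis-parallel path each edge contributes its slope at the starting point
  \<open>y\<close>, up to the oscillation of the first derivatives between \<open>y\<close> and that
  edge; second derivatives bound this oscillation by \<open>?d * B\<close>.\<close>

lemma jet_taylor:
  fixes y :: "real ^ 'n"
  assumes F: "jet F" and B: "\<And>i j z. \<bar>F (inc j (inc i n)) z\<bar> \<le> B"
  shows "\<bar>fdiff h (F n) y - djet h F n y\<bar> \<le> (real CARD('n) * norm h)\<^sup>2 * B"
proof -
  let ?d = "real CARD('n) * norm h"
  have B0: "0 \<le> B" using B[of undefined undefined undefined] by linarith
  have close: "\<bar>F (inc i n) (y + v) - F (inc i n) y\<bar> \<le> ?d * B"
    if "\<And>j. \<bar>v $ j\<bar> \<le> norm h" for v i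
  proof -
    have "(\<Sum>j\<in>UNIV. \<bar>v $ j\<bar>) \<le> ?d"
      using sum_bounded_above[of UNIV "\<lambda>i. \<bar>v $ i\<bar>" "norm h"] that by simp
    then have "(\<Sum>j\<in>UNIV. \<bar>v $ j\<bar>) * B \<le> ?d * B" using B0 by (rule mult_right_mono)
    then show ?thesis using jet_path[OF F B, of i y v] by linarith
  qed
  have "\<bar>F n (y + (\<Sum>i\<in>S. (h $ i) *\<^sub>R axis i 1)) - F n y - (\<Sum>i\<in>S. h $ i * F (inc i n) y)\<bar>
        \<le> (\<Sum>i\<in>S. \<bar>h $ i\<bar>) * (?d * B)" if "finite S" for S :: "'n set"
    using that
  proof (induction S rule: finite_induct)
    case (insert i S)
    define w where "w = (\<Sum>i\<in>S. (h $ i) *\<^sub>R axis i (1::real))"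
    \<comment> \<open>Each point of the path differs from \<open>y\<close> by a vector whose
      coordinates are at most \<open>norm h\<close>, and this coordinatewise bound is what
      \<open>close\<close> asks for.\<close>
    have wc: "w $ j = (if j \<in> S then h $ j else 0)" for j
      unfolding w_def using insert(1)
      by (simp add: sum_component axis_def if_distrib[of "\<lambda>x. _ * x"] cong: if_cong)
    have eq: "y + (\<Sum>i\<in>insert i S. (h $ i) *\<^sub>R axis i 1) = (y + w) + (h $ i) *\<^sub>R axis i 1"
      using insert by (simp add: w_def algebra_simps)
    have "\<bar>F n ((y + w) + (h $ i) *\<^sub>R axis i 1) - F n (y + w) - (h $ i) * F (inc i n) y\<bar> \<le> \<bar>h $ i\<bar> * (?d * B)"
    proof (rule jet_step[OF F])
      fix s assume s: "\<bar>s\<bar> \<le> \<bar>h $ i\<bar>"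
      show "\<bar>F (inc i n) (y + w + s *\<^sub>R axis i 1) - F (inc i n) y\<bar> \<le> ?d * B"
      proof -
        have "\<bar>(w + s *\<^sub>R axis i 1) $ j\<bar> \<le> norm h" for j
          using wc[of j] insert(2) s component_le_norm_cart[of h j]
          by (auto simp: axis_def intro: order_trans)
        from close[OF this] show ?thesis by (simp add: add.assoc)
      qed
    qed
    moreover have "\<bar>F n (y + w) - F n y - (\<Sum>i\<in>S. h $ i * F (inc i n) y)\<bar> \<le> (\<Sum>i\<in>S. \<bar>h $ i\<bar>) * (?d * B)"
      using insert(3) unfolding w_def .
    moreover have "(\<Sum>i\<in>insert i S. h $ i * F (inc i n) y) = h $ i * F (inc i n) y + (\<Sum>i\<in>S. h $ i * F (inc i n) y)"
      "(\<Sum>i\<in>insert i S. \<bar>h $ i\<bar>) * (?d * B) = \<bar>h $ i\<bar> * (?d * B) + (\<Sum>i\<in>S. \<bar>h $ i\<bar>) * (?d * B)"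
      using insert by (simp_all add: distrib_right)
    ultimately show ?case unfolding eq by linarith
  qed simp
  from this[of UNIV] have "\<bar>fdiff h (F n) y - djet h F n y\<bar> \<le> (\<Sum>i\<in>UNIV. \<bar>h $ i\<bar>) * (?d * B)"
    using vec_expand[of h] by (simp add: fdiff_def djet_def)
  also have "\<dots> \<le> ?d * (?d * B)"
    using B0 by (intro mult_right_mono sum_abs_vec_le) auto
  finally show ?thesis by (simp add: power2_eq_square algebra_simps)
qed

section \<open>Operations that preserve jets\<close>

lemma jet_add: "jet F \<Longrightarrow> jet G \<Longrightarrow> jet (\<lambda>n y. F n y + G n y)"
  unfolding jet_def by (auto intro!: derivative_eq_intros bounded_plus_comp)

lemma jet_cmult: "jet F \<Longrightarrow> jet (\<lambda>n y. c * F n y)"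
proof -
  assume F: "jet F"
  have "((\<lambda>t. c * F n (y + t *\<^sub>R axis i 1)) has_real_derivative c * F (inc i n) y) (at 0)" for n i y
    using F unfolding jet_def by (intro DERIV_cmult) blast
  moreover have "bounded (range (\<lambda>y. c * F n y))" for n
    using bounded_scaling[OF jet_bounded[OF F, of n], of c] by (simp add: image_image)
  ultimately show ?thesis unfolding jet_def by blast
qed

lemma jet_zero: "jet (\<lambda>n y. 0)"
  unfolding jet_def by auto

lemma jet_sum: "finite S \<Longrightarrow> (\<And>x. x \<in> S \<Longrightarrow> jet (F x)) \<Longrightarrow> jet (\<lambda>n y. \<Sum>x\<in>S. F x n y)"
  by (induction S rule: finite_induct) (auto intro: jet_zero jet_add)

lemma jet_diff: "jet F \<Longrightarrow> jet G \<Longrightarrow> jet (\<lambda>n y. F n y - G n y)"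
  using jet_add[of F "\<lambda>n y. (-1) * G n y"] jet_cmult[of G "-1"] by simp

lemma jet_shift: "jet F \<Longrightarrow> jet (\<lambda>n y. F n (y + h))"
proof -
  assume F: "jet F"
  have "((\<lambda>t. F n (y + t *\<^sub>R axis i 1 + h)) has_real_derivative F (inc i n) (y + h)) (at 0)" for n i y
    using jet_deriv[OF F, of n "y + h" i 0] by (simp add: algebra_simps)
  moreover have "bounded (range (\<lambda>y. F n (y + h)))" for n
    by (rule bounded_subset[OF jet_bounded[OF F, of n]]) auto
  ultimately show ?thesis unfolding jet_def by blast
qed

lemma jet_fdiff: "jet F \<Longrightarrow> jet (\<lambda>n. fdiff h (F n))"
  unfolding fdiff_def by (intro jet_diff jet_shift)

lemma jet_fdiffs: "jet F \<Longrightarrow> jet (\<lambda>n. foldr fdiff hs (F n))"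
proof (induction hs)
  case (Cons h hs)
  then show ?case using jet_fdiff[of "\<lambda>n. foldr fdiff hs (F n)"] by simp
qed simp

lemma jet_inc: "jet F \<Longrightarrow> jet (\<lambda>n. F (inc i n))"
proof -
  assume F: "jet F"
  have "((\<lambda>t. F (inc i n) (y + t *\<^sub>R axis j 1)) has_real_derivative F (inc i (inc j n)) y) (at 0)" for n j y
  proof -
    have "inc j (inc i n) = inc i (inc j n)"
      by (auto simp: fun_eq_iff inc_def)
    then show ?thesis using jet_deriv[OF F, of "inc i n" y j 0] by simp
  qed
  then show ?thesis using jet_bounded[OF F] unfolding jet_def by blast
qed

lemma jet_djet: "jet F \<Longrightarrow> jet (djet u F)"
  unfolding djet_def[abs_def] by (intro jet_sum finite jet_cmult jet_inc)

text \<open>Bounded derivatives of the next order make \<open>F n\<close> Lipschitz.\<close>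

lemma jet_continuous: "jet F \<Longrightarrow> continuous_on UNIV (F n)"
proof -
  assume F: "jet F"
  have "\<exists>B. \<forall>i z. \<bar>F (inc i n) z\<bar> \<le> B"
  proof -
    have "\<exists>B. \<forall>i z. \<bar>F (inc i n) z\<bar> \<le> B i"
      using jet_bound[OF F] by (intro choice allI)
    then obtain B where B: "\<And>i z. \<bar>F (inc i n) z\<bar> \<le> B i" by blast
    have "\<bar>F (inc i n) z\<bar> \<le> (\<Sum>i\<in>UNIV. \<bar>B i\<bar>)" for i z
      using B[of i z] member_le_sum[of i UNIV "\<lambda>i. \<bar>B i\<bar>"] by simp
    then show ?thesis by blast
  qed
  then obtain B where B: "\<And>i z. \<bar>F (inc i n) z\<bar> \<le> B" by blast
  have "(\<lambda>x. F n x) \<midarrow>y\<rightarrow> F n y" for y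
  proof -
    have "((\<lambda>x. F n x - F n y) \<longlongrightarrow> 0) (at y)"
    proof (rule Lim_null_comparison)
      show "\<forall>\<^sub>F x in at y. norm (F n x - F n y) \<le> real CARD('a) * norm (x - y) * B"
        using jet_fdiff_le[OF F B, of "_ - y" y] by (auto simp: fdiff_def)
      show "((\<lambda>x. real CARD('a) * norm (x - y) * B) \<longlongrightarrow> 0) (at y)"
        by (auto intro!: tendsto_eq_intros)
    qed
    then show ?thesis by (simp add: LIM_zero_iff)
  qed
  then show ?thesis by (simp add: continuous_on_def)
qed

lemma jet_borel[measurable]: "jet F \<Longrightarrow> F n \<in> borel_measurable borel"
  by (simp add: borel_measurable_continuous_onI jet_continuous)

lemma jet_integrable:
  fixes F :: "('n::finite \<Rightarrow> nat) \<Rightarrow> real ^ 'n \<Rightarrow> real"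
  assumes F: "jet F" and w: "integrable M w" and [measurable]: "\<theta> \<in> borel_measurable M"
  shows "integrable M (\<lambda>x. w x * F n (y + \<theta> x))"
proof -
  obtain B where B: "\<And>z. \<bar>F n z\<bar> \<le> B" using jet_bound[OF F] by blast
  note [measurable] = jet_borel[OF F] borel_measurable_integrable[OF w]
  have B0: "0 \<le> B" using B[of 0] by linarith
  show ?thesis
  proof (rule Bochner_Integration.integrable_bound)
    show "integrable M (\<lambda>x. B * w x)" using w by simp
    show "AE x in M. norm (w x * F n (y + \<theta> x)) \<le> norm (B * w x)"
      using B B0 by (intro AE_I2) (simp add: abs_mult mult.commute[of B] mult_left_mono)
  qed measurable
qed

text \<open>Quadratic remainder bounds survive integration against an integrable weight, so this
  criterion allows differentiation under the integral without passing to a limit there.\<close>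

lemma has_derivative_of_quadratic:
  fixes f :: "real \<Rightarrow> real"
  assumes "\<And>t. \<bar>f t - f 0 - t * D\<bar> \<le> t\<^sup>2 * K"
  shows "(f has_real_derivative D) (at 0)"
proof -
  have "((\<lambda>t. (f (0 + t) - f 0) / t - D) \<longlongrightarrow> 0) (at 0)"
  proof (rule Lim_null_comparison)
    show "\<forall>\<^sub>F t in at 0. norm ((f (0 + t) - f 0) / t - D) \<le> \<bar>t\<bar> * K"
      unfolding eventually_at_filter
    proof (rule always_eventually, intro allI impI)
      fix t :: real assume t: "t \<noteq> 0"
      have "\<bar>(f (0 + t) - f 0) / t - D\<bar> = \<bar>f t - f 0 - t * D\<bar> / \<bar>t\<bar>"
        using t by (simp add: abs_divide[symmetric] diff_divide_distrib)
      also have "\<dots> \<le> t\<^sup>2 * K / \<bar>t\<bar>" using assms[of t] by (intro divide_right_mono) auto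
      also have "\<dots> = \<bar>t\<bar> * K" using t by (simp add: field_simps power2_eq_square)
      finally show "norm ((f (0 + t) - f 0) / t - D) \<le> \<bar>t\<bar> * K" by simp
    qed
    show "((\<lambda>t. \<bar>t\<bar> * K) \<longlongrightarrow> 0) (at 0)" by (auto intro!: tendsto_eq_intros)
  qed
  then show ?thesis unfolding DERIV_def by (simp add: LIM_zero_iff)
qed

text \<open>One constant \<open>K\<close> bounds the second derivatives, so the first-order
  remainders at all translates are at most \<open>t\<^sup>2 * K\<close> and integrate to a quadratic
  remainder. Segment averages (\<open>w\<close> an indicator) and correlations
  (\<open>w = f\<close>, \<open>\<theta> x = - x\<close>) are both of this form.\<close>

lemma jet_average:
  fixes F :: "('n::finite \<Rightarrow> nat) \<Rightarrow> real ^ 'n \<Rightarrow> real"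
  assumes F: "jet F" and w: "integrable M w" and \<theta>[measurable]: "\<theta> \<in> borel_measurable M"
  shows "jet (\<lambda>n y. \<integral>x. w x * F n (y + \<theta> x) \<partial>M)"
  unfolding jet_def
proof (intro conjI allI)
  note int = jet_integrable[OF F w \<theta>]
  note wa = integrable_abs[OF w]
  fix n :: "'n \<Rightarrow> nat"
  obtain B where B: "\<And>z. \<bar>F n z\<bar> \<le> B" using jet_bound[OF F] by blast
  have "\<bar>\<integral>x. w x * F n (y + \<theta> x) \<partial>M\<bar> \<le> (\<integral>x. \<bar>w x\<bar> * B \<partial>M)" for y
    using wa B by (intro order_trans[OF integral_abs_bound] integral_mono integrable_abs int)
      (auto simp: abs_mult intro!: mult_left_mono)
  then show "bounded (range (\<lambda>y. \<integral>x. w x * F n (y + \<theta> x) \<partial>M))"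
    unfolding bounded_iff by auto
  fix i y
  let ?n1 = "inc i n" let ?n2 = "inc i ?n1"
  obtain K where K: "\<And>z. \<bar>F ?n2 z\<bar> \<le> K" using jet_bound[OF F] by blast
  have q: "\<bar>F n (z + t *\<^sub>R axis i 1) - F n z - t * F ?n1 z\<bar> \<le> t\<^sup>2 * K" for z t
  proof -
    have "\<bar>F n (z + t *\<^sub>R axis i 1) - F n z - t * F ?n1 z\<bar> \<le> \<bar>t\<bar> * (\<bar>t\<bar> * K)"
    proof (rule jet_step[OF F])
      fix s assume s: "\<bar>s\<bar> \<le> \<bar>t\<bar>"
      have "\<bar>F ?n1 (z + s *\<^sub>R axis i 1) - F ?n1 z - s * 0\<bar> \<le> \<bar>s\<bar> * K"
        by (rule jet_step[OF F]) (use K in auto)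
      also have "\<dots> \<le> \<bar>t\<bar> * K" using s K[of 0] by (intro mult_right_mono) auto
      finally show "\<bar>F ?n1 (z + s *\<^sub>R axis i 1) - F ?n1 z\<bar> \<le> \<bar>t\<bar> * K" by simp
    qed
    then show ?thesis by (simp add: power2_eq_square)
  qed
  show "((\<lambda>t. \<integral>x. w x * F n (y + t *\<^sub>R axis i 1 + \<theta> x) \<partial>M) has_real_derivative
          (\<integral>x. w x * F ?n1 (y + \<theta> x) \<partial>M)) (at 0)"
  proof (rule has_derivative_of_quadratic)
    fix t
    have "(\<integral>x. w x * F n (y + t *\<^sub>R axis i 1 + \<theta> x) \<partial>M) - (\<integral>x. w x * F n (y + 0 *\<^sub>R axis i 1 + \<theta> x) \<partial>M)
          - t * (\<integral>x. w x * F ?n1 (y + \<theta> x) \<partial>M)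
        = (\<integral>x. w x * F n (y + t *\<^sub>R axis i 1 + \<theta> x) - w x * F n (y + 0 *\<^sub>R axis i 1 + \<theta> x) - t * (w x * F ?n1 (y + \<theta> x)) \<partial>M)"
      using int by simp
    also have "\<bar>\<dots>\<bar> \<le> (\<integral>x. \<bar>w x\<bar> * (t\<^sup>2 * K) \<partial>M)"
    proof (intro order_trans[OF integral_abs_bound] integral_mono)
      fix x
      have "\<bar>w x * F n (y + t *\<^sub>R axis i 1 + \<theta> x) - w x * F n (y + 0 *\<^sub>R axis i 1 + \<theta> x) - t * (w x * F ?n1 (y + \<theta> x))\<bar>
           = \<bar>w x\<bar> * \<bar>F n ((y + \<theta> x) + t *\<^sub>R axis i 1) - F n (y + \<theta> x) - t * F ?n1 (y + \<theta> x)\<bar>"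
        unfolding abs_mult[symmetric] by (simp add: algebra_simps)
      also have "\<dots> \<le> \<bar>w x\<bar> * (t\<^sup>2 * K)" by (intro mult_left_mono q) auto
      finally show "\<bar>w x * F n (y + t *\<^sub>R axis i 1 + \<theta> x) - w x * F n (y + 0 *\<^sub>R axis i 1 + \<theta> x) - t * (w x * F ?n1 (y + \<theta> x))\<bar>
        \<le> \<bar>w x\<bar> * (t\<^sup>2 * K)" .
    qed (use int wa in \<open>simp_all\<close>)
    also have "\<dots> = t\<^sup>2 * ((\<integral>x. \<bar>w x\<bar> \<partial>M) * K)" by simp
    finally show "\<bar>(\<integral>x. w x * F n (y + t *\<^sub>R axis i 1 + \<theta> x) \<partial>M) - (\<integral>x. w x * F n (y + 0 *\<^sub>R axis i 1 + \<theta> x) \<partial>M)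
          - t * (\<integral>x. w x * F ?n1 (y + \<theta> x) \<partial>M)\<bar> \<le> t\<^sup>2 * ((\<integral>x. \<bar>w x\<bar> \<partial>M) * K)" .
  qed
qed

section \<open>Averages and iterated differences\<close>

text \<open>Averages are Bochner integrals and linear only where the integrals exist. This class
  guarantees existence and is stable under shifts, differences, averages and finite linear
  combinations.\<close>

definition bounded_borel :: "(real ^ 'n \<Rightarrow> real) \<Rightarrow> bool" where
  "bounded_borel f \<longleftrightarrow> f \<in> borel_measurable borel \<and> bounded (range f)"

lemma jet_bounded_borel: "jet F \<Longrightarrow> bounded_borel (F n)"
  by (simp add: bounded_borel_def jet_borel jet_bounded)

lemma bounded_borel_bound: "bounded_borel f \<Longrightarrow> \<exists>B\<ge>0. \<forall>z. \<bar>f z\<bar> \<le> B"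
  unfolding bounded_borel_def bounded_iff by (auto, meson abs_ge_zero order_trans)

lemma bounded_borelI: "f \<in> borel_measurable borel \<Longrightarrow> (\<And>z. \<bar>f z\<bar> \<le> B) \<Longrightarrow> bounded_borel f"
  unfolding bounded_borel_def bounded_iff by auto

lemma bounded_borel_fdiff: assumes "bounded_borel f" shows "bounded_borel (fdiff h f)"
proof -
  obtain B where "\<And>z. \<bar>f z\<bar> \<le> B" using bounded_borel_bound[OF assms] by blast
  then have "\<bar>fdiff h f z\<bar> \<le> 2 * B" for z unfolding fdiff_def using abs_triangle_ineq4[of "f (z + h)" "f z"] by (metis add_mono mult_2 order_trans)
  moreover have [measurable]: "f \<in> borel_measurable borel" using assms by (simp add: bounded_borel_def)
  have "fdiff h f \<in> borel_measurable borel" unfolding fdiff_def by measurable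
  ultimately show ?thesis by (blast intro: bounded_borelI)
qed

lemma bounded_borel_lincomb: assumes "finite S" "\<And>s. s \<in> S \<Longrightarrow> bounded_borel (f s)" shows "bounded_borel (\<lambda>y. \<Sum>s\<in>S. c s * f s y)"
proof -
  have "\<exists>B. \<forall>s\<in>S. \<forall>z. \<bar>f s z\<bar> \<le> B s"
    using bounded_borel_bound[OF assms(2)] by (intro bchoice) blast
  then obtain B where B: "\<And>s z. s \<in> S \<Longrightarrow> \<bar>f s z\<bar> \<le> B s" by blast
  show ?thesis
  proof (rule bounded_borelI)
    show "(\<lambda>y. \<Sum>s\<in>S. c s * f s y) \<in> borel_measurable borel"
      using assms(2) by (intro borel_measurable_sum borel_measurable_times) (auto simp: bounded_borel_def)
    show "\<bar>\<Sum>s\<in>S. c s * f s z\<bar> \<le> (\<Sum>s\<in>S. \<bar>c s\<bar> * B s)" for z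
      by (rule order_trans[OF sum_abs sum_mono]) (auto simp: abs_mult B intro: mult_left_mono)
  qed
qed

text \<open>The mean over the segment from \<open>y\<close> to
  \<open>y + \<delta> *\<^sub>R axis j 1\<close>. It is one-sided so that the average of a
  derivative is exactly a forward difference quotient.\<close>

definition avgf :: "real \<Rightarrow> 'n \<Rightarrow> (real ^ 'n \<Rightarrow> real) \<Rightarrow> real ^ 'n \<Rightarrow> real" where
  "avgf \<delta> j f y = (\<integral>x. indicat_real {0..1} x * f (y + (\<delta> * x) *\<^sub>R axis j 1) \<partial>lborel)"

lemma avgf_integrable:
  assumes "bounded_borel f"
  shows "integrable lborel (\<lambda>x. indicat_real {0..1} x * f (y + (\<delta> * x) *\<^sub>R axis j 1))"
proof -
  obtain B where B: "B \<ge> 0" "\<And>z. \<bar>f z\<bar> \<le> B" using bounded_borel_bound[OF assms] by blast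
  have [measurable]: "f \<in> borel_measurable borel" using assms by (simp add: bounded_borel_def)
  show ?thesis
  proof (rule Bochner_Integration.integrable_bound)
    show "integrable lborel (\<lambda>x::real. indicat_real {0..1} x * B)"
      by (intro integrable_mult_left) (simp add: integrable_indicator_iff)
    show "AE x in lborel. norm (indicat_real {0..1} x * f (y + (\<delta> * x) *\<^sub>R axis j 1)) \<le> norm (indicat_real {0..1} x * B)"
      using B by (intro AE_I2) (simp add: abs_mult mult_left_mono)
  qed measurable
qed

lemma avgf_close:
  assumes f: "bounded_borel f" and c: "\<And>x. 0 \<le> x \<Longrightarrow> x \<le> 1 \<Longrightarrow> \<bar>f (y + (\<delta> * x) *\<^sub>R axis j 1) - c\<bar> \<le> B"
  shows "\<bar>avgf \<delta> j f y - c\<bar> \<le> B"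
proof -
  have one: "(\<integral>x. indicat_real {0..1::real} x \<partial>lborel) = 1" and [simp]: "integrable lborel (indicat_real {0..1::real})"
    by (simp_all add: integrable_indicator_iff)
  have "avgf \<delta> j f y - c = (\<integral>x. indicat_real {0..1} x * f (y + (\<delta> * x) *\<^sub>R axis j 1) - indicat_real {0..1} x * c \<partial>lborel)"
    unfolding avgf_def by (subst Bochner_Integration.integral_diff) (use avgf_integrable[OF f] one in simp_all)
  also have "\<bar>\<dots>\<bar> \<le> (\<integral>x. indicat_real {0..1} (x::real) * B \<partial>lborel)"
  proof (intro order_trans[OF integral_abs_bound] integral_mono)
    show "integrable lborel (\<lambda>x. \<bar>indicat_real {0..1} x * f (y + (\<delta> * x) *\<^sub>R axis j 1) - indicat_real {0..1} x * c\<bar>)"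
      using avgf_integrable[OF f] by simp
    show "\<bar>indicat_real {0..1} x * f (y + (\<delta> * x) *\<^sub>R axis j 1) - indicat_real {0..1} x * c\<bar> \<le> indicat_real {0..1} x * B" for x
      using c[of x] by (auto simp: indicator_def)
  qed simp
  also have "\<dots> = B" using one by simp
  finally show ?thesis .
qed

lemma avgf_le: "bounded_borel f \<Longrightarrow> (\<And>z. \<bar>f z\<bar> \<le> B) \<Longrightarrow> \<bar>avgf \<delta> j f y\<bar> \<le> B"
  using avgf_close[of f y \<delta> j 0 B] by simp

lemma bounded_borel_avgf: assumes "bounded_borel f" shows "bounded_borel (avgf \<delta> j f)"
proof -
  obtain B where B: "\<And>z. \<bar>f z\<bar> \<le> B" using bounded_borel_bound[OF assms] by blast
  have [measurable]: "f \<in> borel_measurable borel" using assms by (simp add: bounded_borel_def)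
  have "avgf \<delta> j f \<in> borel_measurable borel" unfolding avgf_def[abs_def] by measurable
  then show ?thesis using avgf_le[OF assms B] by (rule bounded_borelI)
qed

lemma avgf_lincomb:
  assumes "finite S" "\<And>s. s \<in> S \<Longrightarrow> bounded_borel (f s)"
  shows "avgf \<delta> j (\<lambda>y. \<Sum>s\<in>S. c s * f s y) = (\<lambda>y. \<Sum>s\<in>S. c s * avgf \<delta> j (f s) y)"
proof
  fix y
  have "avgf \<delta> j (\<lambda>y. \<Sum>s\<in>S. c s * f s y) y
      = (\<integral>x. (\<Sum>s\<in>S. c s * (indicat_real {0..1} x * f s (y + (\<delta> * x) *\<^sub>R axis j 1))) \<partial>lborel)"
    unfolding avgf_def by (simp add: sum_distrib_left algebra_simps)
  also have "\<dots> = (\<Sum>s\<in>S. c s * avgf \<delta> j (f s) y)"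
    unfolding avgf_def by (subst Bochner_Integration.integral_sum) (use avgf_integrable[OF assms(2)] in simp_all)
  finally show "avgf \<delta> j (\<lambda>y. \<Sum>s\<in>S. c s * f s y) y = (\<Sum>s\<in>S. c s * avgf \<delta> j (f s) y)" .
qed

lemma avgf_diff:
  assumes "bounded_borel f" "bounded_borel g"
  shows "avgf \<delta> j (\<lambda>y. f y - g y) = (\<lambda>y. avgf \<delta> j f y - avgf \<delta> j g y)"
  using avgf_lincomb[of UNIV "\<lambda>b. if b then f else g" \<delta> j "\<lambda>b. if b then 1 else -1"] assms
  by (auto simp: UNIV_bool)

lemma bounded_borel_shift: assumes "bounded_borel f" shows "bounded_borel (\<lambda>y. f (y + h))"
proof -
  obtain B where B: "\<And>z. \<bar>f z\<bar> \<le> B" using bounded_borel_bound[OF assms] by blast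
  have [measurable]: "f \<in> borel_measurable borel" using assms by (simp add: bounded_borel_def)
  have "(\<lambda>y. f (y + h)) \<in> borel_measurable borel" by measurable
  then show ?thesis by (rule bounded_borelI) (rule B)
qed

lemma avgf_fdiff: assumes "bounded_borel f" shows "avgf \<delta> j (fdiff h f) = fdiff h (avgf \<delta> j f)"
  unfolding fdiff_def avgf_diff[OF bounded_borel_shift[OF assms] assms]
  by (simp add: avgf_def algebra_simps)

lemma jet_avgf: assumes "jet F" shows "jet (\<lambda>n. avgf \<delta> j (F n))"
  unfolding avgf_def[abs_def] by (rule jet_average[OF assms]) auto

text \<open>The fundamental theorem of calculus along the segment: an average trades one derivative
  in its own direction for a difference quotient.\<close>

lemma avgf_derivative:
  assumes F: "jet F" and \<delta>: "\<delta> \<noteq> 0"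
  shows "avgf \<delta> j (F (inc j n)) = (\<lambda>y. fdiff (\<delta> *\<^sub>R axis j 1) (F n) y / \<delta>)"
proof
  fix y
  let ?n = "inc j n"
  have D: "((\<lambda>x. F m (y + (\<delta> * x) *\<^sub>R axis j 1)) has_real_derivative F (inc j m) (y + (\<delta> * x) *\<^sub>R axis j 1) * \<delta>) (at x)" for x m
    by (rule DERIV_chain2[where f = "\<lambda>t. F m (y + t *\<^sub>R axis j 1)" and g = "\<lambda>x. \<delta> * x"])
      (auto intro!: derivative_eq_intros jet_deriv[OF F])
  have "(\<integral>x. (F ?n (y + (\<delta> * x) *\<^sub>R axis j 1) * \<delta>) * indicator {0..1} x \<partial>lborel)
      = F n (y + (\<delta> * 1) *\<^sub>R axis j 1) - F n (y + (\<delta> * 0) *\<^sub>R axis j 1)"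
  proof (rule integral_FTC_Icc_real)
    fix x show "isCont (\<lambda>x. F ?n (y + (\<delta> * x) *\<^sub>R axis j 1) * \<delta>) x"
      by (intro continuous_intros DERIV_isCont[OF D])
  qed (use D in auto)
  moreover have "(\<integral>x. (F ?n (y + (\<delta> * x) *\<^sub>R axis j 1) * \<delta>) * indicator {0..1} x \<partial>lborel) = \<delta> * avgf \<delta> j (F ?n) y"
    unfolding avgf_def integral_mult_right_zero[symmetric] by (simp add: algebra_simps)
  ultimately show "avgf \<delta> j (F ?n) y = fdiff (\<delta> *\<^sub>R axis j 1) (F n) y / \<delta>"
    using \<delta> by (simp add: fdiff_def field_simps)
qed

section \<open>Iterated averages and iterated differences\<close>

abbreviation avgs :: "real \<Rightarrow> 'n list \<Rightarrow> (real ^ 'n \<Rightarrow> real) \<Rightarrow> real ^ 'n \<Rightarrow> real" where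
  "avgs \<delta> js f \<equiv> foldr (avgf \<delta>) js f"

abbreviation fdiffs :: "(real ^ 'n) list \<Rightarrow> (real ^ 'n \<Rightarrow> real) \<Rightarrow> real ^ 'n \<Rightarrow> real" where
  "fdiffs hs f \<equiv> foldr fdiff hs f"

lemma bounded_borel_avgs: "bounded_borel f \<Longrightarrow> bounded_borel (avgs \<delta> js f)"
  by (induction js) (auto intro: bounded_borel_avgf)

lemma bounded_borel_fdiffs: "bounded_borel f \<Longrightarrow> bounded_borel (fdiffs hs f)"
  by (induction hs) (auto intro: bounded_borel_fdiff)

lemma jet_avgs: "jet F \<Longrightarrow> jet (\<lambda>n. avgs \<delta> js (F n))"
proof (induction js)
  case (Cons j js)
  then show ?case using jet_avgf[of "\<lambda>n. avgs \<delta> js (F n)"] by simp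
qed simp

lemma avgs_lincomb:
  "finite S \<Longrightarrow> (\<And>s. s \<in> S \<Longrightarrow> bounded_borel (f s)) \<Longrightarrow>
   avgs \<delta> js (\<lambda>y. \<Sum>s\<in>S. c s * f s y) = (\<lambda>y. \<Sum>s\<in>S. c s * avgs \<delta> js (f s) y)"
  by (induction js) (auto simp: avgf_lincomb bounded_borel_avgs)

lemma avgs_fdiff: "bounded_borel f \<Longrightarrow> avgs \<delta> js (fdiff h f) = fdiff h (avgs \<delta> js f)"
  by (induction js) (auto simp: avgf_fdiff bounded_borel_avgs)

lemma avgs_fdiffs: "bounded_borel f \<Longrightarrow> avgs \<delta> js (fdiffs hs f) = fdiffs hs (avgs \<delta> js f)"
  by (induction hs) (auto simp: avgs_fdiff bounded_borel_fdiffs)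

text \<open>Each average moves the point by at most \<open>\<delta>\<close>, so all values entering
  the iterated mean are taken within distance \<open>length js * \<delta>\<close> of
  \<open>y\<close>.\<close>

lemma avgs_close:
  assumes "bounded_borel f" and "0 \<le> \<delta>" and "\<And>v. norm v \<le> real (length js) * \<delta> \<Longrightarrow> \<bar>f (y + v) - c\<bar> \<le> B"
  shows "\<bar>avgs \<delta> js f y - c\<bar> \<le> B"
  using assms(3)
proof (induction js arbitrary: y)
  case Nil
  from Nil[of 0] show ?case by simp
next
  case (Cons j js)
  have "\<bar>avgs \<delta> js f (y + (\<delta> * x) *\<^sub>R axis j 1) - c\<bar> \<le> B" if x: "0 \<le> x" "x \<le> 1" for x
  proof (rule Cons.IH)
    fix v :: "real ^ 'a" assume v: "norm v \<le> real (length js) * \<delta>"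
    have "norm ((\<delta> * x) *\<^sub>R axis j (1::real)) \<le> \<delta>" using x \<open>0 \<le> \<delta>\<close> by (simp add: abs_mult mult_left_le)
    then have "norm ((\<delta> * x) *\<^sub>R axis j 1 + v) \<le> real (length (j # js)) * \<delta>"
      using v norm_triangle_ineq[of "(\<delta> * x) *\<^sub>R axis j 1" v] by (simp add: algebra_simps)
    from Cons.prems[OF this] show "\<bar>f (y + (\<delta> * x) *\<^sub>R axis j 1 + v) - c\<bar> \<le> B" by (simp add: add.assoc)
  qed
  then show ?case using avgf_close[OF bounded_borel_avgs[OF assms(1)]] by simp
qed

lemma avgs_le: "bounded_borel f \<Longrightarrow> (\<And>z. \<bar>f z\<bar> \<le> B) \<Longrightarrow> \<bar>avgs \<delta> js f y\<bar> \<le> B"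
  by (induction js arbitrary: y) (auto intro!: avgf_le bounded_borel_avgs)

lemma fdiffs_lincomb: "fdiffs hs (\<lambda>y. \<Sum>s\<in>S. c s * f s y) = (\<lambda>y. \<Sum>s\<in>S. c s * fdiffs hs (f s) y)"
  by (induction hs) (auto simp: fdiff_def sum_subtractf[symmetric] algebra_simps fun_eq_iff)

lemma fdiffs_add: "fdiffs hs (\<lambda>y. f y + g y) = (\<lambda>y. fdiffs hs f y + fdiffs hs g y)"
  by (induction hs) (auto simp: fdiff_def fun_eq_iff)

lemma fdiffs_diff: "fdiffs hs (\<lambda>y. f y - g y) = (\<lambda>y. fdiffs hs f y - fdiffs hs g y)"
  by (induction hs) (auto simp: fdiff_def fun_eq_iff)

lemma fdiffs_le: "(\<And>z. \<bar>f z\<bar> \<le> B) \<Longrightarrow> \<bar>fdiffs hs f y\<bar> \<le> 2 ^ length hs * B"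
proof (induction hs arbitrary: y)
  case (Cons h hs)
  from Cons.IH[of "y + h"] Cons.IH[of y] Cons.prems show ?case
    by (simp add: fdiff_def)
qed simp

lemma mi_order_inc: "mi_order (inc i n) = Suc (mi_order n)"
proof -
  have "sum (inc i n) UNIV = Suc (n i) + sum n (UNIV - {i})"
    by (subst sum.remove[of _ i]) (auto simp: inc_def intro: sum.cong)
  moreover have "sum n UNIV = n i + sum n (UNIV - {i})" by (subst sum.remove[of _ i]) auto
  ultimately show ?thesis by (simp add: mi_order_def)
qed

text \<open>Every difference costs one derivative and gains a factor
  \<open>CARD('n) * t\<close>.\<close>

lemma jet_fdiffs_le:
  fixes y :: "real ^ 'n"
  assumes F: "jet F" and t: "\<And>h. h \<in> set hs \<Longrightarrow> norm h \<le> t"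
    and B: "\<And>N z. mi_order N = mi_order n + length hs \<Longrightarrow> \<bar>F N z\<bar> \<le> B"
  shows "\<bar>fdiffs hs (F n) y\<bar> \<le> (real CARD('n) * t) ^ length hs * B"
  using t B
proof (induction hs arbitrary: n y)
  case (Cons h hs)
  have "\<bar>fdiff h (fdiffs hs (F n)) y\<bar> \<le> real CARD('n) * norm h * ((real CARD('n) * t) ^ length hs * B)"
    by (rule jet_fdiff_le[where F = "\<lambda>n. fdiffs hs (F n)", OF jet_fdiffs[OF F] Cons.IH])
      (use Cons.prems in \<open>auto simp: mi_order_inc\<close>)
  also have "\<dots> \<le> real CARD('n) * t * ((real CARD('n) * t) ^ length hs * B)"
  proof -
    have t0: "norm h \<le> t" "0 \<le> t" using Cons.prems(1)[of h] order_trans[OF norm_ge_zero] by auto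
    \<comment> \<open>\<open>B\<close> bounds absolute values, so one multi-index of the required
      order is enough.\<close>
    have "0 \<le> B"
    proof -
      obtain i :: 'n where True by blast
      have "mi_order (n(i := n i + length (h # hs))) = mi_order n + length (h # hs)"
        unfolding mi_order_def by (simp add: sum.remove[of UNIV i])
      from Cons.prems(2)[OF this, of 0] show ?thesis by linarith
    qed
    then show ?thesis using t0 by (intro mult_right_mono mult_left_mono) auto
  qed
  finally show ?case by (simp add: algebra_simps)
qed simp

text \<open>Averages commute with differences, so the average in direction \<open>i\<close> can be
  consumed by the derivative wherever it stands in the list.\<close>

lemma avgs_inc:
  assumes F: "jet F" and \<delta>: "\<delta> > 0"
  shows "i \<in> set js \<Longrightarrow>
    avgs \<delta> js (F (inc i n)) = (\<lambda>y. fdiff (\<delta> *\<^sub>R axis i 1) (avgs \<delta> (remove1 i js) (F n)) y / \<delta>)"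
proof (induction js)
  case (Cons j js)
  show ?case
  proof (cases "j = i")
    case True
    then show ?thesis using avgf_derivative[OF jet_avgs[OF F], of \<delta> i \<delta> js n] \<delta> by simp
  next
    case False
    then have IH: "avgs \<delta> js (F (inc i n)) = (\<lambda>y. fdiff (\<delta> *\<^sub>R axis i 1) (avgs \<delta> (remove1 i js) (F n)) y / \<delta>)"
      using Cons by auto
    have b: "bounded_borel (avgs \<delta> (remove1 i js) (F n))" by (intro bounded_borel_avgs jet_bounded_borel F)
    have "avgf \<delta> j (\<lambda>y. fdiff (\<delta> *\<^sub>R axis i 1) (avgs \<delta> (remove1 i js) (F n)) y / \<delta>)
       = (\<lambda>y. avgf \<delta> j (fdiff (\<delta> *\<^sub>R axis i 1) (avgs \<delta> (remove1 i js) (F n))) y / \<delta>)"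
      using avgf_lincomb[of "{()}" "\<lambda>_. fdiff (\<delta> *\<^sub>R axis i 1) (avgs \<delta> (remove1 i js) (F n))" \<delta> j "\<lambda>_. 1 / \<delta>"]
        bounded_borel_fdiff[OF b] by simp
    then show ?thesis using False IH by (simp add: avgf_fdiff[OF b])
  qed
qed simp

lemma count_list_remove1: "count_list (remove1 i js) j = count_list js j - (if i = j then 1 else 0)"
  by (induction js) auto

text \<open>Iterates the exchange of an average for a derivative; the multiplicity condition
  provides enough averages in every direction.\<close>

lemma avgs_incs:
  assumes F: "jet F" and \<delta>: "\<delta> > 0"
  shows "(\<And>i. count_list is i \<le> count_list js i) \<Longrightarrow>
    \<exists>js'. avgs \<delta> js (F (foldr inc is n)) =
      (\<lambda>y. fdiffs (map (\<lambda>i. \<delta> *\<^sub>R axis i 1) is) (avgs \<delta> js' (F n)) y / \<delta> ^ length is)"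
proof (induction "is" arbitrary: js)
  case Nil
  show ?case by (rule exI[of _ js]) simp
next
  case (Cons i "is")
  have i: "i \<in> set js" using Cons.prems[of i] by (metis count_list_0_iff count_list.simps(2) le_zero_eq nat.distinct(1) Suc_eq_plus1 if_True)
  have "count_list is j \<le> count_list (remove1 i js) j" for j
    using Cons.prems[of j] by (auto simp: count_list_remove1 split: if_splits)
  from Cons.IH[OF this] obtain js' where js': "avgs \<delta> (remove1 i js) (F (foldr inc is n)) =
      (\<lambda>y. fdiffs (map (\<lambda>i. \<delta> *\<^sub>R axis i 1) is) (avgs \<delta> js' (F n)) y / \<delta> ^ length is)" by blast
  show ?case
    by (rule exI[of _ js']) (simp add: avgs_inc[OF F \<delta> i] js' fdiff_def[of "\<delta> *\<^sub>R axis i 1"] diff_divide_distrib[symmetric] mult.commute)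
qed

lemma mi_decompose:
  fixes N :: "'n::finite \<Rightarrow> nat"
  shows "mi_order N = r + m \<Longrightarrow> \<exists>n is. mi_order n = r \<and> length is = m \<and> N = foldr inc is n"
proof (induction m arbitrary: N)
  case 0
  then show ?case by (intro exI[of _ N] exI[of _ "[]"]) simp
next
  case (Suc m)
  have "\<exists>i. N i \<noteq> 0" using Suc.prems unfolding mi_order_def by (metis add_Suc_right nat.distinct(1) sum.neutral)
  then obtain i where i: "N i \<noteq> 0" by blast
  define N' where "N' = N(i := N i - 1)"
  have N: "N = inc i N'" using i by (simp add: N'_def inc_def)
  have "mi_order N' = r + m" using mi_order_inc[of i N'] Suc.prems unfolding N[symmetric] by simp
  from Suc.IH[OF this] obtain n "is" where "mi_order n = r" "length is = m" "N' = foldr inc is n" by blast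
  then show ?case by (intro exI[of _ n] exI[of _ "i # is"]) (use N in simp)
qed

lemma count_list_concat_replicate: "count_list (concat (replicate m xs)) i = m * count_list xs i"
  by (induction m) auto

text \<open>Repeating an enumeration of the index type \<open>m\<close> times gives averaging
  directions that can absorb any derivative of order \<open>m\<close>.\<close>

lemma ex_rich_list: "\<exists>js :: 'n::finite list. \<forall>i. m \<le> count_list js i"
proof -
  obtain xs :: "'n list" where xs: "set xs = UNIV" using finite_list[OF finite[of "UNIV :: 'n set"]] by blast
  have "m \<le> count_list (concat (replicate m xs)) i" for i
  proof -
    have "count_list xs i \<noteq> 0" using xs by (simp add: count_list_0_iff)
    then show ?thesis by (simp add: count_list_concat_replicate)
  qed
  then show ?thesis by blast
qed

section \<open>Directional differences and interpolation\<close>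

definition mis :: "nat \<Rightarrow> ('n::finite \<Rightarrow> nat) set" where
  "mis m = {n. mi_order n = m}"

definition upow :: "real ^ 'n \<Rightarrow> ('n \<Rightarrow> nat) \<Rightarrow> real" where
  "upow u n = (\<Prod>i\<in>UNIV. (u $ i) ^ n i)"

lemma mi_le_order: "n i \<le> mi_order n"
  unfolding mi_order_def by (rule member_le_sum) auto

lemma finite_mis: "finite (mis m :: ('n::finite \<Rightarrow> nat) set)"
proof (rule finite_subset)
  show "mis m \<subseteq> PiE UNIV (\<lambda>_::'n. {..m})"
    using mi_le_order by (auto simp: mis_def)
qed (auto intro: finite_PiE)

lemma upow_inc: "upow u (inc i n) = u $ i * upow u n"
proof -
  have "upow u (inc i n) = (u $ i) ^ Suc (n i) * (\<Prod>j\<in>UNIV - {i}. (u $ j) ^ n j)"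
    unfolding upow_def by (subst prod.remove[of _ i]) (auto simp: inc_def intro: prod.cong)
  moreover have "upow u n = (u $ i) ^ n i * (\<Prod>j\<in>UNIV - {i}. (u $ j) ^ n j)"
    unfolding upow_def by (subst prod.remove[of _ i]) auto
  ultimately show ?thesis by simp
qed

lemma upow_scale: "upow (c *\<^sub>R u) n = c ^ mi_order n * upow u n"
  unfolding upow_def mi_order_def by (simp add: power_mult_distrib prod.distrib power_sum)

lemma abs_upow_le: "\<bar>upow u n\<bar> \<le> norm u ^ mi_order n"
  unfolding upow_def mi_order_def power_sum abs_prod
  by (intro prod_mono) (auto simp: power_abs component_le_norm_cart intro: power_mono)

lemma inc_surj: assumes "mi_order N = Suc m" obtains n i where "N = inc i n" "mi_order n = m"
proof -
  from mi_decompose[of N m 1] assms obtain n "is" where "mi_order n = m" "length is = 1" "N = foldr inc is n" by auto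
  then show ?thesis using that by (auto simp: length_Suc_conv)
qed

text \<open>The coefficients \<open>c\<close> are positive because no cancellation is possible; this replaces ellipticity.\<close>

lemma directional_symbol_expansion:
  "\<exists>c. (\<forall>N\<in>mis (r + k). 1 \<le> (c N :: real)) \<and>
    (\<forall>F (u :: real ^ 'n) y. (\<Sum>n\<in>mis r. upow u n * (djet u ^^ k) F n y) = (\<Sum>N\<in>mis (r + k). c N * upow u N * F N y))"
proof (induction k)
  case 0
  show ?case by (rule exI[of _ "\<lambda>_. 1"]) simp
next
  case (Suc k)
  then obtain c where c: "\<forall>N\<in>mis (r + k). 1 \<le> (c N :: real)" and
    eq: "\<And>F (u :: real ^ 'n) y. (\<Sum>n\<in>mis r. upow u n * (djet u ^^ k) F n y) = (\<Sum>N\<in>mis (r + k). c N * upow u N * F N y)"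
    by blast
  let ?P = "mis (r + k) \<times> (UNIV :: 'n set)"
  \<comment> \<open>An index of order \<open>r + Suc k\<close> collects the coefficients of all
    pairs \<open>(n, i)\<close> leading to it. At least one such pair exists and contributes at
    least 1, so the lower bound is inherited.\<close>
  define c' where "c' N' = (\<Sum>p\<in>{p \<in> ?P. inc (snd p) (fst p) = N'}. c (fst p))" for N'
  have fin: "finite ?P" by (simp add: finite_mis)
  have "1 \<le> c' N'" if N': "N' \<in> mis (r + Suc k)" for N'
  proof -
    from N' obtain n i where ni: "N' = inc i n" "mi_order n = r + k"
      by (auto simp: mis_def elim: inc_surj)
    then have mem: "(n, i) \<in> {p \<in> ?P. inc (snd p) (fst p) = N'}" by (simp add: mis_def)
    have "1 \<le> c (fst (n, i))" using c ni by (auto simp: mis_def)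
    also have "c (fst (n, i)) \<le> c' N'" unfolding c'_def
    proof (rule member_le_sum[OF mem])
      fix x assume "x \<in> {p \<in> ?P. inc (snd p) (fst p) = N'} - {(n, i)}"
      then have "1 \<le> c (fst x)" using c by auto
      then show "0 \<le> c (fst x)" by simp
    qed (use fin in auto)
    finally show ?thesis .
  qed
  moreover have "(\<Sum>n\<in>mis r. upow u n * (djet u ^^ Suc k) F n y) = (\<Sum>N\<in>mis (r + Suc k). c' N * upow u N * F N y)"
    for F and u :: "real ^ 'n" and y
  proof -
    have "(\<Sum>n\<in>mis r. upow u n * (djet u ^^ Suc k) F n y) = (\<Sum>N\<in>mis (r + k). c N * upow u N * djet u F N y)"
      unfolding funpow_Suc_right comp_def eq ..
    also have "\<dots> = (\<Sum>N\<in>mis (r + k). \<Sum>i\<in>UNIV. c N * upow u (inc i N) * F (inc i N) y)"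
      unfolding djet_def by (simp add: sum_distrib_left upow_inc algebra_simps)
    also have "\<dots> = (\<Sum>p\<in>?P. c (fst p) * upow u (inc (snd p) (fst p)) * F (inc (snd p) (fst p)) y)"
      by (simp add: sum.cartesian_product case_prod_beta)
    also have "\<dots> = (\<Sum>N'\<in>mis (r + Suc k). \<Sum>p\<in>{p \<in> ?P. inc (snd p) (fst p) = N'}.
        c (fst p) * upow u (inc (snd p) (fst p)) * F (inc (snd p) (fst p)) y)"
      by (rule sum.group[symmetric, OF fin finite_mis]) (auto simp: mis_def mi_order_inc)
    also have "\<dots> = (\<Sum>N\<in>mis (r + Suc k). c' N * upow u N * F N y)"
      unfolding c'_def by (intro sum.cong refl) (auto simp: sum_distrib_right intro!: sum.cong)
    finally show ?thesis .
  qed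
  ultimately show ?case by blast
qed

text \<open>Lagrange interpolation at \<open>m + 1\<close> nodes writes \<open>x ^ e\<close>, for
  \<open>e \<le> m\<close>, as the sum of the \<open>b j ^ e * L j\<close>. Comparing the
  coefficients of \<open>x ^ e0\<close> shows that \<open>l j = coeff (L j) e0\<close>
  works.\<close>

lemma coefficient_extraction_1:
  fixes b :: "nat \<Rightarrow> real"
  assumes inj: "inj_on b {..m}" and e0: "e0 \<le> m"
  shows "\<exists>l. \<forall>e\<le>m. (\<Sum>j\<le>m. l j * b j ^ e) = (if e = e0 then 1 else 0)"
proof -
  define L where "L j = (\<Prod>i\<in>{..m} - {j}. smult (1 / (b j - b i)) [:- b i, 1:])" for j
  have Lv: "poly (L j) (b i) = (if i = j then 1 else 0)" if "i \<le> m" "j \<le> m" for i j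
  proof (cases "i = j")
    case True
    have "b j - b i' \<noteq> 0" if "i' \<in> {..m} - {j}" for i'
      using inj \<open>j \<le> m\<close> that by (auto simp: inj_on_def)
    then show ?thesis using True by (auto simp: L_def poly_prod diff_divide_distrib[symmetric] intro!: prod.neutral)
  next
    case False
    then show ?thesis using that by (auto simp: L_def poly_prod intro!: prod_zero)
  qed
  have Ld: "degree (L j) \<le> m" if "j \<le> m" for j
  proof -
    have "degree (L j) \<le> (\<Sum>i\<in>{..m} - {j}. degree (smult (1 / (b j - b i)) [:- b i, 1:]))"
      unfolding L_def by (rule degree_prod_sum_le[unfolded comp_def]) simp
    also have "\<dots> \<le> (\<Sum>i\<in>{..m} - {j}. 1)" by (intro sum_mono) auto
    also have "\<dots> \<le> m" using that by simp
    finally show ?thesis .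
  qed
  \<comment> \<open>Both sides have degree at most \<open>m\<close> and agree at
    \<open>m + 1\<close> points.\<close>
  have "monom 1 e = (\<Sum>j\<le>m. smult (b j ^ e) (L j))" if "e \<le> m" for e
  proof (rule poly_eqI_degree[where A = "b ` {..m}"])
    fix x assume "x \<in> b ` {..m}"
    then obtain i where i: "i \<le> m" "x = b i" by auto
    then have "(\<Sum>j\<le>m. b j ^ e * poly (L j) (b i)) = (\<Sum>j\<le>m. if j = i then b j ^ e else 0)"
      by (intro sum.cong) (auto simp: Lv)
    then show "poly (monom 1 e) x = poly (\<Sum>j\<le>m. smult (b j ^ e) (L j)) x"
      using i by (simp add: poly_monom poly_sum)
  next
    have card: "card (b ` {..m}) = Suc m" by (simp add: card_image inj)
    show "degree (monom 1 e :: real poly) < card (b ` {..m})" using that card by (simp add: degree_monom_eq)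
    have "degree (\<Sum>j\<le>m. smult (b j ^ e) (L j)) \<le> m"
      by (rule degree_sum_le, simp, rule order_trans[OF degree_smult_le Ld], simp)
    then show "degree (\<Sum>j\<le>m. smult (b j ^ e) (L j)) < card (b ` {..m})" using card by simp
  qed
  note mon = this
  have "(\<Sum>j\<le>m. coeff (L j) e0 * b j ^ e) = (if e = e0 then 1 else 0)" if "e \<le> m" for e
    using arg_cong[OF mon[OF that], of "\<lambda>p. coeff p e0"]
    by (simp add: coeff_sum mult.commute split: if_splits)
  then show ?thesis by (intro exI[of _ "\<lambda>j. coeff (L j) e0"]) simp
qed

text \<open>A monomial of order \<open>m\<close> has degree at most \<open>m\<close> in each
  variable, so the product of one-variable extraction functionals over a tensor grid isolates its
  coefficient.\<close>

lemma coefficient_extraction: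
  "\<exists>C\<ge>0. \<forall>(a :: ('n::finite \<Rightarrow> nat) \<Rightarrow> real) B.
     (\<forall>u. norm u \<le> real CARD('n) \<longrightarrow> \<bar>\<Sum>N\<in>mis m. a N * upow u N\<bar> \<le> B) \<longrightarrow> (\<forall>N\<in>mis m. \<bar>a N\<bar> \<le> C * B)"
proof -
  \<comment> \<open>Nodes in \<open>[0, 1]\<close> keep the grid points within norm
    \<open>CARD('n)\<close>. For \<open>m = 0\<close> the single node is
    \<open>0 / 0 = 0\<close>.\<close>
  define b where "b j = real j / real m" for j
  have inj: "inj_on b {..m}" by (cases "m = 0") (auto simp: inj_on_def b_def)
  have "\<exists>l. \<forall>e0\<le>m. \<forall>e\<le>m. (\<Sum>j\<le>m. l e0 j * b j ^ e) = (if e = e0 then 1 else 0)"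
    using coefficient_extraction_1[OF inj] by metis
  then obtain l where l: "\<And>e0 e. e0 \<le> m \<Longrightarrow> e \<le> m \<Longrightarrow> (\<Sum>j\<le>m. l e0 j * b j ^ e) = (if e = e0 then 1 else 0)" by blast
  define J where "J = PiE (UNIV :: 'n set) (\<lambda>_. {..m})"
  define pt where "pt f = (\<chi> i. b (f i))" for f :: "'n \<Rightarrow> nat"
  define lam where "lam N f = (\<Prod>i\<in>UNIV. l (N i) (f i))" for N f :: "'n \<Rightarrow> nat"
  have fJ: "finite J" unfolding J_def by (intro finite_PiE) auto
  have ptn: "norm (pt f) \<le> real CARD('n)" if "f \<in> J" for f
  proof -
    have "\<bar>pt f $ i\<bar> \<le> 1" for i using that by (auto simp: J_def pt_def b_def PiE_def Pi_def divide_le_eq_1)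
    then have "(\<Sum>i\<in>UNIV. \<bar>pt f $ i\<bar>) \<le> real CARD('n)" using sum_bounded_above[of UNIV "\<lambda>i. \<bar>pt f $ i\<bar>" 1] by simp
    then show ?thesis using norm_le_l1_cart[of "pt f"] by linarith
  qed
  have ext: "(\<Sum>f\<in>J. lam N0 f * upow (pt f) N) = (if N = N0 then 1 else 0)" if "N \<in> mis m" "N0 \<in> mis m" for N N0
  proof -
    have le: "N i \<le> m" "N0 i \<le> m" for i using that mi_le_order[of N i] mi_le_order[of N0 i] by (auto simp: mis_def)
    have "(\<Sum>f\<in>J. lam N0 f * upow (pt f) N) = (\<Sum>f\<in>J. \<Prod>i\<in>UNIV. l (N0 i) (f i) * b (f i) ^ N i)"
      by (simp add: lam_def upow_def pt_def prod.distrib)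
    also have "\<dots> = (\<Prod>i\<in>UNIV. \<Sum>j\<le>m. l (N0 i) j * b j ^ N i)"
      unfolding J_def by (rule prod_sum_PiE[symmetric]) auto
    also have "\<dots> = (\<Prod>i\<in>UNIV. if N i = N0 i then 1 else 0)" by (intro prod.cong refl l le)
    also have "\<dots> = (if N = N0 then 1 else 0)"
      by (cases "N = N0") (auto simp: fun_eq_iff intro!: prod_zero)
    finally show ?thesis .
  qed
  define C where "C = (\<Sum>N\<in>mis m. \<Sum>f\<in>J. \<bar>lam N f\<bar>)"
  have "\<bar>a N0\<bar> \<le> C * B" if B: "\<forall>u. norm u \<le> real CARD('n) \<longrightarrow> \<bar>\<Sum>N\<in>mis m. a N * upow u N\<bar> \<le> B" and N0: "N0 \<in> mis m"
    for a :: "('n \<Rightarrow> nat) \<Rightarrow> real" and B N0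
  proof -
    have B0: "0 \<le> B" using B[rule_format, of 0] by (simp add: order_trans[OF abs_ge_zero])
    have "a N0 = (\<Sum>N\<in>mis m. a N * (if N = N0 then 1 else 0))"
      using N0 sum.delta'[OF finite_mis, of N0 a m] by (simp add: if_distrib[of "\<lambda>x. _ * x"] sum.delta[OF finite_mis] cong: if_cong)
    also have "\<dots> = (\<Sum>N\<in>mis m. a N * (\<Sum>f\<in>J. lam N0 f * upow (pt f) N))"
      by (intro sum.cong refl) (simp add: ext N0)
    also have "\<dots> = (\<Sum>f\<in>J. lam N0 f * (\<Sum>N\<in>mis m. a N * upow (pt f) N))"
      unfolding sum_distrib_left by (subst sum.swap) (simp add: algebra_simps)
    also have "\<bar>\<dots>\<bar> \<le> (\<Sum>f\<in>J. \<bar>lam N0 f\<bar> * B)"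
      using B ptn by (intro order_trans[OF sum_abs sum_mono]) (auto simp: abs_mult intro: mult_left_mono)
    also have "\<dots> = (\<Sum>f\<in>J. \<bar>lam N0 f\<bar>) * B" by (simp add: sum_distrib_right)
    also have "\<dots> \<le> C * B" unfolding C_def using N0 finite_mis B0
      by (intro mult_right_mono member_le_sum[of N0 "mis m" "\<lambda>N. \<Sum>f\<in>J. \<bar>lam N f\<bar>"]) (auto intro: sum_nonneg)
    finally show ?thesis .
  qed
  moreover have "C \<ge> 0" unfolding C_def by (intro sum_nonneg) auto
  ultimately show ?thesis by blast
qed

text \<open>Differences are replaced by derivatives one at a time. The defect \<open>X\<close> of
  one replacement is quadratic in \<open>u\<close> and still carries \<open>k\<close> differences,
  each worth a factor \<open>?d\<close>; the rest is the induction hypothesis for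
  \<open>djet u F\<close>, whose derivatives are larger by a factor \<open>?d\<close>.\<close>

lemma jet_taylor_power:
  fixes y :: "real ^ 'n"
  assumes "jet F" and "\<And>N z. mi_order N = mi_order n + k + 1 \<Longrightarrow> \<bar>F N z\<bar> \<le> B"
  shows "\<bar>fdiffs (replicate k u) (F n) y - (djet u ^^ k) F n y\<bar> \<le> real k * (real CARD('n) * norm u) ^ (k + 1) * B"
  using assms
proof (induction k arbitrary: F B)
  case 0
  then show ?case by simp
next
  case (Suc k)
  let ?d = "real CARD('n) * norm u"
  note F = Suc.prems(1)
  define X where "X = (\<lambda>n y. fdiff u (F n) y - djet u F n y)"
  have X: "jet X" unfolding X_def by (intro jet_diff jet_fdiff jet_djet F)
  have B0: "0 \<le> B"
  proof -
    obtain i :: 'n where True by blast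
    have "mi_order (n(i := n i + Suc k + 1)) = mi_order n + Suc k + 1"
      unfolding mi_order_def by (simp add: sum.remove[of UNIV i])
    from Suc.prems(2)[OF this, of 0] show ?thesis by linarith
  qed
  have "\<bar>X N z\<bar> \<le> ?d\<^sup>2 * B" if "mi_order N = mi_order n + k" for N z
    unfolding X_def by (rule jet_taylor[OF F]) (use Suc.prems(2) that in \<open>simp add: mi_order_inc\<close>)
  then have 1: "\<bar>fdiffs (replicate k u) (X n) y\<bar> \<le> ?d ^ k * (?d\<^sup>2 * B)"
    using jet_fdiffs_le[OF X, of "replicate k u" "norm u" n "?d\<^sup>2 * B" y] by simp
  have 2: "\<bar>fdiffs (replicate k u) (djet u F n) y - (djet u ^^ k) (djet u F) n y\<bar> \<le> real k * ?d ^ (k + 1) * (?d * B)"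
  proof (rule Suc.IH[OF jet_djet[OF F]])
    fix N :: "'n \<Rightarrow> nat" and z assume N: "mi_order N = mi_order n + k + 1"
    have "\<bar>djet u F N z\<bar> \<le> (\<Sum>i\<in>UNIV. \<bar>u $ i\<bar> * B)" unfolding djet_def
      by (rule order_trans[OF sum_abs sum_mono]) (use Suc.prems(2) N in \<open>auto simp: abs_mult mi_order_inc intro!: mult_left_mono\<close>)
    also have "\<dots> \<le> ?d * B" using B0 by (simp add: sum_distrib_right[symmetric] sum_abs_vec_le mult_right_mono)
    finally show "\<bar>djet u F N z\<bar> \<le> ?d * B" .
  qed
  have "fdiffs (replicate (Suc k) u) (F n) = fdiffs (replicate k u) (\<lambda>y. djet u F n y + X n y)"
    by (simp add: foldr_replicate funpow_swap1 X_def)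
  then have "fdiffs (replicate (Suc k) u) (F n) y = fdiffs (replicate k u) (djet u F n) y + fdiffs (replicate k u) (X n) y"
    by (simp only: fdiffs_add)
  moreover have "(djet u ^^ Suc k) F n y = (djet u ^^ k) (djet u F) n y" by (simp only: funpow_Suc_right comp_def)
  ultimately have "\<bar>fdiffs (replicate (Suc k) u) (F n) y - (djet u ^^ Suc k) F n y\<bar> \<le> ?d ^ k * (?d\<^sup>2 * B) + real k * ?d ^ (k + 1) * (?d * B)"
    using 1 2 by linarith
  also have "\<dots> = real (Suc k) * ?d ^ (Suc k + 1) * B" by (simp add: algebra_simps power2_eq_square)
  finally show ?case .
qed

section \<open>The single-scale estimate\<close>

text \<open>Averaging turns derivatives of order \<open>r + k + 1\<close> into differences and so
  bounds them by a multiple of \<open>U / \<delta> ^ Suc k\<close>. This controls the Taylor error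
  when the directional differences of step \<open>\<tau>\<close> are replaced by a polynomial in
  \<open>u\<close> with coefficients \<open>c N * H N y\<close>. Interpolation recovers the
  coefficients at the loss of \<open>\<tau> ^ k\<close> in front of \<open>\<omega>\<close>. The
  steps \<open>\<delta>\<close> and \<open>\<tau>\<close> are independent, so that their ratio can
  be tuned afterwards.\<close>

lemma smoothed_derivative_bound:
  fixes js :: "'n::finite list"
  assumes js: "\<And>i. Suc k \<le> count_list js i"
  shows "\<exists>C\<ge>0. \<forall>F \<delta> \<tau> U \<omega>. jet F \<and> 0 < \<delta> \<and> 0 < \<tau> \<and> 0 \<le> U \<and> 0 \<le> \<omega> \<and>
      (\<forall>n hs y. mi_order n = r \<and> length hs = k \<and> (\<forall>h\<in>set hs. norm h \<le> \<delta>) \<longrightarrow> \<bar>fdiffs hs (F n) y\<bar> \<le> U) \<and>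
      (\<forall>u y. norm u \<le> \<tau> * real CARD('n) \<longrightarrow> \<bar>\<Sum>n\<in>mis r. upow u n * fdiffs (replicate k u) (F n) y\<bar> \<le> norm u ^ r * \<omega>) \<longrightarrow>
      (\<forall>N y. mi_order N = r + k \<longrightarrow> \<bar>avgs \<delta> js (F N) (y :: real ^ 'n)\<bar> \<le> C * (\<omega> / \<tau> ^ k + \<tau> / \<delta> ^ Suc k * U))"
proof -
  let ?d = "real CARD('n)"
  from directional_symbol_expansion[of r k, where ?'n = 'n] obtain c where cexp: "(\<forall>N\<in>mis (r + k). 1 \<le> (c (N :: 'n \<Rightarrow> nat) :: real)) \<and>
    (\<forall>F (u :: real ^ 'n) y. (\<Sum>n\<in>mis r. upow u n * (djet u ^^ k) F n y) = (\<Sum>N\<in>mis (r + k). c N * upow u N * F N y))" ..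
  note c = cexp[THEN conjunct1, rule_format] and exp = cexp[THEN conjunct2, rule_format]
  from coefficient_extraction[of "r + k", where ?'n = 'n] obtain L where L': "L \<ge> 0 \<and> (\<forall>(a :: ('n \<Rightarrow> nat) \<Rightarrow> real) B.
     (\<forall>u. norm u \<le> ?d \<longrightarrow> \<bar>\<Sum>N\<in>mis (r + k). a N * upow u N\<bar> \<le> B) \<longrightarrow> (\<forall>N\<in>mis (r + k). \<bar>a N\<bar> \<le> L * B))" ..
  note L0 = L'[THEN conjunct1]
  have L: "\<forall>N\<in>mis (r + k). \<bar>a N\<bar> \<le> L * B" if "\<And>u. norm u \<le> ?d \<Longrightarrow> \<bar>\<Sum>N\<in>mis (r + k). a N * upow u N\<bar> \<le> B"
    for a :: "('n \<Rightarrow> nat) \<Rightarrow> real" and B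
    using L'[THEN conjunct2, THEN spec, THEN spec, THEN mp, of a B] that by simp
  \<comment> \<open>\<open>M\<close> is the Taylor error summed over the multi-indices of order
    \<open>r\<close>, for directions of norm at most \<open>\<tau> * ?d\<close>, with the powers of
    \<open>\<tau>\<close> and \<open>\<delta>\<close> and the factor \<open>U\<close> taken
    out.\<close>
  define M where "M = real (card (mis r :: ('n \<Rightarrow> nat) set)) * (?d ^ r * (real k * (?d * ?d) ^ Suc k * 2))"
  have M0: "M \<ge> 0" unfolding M_def by simp
  define C where "C = L * (?d ^ r + M)"
  have C0: "C \<ge> 0" unfolding C_def using L0 M0 by simp
  have "\<bar>avgs \<delta> js (F N) y\<bar> \<le> C * (\<omega> / \<tau> ^ k + \<tau> / \<delta> ^ Suc k * U)"
    if F: "jet F" and \<delta>: "0 < \<delta>" and \<tau>: "0 < \<tau>" and U: "0 \<le> U" and \<omega>: "0 \<le> \<omega>"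
      and H1: "\<And>n hs y. mi_order n = r \<Longrightarrow> length hs = k \<Longrightarrow> (\<And>h. h \<in> set hs \<Longrightarrow> norm h \<le> \<delta>) \<Longrightarrow> \<bar>fdiffs hs (F n) y\<bar> \<le> U"
      and H2: "\<And>u y. norm u \<le> \<tau> * ?d \<Longrightarrow> \<bar>\<Sum>n\<in>mis r. upow u n * fdiffs (replicate k u) (F n) y\<bar> \<le> norm u ^ r * \<omega>"
      and N: "mi_order N = r + k" for F \<delta> \<tau> U \<omega> N and y :: "real ^ 'n"
  proof -
    define H where "H = (\<lambda>n. avgs \<delta> js (F n))"
    have H: "jet H" unfolding H_def by (rule jet_avgs[OF F])
    \<comment> \<open>The averages absorb \<open>k + 1\<close> derivatives. Of the resulting
      differences \<open>k\<close> are covered by the bound \<open>U\<close>, and the outermost one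
      costs a factor 2.\<close>
    have top: "\<bar>H N z\<bar> \<le> 2 * U / \<delta> ^ Suc k" if N: "mi_order N = r + Suc k" for N z
    proof -
      obtain n "is" where n: "mi_order n = r" "length is = Suc k" "N = foldr inc is n"
        using mi_decompose[OF N] by blast
      have "count_list is i \<le> count_list js i" for i
        using count_le_length[of "is" i] js[of i] n by simp
      from avgs_incs[OF F \<delta> this, of n] obtain js' where
        js': "H N = (\<lambda>y. fdiffs (map (\<lambda>i. \<delta> *\<^sub>R axis i 1) is) (avgs \<delta> js' (F n)) y / \<delta> ^ length is)"
        unfolding n(3) H_def by blast
      obtain i is' where is': "is = i # is'" "length is' = k" using n(2) by (auto simp: length_Suc_conv)
      let ?hs = "map (\<lambda>i. \<delta> *\<^sub>R axis i (1::real)) is'"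
      have le: "\<bar>fdiffs ?hs (avgs \<delta> js' (F n)) w\<bar> \<le> U" for w
        unfolding avgs_fdiffs[OF jet_bounded_borel[OF F], symmetric]
        by (intro avgs_le bounded_borel_fdiffs jet_bounded_borel F H1 n) (use is' \<delta> in auto)
      have "\<bar>fdiffs (map (\<lambda>i. \<delta> *\<^sub>R axis i 1) is) (avgs \<delta> js' (F n)) z\<bar> \<le> 2 * U"
        using le[of "z + \<delta> *\<^sub>R axis i 1"] le[of z] unfolding is'(1) by (simp add: fdiff_def[of "\<delta> *\<^sub>R axis i 1"])
      then show ?thesis unfolding js' using \<delta> n(2) by (simp add: abs_divide divide_right_mono)
    qed
    have E: "\<bar>\<Sum>n\<in>mis r. upow u n * fdiffs (replicate k u) (H n) y\<bar> \<le> norm u ^ r * \<omega>" if "norm u \<le> \<tau> * ?d" for u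
    proof -
      have "(\<lambda>y. \<Sum>n\<in>mis r. upow u n * fdiffs (replicate k u) (H n) y) = avgs \<delta> js (\<lambda>y. \<Sum>n\<in>mis r. upow u n * fdiffs (replicate k u) (F n) y)"
        unfolding H_def by (simp add: avgs_lincomb[OF finite_mis] bounded_borel_fdiffs jet_bounded_borel[OF F] avgs_fdiffs del: foldr_replicate)
      moreover have "\<bar>avgs \<delta> js (\<lambda>y. \<Sum>n\<in>mis r. upow u n * fdiffs (replicate k u) (F n) y) y\<bar> \<le> norm u ^ r * \<omega>"
        by (intro avgs_le bounded_borel_lincomb finite_mis bounded_borel_fdiffs jet_bounded_borel F H2 that)
      ultimately show ?thesis by metis
    qed
    define B where "B = ?d ^ r * \<tau> ^ r * \<omega> + \<tau> ^ r * (\<tau> / \<delta>) ^ Suc k * M * U"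
    \<comment> \<open>By homogeneity \<open>\<tau> ^ (r + k)\<close> comes out of
      \<open>upow u N\<close> for \<open>u = \<tau> *\<^sub>R v\<close>, so \<open>v\<close> ranges
      over the fixed ball that interpolation requires.\<close>
    have "\<forall>N\<in>mis (r + k). \<bar>c N * \<tau> ^ (r + k) * H N y\<bar> \<le> L * B"
    proof (rule L)
      fix v :: "real ^ 'n" assume v: "norm v \<le> ?d"
      define u where "u = \<tau> *\<^sub>R v"
      have nu: "norm u \<le> \<tau> * ?d" using v \<tau> by (simp add: u_def)
      have T: "\<bar>fdiffs (replicate k u) (H n) y - (djet u ^^ k) H n y\<bar> \<le> real k * (?d * (\<tau> * ?d)) ^ Suc k * (2 * U / \<delta> ^ Suc k)"
        if "n \<in> mis r" for n
      proof -
        have "\<bar>fdiffs (replicate k u) (H n) y - (djet u ^^ k) H n y\<bar> \<le> real k * (?d * norm u) ^ (k + 1) * (2 * U / \<delta> ^ Suc k)"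
          by (rule jet_taylor_power[OF H top]) (use that in \<open>simp add: mis_def\<close>)
        also have "\<dots> \<le> real k * (?d * (\<tau> * ?d)) ^ Suc k * (2 * U / \<delta> ^ Suc k)"
          using nu U \<delta> by (intro mult_right_mono mult_left_mono) (auto intro!: power_mono mult_left_mono simp del: power_Suc)
        finally show ?thesis .
      qed
      have "(\<Sum>N\<in>mis (r + k). (c N * \<tau> ^ (r + k) * H N y) * upow v N) = (\<Sum>N\<in>mis (r + k). c N * upow u N * H N y)"
        unfolding u_def upow_scale by (intro sum.cong refl) (simp add: mis_def)
      also have "\<dots> = (\<Sum>n\<in>mis r. upow u n * (djet u ^^ k) H n y)" using exp by simp
      also have "\<dots> = (\<Sum>n\<in>mis r. upow u n * fdiffs (replicate k u) (H n) y)
          - (\<Sum>n\<in>mis r. upow u n * (fdiffs (replicate k u) (H n) y - (djet u ^^ k) H n y))"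
        by (simp add: sum_subtractf[symmetric] algebra_simps)
      finally have eq: "(\<Sum>N\<in>mis (r + k). (c N * \<tau> ^ (r + k) * H N y) * upow v N) = \<dots>" .
      have "\<bar>(\<Sum>N\<in>mis (r + k). (c N * \<tau> ^ (r + k) * H N y) * upow v N)\<bar> \<le> norm u ^ r * \<omega> + (\<Sum>n\<in>(mis r :: ('n \<Rightarrow> nat) set). (\<tau> * ?d) ^ r * (real k * (?d * (\<tau> * ?d)) ^ Suc k * (2 * U / \<delta> ^ Suc k)))"
        unfolding eq
      proof (intro order_trans[OF abs_triangle_ineq4] add_mono E nu order_trans[OF sum_abs sum_mono])
        fix n :: "'n \<Rightarrow> nat" assume n: "n \<in> mis r"
        have "\<bar>upow u n\<bar> \<le> (\<tau> * ?d) ^ r"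
          using abs_upow_le[of u n] power_mono[OF nu norm_ge_zero, of r] n by (simp add: mis_def)
        then show "\<bar>upow u n * (fdiffs (replicate k u) (H n) y - (djet u ^^ k) H n y)\<bar>
            \<le> (\<tau> * ?d) ^ r * (real k * (?d * (\<tau> * ?d)) ^ Suc k * (2 * U / \<delta> ^ Suc k))"
          unfolding abs_mult using T[OF n] \<tau> by (intro mult_mono) auto
      qed
      also have "\<dots> \<le> (\<tau> * ?d) ^ r * \<omega> + (\<Sum>n\<in>(mis r :: ('n \<Rightarrow> nat) set). (\<tau> * ?d) ^ r * (real k * (?d * (\<tau> * ?d)) ^ Suc k * (2 * U / \<delta> ^ Suc k)))"
        using nu \<omega> by (intro add_right_mono mult_right_mono power_mono) auto
      also have "(\<tau> * ?d) ^ r * \<omega> + (\<Sum>n\<in>(mis r :: ('n \<Rightarrow> nat) set). (\<tau> * ?d) ^ r * (real k * (?d * (\<tau> * ?d)) ^ Suc k * (2 * U / \<delta> ^ Suc k))) = B"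
        unfolding B_def M_def by (simp add: power_mult_distrib power_divide field_simps)
      finally show "\<bar>\<Sum>N\<in>mis (r + k). (c N * \<tau> ^ (r + k) * H N y) * upow v N\<bar> \<le> B" by simp
    qed
    then have le: "\<bar>c N * \<tau> ^ (r + k) * H N y\<bar> \<le> L * B" using N by (simp add: mis_def)
    have "\<tau> ^ (r + k) * \<bar>H N y\<bar> \<le> c N * (\<tau> ^ (r + k) * \<bar>H N y\<bar>)"
      using c[of N] N \<tau> mult_right_mono[of 1 "c N" "\<tau> ^ (r + k) * \<bar>H N y\<bar>"] by (simp add: mis_def)
    also have "\<dots> \<le> L * B" using le c[of N] N \<tau> by (simp add: abs_mult mis_def)
    finally have HB: "\<bar>H N y\<bar> \<le> L * (B / \<tau> ^ (r + k))" using \<tau> by (simp add: field_simps)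
    have "B / \<tau> ^ (r + k) = ?d ^ r * (\<omega> / \<tau> ^ k) + M * (\<tau> / \<delta> ^ Suc k * U)"
      unfolding B_def using \<tau> \<delta> by (simp add: power_add power_divide field_simps)
    also have "\<dots> \<le> (?d ^ r + M) * (\<omega> / \<tau> ^ k + \<tau> / \<delta> ^ Suc k * U)"
    proof -
      have gen: "a * x + M * z \<le> (a + M) * (x + z)" if "0 \<le> a" "0 \<le> x" "0 \<le> z" for a x z :: real
        using that M0 by (simp add: algebra_simps)
      show ?thesis by (rule gen) (use \<tau> \<delta> U \<omega> in simp_all)
    qed
    finally have "L * (B / \<tau> ^ (r + k)) \<le> C * (\<omega> / \<tau> ^ k + \<tau> / \<delta> ^ Suc k * U)"
      unfolding C_def mult.assoc using L0 by (rule mult_left_mono)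
    with HB show ?thesis unfolding H_def by (rule order_trans)
  qed
  then show ?thesis using C0 by (intro exI[of _ C]) auto
qed

text \<open>The part of \<open>F\<close> that averaging removes. With \<open>A\<close> for the
  average, \<open>F\<close> is later decomposed by
  \<open>1 = (1 - A) ^ k + (\<Sum>j<k. A * (1 - A) ^ j)\<close>, a geometric sum.\<close>

definition rjet :: "real \<Rightarrow> 'n list \<Rightarrow> (('n \<Rightarrow> nat) \<Rightarrow> real ^ 'n \<Rightarrow> real) \<Rightarrow> ('n \<Rightarrow> nat) \<Rightarrow> real ^ 'n \<Rightarrow> real" where
  "rjet \<delta> js F n y = F n y - avgs \<delta> js (F n) y"

lemma jet_rjet: "jet F \<Longrightarrow> jet (rjet \<delta> js F)"
  unfolding rjet_def[abs_def] by (intro jet_diff jet_avgs)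

lemma jet_rjet_power: "jet F \<Longrightarrow> jet ((rjet \<delta> js ^^ j) F)"
  by (induction j) (auto intro: jet_rjet)

lemma rjet_fdiff: "jet F \<Longrightarrow> rjet \<delta> js (\<lambda>n. fdiff h (F n)) = (\<lambda>n. fdiff h (rjet \<delta> js F n))"
  by (auto simp: rjet_def avgs_fdiff[OF jet_bounded_borel] fun_eq_iff fdiff_def)

lemma rjet_power_fdiff: "jet F \<Longrightarrow> (rjet \<delta> js ^^ j) (\<lambda>n. fdiff h (F n)) = (\<lambda>n. fdiff h ((rjet \<delta> js ^^ j) F n))"
  by (induction j) (auto simp: rjet_fdiff jet_rjet_power)

text \<open>Subtracting the average leaves a mean of first differences whose steps have length at
  most \<open>length js * \<delta>\<close>. As \<open>rjet\<close> commutes with differences,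
  \<open>j\<close> factors produce \<open>j\<close>-fold differences with varying steps; hence the
  hypothesis about lists \<open>hs\<close> in place of powers of one difference.\<close>

lemma rjet_power_le:
  fixes y :: "real ^ 'n"
  assumes "jet F" and \<delta>: "0 \<le> \<delta>"
    and "\<And>hs z. length hs = j \<Longrightarrow> (\<And>h. h \<in> set hs \<Longrightarrow> norm h \<le> real (length js) * \<delta>) \<Longrightarrow> \<bar>fdiffs hs (F n) z\<bar> \<le> U"
  shows "\<bar>(rjet \<delta> js ^^ j) F n y\<bar> \<le> U"
  using assms(1,3)
proof (induction j arbitrary: F y)
  case 0
  from 0(2)[of "[]"] show ?case by simp
next
  case (Suc j)
  let ?G = "(rjet \<delta> js ^^ j) F"
  have G: "jet ?G" by (rule jet_rjet_power[OF Suc.prems(1)])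
  have close: "\<bar>?G n (y + v) - ?G n y\<bar> \<le> U" if v: "norm v \<le> real (length js) * \<delta>" for v
  proof -
    have "\<bar>(rjet \<delta> js ^^ j) (\<lambda>n. fdiff v (F n)) n y\<bar> \<le> U"
    proof (rule Suc.IH[OF jet_fdiff[OF Suc.prems(1)]])
      fix hs :: "(real ^ 'n) list" and z assume "length hs = j" "\<And>h. h \<in> set hs \<Longrightarrow> norm h \<le> real (length js) * \<delta>"
      then show "\<bar>fdiffs hs (fdiff v (F n)) z\<bar> \<le> U" using Suc.prems(2)[of "hs @ [v]" z] v by auto
    qed
    then show ?thesis unfolding rjet_power_fdiff[OF Suc.prems(1)] by (simp add: fdiff_def)
  qed
  have "\<bar>avgs \<delta> js (?G n) y - ?G n y\<bar> \<le> U"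
    by (rule avgs_close[OF jet_bounded_borel[OF G] \<delta> close])
  then show ?case by (simp add: rjet_def[of \<delta> js ?G n y] abs_minus_commute)
qed

lemma rjet_telescope: "F n y = (rjet \<delta> js ^^ k) F n y + (\<Sum>j<k. avgs \<delta> js ((rjet \<delta> js ^^ j) F n) y)"
  by (induction k) (auto simp: rjet_def)

text \<open>The constant \<open>C0\<close> must not depend on \<open>\<eta>\<close>: iteration over scales gains a factor \<open>\<eta> ^ k\<close> per step, which
  has to beat \<open>C0\<close>.\<close>

lemma modulus_recursion:
  "\<exists>C0\<ge>0. \<forall>\<eta>. 0 < \<eta> \<and> \<eta> \<le> 1 \<longrightarrow> (\<exists>C1\<ge>0. \<forall>(F :: ('n::finite \<Rightarrow> nat) \<Rightarrow> real ^ 'n \<Rightarrow> real) t U \<omega>.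
      jet F \<and> 0 < t \<and> 0 \<le> U \<and> 0 \<le> \<omega> \<and>
      (\<forall>n hs y. mi_order n = r \<and> length hs = k \<and> (\<forall>h\<in>set hs. norm h \<le> \<eta> * t) \<longrightarrow> \<bar>fdiffs hs (F n) y\<bar> \<le> U) \<and>
      (\<forall>u y. norm u \<le> t \<longrightarrow> \<bar>\<Sum>n\<in>mis r. upow u n * fdiffs (replicate k u) (F n) y\<bar> \<le> norm u ^ r * \<omega>) \<longrightarrow>
      (\<forall>n hs y. mi_order n = r \<and> length hs = k \<and> (\<forall>h\<in>set hs. norm h \<le> t) \<longrightarrow> \<bar>fdiffs hs (F n) y\<bar> \<le> C1 * \<omega> + C0 * U))"
proof -
  let ?d = "real CARD('n)"
  have d1: "?d \<ge> 1" by (simp add: Suc_leI)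
  obtain js :: "'n list" where js: "\<And>i. Suc k \<le> count_list js i" using ex_rich_list[of "Suc k"] by blast
  define \<kappa> where "\<kappa> = real (length js)"
  have \<kappa>1: "1 \<le> \<kappa>"
    using js[of undefined] count_le_length[of js undefined] unfolding \<kappa>_def by linarith
  from smoothed_derivative_bound[OF js, of r] obtain C where C00: "C \<ge> 0 \<and> (\<forall>F \<delta> \<tau> U \<omega>. jet F \<and> 0 < \<delta> \<and> 0 < \<tau> \<and> 0 \<le> U \<and> 0 \<le> \<omega> \<and>
      (\<forall>n hs y. mi_order n = r \<and> length hs = k \<and> (\<forall>h\<in>set hs. norm h \<le> \<delta>) \<longrightarrow> \<bar>fdiffs hs (F n) y\<bar> \<le> U) \<and>
      (\<forall>u y. norm u \<le> \<tau> * real CARD('n) \<longrightarrow> \<bar>\<Sum>n\<in>mis r. upow u n * fdiffs (replicate k u) (F n) y\<bar> \<le> norm u ^ r * \<omega>) \<longrightarrow>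
      (\<forall>N y. mi_order N = r + k \<longrightarrow> \<bar>avgs \<delta> js (F N) (y :: real ^ 'n)\<bar> \<le> C * (\<omega> / \<tau> ^ k + \<tau> / \<delta> ^ Suc k * U)))" ..
  note C0 = C00[THEN conjunct1] and Craw = C00[THEN conjunct2]
  have C:
    "\<And>F \<delta> \<tau> U \<omega> N (y :: real ^ 'n). jet F \<Longrightarrow> 0 < \<delta> \<Longrightarrow> 0 < \<tau> \<Longrightarrow> 0 \<le> U \<Longrightarrow> 0 \<le> \<omega> \<Longrightarrow>
      (\<forall>n hs y. mi_order n = r \<and> length hs = k \<and> (\<forall>h\<in>set hs. norm h \<le> \<delta>) \<longrightarrow> \<bar>fdiffs hs (F n) y\<bar> \<le> U) \<Longrightarrow>
      (\<forall>u y. norm u \<le> \<tau> * ?d \<longrightarrow> \<bar>\<Sum>n\<in>mis r. upow u n * fdiffs (replicate k u) (F n) y\<bar> \<le> norm u ^ r * \<omega>) \<Longrightarrow>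
      mi_order N = r + k \<Longrightarrow> \<bar>avgs \<delta> js (F N) y\<bar> \<le> C * (\<omega> / \<tau> ^ k + \<tau> / \<delta> ^ Suc k * U)"
    by (rule Craw[THEN spec, THEN spec, THEN spec, THEN spec, THEN spec, THEN mp, THEN spec, THEN spec, THEN mp]) (intro conjI; assumption)+
  \<comment> \<open>\<open>2 ^ k\<close> comes from the \<open>k\<close>-fold oscillation and the
    sum from the averaged parts; \<open>\<eta>\<close> does not occur.\<close>
  define C' where "C' = 2 ^ k + (\<Sum>j<k. ?d ^ k * C * \<kappa> ^ k * 2 ^ j)"
  have C'0: "C' \<ge> 0" unfolding C'_def using C0 \<kappa>1 by (intro add_nonneg_nonneg sum_nonneg mult_nonneg_nonneg) auto
  have "\<exists>C1\<ge>0. \<forall>(F :: ('n::finite \<Rightarrow> nat) \<Rightarrow> real ^ 'n \<Rightarrow> real) t U \<omega>.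
      jet F \<and> 0 < t \<and> 0 \<le> U \<and> 0 \<le> \<omega> \<and>
      (\<forall>n hs y. mi_order n = r \<and> length hs = k \<and> (\<forall>h\<in>set hs. norm h \<le> \<eta> * t) \<longrightarrow> \<bar>fdiffs hs (F n) y\<bar> \<le> U) \<and>
      (\<forall>u y. norm u \<le> t \<longrightarrow> \<bar>\<Sum>n\<in>mis r. upow u n * fdiffs (replicate k u) (F n) y\<bar> \<le> norm u ^ r * \<omega>) \<longrightarrow>
      (\<forall>n hs y. mi_order n = r \<and> length hs = k \<and> (\<forall>h\<in>set hs. norm h \<le> t) \<longrightarrow> \<bar>fdiffs hs (F n) y\<bar> \<le> C1 * \<omega> + C' * U)"
    if \<eta>: "0 < \<eta>" "\<eta> \<le> 1" for \<eta> :: real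
  proof -
    \<comment> \<open>This size makes \<open>t ^ k * (\<tau> / \<delta> ^ Suc k) = \<epsilon> *
      (\<kappa> / \<eta>) ^ k\<close> at most \<open>\<kappa> ^ k\<close>, which removes
      \<open>\<eta>\<close> from the factor of \<open>U\<close>. Dividing by the dimension keeps
      \<open>\<tau> * ?d\<close> below \<open>t\<close>.\<close>
    define \<epsilon> where "\<epsilon> = \<eta> ^ k / ?d"
    have \<epsilon>: "0 < \<epsilon>" "\<epsilon> * ?d \<le> 1" "\<epsilon> \<le> \<eta> ^ k" using \<eta> d1 by (auto simp: \<epsilon>_def power_le_one field_simps)
    define C1 where "C1 = (\<Sum>j<k. ?d ^ k * C * (\<kappa> / (\<epsilon> * \<eta>)) ^ k * 2 ^ j)"
    have C10: "C1 \<ge> 0" unfolding C1_def using C0 \<kappa>1 \<epsilon> \<eta> by (intro sum_nonneg mult_nonneg_nonneg) auto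
    have "\<bar>fdiffs hs (F n) y\<bar> \<le> C1 * \<omega> + C' * U"
      if F: "jet F" and t: "0 < t" and U: "0 \<le> U" and \<omega>: "0 \<le> \<omega>"
        and H1: "\<And>n hs y. mi_order n = r \<Longrightarrow> length hs = k \<Longrightarrow> (\<And>h. h \<in> set hs \<Longrightarrow> norm h \<le> \<eta> * t) \<Longrightarrow> \<bar>fdiffs hs (F n) y\<bar> \<le> U"
        and H2: "\<And>u y. norm u \<le> t \<Longrightarrow> \<bar>\<Sum>n\<in>mis r. upow u n * fdiffs (replicate k u) (F n) y\<bar> \<le> norm u ^ r * \<omega>"
        and n: "mi_order n = r" and hs: "length hs = k" "\<And>h. h \<in> set hs \<Longrightarrow> norm h \<le> t"
      for F :: "('n \<Rightarrow> nat) \<Rightarrow> real ^ 'n \<Rightarrow> real" and t U \<omega> n hs y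
    proof -
      \<comment> \<open>All \<open>\<kappa>\<close> averages together move a point by at most
        \<open>\<kappa> * \<delta> = \<eta> * t\<close>, the scale at which \<open>U\<close> is
        given.\<close>
      define \<delta> where "\<delta> = \<eta> * t / \<kappa>"
      define \<tau> where "\<tau> = \<epsilon> * \<delta>"
      have \<delta>: "0 < \<delta>" "\<kappa> * \<delta> = \<eta> * t" "\<delta> \<le> \<eta> * t"
        using \<eta> t \<kappa>1 by (auto simp: \<delta>_def field_simps)
      have \<tau>: "0 < \<tau>" using \<epsilon> \<delta> by (simp add: \<tau>_def)
      have \<tau>t: "\<tau> * ?d \<le> t"
      proof -
        have "\<tau> * ?d = (\<epsilon> * ?d) * \<delta>" by (simp add: \<tau>_def)
        also have "\<dots> \<le> 1 * \<delta>" using \<epsilon> \<delta> by (intro mult_right_mono) auto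
        also have "\<dots> \<le> \<eta> * t" using \<delta> by simp
        also have "\<dots> \<le> t" using \<eta> t by (simp add: mult_left_le_one_le)
        finally show ?thesis .
      qed
      let ?G = "\<lambda>j. (rjet \<delta> js ^^ j) F"
      have G: "jet (?G j)" for j by (rule jet_rjet_power[OF F])
      \<comment> \<open>Averages do not increase bounds, so each application of \<open>rjet\<close>
        at most doubles them. The same holds for the directional sums in \<open>G2\<close>.\<close>
      have G1: "\<bar>fdiffs hs (?G j n) y\<bar> \<le> 2 ^ j * U"
        if "mi_order n = r" "length hs = k" "\<And>h. h \<in> set hs \<Longrightarrow> norm h \<le> \<delta>" for j n hs y
        using that
      proof (induction j arbitrary: y)
        case 0
        then show ?case using H1[of n hs y] \<delta>(3) by force
      next
        case (Suc j)
        have "\<bar>avgs \<delta> js (fdiffs hs (?G j n)) y\<bar> \<le> 2 ^ j * U"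
          by (intro avgs_le bounded_borel_fdiffs jet_bounded_borel G Suc.IH Suc.prems)
        then have "\<bar>fdiffs hs (avgs \<delta> js (?G j n)) y\<bar> \<le> 2 ^ j * U"
          by (simp add: avgs_fdiffs jet_bounded_borel[OF G])
        moreover have "fdiffs hs (?G (Suc j) n) y = fdiffs hs (?G j n) y - fdiffs hs (avgs \<delta> js (?G j n)) y"
          using fdiffs_diff[of hs "?G j n" "avgs \<delta> js (?G j n)"] by (simp add: rjet_def[abs_def])
        ultimately show ?case using Suc.IH[OF Suc.prems, of y] by simp
      qed
      have G2: "\<bar>\<Sum>n\<in>mis r. upow u n * fdiffs (replicate k u) (?G j n) y\<bar> \<le> norm u ^ r * (2 ^ j * \<omega>)"
        if u: "norm u \<le> t" for u y j
      proof (induction j arbitrary: y)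
        case 0
        then show ?case using H2[OF u] by simp
      next
        case (Suc j)
        have "\<bar>avgs \<delta> js (\<lambda>y. \<Sum>n\<in>mis r. upow u n * fdiffs (replicate k u) (?G j n) y) y\<bar> \<le> norm u ^ r * (2 ^ j * \<omega>)"
          by (intro avgs_le bounded_borel_lincomb finite_mis bounded_borel_fdiffs jet_bounded_borel G Suc.IH)
        then have 1: "\<bar>\<Sum>n\<in>mis r. upow u n * fdiffs (replicate k u) (avgs \<delta> js (?G j n)) y\<bar> \<le> norm u ^ r * (2 ^ j * \<omega>)"
          by (simp add: avgs_lincomb[OF finite_mis] bounded_borel_fdiffs jet_bounded_borel[OF G] avgs_fdiffs del: foldr_replicate)
        have "(\<Sum>n\<in>mis r. upow u n * fdiffs (replicate k u) (?G (Suc j) n) y)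
           = (\<Sum>n\<in>mis r. upow u n * fdiffs (replicate k u) (?G j n) y) - (\<Sum>n\<in>mis r. upow u n * fdiffs (replicate k u) (avgs \<delta> js (?G j n)) y)"
          using fdiffs_diff[of "replicate k u"] by (simp add: rjet_def[abs_def] sum_subtractf[symmetric] algebra_simps)
        then show ?case using 1 Suc.IH[of y] by (simp add: algebra_simps)
      qed
      have "\<bar>avgs \<delta> js (?G j N) y\<bar> \<le> C * (2 ^ j * \<omega> / \<tau> ^ k + \<tau> / \<delta> ^ Suc k * (2 ^ j * U))"
        if "mi_order N = r + k" for j N y
        by (rule C[OF G \<delta>(1) \<tau>]) (use G1 G2 \<tau>t U \<omega> that in auto)
      note avb = this
      have mid: "\<bar>fdiffs hs (avgs \<delta> js (?G j n)) y\<bar> \<le> (?d * t) ^ k * (C * (2 ^ j * \<omega> / \<tau> ^ k + \<tau> / \<delta> ^ Suc k * (2 ^ j * U)))" for j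
      proof -
        have "\<bar>fdiffs hs (avgs \<delta> js (?G j n)) y\<bar> \<le> (?d * t) ^ length hs * (C * (2 ^ j * \<omega> / \<tau> ^ k + \<tau> / \<delta> ^ Suc k * (2 ^ j * U)))"
          by (rule jet_fdiffs_le[where F = "\<lambda>n. avgs \<delta> js (?G j n)", OF jet_avgs[OF G] hs(2) avb]) (use hs n in auto)
        then show ?thesis by (simp only: hs(1))
      qed
      have e1: "t ^ k / \<tau> ^ k = (\<kappa> / (\<epsilon> * \<eta>)) ^ k"
        unfolding power_divide[symmetric] \<tau>_def \<delta>_def using t by simp
      have e2: "t ^ k * (\<tau> / \<delta> ^ Suc k) \<le> \<kappa> ^ k"
      proof -
        have "t ^ k * (\<tau> / \<delta> ^ Suc k) = \<epsilon> * (t / \<delta>) ^ k" using \<delta>(1) by (simp add: \<tau>_def power_divide)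
        also have "t / \<delta> = \<kappa> / \<eta>" unfolding \<delta>_def using t by simp
        also have "\<epsilon> * (\<kappa> / \<eta>) ^ k \<le> \<eta> ^ k * (\<kappa> / \<eta>) ^ k" using \<epsilon> \<eta> \<kappa>1 by (intro mult_right_mono) auto
        also have "\<dots> = \<kappa> ^ k" using \<eta> by (simp add: power_divide)
        finally show ?thesis .
      qed
      have mid': "\<bar>fdiffs hs (avgs \<delta> js (?G j n)) y\<bar> \<le> (?d ^ k * C * (\<kappa> / (\<epsilon> * \<eta>)) ^ k * 2 ^ j) * \<omega> + (?d ^ k * C * \<kappa> ^ k * 2 ^ j) * U" for j
      proof -
        have "(?d * t) ^ k * (C * (2 ^ j * \<omega> / \<tau> ^ k + \<tau> / \<delta> ^ Suc k * (2 ^ j * U)))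
            = (?d ^ k * C * (t ^ k / \<tau> ^ k) * 2 ^ j) * \<omega> + (?d ^ k * C * 2 ^ j * U) * (t ^ k * (\<tau> / \<delta> ^ Suc k))"
          by (simp add: power_mult_distrib algebra_simps)
        also have "\<dots> \<le> (?d ^ k * C * (\<kappa> / (\<epsilon> * \<eta>)) ^ k * 2 ^ j) * \<omega> + (?d ^ k * C * 2 ^ j * U) * \<kappa> ^ k"
          unfolding e1 using e2 C0 U by (intro add_left_mono mult_left_mono) auto
        finally show ?thesis using mid[of j] by (simp add: algebra_simps)
      qed
      \<comment> \<open>\<open>k\<close> applications of \<open>rjet\<close> are bounded by
        \<open>k\<close>-fold differences at scale \<open>\<eta> * t\<close>, hence by
        \<open>U\<close>; the outer differences contribute \<open>2 ^ k\<close>.\<close>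
      have low: "\<bar>fdiffs hs (?G k n) y\<bar> \<le> 2 ^ k * U"
        unfolding hs(1)[symmetric]
      proof (rule fdiffs_le)
        fix z
        show "\<bar>(rjet \<delta> js ^^ length hs) F n z\<bar> \<le> U"
          by (rule rjet_power_le[OF F]) (use \<delta> hs(1) n H1 in \<open>auto simp: \<kappa>_def\<close>)
      qed
      have "F n = (\<lambda>y. ?G k n y + (\<Sum>j<k. 1 * avgs \<delta> js (?G j n) y))"
        using rjet_telescope[where F = F and n = n and k = k and \<delta> = \<delta> and js = js] by (simp add: fun_eq_iff)
      then have "fdiffs hs (F n) = fdiffs hs (\<lambda>y. ?G k n y + (\<Sum>j<k. 1 * avgs \<delta> js (?G j n) y))"
        by (rule arg_cong)
      then have eq: "fdiffs hs (F n) y = fdiffs hs (?G k n) y + (\<Sum>j<k. 1 * fdiffs hs (avgs \<delta> js (?G j n)) y)"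
        by (simp only: fdiffs_add fdiffs_lincomb)
      have "\<bar>fdiffs hs (F n) y\<bar> \<le> 2 ^ k * U + (\<Sum>j<k. (?d ^ k * C * (\<kappa> / (\<epsilon> * \<eta>)) ^ k * 2 ^ j) * \<omega> + (?d ^ k * C * \<kappa> ^ k * 2 ^ j) * U)"
        unfolding eq by (intro order_trans[OF abs_triangle_ineq] add_mono low order_trans[OF sum_abs sum_mono]) (use mid' in simp)
      also have "\<dots> = C1 * \<omega> + C' * U" unfolding C1_def C'_def distrib_right sum_distrib_right sum.distrib by simp
      finally show ?thesis .
    qed
    then show ?thesis using C10 by (intro exI[of _ C1]) auto
  qed
  then show ?thesis using C'0 by (intro exI[of _ C']) auto
qed

text \<open>Unrolls the recursion over the scales \<open>\<eta> ^ i * t0\<close>. It starts from the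
  crude bound of \<open>k\<close>-fold differences by derivatives of order \<open>r + k\<close>,
  which is proportional to \<open>t ^ k\<close> and so picks up \<open>C0 * \<eta> ^ k\<close> per
  step. \<open>K\<close> depends on the jet, but its factor vanishes as \<open>m\<close>
  grows.\<close>

lemma modulus_iterate:
  fixes F :: "('n::finite \<Rightarrow> nat) \<Rightarrow> real ^ 'n \<Rightarrow> real"
  assumes F: "jet F" and \<eta>: "0 < \<eta>" "\<eta> \<le> 1" and C1: "0 \<le> C1" and C0: "0 \<le> C0" and small: "C0 * \<eta> ^ k < 1"
    and rec: "\<And>t U \<omega>. 0 < t \<Longrightarrow> 0 \<le> U \<Longrightarrow> 0 \<le> \<omega> \<Longrightarrow>
      (\<forall>n hs y. mi_order n = r \<and> length hs = k \<and> (\<forall>h\<in>set hs. norm h \<le> \<eta> * t) \<longrightarrow> \<bar>fdiffs hs (F n) y\<bar> \<le> U) \<Longrightarrow>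
      (\<forall>u y. norm u \<le> t \<longrightarrow> \<bar>\<Sum>n\<in>mis r. upow u n * fdiffs (replicate k u) (F n) y\<bar> \<le> norm u ^ r * \<omega>) \<Longrightarrow>
      (\<forall>n hs y. mi_order n = r \<and> length hs = k \<and> (\<forall>h\<in>set hs. norm h \<le> t) \<longrightarrow> \<bar>fdiffs hs (F n) y\<bar> \<le> C1 * \<omega> + C0 * U)"
    and w: "\<And>t. 0 < t \<Longrightarrow> t \<le> t0 \<Longrightarrow> 0 \<le> w t"
    and W: "\<And>u y t. 0 < t \<Longrightarrow> t \<le> t0 \<Longrightarrow> norm u \<le> t \<Longrightarrow> \<bar>\<Sum>n\<in>mis r. upow u n * fdiffs (replicate k u) (F n) y\<bar> \<le> norm u ^ r * w t"
    and n: "mi_order n = r" and hs: "length hs = k" "\<And>h. h \<in> set hs \<Longrightarrow> norm h \<le> t0" and t0: "0 < t0"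
  shows "\<exists>K\<ge>0. \<forall>m. \<bar>fdiffs hs (F n) y\<bar> \<le> (\<Sum>i<m. C0 ^ i * C1 * w (\<eta> ^ i * t0)) + K * (C0 * \<eta> ^ k) ^ m"
proof -
  have "\<exists>B. \<forall>N\<in>mis (r + k). \<forall>z. \<bar>F N z\<bar> \<le> B N" using jet_bound[OF F] by (intro bchoice) blast
  then obtain B where B: "\<And>N z. N \<in> mis (r + k) \<Longrightarrow> \<bar>F N z\<bar> \<le> B N" by blast
  define B' where "B' = (\<Sum>N\<in>mis (r + k). \<bar>B N\<bar>)"
  have B': "\<bar>F N z\<bar> \<le> B'" if "N \<in> mis (r + k)" for N z
    using B[OF that, of z] member_le_sum[of N "mis (r + k)" "\<lambda>N. \<bar>B N\<bar>"] that finite_mis unfolding B'_def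
    by (smt (verit, best) abs_ge_zero)
  have B'0: "0 \<le> B'" unfolding B'_def by (intro sum_nonneg) auto
  define K where "K = (real CARD('n) * t0) ^ k * B'"
  have K0: "0 \<le> K" using B'0 t0 by (simp add: K_def)
  \<comment> \<open>The scale is left general because the induction step uses the hypothesis at
    \<open>\<eta> * t\<close>.\<close>
  have "\<forall>n hs y. mi_order n = r \<and> length hs = k \<and> (\<forall>h\<in>set hs. norm h \<le> t) \<longrightarrow>
      \<bar>fdiffs hs (F n) y\<bar> \<le> (\<Sum>i<m. C0 ^ i * C1 * w (\<eta> ^ i * t)) + K * (t / t0) ^ k * (C0 * \<eta> ^ k) ^ m"
    if t: "0 < t" "t \<le> t0" for m t
    using t
  proof (induction m arbitrary: t)
    case 0
    have "\<bar>fdiffs hs (F n) y\<bar> \<le> K * (t / t0) ^ k"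
      if "mi_order n = r" "length hs = k" "\<forall>h\<in>set hs. norm h \<le> t" for n hs y
    proof -
      have "\<bar>fdiffs hs (F n) y\<bar> \<le> (real CARD('n) * t) ^ length hs * B'"
        by (rule jet_fdiffs_le[OF F]) (use that B' in \<open>auto simp: mis_def\<close>)
      then show ?thesis using that(2) t0 by (simp add: K_def power_mult_distrib power_divide mult_ac)
    qed
    then show ?case by simp
  next
    case (Suc m)
    have \<eta>t: "0 < \<eta> * t" "\<eta> * t \<le> t0" using \<eta> Suc.prems order_trans[OF mult_left_le_one_le[of t \<eta>] Suc.prems(2)] by auto
    define U where "U = (\<Sum>i<m. C0 ^ i * C1 * w (\<eta> ^ i * (\<eta> * t))) + K * (\<eta> * t / t0) ^ k * (C0 * \<eta> ^ k) ^ m"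
    have sc: "0 < \<eta> ^ i * (\<eta> * t)" "\<eta> ^ i * (\<eta> * t) \<le> t0" for i
      using \<eta> \<eta>t order_trans[OF mult_left_le_one_le[of "\<eta> * t" "\<eta> ^ i"] \<eta>t(2)] power_le_one[of \<eta> i]
      by (auto simp del: mult_left_le_one_le)
    have U0: "0 \<le> U" unfolding U_def
      using w[OF sc] C0 C1 K0 \<eta> \<eta>t t0 Suc.prems(1) by (intro add_nonneg_nonneg sum_nonneg mult_nonneg_nonneg zero_le_power divide_nonneg_nonneg) auto
    have "\<forall>n hs y. mi_order n = r \<and> length hs = k \<and> (\<forall>h\<in>set hs. norm h \<le> t) \<longrightarrow> \<bar>fdiffs hs (F n) y\<bar> \<le> C1 * w t + C0 * U"
      by (rule rec[OF Suc.prems(1) U0 w[OF Suc.prems] Suc.IH[OF \<eta>t, folded U_def]]) (use W Suc.prems in auto)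
    moreover have "C1 * w t + C0 * U = (\<Sum>i<Suc m. C0 ^ i * C1 * w (\<eta> ^ i * t)) + K * (t / t0) ^ k * (C0 * \<eta> ^ k) ^ Suc m"
      unfolding U_def by (simp add: sum.lessThan_Suc_shift sum_distrib_left algebra_simps power_mult_distrib power_divide del: sum.lessThan_Suc)
    ultimately show ?case by simp
  qed
  from this[OF t0 order_refl] show ?thesis using K0 n hs t0 by (intro exI[of _ K]) auto
qed

section \<open>Bump functions\<close>

text \<open>These functions form a class closed under differentiation; \<open>P = 1\<close> gives
  the classical function that is flat at 0.\<close>

definition pexp :: "real poly \<Rightarrow> real \<Rightarrow> real" where
  "pexp P x = (if x > 0 then poly P (1 / x) * exp (- 1 / x) else 0)"

lemma poly_exp_decay: "((\<lambda>z. poly P z * exp (- z)) \<longlongrightarrow> (0::real)) at_top"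
proof -
  have *: "((\<lambda>z. z ^ k * exp (- z)) \<longlongrightarrow> (0::real)) at_top" for k
    using tendsto_power_div_exp_0[of k] by (simp add: exp_minus field_simps)
  have "((\<lambda>z. \<Sum>i\<le>degree P. coeff P i * (z ^ i * exp (- z))) \<longlongrightarrow> 0) at_top"
    by (intro tendsto_null_sum tendsto_mult_right_zero *)
  then show ?thesis by (simp only: poly_altdef sum_distrib_right mult.assoc)
qed

text \<open>In the variable \<open>z = 1 / x\<close> differentiation is \<open>- z\<^sup>2\<close>
  times \<open>d/dz\<close> and sends \<open>P * exp (- z)\<close> to
  \<open>z\<^sup>2 * (P - P') * exp (- z)\<close>. At 0 the exponential beats every power of
  \<open>z\<close>.\<close>

lemma pexp_derivative:
  "(pexp P has_real_derivative pexp ([:0, 0, 1:] * (P - pderiv P)) x) (at x)"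
proof -
  consider "x > 0" | "x < 0" | "x = 0" by linarith
  then show ?thesis
  proof cases
    case 1
    have "((\<lambda>x. poly P (1 / x) * exp (- 1 / x)) has_real_derivative pexp ([:0, 0, 1:] * (P - pderiv P)) x) (at x)"
      using 1 by (auto intro!: derivative_eq_intros DERIV_chain2[OF poly_DERIV] simp: pexp_def field_simps power2_eq_square)
    then show ?thesis
    proof (rule has_field_derivative_transform_within_open[where S = "{0<..}"])
      show "poly P (1 / z) * exp (- 1 / z) = pexp P z" if "z \<in> {0<..}" for z using that by (simp add: pexp_def)
    qed (use 1 in auto)
  next
    case 2
    have "((\<lambda>_. 0) has_real_derivative pexp ([:0, 0, 1:] * (P - pderiv P)) x) (at x)"
      using 2 by (simp add: pexp_def)
    then show ?thesis
    proof (rule has_field_derivative_transform_within_open[where S = "{..<0}"])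
      show "0 = pexp P z" if "z \<in> {..<0}" for z using that by (simp add: pexp_def)
    qed (use 2 in auto)
  next
    case 3
    \<comment> \<open>Dividing by \<open>h\<close> multiplies the polynomial by \<open>z\<close>,
      which is \<open>pCons 0 P\<close>, so the difference quotient is again of the decaying
      form.\<close>
    have r: "((\<lambda>h. pexp P h / h) \<longlongrightarrow> 0) (at_right 0)"
    proof -
      have "((\<lambda>h. poly (pCons 0 P) (inverse h) * exp (- (inverse h))) \<longlongrightarrow> 0) (at_right (0::real))"
        by (rule filterlim_compose[OF poly_exp_decay filterlim_inverse_at_top_right])
      then show ?thesis
        by (rule Lim_transform_eventually) (auto simp: eventually_at_right_less pexp_def field_simps intro!: eventually_at_rightI[of 0 1])
    qed
    have l: "((\<lambda>h. pexp P h / h) \<longlongrightarrow> 0) (at_left 0)"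
      by (rule Lim_transform_eventually[OF tendsto_const]) (auto simp: pexp_def intro!: eventually_at_leftI[of "-1"])
    have "((\<lambda>h. (pexp P (0 + h) - pexp P 0) / h) \<longlongrightarrow> 0) (at 0)"
      using filterlim_split_at[OF l r] by (simp add: pexp_def)
    then show ?thesis using 3 by (simp add: DERIV_def pexp_def)
  qed
qed

text \<open>A smooth function is carried together with its sequence of derivatives, so that facts
  about all orders become equations between explicit functions.\<close>

definition tower :: "(nat \<Rightarrow> real \<Rightarrow> real) \<Rightarrow> bool" where
  "tower f \<longleftrightarrow> (\<forall>m x. (f m has_real_derivative f (Suc m) x) (at x))"

lemma tower_pexp: "\<exists>f. tower f \<and> f 0 = pexp P"
proof -
  define f where "f m = pexp (((\<lambda>P. [:0, 0, 1:] * (P - pderiv P)) ^^ m) P)" for m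
  have "tower f" unfolding tower_def f_def using pexp_derivative by simp
  moreover have "f 0 = pexp P" by (simp add: f_def)
  ultimately show ?thesis by blast
qed

lemma tower_affine:
  assumes "tower f" shows "tower (\<lambda>m x. a ^ m * f m (a * x + b))"
  unfolding tower_def
proof (intro allI)
  fix m x
  have "((\<lambda>x. f m (a * x + b)) has_real_derivative f (Suc m) (a * x + b) * a) (at x)"
    by (rule DERIV_chain2[where f = "f m" and g = "\<lambda>x. a * x + b"])
      (use assms in \<open>auto simp: tower_def intro!: derivative_eq_intros\<close>)
  from DERIV_cmult[OF this, of "a ^ m"]
  show "((\<lambda>x. a ^ m * f m (a * x + b)) has_real_derivative a ^ Suc m * f (Suc m) (a * x + b)) (at x)"
    by (simp add: mult_ac)
qed

text \<open>Leibniz's formula: the two sums from the product rule are merged by Pascal's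
  rule.\<close>

lemma tower_mult:
  assumes f: "tower f" and g: "tower g"
  shows "tower (\<lambda>m x. \<Sum>j\<le>m. real (m choose j) * f j x * g (m - j) x)"
  unfolding tower_def
proof (intro allI)
  fix m x
  have df: "(f j has_real_derivative f (Suc j) x) (at x)" and dg: "(g j has_real_derivative g (Suc j) x) (at x)" for j
    using f g by (auto simp: tower_def)
  have "((\<lambda>x. \<Sum>j\<le>m. real (m choose j) * f j x * g (m - j) x) has_real_derivative
      (\<Sum>j\<le>m. real (m choose j) * (f (Suc j) x * g (m - j) x + f j x * g (Suc (m - j)) x))) (at x)"
    by (rule DERIV_sum) (auto intro!: derivative_eq_intros df dg simp: algebra_simps)
  also have "(\<Sum>j\<le>m. real (m choose j) * (f (Suc j) x * g (m - j) x + f j x * g (Suc (m - j)) x))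
      = (\<Sum>j\<le>m. real (m choose j) * f (Suc j) x * g (m - j) x) + (\<Sum>j\<le>m. real (m choose j) * f j x * g (Suc m - j) x)"
    by (simp add: sum.distrib[symmetric] algebra_simps Suc_diff_le)
  \<comment> \<open>The index shift adds a coefficient 0 at \<open>j = 0\<close>, and the other sum
    gains the zero term \<open>m choose Suc m\<close>, so both run over
    \<open>j \<le> Suc m\<close>.\<close>
  also have "(\<Sum>j\<le>m. real (m choose j) * f (Suc j) x * g (m - j) x) = (\<Sum>j\<le>Suc m. (case j of 0 \<Rightarrow> 0 | Suc i \<Rightarrow> real (m choose i)) * f j x * g (Suc m - j) x)"
    by (simp add: sum.atMost_Suc_shift del: sum.atMost_Suc)
  also have "(\<Sum>j\<le>m. real (m choose j) * f j x * g (Suc m - j) x) = (\<Sum>j\<le>Suc m. real (m choose j) * f j x * g (Suc m - j) x)"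
    by simp
  also have "(\<Sum>j\<le>Suc m. (case j of 0 \<Rightarrow> 0 | Suc i \<Rightarrow> real (m choose i)) * f j x * g (Suc m - j) x) + (\<Sum>j\<le>Suc m. real (m choose j) * f j x * g (Suc m - j) x)
      = (\<Sum>j\<le>Suc m. real (Suc m choose j) * f j x * g (Suc m - j) x)"
    unfolding sum.distrib[symmetric] by (intro sum.cong refl) (auto split: nat.split simp: algebra_simps)
  finally show "((\<lambda>x. \<Sum>j\<le>m. real (m choose j) * f j x * g (m - j) x) has_real_derivative
      (\<Sum>j\<le>Suc m. real (Suc m choose j) * f j x * g (Suc m - j) x)) (at x)" .
qed

lemma tower_cont: "tower f \<Longrightarrow> continuous_on UNIV (f m)"
  unfolding tower_def by (meson DERIV_continuous continuous_at_imp_continuous_on)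

text \<open>The complement of a closed interval is open, so vanishing there passes to the
  derivative.\<close>

lemma tower_zero_outside:
  assumes f: "tower f" and z: "\<And>x. x \<notin> {a..b} \<Longrightarrow> f 0 x = 0"
  shows "x \<notin> {a..b} \<Longrightarrow> f m x = 0"
proof (induction m arbitrary: x)
  case (Suc m)
  have "((\<lambda>_. 0) has_real_derivative f (Suc m) x) (at x)"
  proof (rule has_field_derivative_transform_within_open[where S = "- {a..b}" and f = "f m"])
    show "(f m has_real_derivative f (Suc m) x) (at x)" using f by (simp add: tower_def)
  qed (use Suc in auto)
  then show ?case using DERIV_unique[OF _ DERIV_const] by blast
qed (use z in auto)

lemma tower_bounded:
  assumes f: "tower f" and z: "\<And>x. x \<notin> {a..b} \<Longrightarrow> f 0 x = 0"
  shows "\<exists>B. \<forall>x. \<bar>f m x\<bar> \<le> B"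
proof -
  have "bounded (f m ` {a..b})"
    by (intro compact_imp_bounded compact_continuous_image continuous_on_subset[OF tower_cont[OF f]]) auto
  then obtain B where "\<forall>x\<in>{a..b}. \<bar>f m x\<bar> \<le> B" by (auto simp: bounded_iff)
  then have B: "\<And>x. x \<in> {a..b} \<Longrightarrow> \<bar>f m x\<bar> \<le> B" by blast
  have "\<bar>f m x\<bar> \<le> \<bar>B\<bar>" for x
  proof (cases "x \<in> {a..b}")
    case True
    from B[OF this] show ?thesis by linarith
  next
    case False
    from tower_zero_outside[OF f z this] show ?thesis by simp
  qed
  then show ?thesis by blast
qed

text \<open>The factor \<open>Suc k\<close> drives the arguments of both flat functions to infinity
  inside \<open>(a, b)\<close>. The bumps therefore tend to the indicator of the open interval while
  staying between 0 and 1.\<close>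

definition bump1 :: "nat \<Rightarrow> real \<Rightarrow> real \<Rightarrow> real \<Rightarrow> real" where
  "bump1 k a b x = pexp 1 (real (Suc k) * (x - a)) * pexp 1 (real (Suc k) * (b - x))"

lemma bump1_tower: "\<exists>f. tower f \<and> f 0 = bump1 k a b"
proof -
  obtain g where g: "tower g" "g 0 = pexp 1" using tower_pexp[of 1] by blast
  define c where "c = real (Suc k)"
  define g1 where "g1 = (\<lambda>m x. c ^ m * g m (c * x + - (c * a)))"
  define g2 where "g2 = (\<lambda>m x. (- c) ^ m * g m ((- c) * x + c * b))"
  have "tower g1" "tower g2" unfolding g1_def g2_def by (intro tower_affine g)+
  from tower_mult[OF this] show ?thesis
    by (intro exI[of _ "\<lambda>m x. \<Sum>j\<le>m. real (m choose j) * g1 j x * g2 (m - j) x"])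
      (auto simp: g1_def g2_def g bump1_def fun_eq_iff c_def algebra_simps)
qed

lemma bump1_zero: "x \<notin> {a<..<b} \<Longrightarrow> bump1 k a b x = 0"
  by (auto simp: bump1_def pexp_def zero_less_mult_iff)

lemma bump1_range: "0 \<le> bump1 k a b x" "bump1 k a b x \<le> 1"
proof -
  have "0 \<le> pexp 1 z \<and> pexp 1 z \<le> 1" for z by (auto simp: pexp_def)
  then show "0 \<le> bump1 k a b x" "bump1 k a b x \<le> 1" unfolding bump1_def by (auto intro: mult_le_one)
qed

lemma bump1_limit: "(\<lambda>k. bump1 k a b x) \<longlonglongrightarrow> indicator {a<..<b} x"
proof (cases "x \<in> {a<..<b}")
  case False
  then show ?thesis by (simp add: bump1_zero)
next
  case True
  have *: "(\<lambda>k. pexp 1 (real (Suc k) * z)) \<longlonglongrightarrow> 1" if z: "z > 0" for z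
  proof -
    have "(\<lambda>k. exp (- 1 / z * inverse (real (Suc k)))) \<longlonglongrightarrow> exp (- 1 / z * 0)"
      by (intro tendsto_intros LIMSEQ_inverse_real_of_nat)
    moreover have "exp (- 1 / z * inverse (real (Suc k))) = pexp 1 (real (Suc k) * z)" for k
      using z by (simp add: pexp_def field_simps add_pos_nonneg)
    ultimately show ?thesis by simp
  qed
  have "(\<lambda>k. bump1 k a b x) \<longlonglongrightarrow> 1 * 1" unfolding bump1_def using True by (intro tendsto_mult *) auto
  then show ?thesis using True by simp
qed

definition bump :: "nat \<Rightarrow> real ^ 'n \<Rightarrow> real ^ 'n \<Rightarrow> real ^ 'n \<Rightarrow> real" where
  "bump k a b x = (\<Prod>i\<in>UNIV. bump1 k (a $ i) (b $ i) (x $ i))"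

lemma bump_range: "0 \<le> bump k a b x" "bump k a b x \<le> 1"
  unfolding bump_def by (auto intro!: prod_nonneg prod_le_1 simp: bump1_range)

lemma bump_zero: "x \<notin> box a b \<Longrightarrow> bump k a b x = 0"
  unfolding bump_def by (auto simp: mem_box_cart intro!: prod_zero bump1_zero)

lemma bump_limit: "(\<lambda>k. bump k a b x) \<longlonglongrightarrow> indicator (box a b) x"
proof -
  have "(\<lambda>k. bump k a b x) \<longlonglongrightarrow> (\<Prod>i\<in>UNIV. indicator {a $ i<..<b $ i} (x $ i))"
    unfolding bump_def by (intro tendsto_prod bump1_limit)
  also have "(\<Prod>i\<in>UNIV. indicator {a $ i<..<b $ i} (x $ i)) = (indicator (box a b) x :: real)"
    by (cases "x \<in> box a b") (auto simp: mem_box_cart indicator_def intro!: prod.neutral prod_zero)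
  finally show ?thesis .
qed

section \<open>Partial derivatives of products of one-variable functions\<close>

lemma product_tower_deriv:
  fixes f :: "'n::finite \<Rightarrow> nat \<Rightarrow> real \<Rightarrow> real"
  assumes f: "\<And>i. tower (f i)"
  shows "((\<lambda>x. \<Prod>i\<in>UNIV. f i (n i) (x $ i)) has_derivative
      (\<lambda>h. \<Sum>i\<in>UNIV. h $ i * (\<Prod>j\<in>UNIV. f j (inc i n j) (x $ j)))) (at x)"
proof -
  have d: "((\<lambda>x::real^'n. f i (n i) (x $ i)) has_derivative (\<lambda>h. f i (Suc (n i)) (x $ i) * (h $ i))) (at x)" for i
  proof -
    have "(f i (n i) has_derivative (*) (f i (Suc (n i)) (x $ i))) (at (x $ i))"
      using f[of i] by (simp add: tower_def has_field_derivative_def)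
    from has_derivative_compose[OF bounded_linear_imp_has_derivative[OF bounded_linear_vec_nth] this]
    show ?thesis .
  qed
  have "((\<lambda>x. \<Prod>i\<in>UNIV. f i (n i) (x $ i)) has_derivative
      (\<lambda>h. \<Sum>i\<in>UNIV. f i (Suc (n i)) (x $ i) * (h $ i) * (\<Prod>j\<in>UNIV - {i}. f j (n j) (x $ j)))) (at x)"
    by (rule has_derivative_prod) (use d in auto)
  moreover have "f i (Suc (n i)) (x $ i) * (h $ i) * (\<Prod>j\<in>UNIV - {i}. f j (n j) (x $ j)) = h $ i * (\<Prod>j\<in>UNIV. f j (inc i n j) (x $ j))" for h i
    by (subst (2) prod.remove[of _ i]) (auto simp: inc_def intro!: prod.cong)
  ultimately show ?thesis by simp
qed

lemma product_tower_partial: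
  fixes f :: "'n::finite \<Rightarrow> nat \<Rightarrow> real \<Rightarrow> real"
  assumes f: "\<And>i. tower (f i)"
  shows "partial_deriv i (\<lambda>x. \<Prod>i\<in>UNIV. f i (n i) (x $ i)) = (\<lambda>x. \<Prod>j\<in>UNIV. f j (inc i n j) (x $ j))"
proof
  fix x :: "real ^ 'n"
  show "partial_deriv i (\<lambda>x. \<Prod>i\<in>UNIV. f i (n i) (x $ i)) x = (\<Prod>j\<in>UNIV. f j (inc i n j) (x $ j))"
    unfolding partial_deriv_def frechet_derivative_at[OF product_tower_deriv[OF f], symmetric]
    by (subst sum.remove[of _ i]) (auto simp: axis_def intro!: sum.neutral)
qed

lemma count_list_Cons_inc: "count_list (i # is) = inc i (count_list is)"
  by (auto simp: fun_eq_iff inc_def)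

lemma product_tower_iter_partial:
  fixes f :: "'n::finite \<Rightarrow> nat \<Rightarrow> real \<Rightarrow> real"
  assumes f: "\<And>i. tower (f i)"
  shows "iter_partial is (\<lambda>x. \<Prod>i\<in>UNIV. f i 0 (x $ i)) = (\<lambda>x. \<Prod>j\<in>UNIV. f j (count_list is j) (x $ j))"
proof (induction "is")
  case Nil
  then show ?case by (simp add: iter_partial_def)
next
  case (Cons i "is")
  then show ?case using product_tower_partial[where f = f and i = i and n = "count_list is", OF f]
    by (simp add: iter_partial_def count_list_Cons_inc del: count_list.simps)
qed

text \<open>The mixed partial derivatives of a product are read off coordinatewise, so their symmetry is
  automatic.\<close>

lemma bump_jet:
  fixes a b :: "real ^ 'n"
  obtains \<Psi> where "jet \<Psi>" "\<And>is. iter_partial is (bump k a b) = \<Psi> (count_list is)" "test_function (bump k a b)"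
    "\<And>n x. x \<notin> cbox a b \<Longrightarrow> \<Psi> n x = 0"
proof -
  have "\<forall>i. \<exists>f. tower f \<and> f 0 = bump1 k (a $ i) (b $ i)" using bump1_tower by blast
  from choice[OF this] obtain f where f: "\<And>i. tower (f i)" "\<And>i. f i 0 = bump1 k (a $ i) (b $ i)" by blast
  define \<Psi> where "\<Psi> n x = (\<Prod>i\<in>UNIV. f i (n i) (x $ i))" for n :: "'n \<Rightarrow> nat" and x :: "real ^ 'n"
  have bump: "bump k a b = (\<lambda>x. \<Prod>i\<in>UNIV. f i 0 (x $ i))" by (auto simp: bump_def f fun_eq_iff)
  have it: "iter_partial is (bump k a b) = \<Psi> (count_list is)" for "is"
    unfolding bump product_tower_iter_partial[OF f(1)] by (simp add: \<Psi>_def fun_eq_iff)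
  have zero: "f i m x = 0" if "x \<notin> {a $ i..b $ i}" for i m x
    by (rule tower_zero_outside[OF f(1) _ that]) (auto simp: f intro!: bump1_zero)
  have "\<exists>B. \<forall>x. \<bar>f i m x\<bar> \<le> B" for i m
    by (rule tower_bounded[OF f(1), of "a $ i" "b $ i"]) (auto simp: f intro!: bump1_zero)
  then obtain B where B: "\<And>i m x. \<bar>f i m x\<bar> \<le> B i m" by metis
  have "jet \<Psi>" unfolding jet_def
  proof (intro conjI allI)
    fix n :: "'n \<Rightarrow> nat"
    have "\<bar>\<Psi> n x\<bar> \<le> (\<Prod>i\<in>UNIV. B i (n i))" for x
      unfolding \<Psi>_def abs_prod by (intro prod_mono) (auto simp: B)
    then show "bounded (range (\<Psi> n))" unfolding bounded_iff by auto
    fix i and y :: "real ^ 'n"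
    have 1: "(\<Psi> n has_derivative (\<lambda>h. \<Sum>i\<in>UNIV. h $ i * \<Psi> (inc i n) y)) (at (y + 0 *\<^sub>R axis i 1))"
      using product_tower_deriv[where f = f and n = n and x = y, OF f(1)] unfolding \<Psi>_def by simp
    have 2: "((\<lambda>t. y + t *\<^sub>R axis i 1) has_derivative (\<lambda>t. t *\<^sub>R axis i 1)) (at 0)"
      by (auto intro!: derivative_eq_intros)
    have "((\<lambda>t. \<Psi> n (y + t *\<^sub>R axis i 1)) has_derivative (\<lambda>t. \<Sum>j\<in>UNIV. (t *\<^sub>R axis i 1) $ j * \<Psi> (inc j n) y)) (at 0)"
      using has_derivative_compose[OF 2 1] .
    moreover have "(\<lambda>t::real. \<Sum>j\<in>UNIV. (t *\<^sub>R axis i 1) $ j * \<Psi> (inc j n) y) = (*) (\<Psi> (inc i n) y)"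
      by (rule ext, subst sum.remove[of _ i]) (auto simp: axis_def intro!: sum.neutral)
    ultimately show "((\<lambda>t. \<Psi> n (y + t *\<^sub>R axis i 1)) has_real_derivative \<Psi> (inc i n) y) (at 0)"
      by (simp add: has_field_derivative_def)
  qed
  moreover have "test_function (bump k a b)"
    unfolding test_function_def it
  proof (intro conjI allI)
    fix "is" :: "'n list"
    show "\<Psi> (count_list is) differentiable_on UNIV"
      using product_tower_deriv[where f = f and n = "count_list is", OF f(1)] unfolding \<Psi>_def differentiable_on_def differentiable_def by auto
    have "closure {x. bump k a b x \<noteq> 0} \<subseteq> cbox a b"
      using bump_zero[of _ a b k] box_subset_cbox[of a b] by (intro closure_minimal closed_cbox) auto
    then have "bounded (closure {x. bump k a b x \<noteq> 0})" using bounded_subset bounded_cbox by blast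
    then show "compact (closure {x. bump k a b x \<noteq> 0})" by (simp add: compact_eq_bounded_closed)
  qed
  moreover have "\<Psi> n x = 0" if "x \<notin> cbox a b" for n x
    unfolding \<Psi>_def using that zero by (fastforce simp: mem_box_cart intro!: prod_zero)
  ultimately show ?thesis using it that by blast
qed

text \<open>Translates of bumps are bumps, so whatever holds for all bumps as test functions holds
  for their translates.\<close>

lemma bump_shift: "bump k a b (x - y) = bump k (a + y) (b + y) x"
  by (simp add: bump_def bump1_def algebra_simps)

section \<open>\<open>L\<^sub>p\<close> norms and duality\<close>

lemma epowr_0 [simp]: "epowr 0 a = 0"
  by (simp add: epowr_def)

lemma epowr_top [simp]: "epowr top a = top"
  by (simp add: epowr_def)

lemma epowr_ennreal: "0 \<le> x \<Longrightarrow> epowr (ennreal x) a = ennreal (x powr a)"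
  by (simp add: epowr_def)

lemma epowr_1 [simp]: "epowr x 1 = x"
  by (cases x) (auto simp: epowr_ennreal)

lemma epowr_mono: "x \<le> y \<Longrightarrow> 0 < a \<Longrightarrow> epowr x a \<le> epowr y a"
  by (cases x; cases y) (auto simp: epowr_ennreal ennreal_leI powr_mono2 top_unique)

lemma epowr_mult:
  assumes "0 < a" shows "epowr (x * y) a = epowr x a * epowr y a"
proof (cases x)
  case (real u)
  show ?thesis
  proof (cases y)
    case (real v)
    then show ?thesis using \<open>x = ennreal u\<close> \<open>0 \<le> u\<close>
      by (simp add: epowr_ennreal ennreal_mult[symmetric] powr_mult)
  next
    case top
    then show ?thesis using \<open>x = ennreal u\<close> \<open>0 \<le> u\<close> assms
      by (cases "u = 0") (auto simp: epowr_ennreal ennreal_mult_top)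
  qed
next
  case top
  show ?thesis
  proof (cases y)
    case (real v)
    then show ?thesis using top assms
      by (cases "v = 0") (auto simp: epowr_ennreal ennreal_top_mult)
  qed (use top in simp)
qed

lemma epowr_epowr: "epowr (epowr x a) b = epowr x (a * b)"
  by (cases x) (auto simp: epowr_ennreal powr_powr)

lemma epowr_le_iff_root: "0 < a \<Longrightarrow> epowr x (1 / a) \<le> y \<longleftrightarrow> x \<le> epowr y a"
proof
  assume a: "0 < a"
  { assume "epowr x (1 / a) \<le> y"
    from epowr_mono[OF this a] show "x \<le> epowr y a" using a by (simp add: epowr_epowr) }
  { assume "x \<le> epowr y a"
    from epowr_mono[OF this, of "1 / a"] show "epowr x (1 / a) \<le> y" using a by (simp add: epowr_epowr) }
qed

lemma epowr_measurable [measurable]: "(\<lambda>x. epowr x a) \<in> borel_measurable borel"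
  unfolding epowr_def by measurable

text \<open>Bounds the sum by twice the maximum. This is crude but valid for every
  \<open>a > 0\<close>, hence for roots as well as for powers.\<close>

lemma epowr_add_le:
  assumes "0 < a" shows "epowr (x + y) a \<le> epowr 2 a * (epowr x a + epowr y a)"
proof -
  have "x + y \<le> 2 * max x y" by (metis add_mono max.cobounded1 max.cobounded2 mult_2)
  then have "epowr (x + y) a \<le> epowr 2 a * epowr (max x y) a"
    using epowr_mono[of "x + y" "2 * max x y" a] assms by (simp add: epowr_mult)
  also have "epowr (max x y) a \<le> epowr x a + epowr y a"
    by (cases "x \<le> y") (auto simp: max_def)
  finally show ?thesis by (simp add: mult_left_mono)
qed

lemma epowr_tendsto:
  assumes "(f \<longlongrightarrow> ennreal x) F" "0 \<le> x" "0 < a" shows "((\<lambda>i. epowr (f i) a) \<longlongrightarrow> epowr (ennreal x) a) F"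
proof -
  have lt: "eventually (\<lambda>i. f i < top) F" by (rule order_tendstoD[OF assms(1)]) simp
  have "((\<lambda>i. enn2real (f i)) \<longlongrightarrow> x) F"
    using tendsto_enn2real[OF assms(1,2)] .
  then have "((\<lambda>i. enn2real (f i) powr a) \<longlongrightarrow> x powr a) F"
    using assms by (intro tendsto_powr2[where b = a]) auto
  then have "((\<lambda>i. ennreal (enn2real (f i) powr a)) \<longlongrightarrow> ennreal (x powr a)) F" by (rule tendsto_ennrealI)
  then show ?thesis unfolding epowr_ennreal[OF assms(2)]
    by (rule Lim_transform_eventually) (use lt in eventually_elim, auto simp: epowr_def)
qed

section \<open>Monotonicity and quasi-linearity of the norms\<close>

lemma finite_exponent: "1 \<le> p \<Longrightarrow> p \<noteq> \<infinity> \<Longrightarrow> 1 \<le> enn2real p"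
  by (cases p) auto

lemma Lp_norm_finite: "p \<noteq> \<infinity> \<Longrightarrow> Lp_norm p f = epowr (\<integral>\<^sup>+ x. ennreal (\<bar>f x\<bar> powr enn2real p) \<partial>lborel) (1 / enn2real p)"
  by (simp add: Lp_norm_def)

lemma Lp_norm_infinite: "Lp_norm \<infinity> f = esssup lborel (\<lambda>x. ennreal \<bar>f x\<bar>)"
  by (simp add: Lp_norm_def)

lemma Lp_norm_AE_bound:
  assumes "1 \<le> p" and [measurable]: "f \<in> borel_measurable borel" "g \<in> borel_measurable borel"
    and "AE x in lborel. \<bar>f x\<bar> \<le> \<bar>g x\<bar>"
  shows "Lp_norm p f \<le> Lp_norm p g"
proof (cases "p = \<infinity>")
  case True
  show ?thesis unfolding True Lp_norm_infinite
    by (rule esssup_AE_mono) (use assms(4) in \<open>auto intro: ennreal_leI\<close>)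
next
  case False
  show ?thesis unfolding Lp_norm_finite[OF False]
    by (intro epowr_mono nn_integral_mono_AE)
      (use assms(4) finite_exponent[OF assms(1) False] in \<open>auto intro!: ennreal_leI powr_mono2 elim!: AE_mp\<close>)
qed

lemma Lp_norm_cong_AE:
  assumes "1 \<le> p" and "f \<in> borel_measurable borel" "g \<in> borel_measurable borel" "AE x in lborel. f x = g x"
  shows "Lp_norm p f = Lp_norm p g"
  by (intro antisym Lp_norm_AE_bound assms) (use assms(4) in auto)

lemma Lp_norm_cmult_le:
  assumes p: "1 \<le> p" and [measurable]: "f \<in> borel_measurable borel"
  shows "Lp_norm p (\<lambda>x. c * f x) \<le> ennreal \<bar>c\<bar> * Lp_norm p f"
proof (cases "p = \<infinity>")
  case True
  show ?thesis unfolding True Lp_norm_infinite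
  proof (rule esssup_I)
    show "AE x in lborel. ennreal \<bar>c * f x\<bar> \<le> ennreal \<bar>c\<bar> * esssup lborel (\<lambda>x. ennreal \<bar>f x\<bar>)"
      using esssup_AE[of "\<lambda>x. ennreal \<bar>f x\<bar>" lborel]
      by (auto simp: abs_mult ennreal_mult mult_left_mono elim!: AE_mp)
  qed measurable
next
  case False
  note P = finite_exponent[OF p False]
  have "(\<integral>\<^sup>+ x. ennreal (\<bar>c * f x\<bar> powr enn2real p) \<partial>lborel)
      = ennreal (\<bar>c\<bar> powr enn2real p) * (\<integral>\<^sup>+ x. ennreal (\<bar>f x\<bar> powr enn2real p) \<partial>lborel)"
    by (subst nn_integral_cmult[symmetric]) (auto simp: abs_mult powr_mult ennreal_mult)
  then show ?thesis unfolding Lp_norm_finite[OF False]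
    using P by (simp add: epowr_mult epowr_ennreal powr_powr)
qed

text \<open>A triangle inequality up to a constant is enough for comparisons up to constants. One
  factor 2 comes from the \<open>P\<close>-th power and one, \<open>2 powr (1 / P) \<le> 2\<close>,
  from the root.\<close>

lemma Lp_norm_add_le:
  assumes p: "1 \<le> p" and [measurable]: "f \<in> borel_measurable borel" "g \<in> borel_measurable borel"
  shows "Lp_norm p (\<lambda>x. f x + g x) \<le> 4 * (Lp_norm p f + Lp_norm p g)"
proof (cases "p = \<infinity>")
  case True
  have "Lp_norm p (\<lambda>x. f x + g x) \<le> Lp_norm p f + Lp_norm p g"
    unfolding True Lp_norm_infinite
  proof (rule esssup_I)
    show "AE x in lborel. ennreal \<bar>f x + g x\<bar> \<le> esssup lborel (\<lambda>x. ennreal \<bar>f x\<bar>) + esssup lborel (\<lambda>x. ennreal \<bar>g x\<bar>)"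
      using esssup_AE[of "\<lambda>x. ennreal \<bar>f x\<bar>" lborel] esssup_AE[of "\<lambda>x. ennreal \<bar>g x\<bar>" lborel]
    proof eventually_elim
      case (elim x)
      have "ennreal \<bar>f x + g x\<bar> \<le> ennreal \<bar>f x\<bar> + ennreal \<bar>g x\<bar>"
        by (simp add: ennreal_plus[symmetric] del: ennreal_plus)
      then show ?case using add_mono[OF elim] by (rule order_trans)
    qed
  qed measurable
  also have "\<dots> \<le> 4 * \<dots>" using mult_right_mono[of 1 4 "Lp_norm p f + Lp_norm p g"] by simp
  finally show ?thesis .
next
  case False
  define P where "P = enn2real p"
  have P: "1 \<le> P" using finite_exponent[OF p False] by (simp add: P_def)
  let ?I = "\<lambda>f. \<integral>\<^sup>+ x. ennreal (\<bar>f x :: real\<bar> powr P) \<partial>(lborel :: 'a measure)"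
  have pt: "ennreal (\<bar>f x + g x\<bar> powr P) \<le> epowr 2 P * (ennreal (\<bar>f x\<bar> powr P) + ennreal (\<bar>g x\<bar> powr P))" for x
  proof -
    have "ennreal (\<bar>f x + g x\<bar> powr P) = epowr (ennreal \<bar>f x + g x\<bar>) P" by (simp add: epowr_ennreal)
    also have "\<dots> \<le> epowr (ennreal \<bar>f x\<bar> + ennreal \<bar>g x\<bar>) P"
      using P by (intro epowr_mono) (auto simp: ennreal_plus[symmetric] simp del: ennreal_plus)
    also have "\<dots> \<le> epowr 2 P * (epowr (ennreal \<bar>f x\<bar>) P + epowr (ennreal \<bar>g x\<bar>) P)"
      using P by (intro epowr_add_le) auto
    finally show ?thesis by (simp add: epowr_ennreal)
  qed
  have "?I (\<lambda>x. f x + g x) \<le> (\<integral>\<^sup>+ x. epowr 2 P * (ennreal (\<bar>f x\<bar> powr P) + ennreal (\<bar>g x\<bar> powr P)) \<partial>lborel)"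
    by (intro nn_integral_mono pt)
  also have "\<dots> = epowr 2 P * (?I f + ?I g)"
    by (simp add: nn_integral_cmult nn_integral_add)
  finally have "epowr (?I (\<lambda>x. f x + g x)) (1 / P) \<le> epowr (epowr 2 P * (?I f + ?I g)) (1 / P)"
    using P by (intro epowr_mono) auto
  also have "\<dots> = 2 * epowr (?I f + ?I g) (1 / P)"
    using P by (simp add: epowr_mult epowr_epowr)
  also have "\<dots> \<le> 2 * (epowr 2 (1 / P) * (epowr (?I f) (1 / P) + epowr (?I g) (1 / P)))"
    using P by (intro mult_left_mono epowr_add_le) auto
  also have "epowr 2 (1 / P) \<le> 2"
  proof -
    have "(2::real) powr (1 / P) \<le> 2 powr 1" using P by (intro powr_mono) auto
    then have "ennreal (2 powr (1 / P)) \<le> ennreal 2" by (intro ennreal_leI) simp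
    then show ?thesis using epowr_ennreal[of 2 "1 / P"] by simp
  qed
  finally have "epowr (?I (\<lambda>x. f x + g x)) (1 / P) \<le> 2 * (2 * (epowr (?I f) (1 / P) + epowr (?I g) (1 / P)))"
    by (simp add: mult_left_mono mult_right_mono)
  then show ?thesis unfolding Lp_norm_finite[OF False] P_def[symmetric] by (simp add: mult.assoc[symmetric])
qed

lemma Lp_norm_zero: "1 \<le> p \<Longrightarrow> Lp_norm p (\<lambda>x. 0) = 0"
  using Lp_norm_cmult_le[of p "\<lambda>_. 0" 0] by simp

lemma Lp_norm_sum_le:
  assumes p: "1 \<le> p" and "finite S" and "\<And>s. s \<in> S \<Longrightarrow> f s \<in> borel_measurable borel"
  shows "Lp_norm p (\<lambda>x. \<Sum>s\<in>S. f s x) \<le> 4 ^ card S * (\<Sum>s\<in>S. Lp_norm p (f s))"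
  using assms(2,3)
proof (induction S rule: finite_induct)
  case empty
  then show ?case using p by (simp add: Lp_norm_zero)
next
  case (insert s S)
  have "Lp_norm p (\<lambda>x. \<Sum>s\<in>insert s S. f s x) = Lp_norm p (\<lambda>x. f s x + (\<Sum>s\<in>S. f s x))"
    using insert by simp
  also have "\<dots> \<le> 4 * (Lp_norm p (f s) + Lp_norm p (\<lambda>x. \<Sum>s\<in>S. f s x))"
    using insert.prems by (intro Lp_norm_add_le[OF p] borel_measurable_sum) auto
  also have "\<dots> \<le> 4 * (4 ^ card S * Lp_norm p (f s) + 4 ^ card S * (\<Sum>s\<in>S. Lp_norm p (f s)))"
  proof (intro mult_left_mono add_mono)
    show "Lp_norm p (f s) \<le> 4 ^ card S * Lp_norm p (f s)"
      using mult_right_mono[of 1 "4 ^ card S" "Lp_norm p (f s)"] by (simp add: one_le_power)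
  qed (use insert in auto)
  also have "\<dots> = 4 ^ card (insert s S) * (\<Sum>s\<in>insert s S. Lp_norm p (f s))"
    using insert by (simp add: distrib_left mult.assoc)
  finally show ?case .
qed

text \<open>The Hoelder conjugate. At \<open>p = 1\<close> the quotient is \<open>1 / 0 = 0\<close>,
  and \<open>dual_norm\<close> treats that case separately.\<close>

definition dual_exponent :: "ennreal \<Rightarrow> real" where
  "dual_exponent p = (if p = \<infinity> then 1 else enn2real p / (enn2real p - 1))"

text \<open>For \<open>p = 1\<close> the plain supremum is more convenient than the essential one: it passes to
  pointwise dominated approximations.\<close>

definition dual_norm :: "ennreal \<Rightarrow> ('a::euclidean_space \<Rightarrow> real) \<Rightarrow> ennreal" where
  "dual_norm p \<psi> =
     (if p = 1 then SUP x. ennreal \<bar>\<psi> x\<bar>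
      else epowr (\<integral>\<^sup>+ x. ennreal (\<bar>\<psi> x\<bar> powr dual_exponent p) \<partial>lborel) (1 / dual_exponent p))"

lemma dual_exponent_ge_1: "1 \<le> p \<Longrightarrow> p \<noteq> 1 \<Longrightarrow> 1 \<le> dual_exponent p"
  by (cases p) (auto simp: dual_exponent_def field_simps)

lemma finite_exponent_gt: "1 \<le> p \<Longrightarrow> p \<noteq> 1 \<Longrightarrow> p \<noteq> \<infinity> \<Longrightarrow> 1 < enn2real p"
  by (cases p) auto

lemma dual_norm_mono:
  assumes "1 \<le> p" "\<And>x. \<bar>f x\<bar> \<le> \<bar>g x\<bar>" shows "dual_norm p f \<le> dual_norm p g"
proof (cases "p = 1")
  case True
  then show ?thesis unfolding dual_norm_def using assms(2) by (auto intro!: SUP_mono ennreal_leI)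
next
  case False
  then show ?thesis unfolding dual_norm_def using dual_exponent_ge_1[OF assms(1) False] assms(2)
    by (auto intro!: epowr_mono nn_integral_mono ennreal_leI powr_mono2)
qed

text \<open>Young's inequality for the normalised functions; norms that are 0 or infinite are split
  off because they cannot be normalised.\<close>

lemma Hoelder:
  fixes f \<psi> :: "'a::euclidean_space \<Rightarrow> real"
  assumes p: "1 \<le> p" and [measurable]: "f \<in> borel_measurable borel" "\<psi> \<in> borel_measurable borel"
  shows "(\<integral>\<^sup>+ x. ennreal (\<bar>f x\<bar> * \<bar>\<psi> x\<bar>) \<partial>lborel) \<le> Lp_norm p f * dual_norm p \<psi>"
proof -
  consider "p = 1" | "p = \<infinity>" | "p \<noteq> 1" "p \<noteq> \<infinity>" by blast
  then show ?thesis
  proof cases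
    case 1
    have "ennreal (\<bar>f x\<bar> * \<bar>\<psi> x\<bar>) \<le> ennreal \<bar>f x\<bar> * dual_norm p \<psi>" for x
      unfolding dual_norm_def using 1 by (auto simp: ennreal_mult intro!: mult_left_mono SUP_upper)
    then have "(\<integral>\<^sup>+ x. ennreal (\<bar>f x\<bar> * \<bar>\<psi> x\<bar>) \<partial>lborel) \<le> (\<integral>\<^sup>+ x. ennreal \<bar>f x\<bar> * dual_norm p \<psi> \<partial>lborel)"
      by (intro nn_integral_mono)
    also have "\<dots> = (\<integral>\<^sup>+ x. ennreal \<bar>f x\<bar> \<partial>lborel) * dual_norm p \<psi>" by (rule nn_integral_multc) simp
    also have "(\<integral>\<^sup>+ x. ennreal \<bar>f x\<bar> \<partial>lborel) = Lp_norm p f" using 1 by (simp add: Lp_norm_finite)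
    finally show ?thesis .
  next
    case 2
    have "(\<integral>\<^sup>+ x. ennreal (\<bar>f x\<bar> * \<bar>\<psi> x\<bar>) \<partial>lborel) \<le> (\<integral>\<^sup>+ x. Lp_norm p f * ennreal \<bar>\<psi> x\<bar> \<partial>lborel)"
    proof (rule nn_integral_mono_AE)
      show "AE x in lborel. ennreal (\<bar>f x\<bar> * \<bar>\<psi> x\<bar>) \<le> Lp_norm p f * ennreal \<bar>\<psi> x\<bar>"
        using esssup_AE[of "\<lambda>x. ennreal \<bar>f x\<bar>" lborel] unfolding 2 Lp_norm_infinite
        by eventually_elim (simp add: ennreal_mult mult_right_mono)
    qed
    also have "\<dots> = Lp_norm p f * (\<integral>\<^sup>+ x. ennreal \<bar>\<psi> x\<bar> \<partial>lborel)" by (rule nn_integral_cmult) simp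
    finally show ?thesis using 2 by (simp add: dual_norm_def dual_exponent_def)
  next
    case 3
    define P where "P = enn2real p"
    define e where "e = dual_exponent p"
    have P: "1 < P" using finite_exponent_gt[OF p 3] by (simp add: P_def)
    have e: "e = P / (P - 1)" "1 < e" "1 / P + 1 / e = 1"
      using P 3 by (auto simp: e_def dual_exponent_def P_def field_simps)
    define a where "a = (\<integral>\<^sup>+ x. ennreal (\<bar>f x\<bar> powr P) \<partial>lborel)"
    define b where "b = (\<integral>\<^sup>+ x. ennreal (\<bar>\<psi> x\<bar> powr e) \<partial>lborel)"
    have rhs: "Lp_norm p f * dual_norm p \<psi> = epowr a (1 / P) * epowr b (1 / e)"
      using 3 by (simp add: Lp_norm_finite dual_norm_def a_def b_def P_def e_def)
    consider "a = 0" | "b = 0" | "a \<noteq> 0" "b \<noteq> 0" "a = top \<or> b = top" | "0 < a" "0 < b" "a < top" "b < top"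
      by (metis not_gr_zero top.not_eq_extremum)
    then show ?thesis
    proof cases
      case 1
      then have "AE x in lborel. f x = 0" unfolding a_def by (subst (asm) nn_integral_0_iff_AE) auto
      then have "(\<integral>\<^sup>+ x. ennreal (\<bar>f x\<bar> * \<bar>\<psi> x\<bar>) \<partial>lborel) = 0" by (subst nn_integral_0_iff_AE) auto
      then show ?thesis by simp
    next
      case 2
      then have "AE x in lborel. \<psi> x = 0" unfolding b_def by (subst (asm) nn_integral_0_iff_AE) auto
      then have "(\<integral>\<^sup>+ x. ennreal (\<bar>f x\<bar> * \<bar>\<psi> x\<bar>) \<partial>lborel) = 0" by (subst nn_integral_0_iff_AE) auto
      then show ?thesis by simp
    next
      case 3
      have nz: "epowr x c \<noteq> 0" if "x \<noteq> 0" for x c using that by (cases x) (auto simp: epowr_ennreal)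
      have "epowr a (1 / P) * epowr b (1 / e) = top"
        using 3 nz[of a "1 / P"] nz[of b "1 / e"] by (auto simp: ennreal_top_mult ennreal_mult_top)
      then show ?thesis unfolding rhs by simp
    next
      case 4
      obtain a' b' where ab: "a = ennreal a'" "b = ennreal b'" "0 < a'" "0 < b'"
        using 4 by (cases a; cases b) auto
      \<comment> \<open>\<open>A\<close> and \<open>B\<close> are the two norms; after division by
        them the right-hand side of Young's inequality integrates to
        \<open>1 / P + 1 / e = 1\<close>.\<close>
      define A where "A = a' powr (1 / P)"
      define B where "B = b' powr (1 / e)"
      have AB: "A > 0" "B > 0" "A powr P = a'" "B powr e = b'" using ab P e by (auto simp: A_def B_def powr_powr)
      have "\<bar>f x\<bar> * \<bar>\<psi> x\<bar> \<le> A * B * (\<bar>f x\<bar> powr P / (P * a') + \<bar>\<psi> x\<bar> powr e / (e * b'))" for x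
      proof -
        have "(\<bar>f x\<bar> / A) * (\<bar>\<psi> x\<bar> / B) \<le> (\<bar>f x\<bar> / A) powr P / P + (\<bar>\<psi> x\<bar> / B) powr e / e"
          using P e AB by (intro Youngs_inequality) auto
        also have "\<dots> = \<bar>f x\<bar> powr P / (P * a') + \<bar>\<psi> x\<bar> powr e / (e * b')"
          using AB by (simp add: powr_divide mult.commute)
        finally show ?thesis using AB by (simp add: field_simps)
      qed
      then have "(\<integral>\<^sup>+ x. ennreal (\<bar>f x\<bar> * \<bar>\<psi> x\<bar>) \<partial>lborel)
          \<le> (\<integral>\<^sup>+ x. ennreal (A * B) * (ennreal (1 / (P * a')) * ennreal (\<bar>f x\<bar> powr P) + ennreal (1 / (e * b')) * ennreal (\<bar>\<psi> x\<bar> powr e)) \<partial>lborel)"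
        using AB P e(2) ab by (intro nn_integral_mono)
          (simp add: ennreal_mult[symmetric] ennreal_plus[symmetric] ennreal_leI del: ennreal_plus)
      also have "\<dots> = ennreal (A * B) * (ennreal (1 / (P * a')) * a + ennreal (1 / (e * b')) * b)"
        unfolding a_def b_def by (simp add: nn_integral_cmult nn_integral_add)
      also have "ennreal (1 / (P * a')) * a + ennreal (1 / (e * b')) * b = ennreal (1 / P + 1 / e)"
        using ab P e(2) by (simp add: ennreal_mult[symmetric] ennreal_plus[symmetric] del: ennreal_plus)
      also have "ennreal (A * B) * ennreal (1 / P + 1 / e) = epowr a (1 / P) * epowr b (1 / e)"
        unfolding e(3) using ab by (simp add: epowr_ennreal A_def B_def ennreal_mult)
      finally show ?thesis unfolding rhs .
    qed
  qed
qed

text \<open>The converse of Hoelder's inequality by explicit extremals: the power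
  \<open>P - 1\<close> of the absolute value for finite \<open>p\<close>, the indicator of a set
  where \<open>F\<close> is too large for \<open>p = \<infinity>\<close>. Truncation makes them
  bounded with bounded support, so only such test functions have to be controlled.\<close>

lemma Lp_norm_dual:
  fixes F :: "'a::euclidean_space \<Rightarrow> real"
  assumes p: "1 \<le> p" and F [measurable]: "F \<in> borel_measurable borel" and B: "0 \<le> B"
    and dual: "\<And>\<psi> M R. \<psi> \<in> borel_measurable borel \<Longrightarrow> (\<And>x. 0 \<le> \<psi> x) \<Longrightarrow> (\<And>x. \<psi> x \<le> M) \<Longrightarrow> (\<And>x. norm x > R \<Longrightarrow> \<psi> x = 0) \<Longrightarrow>
      (\<integral>\<^sup>+ x. ennreal (\<bar>F x\<bar> * \<psi> x) \<partial>lborel) \<le> ennreal B * dual_norm p \<psi>"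
  shows "Lp_norm p F \<le> ennreal B"
proof (cases "p = \<infinity>")
  case True
  have "AE x in lborel. \<not> (\<bar>F x\<bar> > B + 1 / real (Suc j) \<and> norm x \<le> real j)" for j
  proof -
    define E where "E = {x. \<bar>F x\<bar> > B + 1 / real (Suc j) \<and> norm x \<le> real j}"
    have [measurable]: "E \<in> sets borel" unfolding E_def by measurable
    have "E \<subseteq> cball 0 (real j)" by (auto simp: E_def)
    then have "emeasure lborel E \<le> emeasure lborel (cball (0::'a) (real j))" by (intro emeasure_mono) auto
    then have fin: "emeasure lborel E < top"
      using emeasure_lborel_cball_finite[of "0::'a" "real j"] by (auto simp: top.not_eq_extremum less_top dest: le_less_trans)
    have "ennreal (B + 1 / real (Suc j)) * emeasure lborel E = (\<integral>\<^sup>+ x. ennreal (B + 1 / real (Suc j)) * indicator E x \<partial>lborel)"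
      by (simp add: nn_integral_cmult_indicator)
    also have "\<dots> \<le> (\<integral>\<^sup>+ x. ennreal (\<bar>F x\<bar> * indicat_real E x) \<partial>lborel)"
      by (intro nn_integral_mono) (auto simp: indicator_def E_def intro!: ennreal_leI)
    also have "\<dots> \<le> ennreal B * dual_norm p (indicat_real E)"
      by (rule dual[of _ 1 "real j"]) (auto simp: E_def indicator_def)
    also have "dual_norm p (indicat_real E) = emeasure lborel E"
      using True by (simp add: dual_norm_def dual_exponent_def ennreal_indicator)
    finally have le: "ennreal (B + 1 / real (Suc j)) * emeasure lborel E \<le> ennreal B * emeasure lborel E" .
    have "emeasure lborel E = 0"
    proof (cases "emeasure lborel E")
      case (real m)
      then have "(B + 1 / real (Suc j)) * m \<le> B * m" using le B by (simp add: ennreal_mult[symmetric] del: ennreal_plus)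
      then have "m / real (Suc j) \<le> 0" by (simp add: algebra_simps)
      then have "m = 0" using real by (simp add: field_simps)
      then show ?thesis using real by simp
    qed (use fin in simp)
    then have "AE x in lborel. x \<notin> E" by (intro AE_not_in) auto
    then show ?thesis by (simp add: E_def)
  qed
  then have "AE x in lborel. \<forall>j. \<not> (\<bar>F x\<bar> > B + 1 / real (Suc j) \<and> norm x \<le> real j)" by (simp add: AE_all_countable)
  then have "AE x in lborel. ennreal \<bar>F x\<bar> \<le> ennreal B"
  proof eventually_elim
    case (elim x)
    have "\<bar>F x\<bar> \<le> B"
    proof (rule ccontr)
      assume "\<not> \<bar>F x\<bar> \<le> B"
      then obtain j1 where j1: "inverse (real (Suc j1)) < \<bar>F x\<bar> - B" using reals_Archimedean[of "\<bar>F x\<bar> - B"] by auto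
      obtain j2 where j2: "norm x \<le> real j2" using real_arch_simple by blast
      define j where "j = max j1 j2"
      have "1 / real (Suc j) \<le> inverse (real (Suc j1))" by (simp add: j_def field_simps)
      then show False using elim j1 j2 by (auto simp: j_def not_less max_def split: if_splits dest!: spec[of _ j])
    qed
    then show ?case by (rule ennreal_leI)
  qed
  then show ?thesis unfolding True Lp_norm_infinite by (intro esssup_I) auto
next
  case False
  define P where "P = enn2real p"
  have P: "1 \<le> P" using finite_exponent[OF p False] by (simp add: P_def)
  \<comment> \<open>Truncation in height and in radius makes the integral of the \<open>P\<close>-th
    power finite, so that it can be cancelled.\<close>
  define m where "m N x = (if norm x \<le> real N then min \<bar>F x\<bar> (real N) else 0)" for N x
  have m0: "0 \<le> m N x" "m N x \<le> real N" "m N x \<le> \<bar>F x\<bar>" "norm x > real N \<Longrightarrow> m N x = 0" for N x by (auto simp: m_def)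
  have [measurable]: "m N \<in> borel_measurable borel" for N unfolding m_def by measurable
  have IN: "(\<integral>\<^sup>+ x. ennreal (m N x powr P) \<partial>lborel) \<le> epowr (ennreal B) P" for N
  proof -
    let ?I = "\<integral>\<^sup>+ x. ennreal (m N x powr P) \<partial>lborel"
    \<comment> \<open>For \<open>p = 1\<close> this is the indicator of the set where
      \<open>m N\<close> is nonzero, because \<open>0 powr 0 = 0\<close>.\<close>
    define \<psi> where "\<psi> x = m N x powr (P - 1)" for x
    have "?I \<le> (\<integral>\<^sup>+ x. ennreal (\<bar>F x\<bar> * \<psi> x) \<partial>lborel)"
    proof (intro nn_integral_mono ennreal_leI)
      fix x
      have "m N x powr P = m N x * m N x powr (P - 1)" using m0(1)[of N x] by (simp add: powr_mult_base)
      also have "\<dots> \<le> \<bar>F x\<bar> * \<psi> x" unfolding \<psi>_def by (intro mult_right_mono m0) auto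
      finally show "m N x powr P \<le> \<bar>F x\<bar> * \<psi> x" .
    qed
    also have "\<dots> \<le> ennreal B * dual_norm p \<psi>"
    proof (rule dual)
      show "\<psi> \<in> borel_measurable borel" unfolding \<psi>_def by measurable
      show "\<psi> x \<le> real N powr (P - 1)" for x unfolding \<psi>_def using P m0 by (intro powr_mono2) auto
      show "\<psi> x = 0" if "norm x > real N" for x using m0(4)[OF that] by (simp add: \<psi>_def)
    qed (simp add: \<psi>_def)
    finally have le: "?I \<le> ennreal B * dual_norm p \<psi>" .
    show ?thesis
    proof (cases "p = 1")
      case True
      then have "P = 1" by (simp add: P_def)
      have "dual_norm p \<psi> \<le> 1" unfolding dual_norm_def using True \<open>P = 1\<close>
        by (auto intro!: SUP_least simp: \<psi>_def)
      then have "ennreal B * dual_norm p \<psi> \<le> ennreal B" using mult_left_mono[of "dual_norm p \<psi>" 1 "ennreal B"] by simp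
      then show ?thesis using le \<open>P = 1\<close> by simp
    next
      case p1: False
      define e where "e = dual_exponent p"
      have P1: "1 < P" using finite_exponent_gt[OF p p1 False] by (simp add: P_def)
      have e: "e = P / (P - 1)" "1 < e" "(P - 1) * e = P" "1 / e = 1 - 1 / P"
      proof -
        show e1: "e = P / (P - 1)" using False by (simp add: e_def dual_exponent_def P_def)
        show "1 < e" "(P - 1) * e = P" "1 / e = 1 - 1 / P" unfolding e1 using P1 by (simp_all add: diff_divide_distrib)
      qed
      have dn: "dual_norm p \<psi> = epowr ?I (1 / e)"
        unfolding dual_norm_def using p1 by (simp add: e_def[symmetric] \<psi>_def powr_powr e(3))
      have fin: "?I < top"
      proof -
        have "?I \<le> (\<integral>\<^sup>+ x. ennreal (real N powr P) * indicator (cball (0::'a) (real N)) x \<partial>lborel)"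
          using P by (intro nn_integral_mono) (auto simp: m_def indicator_def intro!: ennreal_leI powr_mono2)
        also have "\<dots> = ennreal (real N powr P) * emeasure lborel (cball (0::'a) (real N))"
          by (simp add: nn_integral_cmult_indicator)
        also have "\<dots> < top" using emeasure_lborel_cball_finite[of "0::'a" "real N"] by (simp add: ennreal_mult_less_top less_top)
        finally show ?thesis .
      qed
      obtain I where I: "?I = ennreal I" "0 \<le> I" using fin by (cases ?I) auto
      have "I \<le> B powr P"
      proof (cases "I = 0")
        case nz: False
        \<comment> \<open>The test inequality bounds \<open>I\<close> by a smaller power of itself;
          cancelling leaves \<open>I powr (1 / P) \<le> B\<close>.\<close>
        have "I \<le> B * I powr (1 / e)"
          using le I B unfolding dn by (simp add: epowr_ennreal ennreal_mult[symmetric])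
        also have "I powr (1 / e) = I / I powr (1 / P)" unfolding e(4) using nz I by (simp add: powr_diff)
        finally have "I * I powr (1 / P) \<le> I * B" using nz I by (simp add: field_simps)
        then have "I powr (1 / P) \<le> B" using nz I by simp
        then have "(I powr (1 / P)) powr P \<le> B powr P" using P1 by (intro powr_mono2) auto
        then show ?thesis using P1 I by (simp add: powr_powr)
      qed simp
      then show ?thesis using I B by (simp add: epowr_ennreal ennreal_leI)
    qed
  qed
  have "(\<lambda>N. \<integral>\<^sup>+ x. ennreal (m N x powr P) \<partial>lborel) \<longlonglongrightarrow> (\<integral>\<^sup>+ x. ennreal (\<bar>F x\<bar> powr P) \<partial>lborel)"
  proof (rule nn_integral_LIMSEQ)
    show "incseq (\<lambda>N x. ennreal (m N x powr P))"
      using P by (auto simp: incseq_def le_fun_def m_def intro!: ennreal_leI powr_mono2)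
    show "(\<lambda>N. ennreal (m N x powr P)) \<longlonglongrightarrow> ennreal (\<bar>F x\<bar> powr P)" for x
    proof (rule tendsto_eventually)
      obtain N0 where N0: "max (norm x) \<bar>F x\<bar> \<le> real N0" using real_arch_simple by blast
      then have "m N x = \<bar>F x\<bar>" if "N \<ge> N0" for N
        using that order_trans[of _ "real N0" "real N"] by (auto simp: m_def)
      then show "\<forall>\<^sub>F N in sequentially. ennreal (m N x powr P) = ennreal (\<bar>F x\<bar> powr P)"
        by (auto simp: eventually_sequentially intro!: exI[of _ N0])
    qed
  qed measurable
  then have "(\<integral>\<^sup>+ x. ennreal (\<bar>F x\<bar> powr P) \<partial>lborel) \<le> epowr (ennreal B) P"
    by (rule LIMSEQ_le_const2) (use IN in auto)
  then show ?thesis unfolding Lp_norm_finite[OF False] P_def[symmetric] using P by (simp add: epowr_le_iff_root)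
qed

section \<open>Linear changes of variables\<close>

lemma linear_measurable_vec: "(\<lambda>x. (B :: real ^ 'n ^ 'n) *v x) \<in> borel_measurable borel"
  by (rule borel_measurable_continuous_onI) (simp add: linear_continuous_on)

text \<open>For invertible \<open>B\<close> this is the reciprocal of the absolute determinant,
  expressed as the volume of the preimage of the unit cube.\<close>

definition lin_scale :: "real ^ 'n ^ 'n \<Rightarrow> real" where
  "lin_scale B = measure lborel {x. B *v x \<in> box 0 One}"

lemma nn_integral_lborel_reflect:
  fixes f :: "'a::euclidean_space \<Rightarrow> ennreal"
  assumes [measurable]: "f \<in> borel_measurable borel"
  shows "(\<integral>\<^sup>+ x. f (t - x) \<partial>lborel) = (\<integral>\<^sup>+ x. f x \<partial>lborel)"
  by (subst (2) lborel_affine[of "-1" t]) (simp_all add: nn_integral_density nn_integral_distr)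

lemma nn_integral_lborel_shift:
  fixes f :: "'a::euclidean_space \<Rightarrow> ennreal"
  assumes [measurable]: "f \<in> borel_measurable borel"
  shows "(\<integral>\<^sup>+ x. f (x - t) \<partial>lborel) = (\<integral>\<^sup>+ x. f x \<partial>lborel)"
  by (subst (2) lborel_affine[of "1" "- t"]) (simp_all add: nn_integral_density nn_integral_distr)

text \<open>The determinant formula of HOL-Analysis needs a well-ordered index type. The value of the
  constant is irrelevant here, and its existence is the uniqueness of translation invariant measures:
  integrate \<open>f (B x) * indicator Q (y - B x)\<close> over \<open>x\<close> and \<open>y\<close> in both orders.\<close>

lemma
  fixes B :: "real ^ 'n ^ 'n"
  assumes B: "invertible B"
  shows lin_scale_pos: "0 < lin_scale B"
    and nn_integral_linear: "f \<in> borel_measurable borel \<Longrightarrow> (\<integral>\<^sup>+ x. f (B *v x) \<partial>lborel) = ennreal (lin_scale B) * (\<integral>\<^sup>+ x. f x \<partial>lborel)"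
proof -
  obtain B' where B': "B ** B' = mat 1" "B' ** B = mat 1" using B unfolding invertible_def by blast
  note [measurable] = linear_measurable_vec[of B]
  let ?Q = "box (0 :: real ^ 'n) One"
  have Q1: "emeasure lborel ?Q = 1" by (simp add: emeasure_lborel_box_eq)
  have set: "{x. B *v x \<in> ?Q} \<in> sets lborel" by measurable
  have "{x. B *v x \<in> ?Q} \<subseteq> (\<lambda>x. B' *v x) ` ?Q"
  proof
    fix x assume "x \<in> {x. B *v x \<in> ?Q}"
    then have "B *v x \<in> ?Q" "x = B' *v (B *v x)" by (simp_all add: matrix_vector_mul_assoc B')
    then show "x \<in> (\<lambda>x. B' *v x) ` ?Q" by blast
  qed
  then have "bounded {x. B *v x \<in> ?Q}"
    by (rule bounded_subset[rotated]) (intro bounded_linear_image bounded_box matrix_vector_mul_bounded_linear)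
  then have fin: "emeasure lborel {x. B *v x \<in> ?Q} < top"
    using emeasure_bounded_finite by (auto simp: less_top)
  have e: "emeasure lborel {x. B *v x \<in> ?Q} = ennreal (lin_scale B)"
    unfolding lin_scale_def using fin by (simp add: emeasure_eq_ennreal_measure)
  have main: "(\<integral>\<^sup>+ x. f (B *v x) \<partial>lborel) = ennreal (lin_scale B) * (\<integral>\<^sup>+ x. f x \<partial>lborel)"
    if [measurable]: "f \<in> borel_measurable borel" for f :: "real ^ 'n \<Rightarrow> ennreal"
  proof -
    \<comment> \<open>The inserted inner integral is the volume 1 of a translate of the unit
      cube.\<close>
    have "(\<integral>\<^sup>+ x. f (B *v x) \<partial>lborel) = (\<integral>\<^sup>+ x. f (B *v x) * (\<integral>\<^sup>+ y. indicator ?Q (y - B *v x) \<partial>lborel) \<partial>lborel)"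
      by (subst nn_integral_lborel_shift) (simp_all add: Q1)
    also have "\<dots> = (\<integral>\<^sup>+ x. \<integral>\<^sup>+ y. f (B *v x) * indicator ?Q (y - B *v x) \<partial>lborel \<partial>lborel)"
      by (intro nn_integral_cong nn_integral_cmult[symmetric]) measurable
    also have "\<dots> = (\<integral>\<^sup>+ y. \<integral>\<^sup>+ x. f (B *v x) * indicator ?Q (y - B *v x) \<partial>lborel \<partial>lborel)"
      by (rule lborel_pair.Fubini') measurable
    \<comment> \<open>For fixed \<open>y\<close> the substitution of \<open>B' *v y - x\<close> for
      \<open>x\<close> interchanges \<open>B *v x\<close> and \<open>y - B *v x\<close>.\<close>
    also have "\<dots> = (\<integral>\<^sup>+ y. \<integral>\<^sup>+ x. f (y - B *v x) * indicator ?Q (B *v x) \<partial>lborel \<partial>lborel)"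
    proof (rule nn_integral_cong)
      fix y
      have "(\<integral>\<^sup>+ x. f (B *v x) * indicator ?Q (y - B *v x) \<partial>lborel)
          = (\<integral>\<^sup>+ x. f (B *v (B' *v y - x)) * indicator ?Q (y - B *v (B' *v y - x)) \<partial>lborel)"
        by (rule nn_integral_lborel_reflect[symmetric]) measurable
      then show "(\<integral>\<^sup>+ x. f (B *v x) * indicator ?Q (y - B *v x) \<partial>lborel) = (\<integral>\<^sup>+ x. f (y - B *v x) * indicator ?Q (B *v x) \<partial>lborel)"
        by (simp add: matrix_vector_mult_diff_distrib matrix_vector_mul_assoc B')
    qed
    also have "\<dots> = (\<integral>\<^sup>+ x. \<integral>\<^sup>+ y. f (y - B *v x) * indicator ?Q (B *v x) \<partial>lborel \<partial>lborel)"
      by (rule lborel_pair.Fubini'[symmetric]) measurable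
    also have "\<dots> = (\<integral>\<^sup>+ x. (\<integral>\<^sup>+ y. f (y - B *v x) \<partial>lborel) * indicator ?Q (B *v x) \<partial>lborel)"
      by (intro nn_integral_cong nn_integral_multc) measurable
    also have "\<dots> = (\<integral>\<^sup>+ x. (\<integral>\<^sup>+ y. f y \<partial>lborel) * indicator {x. B *v x \<in> ?Q} x \<partial>lborel)"
      by (subst nn_integral_lborel_shift) (auto simp: indicator_def)
    also have "\<dots> = (\<integral>\<^sup>+ y. f y \<partial>lborel) * emeasure lborel {x. B *v x \<in> ?Q}"
      by (rule nn_integral_cmult_indicator[OF set])
    finally show ?thesis unfolding e by (simp add: mult.commute)
  qed
  then show "f \<in> borel_measurable borel \<Longrightarrow> (\<integral>\<^sup>+ x. f (B *v x) \<partial>lborel) = ennreal (lin_scale B) * (\<integral>\<^sup>+ x. f x \<partial>lborel)" .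
  \<comment> \<open>Otherwise the identity for the constant 1 would make the measure of the whole
    space vanish.\<close>
  have "lin_scale B \<noteq> 0"
  proof
    assume "lin_scale B = 0"
    then show False using main[of "\<lambda>_. 1"] by simp
  qed
  then show "0 < lin_scale B" by (simp add: lin_scale_def measure_nonneg order_less_le)
qed

lemma lborel_linear:
  fixes B :: "real ^ 'n ^ 'n"
  assumes B: "invertible B"
  shows "lborel = density (distr lborel borel (\<lambda>x. B *v x)) (\<lambda>_. ennreal (1 / lin_scale B))"
proof (rule measure_eqI)
  note [measurable] = linear_measurable_vec[of B]
  fix E :: "(real ^ 'n) set" assume "E \<in> sets lborel"
  then have [measurable]: "E \<in> sets borel" by simp
  have "emeasure (density (distr lborel borel (\<lambda>x. B *v x)) (\<lambda>_. ennreal (1 / lin_scale B))) E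
      = ennreal (1 / lin_scale B) * (\<integral>\<^sup>+ x. indicator E (B *v x) \<partial>lborel)"
    by (simp add: emeasure_density nn_integral_distr nn_integral_cmult del: nn_integral_indicator nn_integral_cmult_indicator)
  also have "\<dots> = (ennreal (1 / lin_scale B) * ennreal (lin_scale B)) * emeasure lborel E"
    by (subst nn_integral_linear[OF B]) (simp_all add: mult.assoc)
  also have "ennreal (1 / lin_scale B) * ennreal (lin_scale B) = 1"
    using lin_scale_pos[OF B] by (simp add: ennreal_mult[symmetric])
  finally show "emeasure lborel E = emeasure (density (distr lborel borel (\<lambda>x. B *v x)) (\<lambda>_. ennreal (1 / lin_scale B))) E" by simp
qed simp

lemma integral_linear_vec:
  fixes B :: "real ^ 'n ^ 'n" and f :: "real ^ 'n \<Rightarrow> real"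
  assumes B: "invertible B" and [measurable]: "f \<in> borel_measurable borel"
  shows "(\<integral> x. f x \<partial>lborel) = 1 / lin_scale B * (\<integral> x. f (B *v x) \<partial>lborel)"
proof -
  note [measurable] = linear_measurable_vec[of B]
  show ?thesis using lin_scale_pos[OF B] by (subst lborel_linear[OF B]) (simp add: integral_density integral_distr)
qed

lemma integrable_linear_vec:
  fixes B :: "real ^ 'n ^ 'n" and f :: "real ^ 'n \<Rightarrow> real"
  assumes B: "invertible B" and f: "integrable lborel f"
  shows "integrable lborel (\<lambda>x. f (B *v x))"
proof -
  have [measurable]: "f \<in> borel_measurable borel" using borel_measurable_integrable[OF f] by simp
  note [measurable] = linear_measurable_vec[of B]
  have "integrable (density (distr lborel borel (\<lambda>x. B *v x)) (\<lambda>_. ennreal (1 / lin_scale B))) f"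
    using f lborel_linear[OF B] by simp
  then have "integrable lborel (\<lambda>x. f (B *v x) / lin_scale B)"
    using lin_scale_pos[OF B] by (simp add: integrable_density integrable_distr_eq)
  from integrable_mult_right[OF this, of "lin_scale B"] show ?thesis
    using lin_scale_pos[OF B] by simp
qed

lemma AE_linear:
  fixes B :: "real ^ 'n ^ 'n"
  assumes B: "invertible B" and P: "AE x in lborel. P x" shows "AE x in lborel. P (B *v x)"
proof -
  from AE_E[OF P] obtain N where N': "{x \<in> space lborel. \<not> P x} \<subseteq> N" "emeasure lborel N = 0" "N \<in> sets lborel" .
  then have N: "{x. \<not> P x} \<subseteq> N" "N \<in> sets borel" "emeasure lborel N = 0" by simp_all
  note [measurable] = linear_measurable_vec[of B] N(2)
  have "(\<integral>\<^sup>+ x. indicator N (B *v x) \<partial>lborel) = 0"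
    by (subst nn_integral_linear[OF B]) (use N in auto)
  then have "AE x in lborel. indicator N (B *v x) = (0::ennreal)" by (subst (asm) nn_integral_0_iff_AE) auto
  then show ?thesis by eventually_elim (use N(1) in \<open>auto simp: indicator_def split: if_splits\<close>)
qed

text \<open>The exact factor \<open>lin_scale B powr (1 / P)\<close> is weakened to
  \<open>max 1 (lin_scale B)\<close>, which covers every exponent.\<close>

lemma Lp_norm_linear_le:
  fixes B :: "real ^ 'n ^ 'n"
  assumes p: "1 \<le> p" and B: "invertible B" and [measurable]: "f \<in> borel_measurable borel"
  shows "Lp_norm p (\<lambda>x. f (B *v x)) \<le> ennreal (max 1 (lin_scale B)) * Lp_norm p f"
proof (cases "p = \<infinity>")
  case True
  note [measurable] = linear_measurable_vec[of B]
  have "Lp_norm p (\<lambda>x. f (B *v x)) \<le> Lp_norm p f"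
    unfolding True Lp_norm_infinite
    by (rule esssup_I) (use AE_linear[OF B esssup_AE] in auto)
  also have "\<dots> \<le> ennreal (max 1 (lin_scale B)) * Lp_norm p f"
    using mult_right_mono[of 1 "ennreal (max 1 (lin_scale B))" "Lp_norm p f"] using ennreal_leI[of 1 "max 1 (lin_scale B)"] by simp
  finally show ?thesis .
next
  case False
  define P where "P = enn2real p"
  have P: "1 \<le> P" using finite_exponent[OF p False] by (simp add: P_def)
  have "Lp_norm p (\<lambda>x. f (B *v x)) = epowr (ennreal (lin_scale B) * (\<integral>\<^sup>+ x. ennreal (\<bar>f x\<bar> powr P) \<partial>lborel)) (1 / P)"
    unfolding Lp_norm_finite[OF False] P_def[symmetric]
    by (subst nn_integral_linear[OF B, of "\<lambda>x. ennreal (\<bar>f x\<bar> powr P)"]) auto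
  also have "\<dots> = ennreal ((lin_scale B) powr (1 / P)) * Lp_norm p f"
    unfolding Lp_norm_finite[OF False] P_def[symmetric] using P lin_scale_pos[OF B] by (simp add: epowr_mult epowr_ennreal)
  also have "\<dots> \<le> ennreal (max 1 (lin_scale B)) * Lp_norm p f"
  proof (intro mult_right_mono ennreal_leI)
    let ?x = "lin_scale B"
    note xp = lin_scale_pos[OF B]
    have "?x powr (1 / P) \<le> max 1 ?x powr (1 / P)" using P xp by (intro powr_mono2) auto
    also have "\<dots> \<le> max 1 ?x powr 1" using P by (intro powr_mono) auto
    finally show "?x powr (1 / P) \<le> max 1 ?x" by simp
  qed simp
  finally show ?thesis .
qed

text \<open>The function is the pointwise limit of its restrictions to growing balls, which are
  integrable and hence measurable.\<close>

lemma locally_integrable_borel: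
  assumes "locally_integrable F" shows "F \<in> borel_measurable borel"
proof (rule borel_measurable_LIMSEQ_real)
  show "(\<lambda>j. indicat_real (cball 0 (real j)) x * F x) \<longlonglongrightarrow> F x" for x
  proof (rule tendsto_eventually)
    obtain N where "norm x \<le> real N" using real_arch_simple by blast
    then show "\<forall>\<^sub>F j in sequentially. indicat_real (cball 0 (real j)) x * F x = F x"
      by (auto simp: eventually_sequentially indicator_def intro!: exI[of _ N])
  qed
  show "(\<lambda>x. indicat_real (cball 0 (real j)) x * F x) \<in> borel_measurable borel" for j
    using assms borel_measurable_integrable[of lborel] unfolding locally_integrable_def set_integrable_def
    by (auto dest!: spec[of _ "cball 0 (real j)"])
qed

lemma locally_integrable_mult:
  fixes F :: "real ^ 'n \<Rightarrow> real"
  assumes F: "locally_integrable F" and [measurable]: "\<psi> \<in> borel_measurable borel"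
    and M: "\<And>x. \<bar>\<psi> x\<bar> \<le> M" and R: "\<And>x. norm x > R \<Longrightarrow> \<psi> x = 0"
  shows "integrable lborel (\<lambda>x. F x * \<psi> x)"
proof -
  have i: "integrable lborel (\<lambda>x. indicat_real (cball 0 R) x * F x)"
    using F unfolding locally_integrable_def set_integrable_def by (auto dest!: spec[of _ "cball 0 R"])
  note [measurable] = locally_integrable_borel[OF F]
  show ?thesis
  proof (rule Bochner_Integration.integrable_bound)
    show "integrable lborel (\<lambda>x. M * (indicat_real (cball 0 R) x * F x))" using i by simp
    show "AE x in lborel. norm (F x * \<psi> x) \<le> norm (M * (indicat_real (cball 0 R) x * F x))"
    proof (rule AE_I2)
      fix x
      have "\<bar>F x\<bar> * \<bar>\<psi> x\<bar> \<le> \<bar>F x\<bar> * \<bar>M\<bar>" using M[of x] by (intro mult_left_mono) auto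
      then show "norm (F x * \<psi> x) \<le> norm (M * (indicat_real (cball 0 R) x * F x))"
        using R[of x] by (cases "norm x \<le> R") (auto simp: abs_mult mult.commute)
    qed
  qed measurable
qed

text \<open>The norm bound of the functional induced by \<open>F\<close>, for one
  \<open>\<psi>\<close> at a time, so that it can be carried along limits of test functions.\<close>

definition tested :: "ennreal \<Rightarrow> real \<Rightarrow> (real ^ 'n \<Rightarrow> real) \<Rightarrow> (real ^ 'n \<Rightarrow> real) \<Rightarrow> bool" where
  "tested p B F \<psi> \<longleftrightarrow> ennreal \<bar>\<integral> x. F x * \<psi> x \<partial>lborel\<bar> \<le> ennreal B * dual_norm p \<psi>"

text \<open>Dominated convergence takes the pairing and, for \<open>p \<noteq> 1\<close>, the dual
  norm to the limit. The supremum norm used for \<open>p = 1\<close> can drop in a pointwise limit;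
  \<open>sup\<close> therefore demands that no approximant exceed a bound of
  \<open>\<psi>\<close>.\<close>

lemma tested_limit:
  fixes F :: "real ^ 'n \<Rightarrow> real"
  assumes p: "1 \<le> p" and F: "locally_integrable F"
    and \<phi>: "\<And>j. \<phi> j \<in> borel_measurable borel" and \<psi>: "\<psi> \<in> borel_measurable borel"
    and M: "\<And>j x. \<bar>\<phi> j x\<bar> \<le> M" and R: "\<And>j x. norm x > R \<Longrightarrow> \<phi> j x = 0"
    and M': "\<And>x. \<bar>\<psi> x\<bar> \<le> M" and R': "\<And>x. norm x > R \<Longrightarrow> \<psi> x = 0"
    and lim: "AE x in lborel. (\<lambda>j. \<phi> j x) \<longlonglongrightarrow> \<psi> x"
    and sup: "\<And>S j x. (\<And>x. \<bar>\<psi> x\<bar> \<le> S) \<Longrightarrow> \<bar>\<phi> j x\<bar> \<le> S"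
    and t: "\<And>j. tested p B F (\<phi> j)"
  shows "tested p B F \<psi>"
proof -
  note [measurable] = locally_integrable_borel[OF F] \<phi> \<psi>
  have M0: "0 \<le> M" using M'[of 0] by linarith
  define K where "K x = indicat_real (cball 0 R) x * M" for x :: "real ^ 'n"
  have bd: "\<bar>\<phi> j x\<bar> \<le> K x" "\<bar>\<psi> x\<bar> \<le> K x" for j x
    using M[of j x] M'[of x] R[of x j] R'[of x] M0 by (auto simp: K_def indicator_def)
  have [measurable]: "K \<in> borel_measurable borel" unfolding K_def
    by (intro borel_measurable_times borel_measurable_const borel_measurable_indicator) auto
  have K0: "0 \<le> K x" for x using M0 by (simp add: K_def)
  have "(\<lambda>j. \<integral> x. F x * \<phi> j x \<partial>lborel) \<longlonglongrightarrow> (\<integral> x. F x * \<psi> x \<partial>lborel)"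
  proof (rule integral_dominated_convergence[where w = "\<lambda>x. \<bar>F x * K x\<bar>"])
    show "integrable lborel (\<lambda>x. \<bar>F x * K x\<bar>)"
      by (intro integrable_abs locally_integrable_mult[OF F, of _ M R]) (auto simp: K_def indicator_def M0)
    show "AE x in lborel. (\<lambda>j. F x * \<phi> j x) \<longlonglongrightarrow> F x * \<psi> x" using lim by eventually_elim (intro tendsto_intros)
    show "AE x in lborel. norm (F x * \<phi> j x) \<le> \<bar>F x * K x\<bar>" for j
      using bd K0 by (intro AE_I2) (auto simp: abs_mult intro!: mult_left_mono)
  qed measurable
  then have L: "(\<lambda>j. ennreal \<bar>\<integral> x. F x * \<phi> j x \<partial>lborel\<bar>) \<longlonglongrightarrow> ennreal \<bar>\<integral> x. F x * \<psi> x \<partial>lborel\<bar>"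
    by (intro tendsto_ennrealI tendsto_rabs)
  show ?thesis
  proof (cases "p = 1")
    case True
    have le: "dual_norm p (\<phi> j) \<le> dual_norm p \<psi>" for j
    proof -
      define T where "T = (SUP x. ennreal \<bar>\<psi> x\<bar>)"
      have "T \<le> ennreal M" unfolding T_def using M' by (intro SUP_least ennreal_leI)
      then obtain S where S: "T = ennreal S" "0 \<le> S" by (cases T) (auto simp: top_unique)
      have "\<bar>\<psi> x\<bar> \<le> S" for x
      proof -
        have "ennreal \<bar>\<psi> x\<bar> \<le> T" unfolding T_def by (rule SUP_upper) simp
        then show ?thesis using S by simp
      qed
      from sup[OF this] have "(SUP x. ennreal \<bar>\<phi> j x\<bar>) \<le> T" unfolding S(1) by (intro SUP_least ennreal_leI)
      then show ?thesis using True by (simp add: dual_norm_def T_def)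
    qed
    show ?thesis unfolding tested_def
    proof (rule LIMSEQ_le_const2[OF L])
      have "ennreal \<bar>\<integral> x. F x * \<phi> j x \<partial>lborel\<bar> \<le> ennreal B * dual_norm p \<psi>" for j
        using t[of j] mult_left_mono[OF le[of j], of "ennreal B"] unfolding tested_def by simp
      then show "\<exists>N. \<forall>j\<ge>N. ennreal \<bar>\<integral> x. F x * \<phi> j x \<partial>lborel\<bar> \<le> ennreal B * dual_norm p \<psi>" by blast
    qed
  next
    case False
    define e where "e = dual_exponent p"
    have e: "1 \<le> e" using dual_exponent_ge_1[OF p False] by (simp add: e_def)
    have fin: "(\<integral>\<^sup>+ x. ennreal (K x powr e) \<partial>lborel) < \<infinity>"
    proof -
      have "(\<integral>\<^sup>+ x. ennreal (K x powr e) \<partial>lborel) = (\<integral>\<^sup>+ x. ennreal (M powr e) * indicator (cball 0 R) x \<partial>(lborel :: (real ^ 'n) measure))"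
        using e by (intro nn_integral_cong) (auto simp: K_def indicator_def)
      also have "\<dots> = ennreal (M powr e) * emeasure lborel (cball (0::real^'n) R)" by (simp add: nn_integral_cmult_indicator)
      also have "\<dots> < top" using emeasure_lborel_cball_finite[of "0::real^'n" R] by (simp add: ennreal_mult_less_top less_top)
      finally show ?thesis by simp
    qed
    have I: "(\<lambda>j. \<integral>\<^sup>+ x. ennreal (\<bar>\<phi> j x\<bar> powr e) \<partial>lborel) \<longlonglongrightarrow> (\<integral>\<^sup>+ x. ennreal (\<bar>\<psi> x\<bar> powr e) \<partial>lborel)"
    proof (rule nn_integral_dominated_convergence[where w = "\<lambda>x. ennreal (K x powr e)"])
      show "AE x in lborel. (\<lambda>j. ennreal (\<bar>\<phi> j x\<bar> powr e)) \<longlonglongrightarrow> ennreal (\<bar>\<psi> x\<bar> powr e)"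
        using lim by eventually_elim (use e in \<open>intro tendsto_ennrealI tendsto_powr2[where b = e] tendsto_intros tendsto_rabs, auto\<close>)
      show "AE x in lborel. ennreal (\<bar>\<phi> j x\<bar> powr e) \<le> ennreal (K x powr e)" for j
        using bd e by (intro AE_I2 ennreal_leI powr_mono2) auto
    qed (use fin in simp_all)
    have "(\<integral>\<^sup>+ x. ennreal (\<bar>\<psi> x\<bar> powr e) \<partial>lborel) \<le> (\<integral>\<^sup>+ x. ennreal (K x powr e) \<partial>lborel)"
      using bd e by (intro nn_integral_mono ennreal_leI powr_mono2) auto
    with fin obtain I0 where I0: "(\<integral>\<^sup>+ x. ennreal (\<bar>\<psi> x\<bar> powr e) \<partial>lborel) = ennreal I0" "0 \<le> I0"
      by (cases "\<integral>\<^sup>+ x. ennreal (\<bar>\<psi> x\<bar> powr e) \<partial>lborel") (auto simp: top_unique)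
    have "(\<lambda>j. epowr (\<integral>\<^sup>+ x. ennreal (\<bar>\<phi> j x\<bar> powr e) \<partial>lborel) (1 / e)) \<longlonglongrightarrow> epowr (ennreal I0) (1 / e)"
      by (rule epowr_tendsto[OF I[unfolded I0(1)] I0(2)]) (use e in simp)
    then have "(\<lambda>j. dual_norm p (\<phi> j)) \<longlonglongrightarrow> dual_norm p \<psi>"
      using False by (simp add: dual_norm_def e_def[symmetric] I0(1))
    then have "(\<lambda>j. ennreal B * dual_norm p (\<phi> j)) \<longlonglongrightarrow> ennreal B * dual_norm p \<psi>"
      by (intro ennreal_tendsto_cmult) auto
    from LIMSEQ_le[OF L this] show ?thesis using t unfolding tested_def by blast
  qed
qed

section \<open>Testing against combinations of bumps\<close>

text \<open>The lattice indices of the cells of side \<open>1 / m\<close> in the cube of half side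
  \<open>R\<close>.\<close>

definition grid :: "nat \<Rightarrow> nat \<Rightarrow> ('n::finite \<Rightarrow> int) set" where
  "grid R m = PiE UNIV (\<lambda>_. {- int (R * m)..<int (R * m)})"

definition cell_lo :: "nat \<Rightarrow> ('n::finite \<Rightarrow> int) \<Rightarrow> real ^ 'n" where
  "cell_lo m z = (\<chi> i. real_of_int (z i) / real m)"

definition cell_hi :: "nat \<Rightarrow> ('n::finite \<Rightarrow> int) \<Rightarrow> real ^ 'n" where
  "cell_hi m z = (\<chi> i. (real_of_int (z i) + 1) / real m)"

definition cell_mid :: "nat \<Rightarrow> ('n::finite \<Rightarrow> int) \<Rightarrow> real ^ 'n" where
  "cell_mid m z = (\<chi> i. (real_of_int (z i) + 1 / 2) / real m)"

lemma finite_grid: "finite (grid R m)"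
  unfolding grid_def by (intro finite_PiE) auto

lemma mem_cell: "0 < m \<Longrightarrow> x \<in> box (cell_lo m z) (cell_hi m z) \<longleftrightarrow> (\<forall>i. real_of_int (z i) < x $ i * real m \<and> x $ i * real m < real_of_int (z i) + 1)"
  by (simp add: mem_box_cart cell_lo_def cell_hi_def field_simps)

lemma cell_unique:
  assumes "0 < m" "x \<in> box (cell_lo m z) (cell_hi m z)"
  shows "z = (\<lambda>i. \<lfloor>x $ i * real m\<rfloor>)"
proof
  fix i
  have "real_of_int (z i) < x $ i * real m" "x $ i * real m < real_of_int (z i) + 1"
    using assms by (auto simp: mem_cell)
  then show "z i = \<lfloor>x $ i * real m\<rfloor>" by linarith
qed

lemma cell_mid_mem: "0 < m \<Longrightarrow> cell_mid m z \<in> box (cell_lo m z) (cell_hi m z)"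
  by (auto simp: mem_cell cell_mid_def)

lemma cell_in_cube:
  assumes m: "0 < m" and z: "z \<in> grid R m" and x: "x \<in> box (cell_lo m z) (cell_hi m z)"
  shows "\<bar>x $ i\<bar> < real R"
proof -
  have zi: "- int (R * m) \<le> z i" "z i + 1 \<le> int (R * m)"
  proof -
    have "z i \<in> {- int (R * m)..<int (R * m)}" using z unfolding grid_def by (rule PiE_mem) simp
    then show "- int (R * m) \<le> z i" "z i + 1 \<le> int (R * m)" by auto
  qed
  have "real_of_int (z i) < x $ i * real m" "x $ i * real m < real_of_int (z i) + 1"
    using x m by (auto simp: mem_cell)
  moreover have "- (real R * real m) \<le> real_of_int (z i)" "real_of_int (z i) + 1 \<le> real R * real m"
    using zi by (simp_all flip: of_nat_mult)
  ultimately have "- (real R * real m) < x $ i * real m" "x $ i * real m < real R * real m" by linarith+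
  then have le: "(- real R) * real m < x $ i * real m" "x $ i * real m < real R * real m" by simp_all
  have "- real R < x $ i" by (rule mult_right_less_imp_less[OF le(1)]) simp
  moreover have "x $ i < real R" by (rule mult_right_less_imp_less[OF le(2)]) simp
  ultimately show ?thesis by linarith
qed

text \<open>The cells are open because bumps converge to indicators of open boxes. Sampling at
  midpoints makes each sampled value a value of the step function itself, as the supremum condition
  for limits requires.\<close>

definition grid_step :: "nat \<Rightarrow> nat \<Rightarrow> (real ^ 'n \<Rightarrow> real) \<Rightarrow> real ^ 'n \<Rightarrow> real" where
  "grid_step R m h x = (\<Sum>z\<in>grid R m. h (cell_mid m z) * indicat_real (box (cell_lo m z) (cell_hi m z)) x)"

text \<open>Open cells are disjoint, so only the cell indexed by the floors of the scaled
  coordinates can contribute at \<open>x\<close>.\<close>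

lemma grid_sum_at:
  assumes m: "0 < m" and w: "\<And>z x. x \<notin> box (cell_lo m z) (cell_hi m z) \<Longrightarrow> w z x = (0::real)"
  shows "(\<Sum>z\<in>grid R m. c z * w z x) = (if (\<lambda>i. \<lfloor>x $ i * real m\<rfloor>) \<in> grid R m then c (\<lambda>i. \<lfloor>x $ i * real m\<rfloor>) * w (\<lambda>i. \<lfloor>x $ i * real m\<rfloor>) x else 0)"
proof -
  let ?z = "\<lambda>i. \<lfloor>x $ i * real m\<rfloor>"
  have "c z * w z x = (if z = ?z then c z * w z x else 0)" for z
  proof (cases "x \<in> box (cell_lo m z) (cell_hi m z)")
    case True
    then show ?thesis using cell_unique[OF m True] by simp
  next
    case False
    then show ?thesis using w[OF False] by auto
  qed
  then have "(\<Sum>z\<in>grid R m. c z * w z x) = (\<Sum>z\<in>grid R m. if z = ?z then c z * w z x else 0)" by (intro sum.cong) auto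
  then show ?thesis by (simp add: finite_grid)
qed

lemma grid_step_mid:
  assumes m: "0 < m" and z: "z \<in> grid R m"
  shows "grid_step R m h (cell_mid m z) = h (cell_mid m z)"
proof -
  note mid = cell_mid_mem[OF m, of z]
  show ?thesis unfolding grid_step_def
    by (subst grid_sum_at[OF m]) (use z mid in \<open>simp_all add: cell_unique[OF m mid, symmetric]\<close>)
qed

text \<open>The faces of all meshes lie in countably many hyperplanes, so one null set serves every
  \<open>m\<close>.\<close>

lemma AE_off_grid: "AE x in lborel. \<forall>m i. 0 < m \<longrightarrow> (x :: real ^ 'n) $ i * real (m::nat) \<notin> \<int>"
proof -
  have "AE x in lborel. \<not> ((x :: real ^ 'n) $ i * real m = real_of_int j)" if "0 < m" for i m and j :: int
  proof -
    have "negligible {x :: real ^ 'n. x $ i = real_of_int j / real m}"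
      using negligible_standard_hyperplane[of "axis i (1::real)"] by (simp add: inner_axis)
    then have "{x :: real ^ 'n. x $ i = real_of_int j / real m} \<in> null_sets lebesgue"
      by (simp add: negligible_iff_null_sets)
    moreover have "{x :: real ^ 'n. x $ i = real_of_int j / real m} \<in> sets borel" by measurable
    ultimately have "{x :: real ^ 'n. x $ i = real_of_int j / real m} \<in> null_sets lborel"
      by (auto simp: null_sets_def)
    from AE_not_in[OF this] show ?thesis by eventually_elim (use that in \<open>auto simp: field_simps\<close>)
  qed
  then have "AE x in lborel. \<forall>m i (j::int). 0 < m \<longrightarrow> \<not> ((x :: real ^ 'n) $ i * real m = real_of_int j)"
    by (auto simp: AE_all_countable)
  then show ?thesis by eventually_elim (auto elim!: Ints_cases)
qed

lemma grid_step_tendsto: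
  fixes h :: "real ^ 'n \<Rightarrow> real"
  assumes h: "continuous_on UNIV h" and off: "\<And>m i. 0 < m \<Longrightarrow> x $ i * real (m::nat) \<notin> \<int>"
  shows "(\<lambda>m. grid_step R (Suc m) h x) \<longlonglongrightarrow> h x * indicat_real {x. \<forall>i. \<bar>x $ i\<bar> < real R} x"
proof -
  let ?z = "\<lambda>m i. \<lfloor>x $ i * real (Suc m)\<rfloor>"
  have cell: "x \<in> box (cell_lo (Suc m) (?z m)) (cell_hi (Suc m) (?z m))" for m
  proof -
    have "real_of_int \<lfloor>x $ i * real (Suc m)\<rfloor> \<noteq> x $ i * real (Suc m)" for i
      using off[of "Suc m" i] by (metis Ints_of_int zero_less_Suc)
    then have "real_of_int (?z m i) < x $ i * real (Suc m) \<and> x $ i * real (Suc m) < real_of_int (?z m i) + 1" for i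
      using floor_correct[of "x $ i * real (Suc m)"] \<open>\<And>i. _ \<noteq> x $ i * real (Suc m)\<close>[of i] by linarith
    then show ?thesis by (simp add: mem_cell del: of_nat_Suc)
  qed
  have mem: "?z m \<in> grid R (Suc m) \<longleftrightarrow> (\<forall>i. \<bar>x $ i\<bar> < real R)" for m
  proof
    assume "?z m \<in> grid R (Suc m)"
    then show "\<forall>i. \<bar>x $ i\<bar> < real R" using cell_in_cube[OF _ _ cell[of m], of R] by auto
  next
    assume a: "\<forall>i. \<bar>x $ i\<bar> < real R"
    have "- int (R * Suc m) \<le> ?z m i \<and> ?z m i < int (R * Suc m)" for i
    proof -
      have "\<bar>x $ i * real (Suc m)\<bar> < real R * real (Suc m)" using a by (simp add: abs_mult)
      then have "- real (R * Suc m) \<le> x $ i * real (Suc m)" "x $ i * real (Suc m) < real (R * Suc m)"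
        by (simp_all only: of_nat_mult abs_less_iff) linarith+
      then show ?thesis by (auto simp: le_floor_iff floor_less_iff simp del: of_nat_Suc of_nat_mult)
    qed
    then show "?z m \<in> grid R (Suc m)" by (auto simp: grid_def)
  qed
  have eq: "grid_step R (Suc m) h x = h (cell_mid (Suc m) (?z m)) * indicat_real {x. \<forall>i. \<bar>x $ i\<bar> < real R} x" for m
    unfolding grid_step_def using cell[of m] mem[of m]
    by (subst grid_sum_at) (auto simp: indicator_def simp del: of_nat_Suc)
  have "(\<lambda>m. cell_mid (Suc m) (?z m)) \<longlonglongrightarrow> x"
  proof (rule vec_tendstoI)
    fix i
    have "\<bar>cell_mid (Suc m) (?z m) $ i - x $ i\<bar> \<le> inverse (real (Suc m))" for m
    proof -
      have "\<bar>(real_of_int (?z m i) + 1 / 2) - x $ i * real (Suc m)\<bar> \<le> 1" by linarith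
      then have "\<bar>(real_of_int (?z m i) + 1 / 2) - x $ i * real (Suc m)\<bar> / real (Suc m) \<le> 1 / real (Suc m)"
        by (intro divide_right_mono) auto
      also have "\<bar>(real_of_int (?z m i) + 1 / 2) - x $ i * real (Suc m)\<bar> / real (Suc m) = \<bar>cell_mid (Suc m) (?z m) $ i - x $ i\<bar>"
      proof -
        have "cell_mid (Suc m) (?z m) $ i - x $ i = ((real_of_int (?z m i) + 1 / 2) - x $ i * real (Suc m)) / real (Suc m)"
          by (simp add: cell_mid_def diff_divide_distrib del: of_nat_Suc)
        then show ?thesis by (simp only: abs_divide abs_of_nat)
      qed
      finally show ?thesis by (simp add: inverse_eq_divide)
    qed
    then have "(\<lambda>m. cell_mid (Suc m) (?z m) $ i - x $ i) \<longlonglongrightarrow> 0"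
      by (intro Lim_null_comparison[OF _ LIMSEQ_inverse_real_of_nat]) (auto simp del: of_nat_Suc)
    then show "(\<lambda>m. cell_mid (Suc m) (?z m) $ i) \<longlonglongrightarrow> x $ i" by (simp add: LIM_zero_iff)
  qed
  from continuous_on_tendsto_compose[OF h this] have "(\<lambda>m. h (cell_mid (Suc m) (?z m))) \<longlonglongrightarrow> h x" by simp
  then show ?thesis unfolding eq by (intro tendsto_mult_right)
qed

definition bump_combination :: "('z \<Rightarrow> real) \<Rightarrow> nat \<Rightarrow> ('z \<Rightarrow> real ^ 'n) \<Rightarrow> ('z \<Rightarrow> real ^ 'n) \<Rightarrow> 'z set \<Rightarrow> real ^ 'n \<Rightarrow> real" where
  "bump_combination c k a b Z x = (\<Sum>z\<in>Z. c z * bump k (a z) (b z) x)"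

lemma bump_borel [measurable]: "bump k a b \<in> borel_measurable borel"
proof -
  obtain \<Psi> where "jet \<Psi>" "\<And>is. iter_partial is (bump k a b) = \<Psi> (count_list is)"
    using bump_jet[of k a b] by metis
  from jet_borel[OF this(1), of "count_list []"] this(2)[of "[]"] show ?thesis by (simp add: iter_partial_def)
qed

lemma cube_bounded: "\<exists>S. \<forall>x. norm (x :: real ^ 'n) > S \<longrightarrow> (\<exists>i. \<not> \<bar>x $ i\<bar> < real R)"
proof (rule exI[of _ "real CARD('n) * real R"], intro allI impI, rule ccontr)
  fix x :: "real ^ 'n"
  assume a: "norm x > real CARD('n) * real R" and "\<nexists>i. \<not> \<bar>x $ i\<bar> < real R"
  then have "(\<Sum>i\<in>UNIV. \<bar>x $ i\<bar>) \<le> (\<Sum>i\<in>(UNIV :: 'n set). real R)" by (intro sum_mono) (auto intro: less_imp_le)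
  then show False using a norm_le_l1_cart[of x] by simp
qed

text \<open>Three passages to the limit: sharpening bumps give step functions, shrinking meshes give
  continuous functions on a cube, and almost everywhere limits of these give bounded measurable
  functions. Each approximation respects the supremum of its target.\<close>

lemma tested_extend:
  fixes F :: "real ^ 'n \<Rightarrow> real"
  assumes p: "1 \<le> p" and F: "locally_integrable F"
    and t: "\<And>c k a b (Z :: ('n \<Rightarrow> int) set). finite Z \<Longrightarrow> tested p B F (bump_combination c k a b Z)"
    and \<psi>: "\<psi> \<in> borel_measurable borel" and M: "\<And>x. \<bar>\<psi> x\<bar> \<le> M" and supp: "\<And>x. norm x > S \<Longrightarrow> \<psi> x = 0"
  shows "tested p B F \<psi>"
proof -
  obtain R where R: "S \<le> real R" using real_arch_simple by blast
  \<comment> \<open>The half side exceeds \<open>S\<close>, so \<open>\<psi>\<close> vanishes off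
    this cube.\<close>
  let ?Q = "{x :: real ^ 'n. \<forall>i. \<bar>x $ i\<bar> < real (Suc R)}"
  obtain S' where S': "\<And>x :: real ^ 'n. norm x > S' \<Longrightarrow> x \<notin> ?Q" using cube_bounded[of "Suc R"] by auto
  have Qb [measurable]: "?Q \<in> sets borel" by measurable
  have step: "tested p B F (grid_step (Suc R) (Suc m) h)" if hM: "\<And>x. \<bar>h x\<bar> \<le> M'" for m h M'
  proof (rule tested_limit[OF p F])
    let ?lo = "cell_lo (Suc m) :: ('n \<Rightarrow> int) \<Rightarrow> _" and ?hi = "cell_hi (Suc m) :: ('n \<Rightarrow> int) \<Rightarrow> _"
    let ?\<phi> = "\<lambda>k. bump_combination (\<lambda>z. h (cell_mid (Suc m) z)) k ?lo ?hi (grid (Suc R) (Suc m))"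
    show "tested p B F (?\<phi> k)" for k by (rule t[OF finite_grid])
    show "?\<phi> k \<in> borel_measurable borel" for k unfolding bump_combination_def by measurable
    show "grid_step (Suc R) (Suc m) h \<in> borel_measurable borel" unfolding grid_step_def by measurable
    have \<phi>: "?\<phi> k x = (if (\<lambda>i. \<lfloor>x $ i * real (Suc m)\<rfloor>) \<in> grid (Suc R) (Suc m) then h (cell_mid (Suc m) (\<lambda>i. \<lfloor>x $ i * real (Suc m)\<rfloor>)) *
        bump k (?lo (\<lambda>i. \<lfloor>x $ i * real (Suc m)\<rfloor>)) (?hi (\<lambda>i. \<lfloor>x $ i * real (Suc m)\<rfloor>)) x else 0)" for k x
      unfolding bump_combination_def by (rule grid_sum_at) (auto intro: bump_zero)
    have gs: "grid_step (Suc R) (Suc m) h x = (if (\<lambda>i. \<lfloor>x $ i * real (Suc m)\<rfloor>) \<in> grid (Suc R) (Suc m) then h (cell_mid (Suc m) (\<lambda>i. \<lfloor>x $ i * real (Suc m)\<rfloor>)) *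
        indicat_real (box (?lo (\<lambda>i. \<lfloor>x $ i * real (Suc m)\<rfloor>)) (?hi (\<lambda>i. \<lfloor>x $ i * real (Suc m)\<rfloor>))) x else 0)" for x
      unfolding grid_step_def by (rule grid_sum_at) auto
    have M'0: "0 \<le> M'" using hM[of 0] by linarith
    show "\<bar>?\<phi> k x\<bar> \<le> M'" for k x
    proof -
      have "\<bar>h w * bump k a b x\<bar> \<le> M'" for w a b
        using mult_mono[OF hM[of w] bump_range(2)[of k a b x] M'0 bump_range(1)[of k a b x]] bump_range(1)[of k a b x]
        by (simp add: abs_mult)
      then show ?thesis unfolding \<phi> using M'0 by auto
    qed
    show "\<bar>grid_step (Suc R) (Suc m) h x\<bar> \<le> M'" for x
      unfolding gs using hM M'0 by (auto simp: abs_mult indicator_def)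
    show "?\<phi> k x = 0" if "norm x > S'" for k x
      unfolding bump_combination_def
    proof (rule sum.neutral, intro ballI)
      fix z :: "'n \<Rightarrow> int" assume "z \<in> grid (Suc R) (Suc m)"
      then have "x \<notin> box (?lo z) (?hi z)" using cell_in_cube[of "Suc m" z "Suc R" x] S'[OF that] by auto
      then show "h (cell_mid (Suc m) z) * bump k (?lo z) (?hi z) x = 0" by (simp add: bump_zero)
    qed
    show "grid_step (Suc R) (Suc m) h x = 0" if "norm x > S'" for x
      unfolding grid_step_def
    proof (rule sum.neutral, intro ballI)
      fix z :: "'n \<Rightarrow> int" assume "z \<in> grid (Suc R) (Suc m)"
      then have "x \<notin> box (?lo z) (?hi z)" using cell_in_cube[of "Suc m" z "Suc R" x] S'[OF that] by auto
      then show "h (cell_mid (Suc m) z) * indicat_real (box (?lo z) (?hi z)) x = 0" by simp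
    qed
    show "AE x in lborel. (\<lambda>k. ?\<phi> k x) \<longlonglongrightarrow> grid_step (Suc R) (Suc m) h x"
      unfolding bump_combination_def grid_step_def by (intro AE_I2 tendsto_sum tendsto_mult_left bump_limit)
    show "\<bar>?\<phi> k x\<bar> \<le> T" if T: "\<And>x. \<bar>grid_step (Suc R) (Suc m) h x\<bar> \<le> T" for T k x
    proof (cases "(\<lambda>i. \<lfloor>x $ i * real (Suc m)\<rfloor>) \<in> grid (Suc R) (Suc m)")
      case True
      let ?z = "\<lambda>i. \<lfloor>x $ i * real (Suc m)\<rfloor>"
      have "grid_step (Suc R) (Suc m) h (cell_mid (Suc m) ?z) = h (cell_mid (Suc m) ?z)"
        by (rule grid_step_mid[OF _ True]) simp
      with T[of "cell_mid (Suc m) ?z"] have hT: "\<bar>h (cell_mid (Suc m) ?z)\<bar> \<le> T" by simp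
      have "\<bar>h (cell_mid (Suc m) ?z)\<bar> * bump k (?lo ?z) (?hi ?z) x \<le> T * 1"
        using hT bump_range by (intro mult_mono) auto
      then show ?thesis unfolding \<phi> using True by (simp add: abs_mult abs_of_nonneg[OF bump_range(1)])
    next
      case False
      then show ?thesis unfolding \<phi> using T[of 0] by (simp add: order_trans[OF abs_ge_zero])
    qed
  qed
  have cont: "tested p B F (\<lambda>x. h x * indicat_real ?Q x)" if h: "continuous_on UNIV h" and hM: "\<And>x. \<bar>h x\<bar> \<le> M'" for h M'
  proof (rule tested_limit[OF p F])
    show "tested p B F (grid_step (Suc R) (Suc m) h)" for m by (rule step[OF hM])
    show "grid_step (Suc R) (Suc m) h \<in> borel_measurable borel" for m unfolding grid_step_def by measurable
    have [measurable]: "h \<in> borel_measurable borel" using h by (rule borel_measurable_continuous_onI)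
    show "(\<lambda>x. h x * indicat_real ?Q x) \<in> borel_measurable borel" by measurable
    have M'0: "0 \<le> M'" using hM[of 0] by linarith
    have gs: "grid_step (Suc R) (Suc m) h x = (if (\<lambda>i. \<lfloor>x $ i * real (Suc m)\<rfloor>) \<in> grid (Suc R) (Suc m) then h (cell_mid (Suc m) (\<lambda>i. \<lfloor>x $ i * real (Suc m)\<rfloor>)) *
        indicat_real (box (cell_lo (Suc m) (\<lambda>i. \<lfloor>x $ i * real (Suc m)\<rfloor>)) (cell_hi (Suc m) (\<lambda>i. \<lfloor>x $ i * real (Suc m)\<rfloor>))) x else 0)" for m x
      unfolding grid_step_def by (rule grid_sum_at) auto
    show "\<bar>grid_step (Suc R) (Suc m) h x\<bar> \<le> M'" for m x unfolding gs using hM M'0 by (auto simp: abs_mult indicator_def)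
    show "\<bar>h x * indicat_real ?Q x\<bar> \<le> M'" for x using hM M'0 by (auto simp: abs_mult indicator_def)
    show "grid_step (Suc R) (Suc m) h x = 0" if "norm x > S'" for m x
      unfolding grid_step_def
    proof (rule sum.neutral, intro ballI)
      fix z :: "'n \<Rightarrow> int" assume "z \<in> grid (Suc R) (Suc m)"
      then have "x \<notin> box (cell_lo (Suc m) z) (cell_hi (Suc m) z)" using cell_in_cube[of "Suc m" z "Suc R" x] S'[OF that] by auto
      then show "h (cell_mid (Suc m) z) * indicat_real (box (cell_lo (Suc m) z) (cell_hi (Suc m) z)) x = 0" by simp
    qed
    show "h x * indicat_real ?Q x = 0" if "norm x > S'" for x using S'[OF that] by simp
    show "AE x in lborel. (\<lambda>m. grid_step (Suc R) (Suc m) h x) \<longlonglongrightarrow> h x * indicat_real ?Q x"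
      using AE_off_grid by eventually_elim (rule grid_step_tendsto[OF h], blast)
    show "\<bar>grid_step (Suc R) (Suc m) h x\<bar> \<le> T" if T: "\<And>x. \<bar>h x * indicat_real ?Q x\<bar> \<le> T" for T m x
    proof (cases "(\<lambda>i. \<lfloor>x $ i * real (Suc m)\<rfloor>) \<in> grid (Suc R) (Suc m)")
      case True
      let ?c = "cell_mid (Suc m) (\<lambda>i. \<lfloor>x $ i * real (Suc m)\<rfloor>)"
      have "?c \<in> ?Q" using cell_in_cube[OF _ True cell_mid_mem] by simp
      then have "\<bar>h ?c\<bar> \<le> T" using T[of ?c] by simp
      then show ?thesis unfolding gs by (auto simp: indicator_def)
    next
      case False
      then show ?thesis unfolding gs using T[of 0] by (simp add: order_trans[OF abs_ge_zero])
    qed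
  qed
  have "\<psi> measurable_on UNIV"
    by (rule lebesgue_measurable_imp_measurable_on) (use \<psi> in \<open>auto intro: measurable_completion\<close>)
  then obtain N g where N: "negligible N" and g: "\<And>n. continuous_on UNIV (g n)" and
    lim: "\<And>x. x \<notin> N \<Longrightarrow> (\<lambda>n. g n x) \<longlonglongrightarrow> \<psi> x"
    unfolding measurable_on_def by auto
  \<comment> \<open>The exact supremum in place of the given bound \<open>M\<close>: truncation at
    this height makes the approximants respect every bound of \<open>\<psi>\<close>.\<close>
  define M0 where "M0 = (SUP x. \<bar>\<psi> x\<bar>)"
  have bdd: "bdd_above (range (\<lambda>x. \<bar>\<psi> x\<bar>))" using M by (auto simp: bdd_above_def)
  have M0: "\<bar>\<psi> x\<bar> \<le> M0" for x unfolding M0_def by (rule cSUP_upper[OF _ bdd]) simp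
  have M0_le: "M0 \<le> T" if "\<And>x. \<bar>\<psi> x\<bar> \<le> T" for T unfolding M0_def by (rule cSUP_least) (use that in auto)
  have M00: "0 \<le> M0" using M0[of 0] by linarith
  define h where "h n x = max (- M0) (min M0 (g n x))" for n x
  have hM: "\<bar>h n x\<bar> \<le> M0" for n x using M00 by (auto simp: h_def)
  have hc: "continuous_on UNIV (h n)" for n unfolding h_def by (intro continuous_intros g)
  have NAE: "AE x in lborel. x \<notin> N"
  proof -
    have "N \<in> null_sets (completion lborel)" using N by (simp add: negligible_iff_null_sets)
    then have "AE x in completion lborel. x \<notin> N" by (rule AE_not_in)
    then show ?thesis by (simp add: AE_completion_iff)
  qed
  show ?thesis
  proof (rule tested_limit[OF p F, where \<phi> = "\<lambda>n x. h n x * indicat_real ?Q x" and M = M0 and R = S'])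
    show "tested p B F (\<lambda>x. h n x * indicat_real ?Q x)" for n by (rule cont[OF hc hM])
    have [measurable]: "h n \<in> borel_measurable borel" for n using hc by (rule borel_measurable_continuous_onI)
    show "(\<lambda>x. h n x * indicat_real ?Q x) \<in> borel_measurable borel" for n by measurable
    show "\<bar>h n x * indicat_real ?Q x\<bar> \<le> M0" for n x using hM M00 by (auto simp: abs_mult indicator_def)
    show "h n x * indicat_real ?Q x = 0" if "norm x > S'" for n x using S'[OF that] by simp
    have Qz: "\<psi> x = 0" if nQ: "x \<notin> ?Q" for x
    proof (rule supp)
      obtain i where "\<not> \<bar>x $ i\<bar> < real (Suc R)" using nQ by blast
      then show "norm x > S" using R component_le_norm_cart[of x i] by simp
    qed
    show "\<psi> x = 0" if "norm x > S'" for x using Qz S'[OF that] by simp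
    show "AE x in lborel. (\<lambda>n. h n x * indicat_real ?Q x) \<longlonglongrightarrow> \<psi> x"
      using NAE
    proof eventually_elim
      case (elim x)
      have "(\<lambda>n. h n x * indicat_real ?Q x) \<longlonglongrightarrow> max (- M0) (min M0 (\<psi> x)) * indicat_real ?Q x"
        unfolding h_def by (intro tendsto_mult_right tendsto_max tendsto_min tendsto_const lim elim)
      also have "max (- M0) (min M0 (\<psi> x)) * indicat_real ?Q x = \<psi> x"
        using M0[of x] Qz[of x] by (auto simp: indicator_def)
      finally show ?case .
    qed
    show "\<bar>h n x * indicat_real ?Q x\<bar> \<le> T" if T: "\<And>x. \<bar>\<psi> x\<bar> \<le> T" for T n x
      using hM[of n x] M0_le[OF T] M00 by (auto simp: indicator_def)
  qed (use \<psi> M0 in auto)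
qed

text \<open>Multiplying a nonnegative test function by the sign of \<open>F\<close> turns the signed
  pairing into the integral of the absolute value, as the converse Hoelder inequality needs, without
  increasing the dual norm.\<close>

lemma Lp_norm_tested:
  fixes F :: "real ^ 'n \<Rightarrow> real"
  assumes p: "1 \<le> p" and F: "locally_integrable F" and B: "0 \<le> B"
    and t: "\<And>c k a b (Z :: ('n \<Rightarrow> int) set). finite Z \<Longrightarrow> tested p B F (bump_combination c k a b Z)"
  shows "Lp_norm p F \<le> ennreal B"
proof (rule Lp_norm_dual[OF p locally_integrable_borel[OF F] B])
  note Fb [measurable] = locally_integrable_borel[OF F]
  fix \<psi> :: "real ^ 'n \<Rightarrow> real" and M R
  assume [measurable]: "\<psi> \<in> borel_measurable borel" and \<psi>: "\<And>x. 0 \<le> \<psi> x" "\<And>x. \<psi> x \<le> M" "\<And>x. norm x > R \<Longrightarrow> \<psi> x = 0"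
  define \<psi>' where "\<psi>' x = sgn (F x) * \<psi> x" for x
  have \<psi>': "\<bar>\<psi>' x\<bar> \<le> \<bar>\<psi> x\<bar>" for x by (auto simp: \<psi>'_def abs_mult sgn_if)
  have [measurable]: "\<psi>' \<in> borel_measurable borel" unfolding \<psi>'_def by measurable
  have "tested p B F \<psi>'"
    by (rule tested_extend[OF p F t, where M = M and S = R])
      (use \<psi> order_trans[OF \<psi>'] in \<open>auto simp: \<psi>'_def\<close>)
  moreover have eq: "F x * \<psi>' x = \<bar>F x\<bar> * \<psi> x" for x by (simp add: \<psi>'_def abs_sgn mult_ac)
  moreover have "integrable lborel (\<lambda>x. \<bar>F x\<bar> * \<psi> x)"
    unfolding eq[symmetric] by (rule locally_integrable_mult[OF F, where M = M and R = R])
      (use \<psi> order_trans[OF \<psi>'] in \<open>auto simp: \<psi>'_def\<close>)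
  then have "(\<integral>\<^sup>+ x. ennreal (\<bar>F x\<bar> * \<psi> x) \<partial>lborel) = ennreal (\<integral> x. \<bar>F x\<bar> * \<psi> x \<partial>lborel)"
    by (intro nn_integral_eq_integral) (auto simp: \<psi>)
  moreover have "0 \<le> (\<integral> x. \<bar>F x\<bar> * \<psi> x \<partial>lborel)" by (intro integral_nonneg_AE AE_I2 mult_nonneg_nonneg \<psi>) auto
  ultimately have "(\<integral>\<^sup>+ x. ennreal (\<bar>F x\<bar> * \<psi> x) \<partial>lborel) \<le> ennreal B * dual_norm p \<psi>'"
    unfolding tested_def by simp
  also have "\<dots> \<le> ennreal B * dual_norm p \<psi>" by (intro mult_left_mono dual_norm_mono[OF p] \<psi>') auto
  finally show "(\<integral>\<^sup>+ x. ennreal (\<bar>F x\<bar> * \<psi> x) \<partial>lborel) \<le> ennreal B * dual_norm p \<psi>" .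
qed

section \<open>Generalized derivatives under linear maps\<close>

definition lists_of_length :: "nat \<Rightarrow> 'n list set" where
  "lists_of_length m = {js. length js = m}"

lemma finite_lists_of_length: "finite (lists_of_length m :: 'n::finite list set)"
  using finite_lists_length_eq[of "UNIV :: 'n set" m] by (simp add: lists_of_length_def)

lemma lists_of_length_0: "lists_of_length 0 = {[]}"
  by (auto simp: lists_of_length_def)

lemma sum_lists_of_length_Suc: "(\<Sum>js\<in>lists_of_length (Suc m). f js) = (\<Sum>j\<in>UNIV. \<Sum>js\<in>lists_of_length m. f ((j :: 'n::finite) # js))"
proof -
  let ?g = "\<lambda>(j, js). (j :: 'n) # js"
  have inj: "inj_on ?g (UNIV \<times> lists_of_length m)" by (auto simp: inj_on_def)
  have eq: "lists_of_length (Suc m) = ?g ` (UNIV \<times> lists_of_length m)"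
    by (force simp: lists_of_length_def length_Suc_conv)
  have "(\<Sum>js\<in>lists_of_length (Suc m). f js) = (\<Sum>x\<in>UNIV \<times> lists_of_length m. f (?g x))"
    unfolding eq by (subst sum.reindex[OF inj]) (simp add: comp_def)
  then show ?thesis by (simp add: sum.cartesian_product case_prod_unfold)
qed

text \<open>The coefficient of the derivative along \<open>js\<close> in the expansion of the
  derivative along \<open>is\<close> of a function composed with \<open>B\<close>. Only lists of
  equal length are paired; the value 1 then is the empty product.\<close>

fun chain_coeff :: "real ^ 'n ^ 'n \<Rightarrow> 'n list \<Rightarrow> 'n list \<Rightarrow> real" where
  "chain_coeff B (i # is) (j # js) = B $ j $ i * chain_coeff B is js"
| "chain_coeff B _ _ = 1"

section \<open>The chain rule for test functions\<close>

lemma has_derivative_linear_compose: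
  fixes B :: "real ^ 'n ^ 'n" and f :: "real ^ 'n \<Rightarrow> real"
  assumes "f differentiable (at (B *v x))"
  shows "((\<lambda>x. f (B *v x)) has_derivative (\<lambda>h. frechet_derivative f (at (B *v x)) (B *v h))) (at x)"
proof -
  have "((\<lambda>x. B *v x) has_derivative (\<lambda>h. B *v h)) (at x)"
    by (rule bounded_linear_imp_has_derivative[OF matrix_vector_mul_bounded_linear])
  from has_derivative_compose[OF this frechet_derivative_works[THEN iffD1, OF assms]] show ?thesis .
qed

lemma partial_deriv_linear_compose:
  fixes B :: "real ^ 'n ^ 'n" and f :: "real ^ 'n \<Rightarrow> real"
  assumes f: "f differentiable (at (B *v x))"
  shows "partial_deriv i (\<lambda>x. f (B *v x)) x = (\<Sum>j\<in>UNIV. B $ j $ i * partial_deriv j f (B *v x))"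
proof -
  let ?D = "frechet_derivative f (at (B *v x))"
  interpret linear ?D using linear_frechet_derivative[OF f] .
  have "B *v axis i 1 = (\<Sum>j\<in>UNIV. B $ j $ i *\<^sub>R axis j 1)"
    using vec_expand[of "B *v axis i 1"] by (simp add: matrix_vector_mult_basis column_def)
  then have "?D (B *v axis i 1) = (\<Sum>j\<in>UNIV. B $ j $ i * ?D (axis j 1))"
    by (simp add: sum scale)
  then show ?thesis
    using frechet_derivative_at[OF has_derivative_linear_compose[OF f]]
    by (simp add: partial_deriv_def fun_eq_iff)
qed

lemma test_iter_differentiable: "test_function \<phi> \<Longrightarrow> iter_partial is \<phi> differentiable (at x)"
  unfolding test_function_def differentiable_on_def by auto

text \<open>Lists keep the order of differentiation, so the induction applies the chain rule to one
  direction at a time and never exchanges derivatives.\<close>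

lemma iter_partial_linear_compose:
  fixes B :: "real ^ 'n ^ 'n"
  assumes \<phi>: "test_function \<phi>"
  shows "iter_partial is (\<lambda>x. \<phi> (B *v x)) = (\<lambda>x. \<Sum>js\<in>lists_of_length (length is). chain_coeff B is js * iter_partial js \<phi> (B *v x))"
proof (induction "is")
  case Nil
  show ?case by (simp add: iter_partial_def lists_of_length_0)
next
  case (Cons i "is")
  have "partial_deriv i (\<lambda>x. \<Sum>js\<in>lists_of_length (length is). chain_coeff B is js * iter_partial js \<phi> (B *v x)) x
      = (\<Sum>js\<in>lists_of_length (length is). chain_coeff B is js * partial_deriv i (\<lambda>x. iter_partial js \<phi> (B *v x)) x)" for x
  proof -
    have "((\<lambda>x. \<Sum>js\<in>lists_of_length (length is). chain_coeff B is js * iter_partial js \<phi> (B *v x)) has_derivative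
        (\<lambda>h. \<Sum>js\<in>lists_of_length (length is). chain_coeff B is js * frechet_derivative (\<lambda>x. iter_partial js \<phi> (B *v x)) (at x) h)) (at x)"
    proof (intro has_derivative_sum has_derivative_mult_right)
      fix js :: "'n list"
      have "(\<lambda>x. iter_partial js \<phi> (B *v x)) differentiable (at x)"
        using has_derivative_linear_compose[OF test_iter_differentiable[OF \<phi>]] unfolding differentiable_def by blast
      then show "((\<lambda>x. iter_partial js \<phi> (B *v x)) has_derivative frechet_derivative (\<lambda>x. iter_partial js \<phi> (B *v x)) (at x)) (at x)"
        by (simp add: frechet_derivative_works)
    qed
    from frechet_derivative_at[OF this] show ?thesis by (simp add: partial_deriv_def fun_eq_iff)
  qed
  then have "iter_partial (i # is) (\<lambda>x. \<phi> (B *v x)) x = (\<Sum>js\<in>lists_of_length (length is). \<Sum>j\<in>UNIV. chain_coeff B is js * (B $ j $ i * iter_partial (j # js) \<phi> (B *v x)))" for x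
    using Cons by (simp add: iter_partial_def partial_deriv_linear_compose[OF test_iter_differentiable[OF \<phi>, unfolded iter_partial_def]] sum_distrib_left)
  also have "(\<Sum>js\<in>lists_of_length (length is). \<Sum>j\<in>UNIV. chain_coeff B is js * (B $ j $ i * iter_partial (j # js) \<phi> (B *v x)))
      = (\<Sum>js\<in>lists_of_length (length (i # is)). chain_coeff B (i # is) js * iter_partial js \<phi> (B *v x))" for x
    by (subst sum.swap) (simp add: sum_lists_of_length_Suc mult_ac)
  finally show ?case by (rule ext)
qed

lemma test_function_linear:
  fixes B :: "real ^ 'n ^ 'n"
  assumes \<phi>: "test_function \<phi>" and B: "invertible B"
  shows "test_function (\<lambda>x. \<phi> (B *v x))"
  unfolding test_function_def
proof (intro conjI allI)
  fix "is" :: "'n list"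
  have "(\<lambda>x. chain_coeff B is js * iter_partial js \<phi> (B *v x)) differentiable (at x)" for js x
    using has_derivative_mult_right[OF has_derivative_linear_compose[of "iter_partial js \<phi>" B x, OF test_iter_differentiable[OF \<phi>]]]
    unfolding differentiable_def by blast
  then show "iter_partial is (\<lambda>x. \<phi> (B *v x)) differentiable_on UNIV"
    unfolding iter_partial_linear_compose[OF \<phi>] differentiable_on_def
    by (auto intro!: differentiable_sum finite_lists_of_length)
  obtain B' where B': "B ** B' = mat 1" "B' ** B = mat 1" using B unfolding invertible_def by blast
  let ?K = "closure {x. \<phi> x \<noteq> 0}"
  have K: "compact ?K" using \<phi> by (simp add: test_function_def)
  have "{x. \<phi> (B *v x) \<noteq> 0} \<subseteq> (\<lambda>x. B' *v x) ` ?K"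
  proof
    fix x assume "x \<in> {x. \<phi> (B *v x) \<noteq> 0}"
    then have "B *v x \<in> ?K" "x = B' *v (B *v x)"
      using closure_subset[of "{x. \<phi> x \<noteq> 0}"] by (auto simp: matrix_vector_mul_assoc B')
    then show "x \<in> (\<lambda>x. B' *v x) ` ?K" by blast
  qed
  moreover have "bounded ((\<lambda>x. B' *v x) ` ?K)"
    by (intro bounded_linear_image compact_imp_bounded K matrix_vector_mul_bounded_linear)
  ultimately show "compact (closure {x. \<phi> (B *v x) \<noteq> 0})"
    by (auto intro: bounded_subset)
qed

lemma test_iter_support:
  assumes \<phi>: "test_function \<phi>" and x: "x \<notin> closure {x. \<phi> x \<noteq> 0}"
  shows "iter_partial is \<phi> x = 0"
  using x
proof (induction "is" arbitrary: x)
  case Nil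
  then show ?case using closure_subset[of "{x. \<phi> x \<noteq> 0}"] by (auto simp: iter_partial_def)
next
  case (Cons i "is")
  have "((\<lambda>_. 0) has_derivative (\<lambda>_. 0)) (at x)" by simp
  then have "(iter_partial is \<phi> has_derivative (\<lambda>_. 0)) (at x)"
    by (rule has_derivative_transform_within_open[where s = "- closure {x. \<phi> x \<noteq> 0}"]) (use Cons in auto)
  from frechet_derivative_at[OF this] show ?case by (simp add: iter_partial_def partial_deriv_def fun_eq_iff)
qed

lemma test_iter_bounds:
  assumes \<phi>: "test_function \<phi>"
  obtains M R where "iter_partial is \<phi> \<in> borel_measurable borel" "\<And>x. \<bar>iter_partial is \<phi> x\<bar> \<le> M" "\<And>x. norm x > R \<Longrightarrow> iter_partial is \<phi> x = 0"
proof -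
  let ?K = "closure {x. \<phi> x \<noteq> 0}"
  have K: "compact ?K" using \<phi> by (simp add: test_function_def)
  have c: "continuous_on UNIV (iter_partial is \<phi>)"
    using \<phi> by (intro differentiable_imp_continuous_on) (simp add: test_function_def)
  obtain R where R: "\<And>x. x \<in> ?K \<Longrightarrow> norm x \<le> R" using compact_imp_bounded[OF K] unfolding bounded_iff by blast
  have "bounded (iter_partial is \<phi> ` ?K)"
    by (intro compact_imp_bounded compact_continuous_image K continuous_on_subset[OF c]) auto
  then obtain M where M: "\<forall>x\<in>?K. \<bar>iter_partial is \<phi> x\<bar> \<le> M" unfolding bounded_iff by auto
  show ?thesis
  proof (rule that[of "\<bar>M\<bar>" R])
    show "\<bar>iter_partial is \<phi> x\<bar> \<le> \<bar>M\<bar>" for x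
      using M test_iter_support[OF \<phi>, of x "is"] by (cases "x \<in> ?K") (force, simp)
    show "iter_partial is \<phi> x = 0" if "norm x > R" for x
      using R[of x] that by (intro test_iter_support[OF \<phi>]) auto
  qed (rule borel_measurable_continuous_onI[OF c])
qed

lemma integrable_test:
  assumes "locally_integrable f" and "test_function \<phi>"
  shows "integrable lborel (\<lambda>x. f x * iter_partial is \<phi> x)"
  using test_iter_bounds[OF assms(2)] locally_integrable_mult[OF assms(1)] by metis

lemma locally_integrable_linear:
  fixes B :: "real ^ 'n ^ 'n"
  assumes B: "invertible B" and f: "locally_integrable f"
  shows "locally_integrable (\<lambda>x. c * f (B *v x))"
  unfolding locally_integrable_def set_integrable_def
proof (intro allI impI)
  fix K :: "(real ^ 'n) set" assume K: "compact K"
  have "compact ((\<lambda>x. B *v x) ` K)"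
    by (intro compact_continuous_image K linear_continuous_on) auto
  then have "integrable lborel (\<lambda>x. indicat_real ((\<lambda>x. B *v x) ` K) x * f x)"
    using f by (simp add: locally_integrable_def set_integrable_def)
  from integrable_linear_vec[OF B this]
  have "integrable lborel (\<lambda>x. c * (indicat_real ((\<lambda>x. B *v x) ` K) (B *v x) * f (B *v x)))" by simp
  moreover have "indicat_real ((\<lambda>x. B *v x) ` K) (B *v x) = indicat_real K x" for x
    using B by (auto simp: indicator_def dest: injD[OF inj_matrix_vector_mult])
  ultimately show "integrable lborel (\<lambda>x. indicat_real K x *\<^sub>R (c * f (B *v x)))" by (simp add: mult_ac)
qed

lemma locally_integrable_lincomb:
  fixes f :: "'s \<Rightarrow> real ^ 'n \<Rightarrow> real"
  assumes "\<And>s. s \<in> S \<Longrightarrow> locally_integrable (f s)"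
  shows "locally_integrable (\<lambda>x. \<Sum>s\<in>S. c s * f s x)"
  unfolding locally_integrable_def set_integrable_def
proof (intro allI impI)
  fix K :: "(real ^ 'n) set" assume K: "compact K"
  have "integrable lborel (\<lambda>x. \<Sum>s\<in>S. c s * (indicat_real K x * f s x))"
    using assms K by (intro Bochner_Integration.integrable_sum integrable_mult_right) (simp add: locally_integrable_def set_integrable_def)
  then show "integrable lborel (\<lambda>x. indicat_real K x *\<^sub>R (\<Sum>s\<in>S. c s * f s x))"
    by (simp add: sum_distrib_left mult_ac)
qed

lemma locally_integrable_diff:
  "locally_integrable f \<Longrightarrow> locally_integrable g \<Longrightarrow> locally_integrable (\<lambda>x. f x - g x)"
  using locally_integrable_lincomb[of UNIV "\<lambda>b. if b then f else g" "\<lambda>b. if b then 1 else -1"] by (simp add: UNIV_bool)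

lemma mi_order_count_list: "mi_order (count_list is) = length is"
proof (induction "is")
  case (Cons i "is")
  then show ?case by (simp only: count_list_Cons_inc mi_order_inc length_Cons)
qed (simp add: mi_order_def)

lemma ex_list_of_mi: "\<exists>is. count_list is = (n :: 'n::finite \<Rightarrow> nat)"
proof -
  obtain n0 "is" where n0: "mi_order n0 = 0" "n = foldr inc is n0" using mi_decompose[of n 0 "mi_order n"] by auto
  have "n0 = (\<lambda>_. 0)" using n0(1) by (auto simp: mi_order_def fun_eq_iff)
  moreover have "foldr inc is (\<lambda>_. 0) = count_list is"
  proof (induction "is")
    case (Cons i "is")
    then show ?case by (simp only: count_list_Cons_inc foldr.simps comp_def)
  qed auto
  ultimately show ?thesis using n0 by auto
qed

text \<open>One application of the chain rule as an operator on families indexed by multi-indices,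
  where such operators commute.\<close>

definition chain_op :: "real ^ 'n ^ 'n \<Rightarrow> 'n \<Rightarrow> (('n \<Rightarrow> nat) \<Rightarrow> real) \<Rightarrow> ('n \<Rightarrow> nat) \<Rightarrow> real" where
  "chain_op B i X n = (\<Sum>j\<in>UNIV. B $ j $ i * X (inc j n))"

lemma inc_commute: "inc i (inc j n) = inc j (inc i n)"
  by (auto simp: inc_def fun_eq_iff)

lemma chain_op_commute: "chain_op B i \<circ> chain_op B i' = chain_op B i' \<circ> chain_op B i"
proof (intro ext)
  fix X n
  have "(chain_op B i \<circ> chain_op B i') X n = (\<Sum>j\<in>UNIV. \<Sum>j'\<in>UNIV. B $ j $ i * (B $ j' $ i' * X (inc j' (inc j n))))"
    by (simp add: chain_op_def sum_distrib_left)
  also have "\<dots> = (\<Sum>j'\<in>UNIV. \<Sum>j\<in>UNIV. B $ j' $ i' * (B $ j $ i * X (inc j (inc j' n))))"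
    by (subst sum.swap) (simp add: inc_commute mult_ac)
  also have "\<dots> = (chain_op B i' \<circ> chain_op B i) X n"
    by (simp add: chain_op_def sum_distrib_left)
  finally show "(chain_op B i \<circ> chain_op B i') X n = (chain_op B i' \<circ> chain_op B i) X n" .
qed

text \<open>When the summand sees \<open>js\<close> only through its multiplicities, the sum over
  lists is an iteration of commuting operators.\<close>

lemma chain_sum_fold:
  "(\<Sum>js\<in>lists_of_length (length is). chain_coeff B is js * X (count_list js)) = fold (chain_op B) is X (\<lambda>_. 0)"
proof (induction "is" arbitrary: X)
  case Nil
  show ?case by (simp add: lists_of_length_0)
next
  case (Cons i "is")
  have "(\<Sum>js\<in>lists_of_length (length (i # is)). chain_coeff B (i # is) js * X (count_list js))
      = (\<Sum>js\<in>lists_of_length (length is). \<Sum>j\<in>UNIV. chain_coeff B is js * (B $ j $ i * X (inc j (count_list js))))"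
    by (subst sum.swap) (simp add: sum_lists_of_length_Suc mult_ac count_list_Cons_inc del: count_list.simps)
  also have "\<dots> = (\<Sum>js\<in>lists_of_length (length is). chain_coeff B is js * chain_op B i X (count_list js))"
    by (simp add: chain_op_def sum_distrib_left)
  finally show ?case using Cons by simp
qed

text \<open>Only the multiplicities of the list of directions matter; this is why no symmetry of the
  mixed derivatives of test functions has to be proved.\<close>

lemma chain_sum_cong:
  assumes "count_list is = count_list is'"
  shows "(\<Sum>js\<in>lists_of_length (length is). chain_coeff B is js * X (count_list js)) = (\<Sum>js\<in>lists_of_length (length is'). chain_coeff B is' js * X (count_list js))"
proof -
  have "mset is = mset is'" using assms by (intro multiset_eqI) (metis count_mset)
  then have "fold (chain_op B) is = fold (chain_op B) is'"
    by (rule fold_multiset_equiv[OF chain_op_commute])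
  then show ?thesis by (simp add: chain_sum_fold)
qed

definition mi_list :: "('n::finite \<Rightarrow> nat) \<Rightarrow> 'n list" where
  "mi_list n = (SOME is. count_list is = n)"

lemma count_mi_list [simp]: "count_list (mi_list n) = n"
  unfolding mi_list_def using ex_list_of_mi by (rule someI_ex)

lemma length_mi_list: "length (mi_list n) = mi_order n"
  using mi_order_count_list[of "mi_list n"] by simp

text \<open>The test function is written as \<open>\<psi>\<close> composed with \<open>B\<close>;
  the chain rule expands its derivatives, a change of variables removes \<open>B\<close>, and the
  derivatives move from \<open>\<psi>\<close> to \<open>f\<close>. The expansion refers to the list
  at hand, while the resulting function must not. The canonical list \<open>mi_list n\<close> is
  substituted after integration, where only multiplicities enter.\<close>

lemma is_weak_deriv_linear:
  fixes B :: "real ^ 'n ^ 'n"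
  assumes B: "invertible B" and G: "\<And>m. mi_order m = mi_order n \<Longrightarrow> is_weak_deriv m f (G m)"
  shows "is_weak_deriv n (\<lambda>x. c * f (B *v x))
     (\<lambda>x. c * (\<Sum>js\<in>lists_of_length (mi_order n). chain_coeff B (mi_list n) js * G (count_list js) (B *v x)))"
proof -
  have f: "locally_integrable f" using G[of n] by (simp add: is_weak_deriv_def)
  have Gl: "locally_integrable (G (count_list js))" if "js \<in> lists_of_length (mi_order n)" for js
    using G[of "count_list js"] that by (simp add: is_weak_deriv_def mi_order_count_list lists_of_length_def)
  obtain B' where B': "B ** B' = mat 1" "B' ** B = mat 1" using B unfolding invertible_def by blast
  then have B'i: "invertible B'" unfolding invertible_def by blast
  let ?H = "\<lambda>x. \<Sum>js\<in>lists_of_length (mi_order n). chain_coeff B (mi_list n) js * G (count_list js) x"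
  have Hl: "locally_integrable ?H" by (rule locally_integrable_lincomb) (rule Gl)
  have pos: "0 < lin_scale B" by (rule lin_scale_pos[OF B])
  have "(\<integral> x. c * f (B *v x) * iter_partial is \<phi> x \<partial>lborel) = (-1) ^ mi_order n * (\<integral> x. c * ?H (B *v x) * \<phi> x \<partial>lborel)"
    if \<phi>: "test_function \<phi>" and cnt: "\<forall>i. count_list is i = n i" for \<phi> "is"
  proof -
    have cis: "count_list is = n" using cnt by auto
    then have len: "length is = mi_order n" using mi_order_count_list[of "is"] by simp
    define \<psi> where "\<psi> = (\<lambda>x. \<phi> (B' *v x))"
    have \<psi>: "test_function \<psi>" unfolding \<psi>_def by (rule test_function_linear[OF \<phi> B'i])
    have \<phi>\<psi>: "\<phi> = (\<lambda>x. \<psi> (B *v x))" by (simp add: \<psi>_def matrix_vector_mul_assoc B')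
    note int = integrable_test[OF f \<psi>]
    have meas: "(\<lambda>x. f x * iter_partial js \<psi> x) \<in> borel_measurable borel" for js
      using borel_measurable_integrable[OF int[of js]] by simp
    have "(\<integral> x. c * f (B *v x) * iter_partial is \<phi> x \<partial>lborel)
        = (\<integral> x. (\<Sum>js\<in>lists_of_length (length is). c * chain_coeff B is js * (f (B *v x) * iter_partial js \<psi> (B *v x))) \<partial>lborel)"
      unfolding \<phi>\<psi> iter_partial_linear_compose[OF \<psi>] by (simp add: sum_distrib_left mult_ac)
    also have "\<dots> = (\<Sum>js\<in>lists_of_length (length is). c * chain_coeff B is js * (\<integral> x. f (B *v x) * iter_partial js \<psi> (B *v x) \<partial>lborel))"
      by (subst Bochner_Integration.integral_sum) (use integrable_linear_vec[OF B int] in auto)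
    also have "\<dots> = (\<Sum>js\<in>lists_of_length (length is). c * chain_coeff B is js * (lin_scale B * ((-1) ^ mi_order n * (\<integral> x. G (count_list js) x * \<psi> x \<partial>lborel))))"
    proof (intro sum.cong refl arg_cong2[where f = "(*)"])
      fix js :: "'n list" assume js: "js \<in> lists_of_length (length is)"
      have "(\<integral> x. f (B *v x) * iter_partial js \<psi> (B *v x) \<partial>lborel) = lin_scale B * (\<integral> x. f x * iter_partial js \<psi> x \<partial>lborel)"
        unfolding integral_linear_vec[OF B meas] using pos by simp
      also have "(\<integral> x. f x * iter_partial js \<psi> x \<partial>lborel) = (-1) ^ mi_order n * (\<integral> x. G (count_list js) x * \<psi> x \<partial>lborel)"
        using G[of "count_list js"] \<psi> js len unfolding is_weak_deriv_def by (simp add: mi_order_count_list lists_of_length_def)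
      finally show "(\<integral> x. f (B *v x) * iter_partial js \<psi> (B *v x) \<partial>lborel) = lin_scale B * ((-1) ^ mi_order n * (\<integral> x. G (count_list js) x * \<psi> x \<partial>lborel))" .
    qed
    also have "\<dots> = c * lin_scale B * (-1) ^ mi_order n * (\<Sum>js\<in>lists_of_length (length is). chain_coeff B is js * (\<integral> x. G (count_list js) x * \<psi> x \<partial>lborel))"
      by (simp add: sum_distrib_left mult_ac)
    also have "(\<Sum>js\<in>lists_of_length (length is). chain_coeff B is js * (\<integral> x. G (count_list js) x * \<psi> x \<partial>lborel))
        = (\<Sum>js\<in>lists_of_length (mi_order n). chain_coeff B (mi_list n) js * (\<integral> x. G (count_list js) x * \<psi> x \<partial>lborel))"
      using chain_sum_cong[of "is" "mi_list n" B "\<lambda>m. \<integral> x. G m x * \<psi> x \<partial>lborel"] cis by (simp add: length_mi_list)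
    also have "\<dots> = (\<integral> x. ?H x * \<psi> x \<partial>lborel)"
    proof -
      have "(\<integral> x. ?H x * \<psi> x \<partial>lborel) = (\<integral> x. (\<Sum>js\<in>lists_of_length (mi_order n). chain_coeff B (mi_list n) js * (G (count_list js) x * \<psi> x)) \<partial>lborel)"
        by (simp only: sum_distrib_right mult.assoc)
      also have "\<dots> = (\<Sum>js\<in>lists_of_length (mi_order n). chain_coeff B (mi_list n) js * (\<integral> x. G (count_list js) x * \<psi> x \<partial>lborel))"
        using integrable_test[OF Gl \<psi>, of _ "[]"]
        by (subst Bochner_Integration.integral_sum) (auto simp: iter_partial_def)
      finally show ?thesis ..
    qed
    also have "lin_scale B * (\<integral> x. ?H x * \<psi> x \<partial>lborel) = (\<integral> x. ?H (B *v x) * \<psi> (B *v x) \<partial>lborel)"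
    proof -
      have "(\<lambda>x. ?H x * \<psi> x) \<in> borel_measurable borel"
        using borel_measurable_integrable[OF integrable_test[OF Hl \<psi>, of "[]"]] by (simp add: iter_partial_def)
      from integral_linear_vec[OF B this] show ?thesis using pos by simp
    qed
    then have "c * lin_scale B * (-1) ^ mi_order n * (\<integral> x. ?H x * \<psi> x \<partial>lborel) = (-1) ^ mi_order n * (\<integral> x. c * ?H (B *v x) * \<phi> x \<partial>lborel)"
      unfolding \<phi>\<psi> by (simp add: mult.assoc)
    finally show ?thesis .
  qed
  then show ?thesis unfolding is_weak_deriv_def
    using locally_integrable_linear[OF B f, of c] locally_integrable_linear[OF B Hl, of c] by blast
qed

lemma weak_deriv_exists: "has_weak_derivs r f \<Longrightarrow> mi_order n \<le> r \<Longrightarrow> is_weak_deriv n f (weak_deriv n f)"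
  unfolding has_weak_derivs_def weak_deriv_def by (drule spec, drule mp, assumption, erule someI_ex)

lemma has_weak_derivs_linear:
  fixes B :: "real ^ 'n ^ 'n"
  assumes B: "invertible B" and f: "has_weak_derivs r f"
  shows "has_weak_derivs r (\<lambda>x. c * f (B *v x))"
  unfolding has_weak_derivs_def
proof (intro allI impI)
  fix n :: "'n \<Rightarrow> nat" assume "mi_order n \<le> r"
  then show "\<exists>g. is_weak_deriv n (\<lambda>x. c * f (B *v x)) g"
    using is_weak_deriv_linear[OF B, of n f "\<lambda>m. weak_deriv m f" c] weak_deriv_exists[OF f] by auto
qed

text \<open>The difference annihilates every bump, so it passes the test inequality with bound 0 and
  has vanishing L1 norm.\<close>

lemma weak_deriv_unique:
  assumes g1: "is_weak_deriv n f g1" and g2: "is_weak_deriv n f g2"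
  shows "AE x in lborel. g1 x = g2 x"
proof -
  define F where "F = (\<lambda>x. g1 x - g2 x)"
  have l: "locally_integrable g1" "locally_integrable g2" using g1 g2 by (auto simp: is_weak_deriv_def)
  have F: "locally_integrable F" unfolding F_def using l by (rule locally_integrable_diff)
  have int: "integrable lborel (\<lambda>x. g x * bump k a b x)" if "locally_integrable g" for g k and a b :: "real ^ 'a"
  proof -
    have "test_function (bump k a b)" by (rule bump_jet)
    from integrable_test[OF that this, of "[]"] show ?thesis by (simp add: iter_partial_def)
  qed
  have bump0: "(\<integral> x. F x * bump k a b x \<partial>lborel) = 0" for k a b
  proof -
    have t: "test_function (bump k a b)" by (rule bump_jet)
    have "(-1) ^ mi_order n * (\<integral> x. g1 x * bump k a b x \<partial>lborel) = (-1) ^ mi_order n * (\<integral> x. g2 x * bump k a b x \<partial>lborel)"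
    proof -
      have "(\<integral> x. f x * iter_partial (mi_list n) (bump k a b) x \<partial>lborel) = (-1) ^ mi_order n * (\<integral> x. g x * bump k a b x \<partial>lborel)"
        if "is_weak_deriv n f g" for g
        using that t unfolding is_weak_deriv_def by simp
      from this[OF g1] this[OF g2] show ?thesis by simp
    qed
    then have "(\<integral> x. g1 x * bump k a b x \<partial>lborel) = (\<integral> x. g2 x * bump k a b x \<partial>lborel)" by simp
    then show ?thesis unfolding F_def left_diff_distrib using int l by simp
  qed
  have "Lp_norm 1 F \<le> ennreal 0"
  proof (rule Lp_norm_tested[OF _ F])
    fix c k a b and Z :: "('a \<Rightarrow> int) set" assume "finite Z"
    have "(\<integral> x. F x * bump_combination c k a b Z x \<partial>lborel) = (\<integral> x. (\<Sum>z\<in>Z. c z * (F x * bump k (a z) (b z) x)) \<partial>lborel)"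
      by (simp add: bump_combination_def sum_distrib_left mult_ac)
    also have "\<dots> = 0" by (subst Bochner_Integration.integral_sum) (auto simp: int[OF F] bump0)
    finally show "tested 1 0 F (bump_combination c k a b Z)" by (simp add: tested_def)
  qed auto
  then have "(\<integral>\<^sup>+ x. ennreal \<bar>F x\<bar> \<partial>lborel) = 0" by (simp add: Lp_norm_finite)
  then have "AE x in lborel. F x = 0"
    using locally_integrable_borel[OF F] by (subst (asm) nn_integral_0_iff_AE) auto
  then show ?thesis by (simp add: F_def)
qed

section \<open>Besov integrals\<close>

text \<open>Superlevel sets of a monotone function are intervals. The moduli are suprema over
  uncountable families; monotonicity in the step is the source of their measurability.\<close>

lemma borel_measurable_mono_ennreal:
  fixes w :: "real \<Rightarrow> ennreal"
  assumes w: "mono w" shows "w \<in> borel_measurable borel"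
proof (rule borel_measurableI_greater)
  fix y
  have "is_interval {x. y < w x}"
    unfolding is_interval_1 using w by (auto simp: mono_def intro: less_le_trans)
  then have "{x. y < w x} \<in> sets borel" by (rule real_interval_borel_measurable)
  then show "{x \<in> space borel. y < w x} \<in> sets borel" by simp
qed

lemma besov_infinite: "besov_integral \<sigma> \<infinity> w = (SUP t\<in>{0<..}. ennreal (t powr - \<sigma>) * w t)"
  by (simp add: besov_integral_def)

definition bpow :: "real \<Rightarrow> real \<Rightarrow> (real \<Rightarrow> ennreal) \<Rightarrow> ennreal" where
  "bpow \<sigma> Q w = (\<integral>\<^sup>+ t\<in>{0<..}. epowr (ennreal (t powr - \<sigma>) * w t) Q * ennreal (1 / t) \<partial>lborel)"

lemma besov_finite: "q \<noteq> \<infinity> \<Longrightarrow> besov_integral \<sigma> q w = epowr (bpow \<sigma> (enn2real q) w) (1 / enn2real q)"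
  by (simp add: besov_integral_def bpow_def)

lemma bpow_measurable:
  assumes [measurable]: "w \<in> borel_measurable borel"
  shows "(\<lambda>t. epowr (ennreal (t powr - \<sigma>) * w t) Q * ennreal (1 / t) * indicator {0<..} t) \<in> borel_measurable lborel"
  by measurable

lemma besov_mono:
  assumes q: "1 \<le> q" and le: "\<And>t. 0 < t \<Longrightarrow> v t \<le> w t"
  shows "besov_integral \<sigma> q v \<le> besov_integral \<sigma> q w"
proof (cases "q = \<infinity>")
  case True
  show ?thesis unfolding True besov_infinite by (intro SUP_least SUP_upper2) (use le in \<open>auto intro!: mult_left_mono\<close>)
next
  case False
  have "epowr (ennreal (t powr - \<sigma>) * v t) (enn2real q) * ennreal (1 / t) * indicator {0<..} t
      \<le> epowr (ennreal (t powr - \<sigma>) * w t) (enn2real q) * ennreal (1 / t) * indicator {0<..} t" for t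
  proof (cases "0 < t")
    case True
    then show ?thesis using finite_exponent[OF q False] le[OF True]
      by (intro mult_right_mono epowr_mono mult_left_mono) auto
  qed simp
  then show ?thesis unfolding besov_finite[OF False] bpow_def using finite_exponent[OF q False]
    by (intro epowr_mono nn_integral_mono) auto
qed

lemma besov_cmult_le:
  assumes q: "1 \<le> q" and w: "w \<in> borel_measurable borel"
  shows "besov_integral \<sigma> q (\<lambda>t. c * w t) \<le> c * besov_integral \<sigma> q w"
proof (cases "q = \<infinity>")
  case True
  have "ennreal (t powr - \<sigma>) * (c * w t) \<le> c * (SUP t\<in>{0<..}. ennreal (t powr - \<sigma>) * w t)" if "0 < t" for t
    using that unfolding mult.left_commute[of _ c] by (intro mult_left_mono SUP_upper) auto
  then show ?thesis unfolding True besov_infinite by (intro SUP_least) auto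
next
  case False
  define Q where "Q = enn2real q"
  have Q: "1 \<le> Q" using finite_exponent[OF q False] by (simp add: Q_def)
  have "bpow \<sigma> Q (\<lambda>t. c * w t) = (\<integral>\<^sup>+ t. epowr c Q * (epowr (ennreal (t powr - \<sigma>) * w t) Q * ennreal (1 / t) * indicator {0<..} t) \<partial>lborel)"
    unfolding bpow_def using Q by (simp add: epowr_mult mult_ac)
  also have "\<dots> = epowr c Q * bpow \<sigma> Q w"
    unfolding bpow_def by (rule nn_integral_cmult[OF bpow_measurable[OF w]])
  finally show ?thesis unfolding besov_finite[OF False] Q_def[symmetric] using Q by (simp add: epowr_mult epowr_epowr)
qed

text \<open>The same crude triangle inequality as for the norms, with the same two factors
  2.\<close>

lemma besov_add_le:
  assumes q: "1 \<le> q" and v: "v \<in> borel_measurable borel" and w: "w \<in> borel_measurable borel"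
  shows "besov_integral \<sigma> q (\<lambda>t. v t + w t) \<le> 4 * (besov_integral \<sigma> q v + besov_integral \<sigma> q w)"
proof (cases "q = \<infinity>")
  case True
  have "besov_integral \<sigma> q (\<lambda>t. v t + w t) \<le> besov_integral \<sigma> q v + besov_integral \<sigma> q w"
    unfolding True besov_infinite
    by (intro SUP_least) (auto simp: distrib_left intro!: add_mono SUP_upper)
  also have "\<dots> \<le> 4 * \<dots>" using mult_right_mono[of 1 4 "besov_integral \<sigma> q v + besov_integral \<sigma> q w"] by simp
  finally show ?thesis .
next
  case False
  define Q where "Q = enn2real q"
  have Q: "1 \<le> Q" using finite_exponent[OF q False] by (simp add: Q_def)
  let ?f = "\<lambda>w t. epowr (ennreal (t powr - \<sigma>) * w t) Q * ennreal (1 / t) * indicator {0<..} t"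
  have "bpow \<sigma> Q (\<lambda>t. v t + w t) \<le> (\<integral>\<^sup>+ t. epowr 2 Q * (?f v t + ?f w t) \<partial>lborel)"
    unfolding bpow_def
  proof (rule nn_integral_mono)
    fix t :: real
    have "epowr (ennreal (t powr - \<sigma>) * (v t + w t)) Q \<le> epowr 2 Q * (epowr (ennreal (t powr - \<sigma>) * v t) Q + epowr (ennreal (t powr - \<sigma>) * w t) Q)"
      using epowr_add_le[of Q "ennreal (t powr - \<sigma>) * v t" "ennreal (t powr - \<sigma>) * w t"] Q by (simp add: distrib_left)
    then have "epowr (ennreal (t powr - \<sigma>) * (v t + w t)) Q * (ennreal (1 / t) * indicator {0<..} t)
      \<le> epowr 2 Q * (epowr (ennreal (t powr - \<sigma>) * v t) Q + epowr (ennreal (t powr - \<sigma>) * w t) Q) * (ennreal (1 / t) * indicator {0<..} t)"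
      by (rule mult_right_mono) simp
    then show "?f (\<lambda>t. v t + w t) t \<le> epowr 2 Q * (?f v t + ?f w t)"
      by (simp add: distrib_left distrib_right mult.assoc)
  qed
  also have "\<dots> = epowr 2 Q * (bpow \<sigma> Q v + bpow \<sigma> Q w)"
    unfolding bpow_def using bpow_measurable[OF v] bpow_measurable[OF w]
    by (subst nn_integral_cmult) (simp_all add: nn_integral_add)
  finally have "epowr (bpow \<sigma> Q (\<lambda>t. v t + w t)) (1 / Q) \<le> epowr (epowr 2 Q * (bpow \<sigma> Q v + bpow \<sigma> Q w)) (1 / Q)"
    using Q by (intro epowr_mono) auto
  also have "\<dots> = 2 * epowr (bpow \<sigma> Q v + bpow \<sigma> Q w) (1 / Q)" using Q by (simp add: epowr_mult epowr_epowr)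
  also have "\<dots> \<le> 2 * (epowr 2 (1 / Q) * (epowr (bpow \<sigma> Q v) (1 / Q) + epowr (bpow \<sigma> Q w) (1 / Q)))"
    using Q by (intro mult_left_mono epowr_add_le) auto
  also have "\<dots> \<le> 2 * (2 * (epowr (bpow \<sigma> Q v) (1 / Q) + epowr (bpow \<sigma> Q w) (1 / Q)))"
  proof (intro mult_left_mono mult_right_mono)
    have "(2::real) powr (1 / Q) \<le> 2 powr 1" using Q by (intro powr_mono) auto
    then have "ennreal (2 powr (1 / Q)) \<le> ennreal 2" by (intro ennreal_leI) simp
    then show "epowr 2 (1 / Q) \<le> 2" using epowr_ennreal[of 2 "1 / Q"] by simp
  qed auto
  finally show ?thesis unfolding besov_finite[OF False] Q_def[symmetric] by (simp add: mult.assoc[symmetric])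
qed

lemma besov_sum_le:
  assumes q: "1 \<le> q" and "finite S" and "\<And>s. s \<in> S \<Longrightarrow> w s \<in> borel_measurable borel"
  shows "besov_integral \<sigma> q (\<lambda>t. \<Sum>s\<in>S. w s t) \<le> 4 ^ card S * (\<Sum>s\<in>S. besov_integral \<sigma> q (w s))"
  using assms(2,3)
proof (induction S rule: finite_induct)
  case empty
  then show ?case using besov_cmult_le[OF q, of "\<lambda>_. 0" \<sigma> 0] by simp
next
  case (insert s S)
  have "besov_integral \<sigma> q (\<lambda>t. \<Sum>s\<in>insert s S. w s t) = besov_integral \<sigma> q (\<lambda>t. w s t + (\<Sum>s\<in>S. w s t))"
    using insert by simp
  also have "\<dots> \<le> 4 * (besov_integral \<sigma> q (w s) + besov_integral \<sigma> q (\<lambda>t. \<Sum>s\<in>S. w s t))"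
    using insert.prems by (intro besov_add_le[OF q] borel_measurable_sum) auto
  also have "\<dots> \<le> 4 * (4 ^ card S * besov_integral \<sigma> q (w s) + 4 ^ card S * (\<Sum>s\<in>S. besov_integral \<sigma> q (w s)))"
  proof (intro mult_left_mono add_mono)
    show "besov_integral \<sigma> q (w s) \<le> 4 ^ card S * besov_integral \<sigma> q (w s)"
      using mult_right_mono[of 1 "4 ^ card S" "besov_integral \<sigma> q (w s)"] by (simp add: one_le_power)
  qed (use insert in auto)
  also have "\<dots> = 4 ^ card (insert s S) * (\<Sum>s\<in>insert s S. besov_integral \<sigma> q (w s))"
    using insert by (simp add: distrib_left mult.assoc)
  finally show ?case .
qed

text \<open>The measure \<open>dt / t\<close> is invariant under dilations, so only the weight
  contributes.\<close>

lemma bpow_scale: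
  assumes c: "0 < c" and Q: "0 < Q" and [measurable]: "w \<in> borel_measurable borel"
  shows "bpow \<sigma> Q (\<lambda>t. w (c * t)) = epowr (ennreal (c powr \<sigma>)) Q * bpow \<sigma> Q w"
proof -
  let ?f = "\<lambda>w t. epowr (ennreal (t powr - \<sigma>) * w t) Q * ennreal (1 / t) * indicator {0<..} t"
  have "bpow \<sigma> Q w = ennreal \<bar>c\<bar> * (\<integral>\<^sup>+ t. ?f w (0 + c * t) \<partial>lborel)"
    unfolding bpow_def by (rule nn_integral_real_affine) (use c in auto)
  also have "\<dots> = (\<integral>\<^sup>+ t. ennreal \<bar>c\<bar> * ?f w (0 + c * t) \<partial>lborel)"
    by (rule nn_integral_cmult[symmetric]) measurable
  finally have "epowr (ennreal (c powr \<sigma>)) Q * bpow \<sigma> Q w = epowr (ennreal (c powr \<sigma>)) Q * (\<integral>\<^sup>+ t. ennreal \<bar>c\<bar> * ?f w (0 + c * t) \<partial>lborel)"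
    by simp
  also have "\<dots> = (\<integral>\<^sup>+ t. epowr (ennreal (c powr \<sigma>)) Q * (ennreal \<bar>c\<bar> * ?f w (0 + c * t)) \<partial>lborel)"
    by (rule nn_integral_cmult[symmetric]) measurable
  also have "\<dots> = bpow \<sigma> Q (\<lambda>t. w (c * t))"
    unfolding bpow_def
  proof (rule nn_integral_cong)
    fix t :: real
    show "epowr (ennreal (c powr \<sigma>)) Q * (ennreal \<bar>c\<bar> * ?f w (0 + c * t)) = ?f (\<lambda>t. w (c * t)) t"
    proof (cases "0 < t")
      case True
      have 1: "ennreal \<bar>c\<bar> * ennreal (1 / (c * t)) = ennreal (1 / t)" using c True by (simp add: ennreal_mult[symmetric])
      have "c powr \<sigma> * (c * t) powr - \<sigma> = t powr - \<sigma>"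
        using c True by (simp add: powr_mult powr_minus field_simps)
      then have "ennreal (c powr \<sigma>) * (ennreal ((c * t) powr - \<sigma>) * w (c * t)) = ennreal (t powr - \<sigma>) * w (c * t)"
        by (simp add: mult.assoc[symmetric] ennreal_mult[symmetric])
      then have 2: "epowr (ennreal (c powr \<sigma>)) Q * epowr (ennreal ((c * t) powr - \<sigma>) * w (c * t)) Q = epowr (ennreal (t powr - \<sigma>) * w (c * t)) Q"
        unfolding epowr_mult[OF Q, symmetric] by simp
      have "epowr (ennreal (c powr \<sigma>)) Q * (ennreal \<bar>c\<bar> * ?f w (0 + c * t))
          = (epowr (ennreal (c powr \<sigma>)) Q * epowr (ennreal ((c * t) powr - \<sigma>) * w (c * t)) Q) * (ennreal \<bar>c\<bar> * ennreal (1 / (c * t)))"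
        using c True by (simp add: mult_ac)
      then show ?thesis unfolding 1 2 using True by simp
    next
      case False
      then show ?thesis using c by (simp add: indicator_def zero_less_mult_iff)
    qed
  qed
  finally show ?thesis by simp
qed

lemma besov_scale:
  assumes q: "1 \<le> q" and c: "0 < c" and w: "w \<in> borel_measurable borel"
  shows "besov_integral \<sigma> q (\<lambda>t. w (c * t)) \<le> ennreal (c powr \<sigma>) * besov_integral \<sigma> q w"
proof (cases "q = \<infinity>")
  case True
  show ?thesis unfolding True besov_infinite
  proof (rule SUP_least)
    fix t :: real assume "t \<in> {0<..}"
    then have t: "0 < t" by simp
    have "c powr \<sigma> * (c * t) powr - \<sigma> = t powr - \<sigma>"
      using c t by (simp add: powr_mult powr_minus field_simps)
    then have "ennreal (t powr - \<sigma>) * w (c * t) = ennreal (c powr \<sigma>) * (ennreal ((c * t) powr - \<sigma>) * w (c * t))"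
      by (simp add: mult.assoc[symmetric] ennreal_mult[symmetric])
    also have "\<dots> \<le> ennreal (c powr \<sigma>) * (SUP t\<in>{0<..}. ennreal (t powr - \<sigma>) * w t)"
      using c t by (intro mult_left_mono SUP_upper) auto
    finally show "ennreal (t powr - \<sigma>) * w (c * t) \<le> ennreal (c powr \<sigma>) * (SUP t\<in>{0<..}. ennreal (t powr - \<sigma>) * w t)" .
  qed
next
  case False
  show ?thesis unfolding besov_finite[OF False] using finite_exponent[OF q False] c w
    by (simp add: bpow_scale epowr_mult epowr_epowr)
qed

lemma ennreal_two_power: "ennreal (2 ^ n) = 2 ^ n"
  by (metis ennreal_numeral ennreal_power zero_le_numeral)

text \<open>Each term is at most \<open>(1 / 2) ^ Suc i\<close> times the supremum, and these
  weights sum to 1.\<close>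

lemma suminf_le_SUP_geometric:
  fixes a :: "nat \<Rightarrow> ennreal"
  shows "(\<Sum>i. a i) \<le> (SUP i. 2 ^ Suc i * a i)"
proof -
  let ?S = "SUP i. 2 ^ Suc i * a i"
  have "a i \<le> ennreal ((1 / 2) ^ Suc i) * ?S" for i
  proof -
    have "ennreal ((1 / 2) ^ Suc i) * 2 ^ Suc i = ennreal ((1 / 2) ^ Suc i) * ennreal (2 ^ Suc i)"
      by (simp only: ennreal_two_power)
    also have "\<dots> = 1" by (simp only: ennreal_mult[symmetric] zero_le_power zero_le_numeral zero_le_divide_1_iff power_mult_distrib[symmetric]) simp
    finally have "a i = ennreal ((1 / 2) ^ Suc i) * (2 ^ Suc i * a i)" by (simp only: mult.assoc[symmetric]) simp
    also have "\<dots> \<le> ennreal ((1 / 2) ^ Suc i) * ?S" by (intro mult_left_mono SUP_upper) auto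
    finally show ?thesis .
  qed
  then have "(\<Sum>i. a i) \<le> (\<Sum>i. ennreal ((1 / 2) ^ Suc i) * ?S)" by (intro suminf_le) auto
  also have "\<dots> = (\<Sum>i. ennreal ((1 / 2) ^ Suc i)) * ?S" by (rule ennreal_suminf_multc)
  also have "(\<Sum>i. ennreal ((1 / 2 :: real) ^ Suc i)) = 1"
    unfolding ennreal_1[symmetric] by (rule suminf_ennreal_eq[OF _ power_half_series]) simp
  finally show ?thesis by simp
qed

text \<open>A Hardy-type inequality; the geometric weights replace the countable Minkowski inequality.\<close>

lemma besov_geometric_sum:
  fixes w :: "real \<Rightarrow> ennreal"
  assumes q: "1 \<le> q" and \<eta>: "0 < \<eta>" and C0: "0 \<le> C0" and C1: "0 \<le> C1" and small: "4 * (C0 * \<eta> powr \<sigma>) \<le> 1"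
    and w: "w \<in> borel_measurable borel"
    and v: "\<And>t. 0 < t \<Longrightarrow> v t \<le> (\<Sum>i. ennreal (C0 ^ i * C1) * w (\<eta> ^ i * t))"
  shows "besov_integral \<sigma> q v \<le> ennreal (4 * C1) * besov_integral \<sigma> q w"
proof -
  \<comment> \<open>The geometric weights that turn the series into a supremum are merged into the
    coefficients.\<close>
  define k where "k i = 2 ^ Suc i * (C0 ^ i * C1)" for i
  have k0: "0 \<le> k i" for i using C0 C1 by (simp add: k_def)
  \<comment> \<open>Dilation by \<open>\<eta> ^ i\<close> contributes
    \<open>(\<eta> powr \<sigma>) ^ i\<close>, which by \<open>small\<close> outweighs both
    \<open>C0 ^ i\<close> and the weights and leaves \<open>(1 / 2) ^ i\<close>.\<close>
  have kS: "k i * (\<eta> ^ i) powr \<sigma> \<le> (1 / 2) ^ i * (2 * C1)" for i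
  proof -
    have "(\<eta> ^ i) powr \<sigma> = (\<eta> powr \<sigma>) ^ i" using \<eta> by (simp add: powr_power powr_powr mult.commute powr_realpow[symmetric])
    then have "k i * (\<eta> ^ i) powr \<sigma> = (2 * (C0 * \<eta> powr \<sigma>)) ^ i * (2 * C1)"
      by (simp add: k_def power_mult_distrib mult_ac)
    also have "\<dots> \<le> (1 / 2) ^ i * (2 * C1)" using small C0 C1 by (intro mult_right_mono power_mono) auto
    finally show ?thesis .
  qed
  have vS: "v t \<le> (SUP i. ennreal (k i) * w (\<eta> ^ i * t))" if "0 < t" for t
  proof -
    have e: "2 ^ Suc i * (ennreal (C0 ^ i * C1) * X) = ennreal (k i) * X" for i X
    proof -
      have "ennreal (k i) = ennreal (2 ^ Suc i) * ennreal (C0 ^ i * C1)" unfolding k_def using C0 C1 by (intro ennreal_mult) auto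
      also have "ennreal (2 ^ Suc i) = 2 ^ Suc i" by (rule ennreal_two_power)
      finally show ?thesis by (simp add: mult.assoc)
    qed
    show ?thesis using order_trans[OF v[OF that] suminf_le_SUP_geometric] unfolding e .
  qed
  have wi: "(\<lambda>t. w (\<eta> ^ i * t)) \<in> borel_measurable borel" for i using w by measurable
  have piece: "besov_integral \<sigma> q (\<lambda>t. ennreal (k i) * w (\<eta> ^ i * t)) \<le> ennreal ((1 / 2) ^ i * (2 * C1)) * besov_integral \<sigma> q w" for i
  proof -
    have "besov_integral \<sigma> q (\<lambda>t. ennreal (k i) * w (\<eta> ^ i * t)) \<le> ennreal (k i) * (ennreal ((\<eta> ^ i) powr \<sigma>) * besov_integral \<sigma> q w)"
      using besov_cmult_le[OF q wi, of \<sigma> "ennreal (k i)" i] besov_scale[OF q _ w, of "\<eta> ^ i" \<sigma>] \<eta>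
      by (meson mult_left_mono order_trans zero_le zero_less_power)
    also have "\<dots> = ennreal (k i * (\<eta> ^ i) powr \<sigma>) * besov_integral \<sigma> q w" using k0 by (simp add: ennreal_mult mult.assoc)
    also have "\<dots> \<le> ennreal ((1 / 2) ^ i * (2 * C1)) * besov_integral \<sigma> q w" by (intro mult_right_mono ennreal_leI kS) auto
    finally show ?thesis .
  qed
  show ?thesis
  proof (cases "q = \<infinity>")
    case True
    have "besov_integral \<sigma> q v \<le> ennreal (2 * C1) * besov_integral \<sigma> q w"
      unfolding True besov_infinite[of \<sigma> v]
    proof (rule SUP_least)
      fix t :: real assume "t \<in> {0<..}"
      then have t: "0 < t" by simp
      have "ennreal (t powr - \<sigma>) * v t \<le> ennreal (t powr - \<sigma>) * (SUP i. ennreal (k i) * w (\<eta> ^ i * t))"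
        by (intro mult_left_mono vS t) auto
      also have "\<dots> = (SUP i. ennreal (t powr - \<sigma>) * (ennreal (k i) * w (\<eta> ^ i * t)))"
        by (simp add: SUP_mult_left_ennreal)
      also have "\<dots> \<le> ennreal (2 * C1) * besov_integral \<sigma> \<infinity> w"
      proof (rule SUP_least)
        fix i
        have "ennreal (t powr - \<sigma>) * (ennreal (k i) * w (\<eta> ^ i * t)) \<le> besov_integral \<sigma> \<infinity> (\<lambda>t. ennreal (k i) * w (\<eta> ^ i * t))"
          unfolding besov_infinite using t by (intro SUP_upper2[of t]) auto
        also have "\<dots> \<le> ennreal ((1 / 2) ^ i * (2 * C1)) * besov_integral \<sigma> \<infinity> w" using piece[of i] True by simp
        also have "\<dots> \<le> ennreal (2 * C1) * besov_integral \<sigma> \<infinity> w"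
          using C1 by (intro mult_right_mono ennreal_leI mult_left_le_one_le) (auto simp: power_le_one)
        finally show "ennreal (t powr - \<sigma>) * (ennreal (k i) * w (\<eta> ^ i * t)) \<le> ennreal (2 * C1) * besov_integral \<sigma> \<infinity> w" .
      qed
      finally show "ennreal (t powr - \<sigma>) * v t \<le> ennreal (2 * C1) * besov_integral \<sigma> \<infinity> w" .
    qed
    also have "\<dots> \<le> ennreal (4 * C1) * besov_integral \<sigma> q w" using C1 by (intro mult_right_mono ennreal_leI) auto
    finally show ?thesis .
  next
    case False
    define Q where "Q = enn2real q"
    have Q: "1 \<le> Q" using finite_exponent[OF q False] by (simp add: Q_def)
    define J where "J = besov_integral \<sigma> q w"
    let ?f = "\<lambda>w t. epowr (ennreal (t powr - \<sigma>) * w t) Q * ennreal (1 / t) * indicator {0<..} t"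
    let ?w = "\<lambda>i t. ennreal (k i) * w (\<eta> ^ i * t)"
    have wm: "?w i \<in> borel_measurable borel" for i using w by measurable
    \<comment> \<open>Bounding the supremum of powers by their sum lets the integral act on each
      scale separately.\<close>
    have sup_le: "epowr (SUP i. x i) Q \<le> (\<Sum>i. epowr (x i) Q)" for x :: "nat \<Rightarrow> ennreal"
    proof -
      have "epowr (x i) Q \<le> (\<Sum>i. epowr (x i) Q)" for i
        using sum_le_suminf[of "\<lambda>i. epowr (x i) Q" "{i}"] by (simp add: summableI)
      moreover have e: "epowr z Q \<le> y \<longleftrightarrow> z \<le> epowr y (1 / Q)" for z y
        using epowr_le_iff_root[of "1 / Q" z y] Q by simp
      ultimately have "(SUP i. x i) \<le> epowr (\<Sum>i. epowr (x i) Q) (1 / Q)"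
        by (intro SUP_least) (blast intro: e[THEN iffD1])
      then show ?thesis by (rule e[THEN iffD2])
    qed
    have "bpow \<sigma> Q v \<le> (\<integral>\<^sup>+ t. (\<Sum>i. ?f (?w i) t) \<partial>lborel)"
      unfolding bpow_def
    proof (rule nn_integral_mono)
      fix t :: real
      show "?f v t \<le> (\<Sum>i. ?f (?w i) t)"
      proof (cases "0 < t")
        case True
        have "epowr (ennreal (t powr - \<sigma>) * v t) Q \<le> epowr (SUP i. ennreal (t powr - \<sigma>) * ?w i t) Q"
        proof (rule epowr_mono)
          show "ennreal (t powr - \<sigma>) * v t \<le> (SUP i. ennreal (t powr - \<sigma>) * ?w i t)"
            using mult_left_mono[OF vS[OF True], of "ennreal (t powr - \<sigma>)"] by (simp add: SUP_mult_left_ennreal)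
        qed (use Q in simp)
        also have "\<dots> \<le> (\<Sum>i. epowr (ennreal (t powr - \<sigma>) * ?w i t) Q)" by (rule sup_le)
        finally have "epowr (ennreal (t powr - \<sigma>) * v t) Q * ennreal (1 / t) \<le> (\<Sum>i. epowr (ennreal (t powr - \<sigma>) * ?w i t) Q) * ennreal (1 / t)"
          by (rule mult_right_mono) simp
        then show ?thesis using True by (simp add: ennreal_suminf_multc)
      qed simp
    qed
    also have "\<dots> = (\<Sum>i. bpow \<sigma> Q (?w i))"
      unfolding bpow_def by (rule nn_integral_suminf) (rule bpow_measurable[OF wm])
    also have "\<dots> \<le> (\<Sum>i. ennreal ((1 / 2) ^ i) * epowr (ennreal (2 * C1) * J) Q)"
    proof (rule suminf_le)
      fix i
      have "epowr (bpow \<sigma> Q (?w i)) (1 / Q) \<le> ennreal ((1 / 2) ^ i * (2 * C1)) * J"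
        using piece[of i] unfolding besov_finite[OF False, of \<sigma> "?w i"] Q_def[symmetric] J_def .
      then have "bpow \<sigma> Q (?w i) \<le> epowr (ennreal ((1 / 2) ^ i * (2 * C1)) * J) Q"
        using Q by (simp add: epowr_le_iff_root)
      also have "\<dots> = epowr (ennreal ((1 / 2) ^ i)) Q * epowr (ennreal (2 * C1) * J) Q"
        using Q C1 by (simp add: epowr_mult[symmetric] ennreal_mult mult.assoc)
      also have "epowr (ennreal ((1 / 2) ^ i)) Q \<le> ennreal ((1 / 2) ^ i)"
      proof -
        \<comment> \<open>Raising a weight in \<open>[0, 1]\<close> to a power
          \<open>Q \<ge> 1\<close> does not increase it, so the series still converges
          geometrically.\<close>
        have "((1 / 2 :: real) ^ i) powr Q \<le> ((1 / 2) ^ i) powr 1"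
          using Q by (intro powr_mono') (auto simp: power_le_one)
        then show ?thesis by (simp add: epowr_ennreal ennreal_leI)
      qed
      finally show "bpow \<sigma> Q (?w i) \<le> ennreal ((1 / 2) ^ i) * epowr (ennreal (2 * C1) * J) Q"
        by (simp add: mult_right_mono)
    qed auto
    also have "\<dots> = 2 * epowr (ennreal (2 * C1) * J) Q"
    proof -
      have "(\<Sum>i. ennreal ((1 / 2 :: real) ^ i)) = ennreal 2"
        by (rule suminf_ennreal_eq) (use geometric_sums[of "1 / 2 :: real"] in simp_all)
      then show ?thesis unfolding ennreal_suminf_multc by simp
    qed
    \<comment> \<open>The sum 2 of the geometric series is absorbed into the \<open>Q\<close>-th
      power; after the root it turns \<open>2 * C1\<close> into \<open>4 * C1\<close>.\<close>
    also have "\<dots> \<le> epowr 2 Q * epowr (ennreal (2 * C1) * J) Q"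
    proof (rule mult_right_mono)
      have "(2::real) powr 1 \<le> 2 powr Q" using Q by (intro powr_mono) auto
      then have "ennreal 2 \<le> ennreal (2 powr Q)" by (intro ennreal_leI) simp
      then show "2 \<le> epowr 2 Q" using epowr_ennreal[of 2 Q] by simp
    qed simp
    also have "\<dots> = epowr (2 * (ennreal (2 * C1) * J)) Q" using Q by (simp add: epowr_mult)
    finally have "epowr (bpow \<sigma> Q v) (1 / Q) \<le> 2 * (ennreal (2 * C1) * J)" using Q by (simp add: epowr_le_iff_root)
    also have "\<dots> = ennreal (4 * C1) * J" using C1 by (simp add: mult.assoc[symmetric] ennreal_mult''[symmetric] flip: ennreal_numeral)
    finally show ?thesis unfolding besov_finite[OF False, of \<sigma> v] Q_def[symmetric] J_def .
  qed
qed

section \<open>Comparison of semi-norms under linear maps\<close>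

lemma integrable_shift:
  fixes f :: "'a::euclidean_space \<Rightarrow> real"
  assumes f: "integrable lborel f" shows "integrable lborel (\<lambda>x. f (x + v))"
proof -
  have "integrable (distr lborel borel ((+) v)) f" using f by (simp add: lborel_distr_plus)
  then show ?thesis using borel_measurable_integrable[OF f] by (simp add: integrable_distr_eq add.commute)
qed

lemma integral_shift:
  fixes f :: "'a::euclidean_space \<Rightarrow> real"
  assumes [measurable]: "f \<in> borel_measurable borel" shows "(\<integral> x. f (x + v) \<partial>lborel) = (\<integral> x. f x \<partial>lborel)"
  by (subst (2) lborel_distr_plus[of v, symmetric]) (simp add: integral_distr add.commute)

lemma AE_shift:
  assumes P: "AE x in lborel. P (x :: 'a::euclidean_space)" shows "AE x in lborel. P (x + v)"
proof -
  from AE_E[OF P] obtain N where N': "{x \<in> space lborel. \<not> P x} \<subseteq> N" "emeasure lborel N = 0" "N \<in> sets lborel" .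
  then have [measurable]: "N \<in> sets borel" by simp
  have "(\<integral>\<^sup>+ x. indicator N (x - (- v)) \<partial>lborel) = 0"
    by (subst nn_integral_lborel_shift) (use N' in auto)
  then have "AE x in lborel. indicator N (x - (- v)) = (0::ennreal)" by (subst (asm) nn_integral_0_iff_AE) auto
  then show ?thesis by eventually_elim (use N'(1) in \<open>auto simp: indicator_def split: if_splits\<close>)
qed

lemma Lp_norm_shift_le:
  assumes p: "1 \<le> p" and [measurable]: "f \<in> borel_measurable borel"
  shows "Lp_norm p (\<lambda>x. f (x + v)) \<le> Lp_norm p f"
proof (cases "p = \<infinity>")
  case True
  show ?thesis unfolding True Lp_norm_infinite
    by (rule esssup_I) (use AE_shift[OF esssup_AE] in auto)
next
  case False
  show ?thesis unfolding Lp_norm_finite[OF False]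
    using nn_integral_lborel_shift[of "\<lambda>x. ennreal (\<bar>f x\<bar> powr enn2real p)" "- v"] by simp
qed

lemma fdiff_pow_borel:
  assumes "f \<in> borel_measurable borel" shows "(fdiff v ^^ k) f \<in> borel_measurable borel"
proof (induction k)
  case (Suc k)
  then show ?case by (simp add: fdiff_def[abs_def])
qed (use assms in simp)

lemma fdiff_pow_AE:
  assumes "AE x in lborel. f x = g x" shows "AE x in lborel. (fdiff v ^^ k) f x = (fdiff v ^^ k) g x"
proof (induction k)
  case (Suc k)
  show ?case using Suc AE_shift[OF Suc, of v] by eventually_elim (simp add: fdiff_def)
qed (use assms in simp)

lemma fdiff_pow_lincomb:
  "(fdiff v ^^ k) (\<lambda>x. \<Sum>s\<in>S. c s * f s x) = (\<lambda>x. \<Sum>s\<in>S. c s * (fdiff v ^^ k) (f s) x)"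
  using fdiffs_lincomb[of "replicate k v" c f S] by simp

lemma fdiff_pow_linear:
  "(fdiff v ^^ k) (\<lambda>x. f (B *v x)) = (\<lambda>x. (fdiff (B *v v) ^^ k) f (B *v x))"
  by (induction k) (auto simp: fdiff_def fun_eq_iff matrix_vector_right_distrib)

section \<open>Moduli of smoothness\<close>

lemma dir_modulus_mono: "\<delta> \<le> \<delta>' \<Longrightarrow> dir_modulus k p h f \<delta> \<le> dir_modulus k p h f \<delta>'"
  unfolding dir_modulus_def by (rule SUP_subset_mono) auto

lemma modulus_mono: "\<delta> \<le> \<delta>' \<Longrightarrow> modulus k p f \<delta> \<le> modulus k p f \<delta>'"
  unfolding modulus_def by (rule SUP_mono') (rule dir_modulus_mono)

lemma modulus_borel: "modulus k p f \<in> borel_measurable borel"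
  by (rule borel_measurable_mono_ennreal) (simp add: mono_def modulus_mono)

lemma dir_deriv_modulus_mono: "\<delta> \<le> \<delta>' \<Longrightarrow> dir_deriv_modulus r k p f \<delta> \<le> dir_deriv_modulus r k p f \<delta>'"
  unfolding dir_deriv_modulus_def by (rule SUP_mono') (rule dir_modulus_mono)

lemma dir_deriv_modulus_borel: "dir_deriv_modulus r k p f \<in> borel_measurable borel"
  by (rule borel_measurable_mono_ennreal) (simp add: mono_def dir_deriv_modulus_mono)

text \<open>Splits \<open>v\<close> into a unit direction and a length, with an arbitrary direction
  for \<open>v = 0\<close>. The nested suprema can thus be handled as one over vectors.\<close>

lemma Lp_norm_fdiff_le_modulus:
  assumes "norm v \<le> \<delta>" shows "Lp_norm p ((fdiff v ^^ k) f) \<le> modulus k p f \<delta>"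
proof -
  obtain h t where ht: "norm h = 1" "v = t *\<^sub>R h" "\<bar>t\<bar> \<le> \<delta>"
  proof (cases "v = 0")
    case True
    show ?thesis
      by (rule that[of "axis undefined 1" 0]) (use True assms in auto)
  next
    case False
    show ?thesis
      by (rule that[of "v /\<^sub>R norm v" "norm v"]) (use False assms in auto)
  qed
  have "Lp_norm p ((fdiff v ^^ k) f) \<le> dir_modulus k p h f \<delta>"
    unfolding dir_modulus_def ht(2) by (rule SUP_upper) (use ht in simp)
  also have "\<dots> \<le> modulus k p f \<delta>" unfolding modulus_def by (rule SUP_upper) (use ht in simp)
  finally show ?thesis .
qed

lemma modulus_le:
  assumes "\<And>v. norm v \<le> \<delta> \<Longrightarrow> Lp_norm p ((fdiff v ^^ k) f) \<le> X" shows "modulus k p f \<delta> \<le> X"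
  unfolding modulus_def dir_modulus_def by (intro SUP_least assms) auto

text \<open>Frees the modulus from the representative that \<open>weak_deriv\<close>
  selects.\<close>

lemma modulus_AE_le:
  assumes p: "1 \<le> p" and f: "f \<in> borel_measurable borel" and g: "g \<in> borel_measurable borel" and eq: "AE x in lborel. f x = g x"
  shows "modulus k p f \<delta> \<le> modulus k p g \<delta>"
proof (rule modulus_le)
  fix v :: "real ^ 'a" assume v: "norm v \<le> \<delta>"
  have "Lp_norm p ((fdiff v ^^ k) f) = Lp_norm p ((fdiff v ^^ k) g)"
    by (intro Lp_norm_cong_AE p fdiff_pow_borel f g fdiff_pow_AE eq)
  then show "Lp_norm p ((fdiff v ^^ k) f) \<le> modulus k p g \<delta>" using Lp_norm_fdiff_le_modulus[OF v] by simp
qed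

text \<open>Composition with \<open>B\<close> turns the step \<open>v\<close> into
  \<open>B *v v\<close>, of length at most \<open>L * norm v\<close>, so the modulus is read at the
  dilated scale \<open>L * \<delta>\<close>.\<close>

lemma modulus_linear_le:
  fixes B :: "real ^ 'n ^ 'n"
  assumes p: "1 \<le> p" and B: "invertible B" and S: "finite S" and L: "0 < L" "\<And>v. norm (B *v v) \<le> L * norm v"
    and f: "\<And>s. s \<in> S \<Longrightarrow> f s \<in> borel_measurable borel"
  shows "modulus k p (\<lambda>x. c * (\<Sum>s\<in>S. a s * f s (B *v x))) \<delta>
      \<le> ennreal (4 ^ card S * (max 1 (lin_scale B) * (\<Sum>s\<in>S. \<bar>c * a s\<bar>))) * (\<Sum>s\<in>S. modulus k p (f s) (L * \<delta>))"
proof (rule modulus_le)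
  fix v :: "real ^ 'n" assume v: "norm v \<le> \<delta>"
  let ?M = "max 1 (lin_scale B)" let ?A = "\<Sum>s\<in>S. \<bar>c * a s\<bar>"
  have A0: "0 \<le> ?A" by (intro sum_nonneg) auto
  have nB: "norm (B *v v) \<le> L * \<delta>" using L(2)[of v] v L(1) by (meson less_imp_le mult_left_mono order_trans)
  have m: "(\<lambda>x. (fdiff (B *v v) ^^ k) (f s) (B *v x)) \<in> borel_measurable borel" if "s \<in> S" for s
    using measurable_compose[OF linear_measurable_vec fdiff_pow_borel[OF f[OF that]]] .
  have "(\<lambda>x. c * (\<Sum>s\<in>S. a s * f s (B *v x))) = (\<lambda>x. \<Sum>s\<in>S. (c * a s) * f s (B *v x))"
    by (simp add: sum_distrib_left mult.assoc)
  then have "Lp_norm p ((fdiff v ^^ k) (\<lambda>x. c * (\<Sum>s\<in>S. a s * f s (B *v x))))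
      = Lp_norm p (\<lambda>x. \<Sum>s\<in>S. (c * a s) * (fdiff (B *v v) ^^ k) (f s) (B *v x))"
    by (simp only: fdiff_pow_lincomb fdiff_pow_linear)
  also have "\<dots> \<le> 4 ^ card S * (\<Sum>s\<in>S. Lp_norm p (\<lambda>x. (c * a s) * (fdiff (B *v v) ^^ k) (f s) (B *v x)))"
    by (rule Lp_norm_sum_le[OF p S]) (use m in simp)
  also have "\<dots> \<le> 4 ^ card S * (\<Sum>s\<in>S. ennreal (?M * ?A) * modulus k p (f s) (L * \<delta>))"
  proof (intro mult_left_mono sum_mono)
    fix s assume s: "s \<in> S"
    have "Lp_norm p (\<lambda>x. (c * a s) * (fdiff (B *v v) ^^ k) (f s) (B *v x)) \<le> ennreal \<bar>c * a s\<bar> * Lp_norm p (\<lambda>x. (fdiff (B *v v) ^^ k) (f s) (B *v x))"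
      by (rule Lp_norm_cmult_le[OF p m[OF s]])
    also have "\<dots> \<le> ennreal ?A * (ennreal ?M * modulus k p (f s) (L * \<delta>))"
    proof (intro mult_mono ennreal_leI)
      show "\<bar>c * a s\<bar> \<le> ?A" using S s by (intro member_le_sum) auto
      show "Lp_norm p (\<lambda>x. (fdiff (B *v v) ^^ k) (f s) (B *v x)) \<le> ennreal ?M * modulus k p (f s) (L * \<delta>)"
        using Lp_norm_linear_le[OF p B fdiff_pow_borel[OF f[OF s]]] mult_left_mono[OF Lp_norm_fdiff_le_modulus[OF nB], of "ennreal ?M"]
        by (rule order_trans) simp
    qed auto
    also have "\<dots> = ennreal (?M * ?A) * modulus k p (f s) (L * \<delta>)"
    proof -
      have "ennreal (?M * ?A) = ennreal ?A * ennreal ?M"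
        unfolding mult.commute[of ?M] by (rule ennreal_mult) (use A0 in auto)
      then show ?thesis by (simp only: mult.assoc)
    qed
    finally show "Lp_norm p (\<lambda>x. (c * a s) * (fdiff (B *v v) ^^ k) (f s) (B *v x)) \<le> ennreal (?M * ?A) * modulus k p (f s) (L * \<delta>)" .
  qed simp
  also have "\<dots> = ennreal (4 ^ card S * (?M * ?A)) * (\<Sum>s\<in>S. modulus k p (f s) (L * \<delta>))"
  proof -
    have "ennreal (4 ^ card S) = 4 ^ card S" by (metis ennreal_numeral ennreal_power zero_le_numeral)
    then have "ennreal (4 ^ card S * (?M * ?A)) = 4 ^ card S * ennreal (?M * ?A)" using A0 by (subst ennreal_mult) auto
    then show ?thesis by (simp add: sum_distrib_left mult.assoc)
  qed
  finally show "Lp_norm p ((fdiff v ^^ k) (\<lambda>x. c * (\<Sum>s\<in>S. a s * f s (B *v x))))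
      \<le> ennreal (4 ^ card S * (?M * ?A)) * (\<Sum>s\<in>S. modulus k p (f s) (L * \<delta>))" .
qed

lemma ennreal_four_power: "ennreal (4 ^ n) = 4 ^ n"
  by (metis ennreal_numeral ennreal_power zero_le_numeral)

lemma besov_lincomb_le:
  assumes q: "1 \<le> q" and S: "finite S" and w: "\<And>s. s \<in> S \<Longrightarrow> w s \<in> borel_measurable borel" and L: "0 < L"
    and K: "0 \<le> K" and le: "\<And>s. s \<in> S \<Longrightarrow> besov_integral \<sigma> q (w s) \<le> J"
  shows "besov_integral \<sigma> q (\<lambda>t. ennreal K * (\<Sum>s\<in>S. w s (L * t))) \<le> ennreal (K * (4 ^ card S * (real (card S) * L powr \<sigma>))) * J"
proof -
  have wL: "(\<lambda>t. w s (L * t)) \<in> borel_measurable borel" if "s \<in> S" for s using w[OF that] by measurable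
  have "besov_integral \<sigma> q (\<lambda>t. ennreal K * (\<Sum>s\<in>S. w s (L * t))) \<le> ennreal K * besov_integral \<sigma> q (\<lambda>t. \<Sum>s\<in>S. w s (L * t))"
    by (rule besov_cmult_le[OF q]) (use wL in simp)
  also have "\<dots> \<le> ennreal K * (4 ^ card S * (\<Sum>s\<in>S. besov_integral \<sigma> q (\<lambda>t. w s (L * t))))"
    by (intro mult_left_mono besov_sum_le[OF q S] wL) auto
  also have "\<dots> \<le> ennreal K * (4 ^ card S * (\<Sum>s\<in>S. ennreal (L powr \<sigma>) * J))"
  proof (intro mult_left_mono sum_mono)
    fix s assume s: "s \<in> S"
    show "besov_integral \<sigma> q (\<lambda>t. w s (L * t)) \<le> ennreal (L powr \<sigma>) * J"
      using besov_scale[OF q L w[OF s]] mult_left_mono[OF le[OF s], of "ennreal (L powr \<sigma>)"] by (rule order_trans) simp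
  qed auto
  also have "\<dots> = ennreal (K * (4 ^ card S * (real (card S) * L powr \<sigma>))) * J"
  proof -
    have "(\<Sum>s\<in>S. ennreal (L powr \<sigma>) * J) = ennreal (real (card S)) * (ennreal (L powr \<sigma>) * J)"
      by (simp add: ennreal_of_nat_eq_real_of_nat)
    moreover have "ennreal (K * (4 ^ card S * (real (card S) * L powr \<sigma>))) = ennreal K * (4 ^ card S * (ennreal (real (card S)) * ennreal (L powr \<sigma>)))"
      unfolding ennreal_four_power[symmetric] using K by (simp only: ennreal_mult[symmetric] zero_le_power zero_le_numeral of_nat_0_le_iff powr_ge_zero mult_nonneg_nonneg)
    ultimately show ?thesis by (simp only: mult.assoc)
  qed
  finally show ?thesis .
qed

lemma modulus_le_J1:
  assumes "n \<in> mis r" shows "besov_integral (s - real r) q (modulus k p (weak_deriv n f)) \<le> besov_J1 r k s p q f"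
  unfolding besov_J1_def mis_def[symmetric] by (rule member_le_sum[OF assms _ finite_mis]) simp

text \<open>By uniqueness the selected derivative of the composed function agrees almost everywhere
  with its chain rule expression. The moduli of that expression are bounded at scale
  \<open>L * t\<close>, and the scaling of the Besov integral undoes the dilation.\<close>

lemma J1_linear_le:
  fixes B :: "real ^ 'n ^ 'n"
  assumes p: "1 \<le> p" and q: "1 \<le> q" and B: "invertible B"
  shows "\<exists>C>0. \<forall>f. has_weak_derivs r f \<longrightarrow> besov_J1 r k s p q (\<lambda>x. c * f (B *v x)) \<le> ennreal C * besov_J1 r k s p q f"
proof -
  obtain L where L: "0 < L" "\<And>v. norm (B *v v) \<le> norm v * L"
    using bounded_linear.pos_bounded[OF matrix_vector_mul_bounded_linear[of B]] by blast
  define N where "N = card (lists_of_length r :: 'n list set)"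
  define K where "K n = 4 ^ N * (max 1 (lin_scale B) * (\<Sum>js\<in>lists_of_length r. \<bar>c * chain_coeff B (mi_list n) js\<bar>))" for n
  define D where "D n = K n * (4 ^ N * (real N * L powr (s - real r)))" for n
  have K0: "0 \<le> K n" for n unfolding K_def by (intro mult_nonneg_nonneg sum_nonneg) auto
  have D0: "0 \<le> D n" for n unfolding D_def using K0 by simp
  have "besov_J1 r k s p q (\<lambda>x. c * f (B *v x)) \<le> ennreal ((\<Sum>n\<in>mis r. D n) + 1) * besov_J1 r k s p q f" if f: "has_weak_derivs r f" for f
  proof -
    let ?J = "besov_J1 r k s p q f"
    have piece: "besov_integral (s - real r) q (modulus k p (weak_deriv n (\<lambda>x. c * f (B *v x)))) \<le> ennreal (D n) * ?J" if n: "n \<in> mis r" for n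
    proof -
      have nr: "mi_order n = r" using n by (simp add: mis_def)
      let ?g = "\<lambda>x. c * (\<Sum>js\<in>lists_of_length r. chain_coeff B (mi_list n) js * weak_deriv (count_list js) f (B *v x))"
      have g: "is_weak_deriv n (\<lambda>x. c * f (B *v x)) ?g"
        using is_weak_deriv_linear[OF B, of n f "\<lambda>m. weak_deriv m f" c] weak_deriv_exists[OF f] nr by auto
      have wd: "is_weak_deriv n (\<lambda>x. c * f (B *v x)) (weak_deriv n (\<lambda>x. c * f (B *v x)))"
        by (rule weak_deriv_exists[OF has_weak_derivs_linear[OF B f]]) (simp add: nr)
      have gb: "?g \<in> borel_measurable borel" and wb: "weak_deriv n (\<lambda>x. c * f (B *v x)) \<in> borel_measurable borel"
        using g wd by (auto simp: is_weak_deriv_def intro: locally_integrable_borel)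
      have mem: "count_list js \<in> mis r" if "js \<in> lists_of_length r" for js :: "'n list"
        using that by (simp add: mis_def lists_of_length_def mi_order_count_list)
      have fb: "weak_deriv (count_list js) f \<in> borel_measurable borel" if "js \<in> lists_of_length r" for js
        using weak_deriv_exists[OF f, of "count_list js"] mem[OF that] by (auto simp: is_weak_deriv_def mis_def intro: locally_integrable_borel)
      have "besov_integral (s - real r) q (modulus k p (weak_deriv n (\<lambda>x. c * f (B *v x))))
          \<le> besov_integral (s - real r) q (\<lambda>t. ennreal (K n) * (\<Sum>js\<in>lists_of_length r. modulus k p (weak_deriv (count_list js) f) (L * t)))"
      proof (rule besov_mono[OF q])
        fix t :: real
        have "modulus k p (weak_deriv n (\<lambda>x. c * f (B *v x))) t \<le> modulus k p ?g t"
          by (rule modulus_AE_le[OF p wb gb weak_deriv_unique[OF wd g]])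
        also have "\<dots> \<le> ennreal (K n) * (\<Sum>js\<in>lists_of_length r. modulus k p (weak_deriv (count_list js) f) (L * t))"
          unfolding K_def N_def by (rule modulus_linear_le[OF p B finite_lists_of_length L(1)]) (use L fb in \<open>auto simp: mult.commute\<close>)
        finally show "modulus k p (weak_deriv n (\<lambda>x. c * f (B *v x))) t \<le> ennreal (K n) * (\<Sum>js\<in>lists_of_length r. modulus k p (weak_deriv (count_list js) f) (L * t))" .
      qed
      also have "\<dots> \<le> ennreal (D n) * ?J"
        unfolding D_def N_def by (rule besov_lincomb_le[OF q finite_lists_of_length modulus_borel L(1) K0 modulus_le_J1[OF mem]])
      finally show ?thesis .
    qed
    have "besov_J1 r k s p q (\<lambda>x. c * f (B *v x)) \<le> (\<Sum>n\<in>mis r. ennreal (D n) * ?J)"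
      unfolding besov_J1_def[of _ _ _ _ _ "\<lambda>x. c * f (B *v x)"] mis_def[symmetric] by (intro sum_mono piece)
    also have "\<dots> = ennreal (\<Sum>n\<in>mis r. D n) * ?J" using D0 by (simp add: sum_distrib_right[symmetric] sum_ennreal)
    also have "\<dots> \<le> ennreal ((\<Sum>n\<in>mis r. D n) + 1) * ?J" by (intro mult_right_mono ennreal_leI) auto
    finally show ?thesis .
  qed
  \<comment> \<open>The added 1 makes the constant positive whatever the \<open>D n\<close>
    are.\<close>
  moreover have "0 < (\<Sum>n\<in>mis r. D n) + 1" using D0 by (simp add: add_nonneg_pos sum_nonneg)
  ultimately show ?thesis by blast
qed

text \<open>For a unit vector \<open>h\<close> every \<open>upow h n\<close> is at most 1 in
  absolute value, so the directional expression is a combination of the derivatives with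
  coefficients bounded uniformly in \<open>h\<close>.\<close>

lemma J2_le_J1:
  assumes p: "1 \<le> p" and q: "1 \<le> q"
  shows "\<exists>C>0. \<forall>f :: real ^ 'n \<Rightarrow> real. has_weak_derivs r f \<longrightarrow> besov_J2 r k s p q f \<le> ennreal C * besov_J1 r k s p q f"
proof -
  let ?M = "mis r :: ('n \<Rightarrow> nat) set"
  define K where "K = (4 :: real) ^ card ?M"
  define D where "D = K * (4 ^ card ?M * (real (card ?M) * 1 powr (s - real r)))"
  have "besov_J2 r k s p q f \<le> ennreal (D + 1) * besov_J1 r k s p q f" if f: "has_weak_derivs r f" for f :: "real ^ 'n \<Rightarrow> real"
  proof -
    have fb: "weak_deriv n f \<in> borel_measurable borel" if "n \<in> mis r" for n
      using weak_deriv_exists[OF f, of n] that by (auto simp: is_weak_deriv_def mis_def intro: locally_integrable_borel)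
    have "besov_J2 r k s p q f \<le> besov_integral (s - real r) q (\<lambda>t. ennreal K * (\<Sum>n\<in>mis r. modulus k p (weak_deriv n f) (1 * t)))"
      unfolding besov_J2_def
    proof (rule besov_mono[OF q])
      fix \<delta> :: real
      show "dir_deriv_modulus r k p f \<delta> \<le> ennreal K * (\<Sum>n\<in>mis r. modulus k p (weak_deriv n f) (1 * \<delta>))"
        unfolding dir_deriv_modulus_def dir_modulus_def
      proof (intro SUP_least)
        fix h :: "real ^ 'n" and t assume h: "h \<in> {h. norm h = 1}" and t: "t \<in> {t. \<bar>t\<bar> \<le> \<delta>}"
        have eq: "dir_weak_deriv r h f = (\<lambda>x. \<Sum>n\<in>mis r. upow h n * weak_deriv n f x)"
          by (simp add: dir_weak_deriv_def[abs_def] mis_def upow_def mult.commute)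
        have "Lp_norm p ((fdiff (t *\<^sub>R h) ^^ k) (dir_weak_deriv r h f)) = Lp_norm p (\<lambda>x. \<Sum>n\<in>mis r. upow h n * (fdiff (t *\<^sub>R h) ^^ k) (weak_deriv n f) x)"
          unfolding eq fdiff_pow_lincomb ..
        also have "\<dots> \<le> 4 ^ card ?M * (\<Sum>n\<in>mis r. Lp_norm p (\<lambda>x. upow h n * (fdiff (t *\<^sub>R h) ^^ k) (weak_deriv n f) x))"
          using fdiff_pow_borel[OF fb] by (intro Lp_norm_sum_le[OF p finite_mis] borel_measurable_times borel_measurable_const)
        also have "\<dots> \<le> 4 ^ card ?M * (\<Sum>n\<in>mis r. modulus k p (weak_deriv n f) (1 * \<delta>))"
        proof (intro mult_left_mono sum_mono)
          fix n :: "'n \<Rightarrow> nat" assume n: "n \<in> mis r"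
          have "Lp_norm p (\<lambda>x. upow h n * (fdiff (t *\<^sub>R h) ^^ k) (weak_deriv n f) x) \<le> ennreal \<bar>upow h n\<bar> * Lp_norm p ((fdiff (t *\<^sub>R h) ^^ k) (weak_deriv n f))"
            by (rule Lp_norm_cmult_le[OF p fdiff_pow_borel[OF fb[OF n]]])
          also have "\<dots> \<le> ennreal 1 * modulus k p (weak_deriv n f) (1 * \<delta>)"
          proof (intro mult_mono ennreal_leI)
            show "\<bar>upow h n\<bar> \<le> 1" using abs_upow_le[of h n] h by simp
            show "Lp_norm p ((fdiff (t *\<^sub>R h) ^^ k) (weak_deriv n f)) \<le> modulus k p (weak_deriv n f) (1 * \<delta>)"
              using h t by (intro Lp_norm_fdiff_le_modulus) simp
          qed auto
          finally show "Lp_norm p (\<lambda>x. upow h n * (fdiff (t *\<^sub>R h) ^^ k) (weak_deriv n f) x) \<le> modulus k p (weak_deriv n f) (1 * \<delta>)" by simp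
        qed simp
        finally show "Lp_norm p ((fdiff (t *\<^sub>R h) ^^ k) (dir_weak_deriv r h f)) \<le> ennreal K * (\<Sum>n\<in>mis r. modulus k p (weak_deriv n f) (1 * \<delta>))"
          unfolding K_def ennreal_four_power .
      qed
    qed
    also have "\<dots> \<le> ennreal D * besov_J1 r k s p q f"
      unfolding D_def by (rule besov_lincomb_le[OF q finite_mis modulus_borel _ _ modulus_le_J1]) (auto simp: K_def)
    also have "\<dots> \<le> ennreal (D + 1) * besov_J1 r k s p q f" by (intro mult_right_mono ennreal_leI) auto
    finally show ?thesis .
  qed
  moreover have "0 < D + 1" by (auto simp: D_def K_def intro!: add_nonneg_pos)
  ultimately show ?thesis by blast
qed

section \<open>Directional derivatives control all derivatives\<close>

lemma locally_integrable_shift: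
  fixes f :: "real ^ 'n \<Rightarrow> real"
  assumes f: "locally_integrable f" shows "locally_integrable (\<lambda>x. f (x + v))"
  unfolding locally_integrable_def set_integrable_def
proof (intro allI impI)
  fix K :: "(real ^ 'n) set" assume "compact K"
  then have "compact ((+) v ` K)" by (rule compact_translation)
  then have "integrable lborel (\<lambda>x. indicat_real ((+) v ` K) x * f x)"
    using f by (simp add: locally_integrable_def set_integrable_def)
  from integrable_shift[OF this, of v] have "integrable lborel (\<lambda>x. indicat_real ((+) v ` K) (x + v) * f (x + v))" .
  moreover have "indicat_real ((+) v ` K) (x + v) = indicat_real K x" for x
    by (auto simp: indicator_def image_iff add.commute)
  ultimately show "integrable lborel (\<lambda>x. indicat_real K x *\<^sub>R f (x + v))" by simp
qed

lemma locally_integrable_fdiff: "locally_integrable f \<Longrightarrow> locally_integrable (fdiff h f)"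
  unfolding fdiff_def[abs_def] by (intro locally_integrable_diff locally_integrable_shift)

lemma locally_integrable_fdiffs: "locally_integrable f \<Longrightarrow> locally_integrable (fdiffs hs f)"
  by (induction hs) (auto intro: locally_integrable_fdiff)

lemma dual_norm_finite:
  fixes \<psi> :: "real ^ 'n \<Rightarrow> real"
  assumes p: "1 \<le> p" and M: "\<And>x. \<bar>\<psi> x\<bar> \<le> M" and R: "\<And>x. norm x > R \<Longrightarrow> \<psi> x = 0"
  shows "dual_norm p \<psi> < \<infinity>"
proof (cases "p = 1")
  case True
  have "(SUP x. ennreal \<bar>\<psi> x\<bar>) \<le> ennreal M" by (intro SUP_least ennreal_leI M)
  then show ?thesis using True by (auto simp: dual_norm_def less_top top_unique intro: le_less_trans)
next
  case False
  define e where "e = dual_exponent p"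
  have e: "1 \<le> e" using dual_exponent_ge_1[OF p False] by (simp add: e_def)
  have "(\<integral>\<^sup>+ x. ennreal (\<bar>\<psi> x\<bar> powr e) \<partial>lborel) \<le> (\<integral>\<^sup>+ x. ennreal (M powr e) * indicator (cball (0 :: real ^ 'n) R) x \<partial>lborel)"
  proof (rule nn_integral_mono)
    fix x
    show "ennreal (\<bar>\<psi> x\<bar> powr e) \<le> ennreal (M powr e) * indicator (cball 0 R) x"
      using R[of x] M[of x] e by (cases "norm x \<le> R") (auto intro!: ennreal_leI powr_mono2)
  qed
  also have "\<dots> = ennreal (M powr e) * emeasure lborel (cball (0::real^'n) R)" by (simp add: nn_integral_cmult_indicator)
  also have "\<dots> < top" using emeasure_lborel_cball_finite[of "0::real^'n" R] by (simp add: ennreal_mult_less_top less_top)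
  finally have "(\<integral>\<^sup>+ x. ennreal (\<bar>\<psi> x\<bar> powr e) \<partial>lborel) < top" .
  then show ?thesis using False unfolding dual_norm_def e_def[symmetric] by (simp add: epowr_def less_top[symmetric])
qed

text \<open>The translation acts on \<open>G\<close>, so differences in \<open>y\<close> are
  correlations of the differences of \<open>G\<close> with the same \<open>\<psi>\<close>.\<close>

definition corr :: "(real ^ 'n \<Rightarrow> real) \<Rightarrow> (real ^ 'n \<Rightarrow> real) \<Rightarrow> real ^ 'n \<Rightarrow> real" where
  "corr \<psi> G y = (\<integral> x. G (x + y) * \<psi> x \<partial>lborel)"

definition cutoff :: "(real ^ 'n \<Rightarrow> real) \<Rightarrow> bool" where
  "cutoff \<psi> \<longleftrightarrow> \<psi> \<in> borel_measurable borel \<and> (\<exists>M. \<forall>x. \<bar>\<psi> x\<bar> \<le> M) \<and> (\<exists>R. \<forall>x. norm x > R \<longrightarrow> \<psi> x = 0)"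

lemma corr_integrable: "cutoff \<psi> \<Longrightarrow> locally_integrable G \<Longrightarrow> integrable lborel (\<lambda>x. G (x + y) * \<psi> x)"
  unfolding cutoff_def using locally_integrable_mult[OF locally_integrable_shift] by blast

lemma corr_fdiff: "cutoff \<psi> \<Longrightarrow> locally_integrable G \<Longrightarrow> corr \<psi> (fdiff h G) = fdiff h (corr \<psi> G)"
  unfolding corr_def fdiff_def left_diff_distrib
  by (rule ext, subst Bochner_Integration.integral_diff)
    (auto simp: corr_integrable add.assoc corr_integrable[of \<psi> G "_ + h", unfolded add.assoc[symmetric]])

lemma corr_fdiffs: "cutoff \<psi> \<Longrightarrow> locally_integrable G \<Longrightarrow> corr \<psi> (fdiffs hs G) = fdiffs hs (corr \<psi> G)"
  by (induction hs) (auto simp: corr_fdiff locally_integrable_fdiffs)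

lemma corr_lincomb:
  assumes "cutoff \<psi>" and "\<And>s. s \<in> S \<Longrightarrow> locally_integrable (G s)"
  shows "corr \<psi> (\<lambda>x. \<Sum>s\<in>S. c s * G s x) y = (\<Sum>s\<in>S. c s * corr \<psi> (G s) y)"
proof -
  have "corr \<psi> (\<lambda>x. \<Sum>s\<in>S. c s * G s x) y = (\<integral> x. (\<Sum>s\<in>S. c s * (G s (x + y) * \<psi> x)) \<partial>lborel)"
    by (simp add: corr_def sum_distrib_right mult.assoc)
  also have "\<dots> = (\<Sum>s\<in>S. c s * corr \<psi> (G s) y)"
    unfolding corr_def by (subst Bochner_Integration.integral_sum) (use corr_integrable[OF assms(1) assms(2)] in auto)
  finally show ?thesis .
qed

text \<open>Hoelder's inequality and translation invariance of the norm. The bound is uniform in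
  \<open>y\<close>, which is how norm bounds turn into bounds of suprema.\<close>

lemma corr_le:
  assumes p: "1 \<le> p" and \<psi>: "cutoff \<psi>" and G: "locally_integrable G"
  shows "ennreal \<bar>corr \<psi> G y\<bar> \<le> Lp_norm p G * dual_norm p \<psi>"
proof -
  note Gb [measurable] = locally_integrable_borel[OF G]
  have [measurable]: "\<psi> \<in> borel_measurable borel" using \<psi> by (simp add: cutoff_def)
  have "ennreal \<bar>corr \<psi> G y\<bar> \<le> ennreal (\<integral> x. \<bar>G (x + y) * \<psi> x\<bar> \<partial>lborel)"
    unfolding corr_def by (intro ennreal_leI integral_abs_bound)
  also have "\<dots> = (\<integral>\<^sup>+ x. ennreal \<bar>G (x + y) * \<psi> x\<bar> \<partial>lborel)"
    using corr_integrable[OF \<psi> G, of y] by (intro nn_integral_eq_integral[symmetric]) auto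
  also have "\<dots> = (\<integral>\<^sup>+ x. ennreal (\<bar>G (x + y)\<bar> * \<bar>\<psi> x\<bar>) \<partial>lborel)" by (simp add: abs_mult)
  also have "\<dots> \<le> Lp_norm p (\<lambda>x. G (x + y)) * dual_norm p \<psi>" by (rule Hoelder[OF p]) measurable
  also have "\<dots> \<le> Lp_norm p G * dual_norm p \<psi>" by (intro mult_right_mono Lp_norm_shift_le[OF p Gb]) auto
  finally show ?thesis .
qed

lemma frechet_derivative_shift: "frechet_derivative (\<lambda>x. f (x - y)) (at x) = frechet_derivative f (at (x - y))"
proof -
  have "((\<lambda>x. f (x - y)) has_derivative D) (at x) \<longleftrightarrow> (f has_derivative D) (at (x - y))" for D
  proof
    assume *: "((\<lambda>x. f (x - y)) has_derivative D) (at x)"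
    have "((\<lambda>z. z + y) has_derivative (\<lambda>h. h)) (at (x - y))" by (auto intro!: derivative_eq_intros)
    moreover have "((\<lambda>x. f (x - y)) has_derivative D) (at (x - y + y))" using * by simp
    ultimately show "(f has_derivative D) (at (x - y))" by (auto dest: has_derivative_compose)
  next
    assume *: "(f has_derivative D) (at (x - y))"
    have "((\<lambda>z. z - y) has_derivative (\<lambda>h. h)) (at x)" by (auto intro!: derivative_eq_intros)
    from has_derivative_compose[OF this *] show "((\<lambda>x. f (x - y)) has_derivative D) (at x)" .
  qed
  then show ?thesis unfolding frechet_derivative_def by simp
qed

lemma iter_partial_shift: "iter_partial is (\<lambda>x. \<phi> (x - y)) = (\<lambda>x. iter_partial is \<phi> (x - y))"
proof (induction "is")
  case (Cons i "is")
  then show ?case by (simp add: iter_partial_def partial_deriv_def[abs_def] frechet_derivative_shift)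
qed (simp add: iter_partial_def)

text \<open>Each derivative contributes one sign. The reflection enters because a correlation is a
  convolution with the reflected function.\<close>

lemma jet_reflect:
  assumes "jet \<Psi>" shows "jet (\<lambda>n z. (-1) ^ mi_order n * \<Psi> n (- z))"
  unfolding jet_def
proof (intro conjI allI)
  fix n :: "'a \<Rightarrow> nat" and i and y :: "real ^ 'a"
  have "((\<lambda>t. \<Psi> n (- y + t *\<^sub>R axis i 1)) has_real_derivative \<Psi> (inc i n) (- y + (- 0) *\<^sub>R axis i 1)) (at (- 0))"
    by (rule jet_deriv[OF assms])
  moreover have "(uminus has_real_derivative - 1) (at (0 :: real))" by (auto intro!: derivative_eq_intros)
  ultimately have "((\<lambda>t. \<Psi> n (- y + (- t) *\<^sub>R axis i 1)) has_real_derivative \<Psi> (inc i n) (- y + (- 0) *\<^sub>R axis i 1) * (-1)) (at 0)"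
    by (rule DERIV_chain2)
  from DERIV_cmult[OF this, of "(-1) ^ mi_order n"]
  show "((\<lambda>t. (-1) ^ mi_order n * \<Psi> n (- (y + t *\<^sub>R axis i 1))) has_real_derivative (-1) ^ mi_order (inc i n) * \<Psi> (inc i n) (- y)) (at 0)"
    by (simp add: mi_order_inc)
  obtain B where "\<And>z. \<bar>\<Psi> n z\<bar> \<le> B" using jet_bound[OF assms] by blast
  then show "bounded (range (\<lambda>z. (-1) ^ mi_order n * \<Psi> n (- z)))"
    unfolding bounded_iff by (auto simp: abs_mult)
qed

lemma cutoff_bump_combination:
  assumes "finite Z" shows "cutoff (bump_combination c k a b Z)"
  unfolding cutoff_def
proof (intro conjI)
  show "bump_combination c k a b Z \<in> borel_measurable borel" unfolding bump_combination_def by measurable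
  have "\<bar>bump_combination c k a b Z x\<bar> \<le> (\<Sum>z\<in>Z. \<bar>c z\<bar> * 1)" for x
    unfolding bump_combination_def using bump_range
    by (intro order_trans[OF sum_abs sum_mono]) (auto simp: abs_mult abs_of_nonneg[OF bump_range(1)] intro!: mult_left_le)
  then show "\<exists>M. \<forall>x. \<bar>bump_combination c k a b Z x\<bar> \<le> M" by blast
  have "bounded (\<Union>z\<in>Z. box (a z) (b z))" using assms by (intro bounded_UN) auto
  then obtain R where R: "\<And>x. x \<in> (\<Union>z\<in>Z. box (a z) (b z)) \<Longrightarrow> norm x \<le> R" unfolding bounded_iff by blast
  have "bump_combination c k a b Z x = 0" if "norm x > R" for x
    unfolding bump_combination_def
  proof (rule sum.neutral, intro ballI)
    fix z assume "z \<in> Z"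
    then have "x \<notin> box (a z) (b z)" using R[of x] that by auto
    then show "c z * bump k (a z) (b z) x = 0" by (simp add: bump_zero)
  qed
  then show "\<exists>R. \<forall>x. norm x > R \<longrightarrow> bump_combination c k a b Z x = 0" by blast
qed

text \<open>All derivatives are put on the bumps: \<open>F\<close> is the convolution of
  \<open>f\<close> with the reflected jet of the combination. It thus has bounded derivatives of
  every order, \<open>f\<close> being integrable, although generalized derivatives of
  \<open>f\<close> are assumed only up to order \<open>r\<close>. Up to that order the defining
  identity moves them back to \<open>f\<close>.\<close>

lemma corr_jet:
  fixes f :: "real ^ 'n \<Rightarrow> real"
  assumes f: "integrable lborel f" and wd: "has_weak_derivs r f" and Z: "finite Z"
  shows "\<exists>F. jet F \<and> (\<forall>n y. mi_order n \<le> r \<longrightarrow> F n y = corr (bump_combination c k a b Z) (weak_deriv n f) y)"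
proof -
  have "\<forall>z. \<exists>\<Psi>. jet \<Psi> \<and> (\<forall>is. iter_partial is (bump k (a z) (b z)) = \<Psi> (count_list is)) \<and> test_function (bump k (a z) (b z))"
    using bump_jet by metis
  from choice[OF this] obtain \<Psi> where \<Psi>: "\<And>z. jet (\<Psi> z)" "\<And>z is. iter_partial is (bump k (a z) (b z)) = \<Psi> z (count_list is)"
    by blast
  define \<Phi> where "\<Phi> n x = (\<Sum>z\<in>Z. c z * ((-1) ^ mi_order n * \<Psi> z n (- x)))" for n x
  have \<Phi>: "jet \<Phi>" unfolding \<Phi>_def[abs_def] by (intro jet_sum Z jet_cmult jet_reflect \<Psi>)
  define F where "F n y = (\<integral> x. f x * \<Phi> n (y + - x) \<partial>lborel)" for n y
  have "jet F" unfolding F_def[abs_def] by (rule jet_average[OF \<Phi> f]) measurable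
  moreover have "F n y = corr (bump_combination c k a b Z) (weak_deriv n f) y" if n: "mi_order n \<le> r" for n y
  proof -
    let ?G = "weak_deriv n f"
    have G: "is_weak_deriv n f ?G" by (rule weak_deriv_exists[OF wd n])
    have Gl: "locally_integrable ?G" using G by (simp add: is_weak_deriv_def)
    have fl: "locally_integrable f" using G by (simp add: is_weak_deriv_def)
    have sh: "(\<lambda>x. bump k (a z) (b z) (x - y)) = bump k (a z + y) (b z + y)" for z by (rule ext) (rule bump_shift)
    have t: "test_function (\<lambda>x. bump k (a z) (b z) (x - y))" for z unfolding sh by (rule bump_jet)
    have D: "\<Psi> z n (x - y) = iter_partial (mi_list n) (\<lambda>x. bump k (a z) (b z) (x - y)) x" for z x
      unfolding iter_partial_shift \<Psi>(2) by simp
    have w: "(\<integral> x. f x * \<Psi> z n (x - y) \<partial>lborel) = (-1) ^ mi_order n * (\<integral> x. ?G x * bump k (a z) (b z) (x - y) \<partial>lborel)" for z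
      unfolding D using G t[of z] unfolding is_weak_deriv_def by simp
    have i1: "integrable lborel (\<lambda>x. f x * \<Psi> z n (x - y))" for z unfolding D by (rule integrable_test[OF fl t])
    have i2: "integrable lborel (\<lambda>x. ?G x * bump k (a z) (b z) (x - y))" for z
      using integrable_test[OF Gl t, of "[]"] by (simp add: iter_partial_def)
    have "F n y = (\<integral> x. (\<Sum>z\<in>Z. c z * ((-1) ^ mi_order n * (f x * \<Psi> z n (x - y)))) \<partial>lborel)"
      unfolding F_def \<Phi>_def by (simp add: sum_distrib_left mult_ac)
    also have "\<dots> = (\<Sum>z\<in>Z. c z * ((-1) ^ mi_order n * (\<integral> x. f x * \<Psi> z n (x - y) \<partial>lborel)))"
      by (subst Bochner_Integration.integral_sum) (use i1 in auto)
    also have "\<dots> = (\<Sum>z\<in>Z. c z * (\<integral> x. ?G x * bump k (a z) (b z) (x - y) \<partial>lborel))"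
      unfolding w by (simp add: mult.assoc[symmetric] power_mult_distrib[symmetric])
    also have "\<dots> = (\<integral> x. (\<Sum>z\<in>Z. c z * (?G x * bump k (a z) (b z) (x - y))) \<partial>lborel)"
      by (subst Bochner_Integration.integral_sum) (use i2 in auto)
    also have "\<dots> = (\<integral> x. ?G x * bump_combination c k a b Z (x - y) \<partial>lborel)"
      by (simp add: bump_combination_def sum_distrib_left mult_ac)
    also have "\<dots> = (\<integral> x. ?G (x + y) * bump_combination c k a b Z (x + y - y) \<partial>lborel)"
    proof (rule integral_shift[symmetric])
      note [measurable] = locally_integrable_borel[OF Gl]
      have [measurable]: "bump_combination c k a b Z \<in> borel_measurable borel" unfolding bump_combination_def by measurable
      show "(\<lambda>x. ?G x * bump_combination c k a b Z (x - y)) \<in> borel_measurable borel" by measurable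
    qed
    finally show ?thesis by (simp add: corr_def)
  qed
  ultimately show ?thesis by blast
qed

text \<open>The sum is homogeneous of degree \<open>r\<close> in \<open>u\<close>, which gives the
  factor \<open>norm u ^ r\<close> and reduces to unit directions. For \<open>u = 0\<close> the
  difference vanishes because \<open>1 \<le> k\<close>.\<close>

lemma Lp_norm_directional_difference:
  fixes f :: "real ^ 'n \<Rightarrow> real"
  assumes p: "1 \<le> p" and k: "1 \<le> k" and wd: "has_weak_derivs r f" and u: "norm u \<le> t"
  shows "Lp_norm p ((fdiff u ^^ k) (\<lambda>x. \<Sum>n\<in>mis r. upow u n * weak_deriv n f x)) \<le> ennreal (norm u ^ r) * dir_deriv_modulus r k p f t"
proof -
  have wb: "weak_deriv n f \<in> borel_measurable borel" if "n \<in> mis r" for n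
    using weak_deriv_exists[OF wd, of n] that by (auto simp: is_weak_deriv_def mis_def intro: locally_integrable_borel)
  show ?thesis
  proof (cases "u = 0")
    case True
    obtain k' where "k = Suc k'" using k by (cases k) auto
    then have "(fdiff u ^^ k) (\<lambda>x. \<Sum>n\<in>mis r. upow u n * weak_deriv n f x) = (\<lambda>_. 0)"
      using True by (auto simp: fdiff_def fun_eq_iff)
    then show ?thesis by (simp add: Lp_norm_zero[OF p])
  next
    case False
    define h where "h = u /\<^sub>R norm u"
    have h: "norm h = 1" "u = norm u *\<^sub>R h" using False by (auto simp: h_def)
    have dw: "dir_weak_deriv r h f = (\<lambda>x. \<Sum>n\<in>mis r. upow h n * weak_deriv n f x)"
      by (simp add: dir_weak_deriv_def[abs_def] mis_def upow_def mult.commute)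
    have dwb: "dir_weak_deriv r h f \<in> borel_measurable borel"
      unfolding dw using wb by (intro borel_measurable_sum borel_measurable_times borel_measurable_const)
    have "upow u n = norm u ^ r * upow h n" if "n \<in> mis r" for n
      using upow_scale[of "norm u" h n] that h by (simp add: mis_def)
    then have "(\<lambda>x. \<Sum>n\<in>mis r. upow u n * weak_deriv n f x) = (\<lambda>x. norm u ^ r * dir_weak_deriv r h f x)"
      unfolding dw by (simp add: sum_distrib_left mult.assoc)
    then have "Lp_norm p ((fdiff u ^^ k) (\<lambda>x. \<Sum>n\<in>mis r. upow u n * weak_deriv n f x)) = Lp_norm p (\<lambda>x. norm u ^ r * (fdiff u ^^ k) (dir_weak_deriv r h f) x)"
      using fdiff_pow_lincomb[of k u "\<lambda>_. norm u ^ r" "\<lambda>_. dir_weak_deriv r h f" "{()}"] by simp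
    also have "\<dots> \<le> ennreal \<bar>norm u ^ r\<bar> * Lp_norm p ((fdiff u ^^ k) (dir_weak_deriv r h f))"
      by (rule Lp_norm_cmult_le[OF p fdiff_pow_borel[OF dwb]])
    also have "\<dots> \<le> ennreal (norm u ^ r) * dir_deriv_modulus r k p f t"
    proof -
      have "Lp_norm p ((fdiff (norm u *\<^sub>R h) ^^ k) (dir_weak_deriv r h f)) \<le> dir_modulus k p h (dir_weak_deriv r h f) t"
        unfolding dir_modulus_def by (rule SUP_upper) (use u in simp)
      also have "\<dots> \<le> dir_deriv_modulus r k p f t" unfolding dir_deriv_modulus_def by (rule SUP_upper) (use h in simp)
      finally show ?thesis using h(2) by (simp add: mult_left_mono)
    qed
    finally show ?thesis .
  qed
qed

text \<open>For a fixed step \<open>v\<close> and a fixed bump combination the recursion is iterated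
  on the correlation jet, with the directional modulus times the dual norm \<open>D\<close> as
  \<open>\<omega>\<close>. As the number of scales grows, the remainder that depends on the jet
  disappears. What is left is proportional to \<open>D\<close>, so duality converts it into a norm
  bound.\<close>

lemma modulus_le_series:
  assumes p: "1 \<le> p" and k: "1 \<le> k"
  shows "\<exists>C0\<ge>0. \<forall>\<eta>. 0 < \<eta> \<and> \<eta> \<le> 1 \<and> C0 * \<eta> ^ k < 1 \<longrightarrow> (\<exists>C1\<ge>0. \<forall>(f :: real ^ 'n \<Rightarrow> real) n t0.
      integrable lborel f \<and> has_weak_derivs r f \<and> mi_order n = r \<and> 0 < t0 \<longrightarrow>
      modulus k p (weak_deriv n f) t0 \<le> (\<Sum>i. ennreal (C0 ^ i * C1) * dir_deriv_modulus r k p f (\<eta> ^ i * t0)))"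
proof -
  from modulus_recursion[of r k, where ?'n = 'n] obtain C0 where C00: "0 \<le> C0 \<and> (\<forall>\<eta>. 0 < \<eta> \<and> \<eta> \<le> 1 \<longrightarrow> (\<exists>C1\<ge>0. \<forall>(F :: ('n \<Rightarrow> nat) \<Rightarrow> real ^ 'n \<Rightarrow> real) t U \<omega>.
      jet F \<and> 0 < t \<and> 0 \<le> U \<and> 0 \<le> \<omega> \<and>
      (\<forall>n hs y. mi_order n = r \<and> length hs = k \<and> (\<forall>h\<in>set hs. norm h \<le> \<eta> * t) \<longrightarrow> \<bar>fdiffs hs (F n) y\<bar> \<le> U) \<and>
      (\<forall>u y. norm u \<le> t \<longrightarrow> \<bar>\<Sum>n\<in>mis r. upow u n * fdiffs (replicate k u) (F n) y\<bar> \<le> norm u ^ r * \<omega>) \<longrightarrow>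
      (\<forall>n hs y. mi_order n = r \<and> length hs = k \<and> (\<forall>h\<in>set hs. norm h \<le> t) \<longrightarrow> \<bar>fdiffs hs (F n) y\<bar> \<le> C1 * \<omega> + C0 * U)))" ..
  note C0 = C00[THEN conjunct1] and rec0 = C00[THEN conjunct2]
  have "\<exists>C1\<ge>0. \<forall>(f :: real ^ 'n \<Rightarrow> real) n t0.
      integrable lborel f \<and> has_weak_derivs r f \<and> mi_order n = r \<and> 0 < t0 \<longrightarrow>
      modulus k p (weak_deriv n f) t0 \<le> (\<Sum>i. ennreal (C0 ^ i * C1) * dir_deriv_modulus r k p f (\<eta> ^ i * t0))"
    if \<eta>: "0 < \<eta>" "\<eta> \<le> 1" "C0 * \<eta> ^ k < 1" for \<eta>
  proof -
    from rec0[THEN spec, THEN mp, OF conjI, OF \<eta>(1,2)] obtain C where CC: "0 \<le> C \<and> (\<forall>(F :: ('n \<Rightarrow> nat) \<Rightarrow> real ^ 'n \<Rightarrow> real) t U \<omega>.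
      jet F \<and> 0 < t \<and> 0 \<le> U \<and> 0 \<le> \<omega> \<and>
      (\<forall>n hs y. mi_order n = r \<and> length hs = k \<and> (\<forall>h\<in>set hs. norm h \<le> \<eta> * t) \<longrightarrow> \<bar>fdiffs hs (F n) y\<bar> \<le> U) \<and>
      (\<forall>u y. norm u \<le> t \<longrightarrow> \<bar>\<Sum>n\<in>mis r. upow u n * fdiffs (replicate k u) (F n) y\<bar> \<le> norm u ^ r * \<omega>) \<longrightarrow>
      (\<forall>n hs y. mi_order n = r \<and> length hs = k \<and> (\<forall>h\<in>set hs. norm h \<le> t) \<longrightarrow> \<bar>fdiffs hs (F n) y\<bar> \<le> C * \<omega> + C0 * U))" ..
    note Cpos = CC[THEN conjunct1] and rec1 = CC[THEN conjunct2]
    \<comment> \<open>Strict positivity makes the series infinite as soon as the modulus at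
      \<open>t0\<close> is. In the remaining case all moduli up to \<open>t0\<close> are finite by
      monotonicity.\<close>
    define C1 where "C1 = C + 1"
    have C1: "0 < C1" "C \<le> C1" using Cpos by (auto simp: C1_def)
    have "modulus k p (weak_deriv n f) t0 \<le> (\<Sum>i. ennreal (C0 ^ i * C1) * dir_deriv_modulus r k p f (\<eta> ^ i * t0))"
      if f: "integrable lborel f" and wd: "has_weak_derivs r f" and n: "mi_order n = r" and t0: "0 < t0" for f :: "real ^ 'n \<Rightarrow> real" and n t0
    proof -
      define W where "W = dir_deriv_modulus r k p f"
      let ?S = "\<Sum>i. ennreal (C0 ^ i * C1) * W (\<eta> ^ i * t0)"
      have term_le: "ennreal (C0 ^ i * C1) * W (\<eta> ^ i * t0) \<le> ?S" for i
        using sum_le_suminf[of "\<lambda>i. ennreal (C0 ^ i * C1) * W (\<eta> ^ i * t0)" "{i}"] by (simp add: summableI)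
      show ?thesis
      proof (cases "?S = \<infinity>")
        case True
        then show ?thesis by (simp add: W_def)
      next
        case fin: False
        have Wt0: "W t0 \<noteq> \<infinity>"
        proof
          assume "W t0 = \<infinity>"
          then have "ennreal (C0 ^ 0 * C1) * W (\<eta> ^ 0 * t0) = \<infinity>" using C1 by (simp add: ennreal_mult_top)
          then show False using term_le[of 0] fin by (simp add: top_unique)
        qed
        define w where "w t = enn2real (W t)" for t
        have Wfin: "W t = ennreal (w t)" if "t \<le> t0" for t
        proof -
          have "W t \<le> W t0" unfolding W_def by (rule dir_deriv_modulus_mono[OF that])
          also have "\<dots> < top" using Wt0 by (simp add: top.not_eq_extremum[symmetric])
          finally have "W t < top" .
          then show ?thesis by (simp add: w_def)
        qed
        have w0: "0 \<le> w t" for t by (simp add: w_def)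
        have sc: "\<eta> ^ i * t0 \<le> t0" for i using \<eta> t0 power_le_one[of \<eta> i] by (simp add: mult_left_le_one_le)
        define B where "B = enn2real ?S"
        have B: "?S = ennreal B" "0 \<le> B" using fin by (auto simp: B_def less_top)
        have Bsum: "(\<Sum>i<m. C0 ^ i * C1 * w (\<eta> ^ i * t0)) \<le> B" for m
        proof -
          have "ennreal (\<Sum>i<m. C0 ^ i * C1 * w (\<eta> ^ i * t0)) = (\<Sum>i<m. ennreal (C0 ^ i * C1) * W (\<eta> ^ i * t0))"
            using C0 C1 w0 by (subst sum_ennreal[symmetric]) (auto simp: Wfin[OF sc] ennreal_mult intro!: sum.cong)
          also have "\<dots> \<le> ?S" by (intro sum_le_suminf) (auto simp: summableI)
          finally show ?thesis unfolding B(1) using B(2) by simp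
        qed
        have "modulus k p (weak_deriv n f) t0 \<le> ennreal B"
        proof (rule modulus_le)
          fix v :: "real ^ 'n" assume v: "norm v \<le> t0"
          have Gl: "locally_integrable (weak_deriv m f)" if "mi_order m = r" for m
            using weak_deriv_exists[OF wd, of m] that by (simp add: is_weak_deriv_def)
          have Fl: "locally_integrable ((fdiff v ^^ k) (weak_deriv n f))"
            using locally_integrable_fdiffs[OF Gl[OF n], of "replicate k v"] by simp
          show "Lp_norm p ((fdiff v ^^ k) (weak_deriv n f)) \<le> ennreal B"
          proof (rule Lp_norm_tested[OF p Fl B(2)])
            fix c kk and a b :: "('n \<Rightarrow> int) \<Rightarrow> real ^ 'n" and Z :: "('n \<Rightarrow> int) set" assume Z: "finite Z"
            define \<psi> where "\<psi> = bump_combination c kk a b Z"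
            have \<psi>: "cutoff \<psi>" unfolding \<psi>_def by (rule cutoff_bump_combination[OF Z])
            obtain F where F: "jet F" "\<And>m y. mi_order m \<le> r \<Longrightarrow> F m y = corr \<psi> (weak_deriv m f) y"
              using corr_jet[OF f wd Z, of c kk a b] unfolding \<psi>_def by blast
            have Feq: "F m = corr \<psi> (weak_deriv m f)" if "mi_order m = r" for m using F(2)[of m] that by auto
            define D where "D = enn2real (dual_norm p \<psi>)"
            have "dual_norm p \<psi> < \<infinity>" using \<psi> dual_norm_finite[OF p, of \<psi>] unfolding cutoff_def by blast
            then have D: "dual_norm p \<psi> = ennreal D" "0 \<le> D" by (auto simp: D_def less_top)
            have bound: "\<bar>\<Sum>n\<in>mis r. upow u n * fdiffs (replicate k u) (F n) y\<bar> \<le> norm u ^ r * (w t * D)"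
              if t: "0 < t" "t \<le> t0" and u: "norm u \<le> t" for u y t
            proof -
              let ?G = "\<lambda>x. \<Sum>n\<in>mis r. upow u n * weak_deriv n f x"
              have Glm: "locally_integrable (weak_deriv m f)" if "m \<in> mis r" for m using Gl that by (simp add: mis_def)
              have "(\<Sum>n\<in>mis r. upow u n * fdiffs (replicate k u) (F n) y) = (\<Sum>n\<in>mis r. upow u n * corr \<psi> (fdiffs (replicate k u) (weak_deriv n f)) y)"
                by (intro sum.cong refl) (simp add: Feq mis_def corr_fdiffs[OF \<psi> Gl] del: foldr_replicate)
              also have "\<dots> = corr \<psi> (\<lambda>x. \<Sum>n\<in>mis r. upow u n * fdiffs (replicate k u) (weak_deriv n f) x) y"
                by (rule corr_lincomb[OF \<psi> locally_integrable_fdiffs[OF Glm], symmetric])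
              also have "(\<lambda>x. \<Sum>n\<in>mis r. upow u n * fdiffs (replicate k u) (weak_deriv n f) x) = (fdiff u ^^ k) ?G"
                by (simp add: fdiff_pow_lincomb)
              finally have eq: "(\<Sum>n\<in>mis r. upow u n * fdiffs (replicate k u) (F n) y) = corr \<psi> ((fdiff u ^^ k) ?G) y" .
              have l: "locally_integrable ((fdiff u ^^ k) ?G)"
              proof -
                have "locally_integrable ?G" by (rule locally_integrable_lincomb) (rule Glm)
                from locally_integrable_fdiffs[OF this, of "replicate k u"] show ?thesis by simp
              qed
              have "ennreal \<bar>corr \<psi> ((fdiff u ^^ k) ?G) y\<bar> \<le> Lp_norm p ((fdiff u ^^ k) ?G) * dual_norm p \<psi>"
                by (rule corr_le[OF p \<psi> l])
              also have "\<dots> \<le> (ennreal (norm u ^ r) * W t) * ennreal D"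
                unfolding D(1) W_def by (intro mult_right_mono Lp_norm_directional_difference[OF p k wd u]) simp
              also have "\<dots> = ennreal (norm u ^ r * (w t * D))"
                unfolding Wfin[OF t(2)] using w0 D(2) by (simp add: ennreal_mult mult.assoc)
              finally show ?thesis unfolding eq using w0 D(2) by (simp add: ennreal_le_iff)
            qed
            have step: "\<forall>n hs y. mi_order n = r \<and> length hs = k \<and> (\<forall>h\<in>set hs. norm h \<le> t) \<longrightarrow> \<bar>fdiffs hs (F n) y\<bar> \<le> C * \<omega> + C0 * U"
              if "0 < t" "0 \<le> U" "0 \<le> \<omega>"
                "\<forall>n hs y. mi_order n = r \<and> length hs = k \<and> (\<forall>h\<in>set hs. norm h \<le> \<eta> * t) \<longrightarrow> \<bar>fdiffs hs (F n) y\<bar> \<le> U"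
                "\<forall>u y. norm u \<le> t \<longrightarrow> \<bar>\<Sum>n\<in>mis r. upow u n * fdiffs (replicate k u) (F n) y\<bar> \<le> norm u ^ r * \<omega>" for t U \<omega>
              by (rule rec1[THEN spec, THEN spec, THEN spec, THEN spec, THEN mp]) (intro conjI F that)
            have "\<exists>K\<ge>0. \<forall>m. \<bar>fdiffs (replicate k v) (F n) 0\<bar> \<le> (\<Sum>i<m. C0 ^ i * C * (w (\<eta> ^ i * t0) * D)) + K * (C0 * \<eta> ^ k) ^ m"
            proof (rule modulus_iterate[where w = "\<lambda>t. w t * D" and r = r and k = k, OF F(1) \<eta>(1,2) Cpos C0 \<eta>(3) step _ bound n])
              show "0 \<le> w t * D" for t using w0 D(2) by simp
              show "norm h \<le> t0" if "h \<in> set (replicate k v)" for h using that v by auto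
            qed (use t0 in simp_all)
            then obtain K where K: "\<And>m. \<bar>fdiffs (replicate k v) (F n) 0\<bar> \<le> (\<Sum>i<m. C0 ^ i * C * (w (\<eta> ^ i * t0) * D)) + K * (C0 * \<eta> ^ k) ^ m"
              by blast
            have le: "\<bar>fdiffs (replicate k v) (F n) 0\<bar> \<le> B * D + K * (C0 * \<eta> ^ k) ^ m" for m
            proof -
              have "(\<Sum>i<m. C0 ^ i * C * (w (\<eta> ^ i * t0) * D)) \<le> (\<Sum>i<m. C0 ^ i * C1 * w (\<eta> ^ i * t0)) * D"
                unfolding sum_distrib_right using C0 C1 w0 D(2)
                by (intro sum_mono) (simp add: mult.assoc[symmetric] mult_right_mono mult_left_mono)
              also have "\<dots> \<le> B * D" by (intro mult_right_mono Bsum D)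
              finally show ?thesis using K[of m] by linarith
            qed
            have "(\<lambda>m. B * D + K * (C0 * \<eta> ^ k) ^ m) \<longlonglongrightarrow> B * D + K * 0"
              using \<eta> C0 by (intro tendsto_intros LIMSEQ_realpow_zero) auto
            from LIMSEQ_le_const[OF this] le have fin_le: "\<bar>fdiffs (replicate k v) (F n) 0\<bar> \<le> B * D" by auto
            have "(\<integral> x. (fdiff v ^^ k) (weak_deriv n f) x * \<psi> x \<partial>lborel) = corr \<psi> (fdiffs (replicate k v) (weak_deriv n f)) 0"
              by (simp add: corr_def)
            also have "\<dots> = fdiffs (replicate k v) (F n) 0" by (simp only: corr_fdiffs[OF \<psi> Gl[OF n]] Feq[OF n])
            finally show "tested p B ((fdiff v ^^ k) (weak_deriv n f)) (bump_combination c kk a b Z)"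
              unfolding tested_def \<psi>_def[symmetric] D(1) using fin_le B(2) D(2) by (simp add: ennreal_mult[symmetric] ennreal_leI)
          qed
        qed
        then show ?thesis unfolding B(1)[symmetric] W_def .
      qed
    qed
    then show ?thesis using C1(1) by (intro exI[of _ C1]) auto
  qed
  then show ?thesis using C0 by (intro exI[of _ C0]) auto
qed

text \<open>The scale ratio \<open>\<eta>\<close> is chosen so small that the contraction constant \<open>C0\<close>, which does not depend
  on \<open>\<eta>\<close>, is absorbed by the smoothness exponent.\<close>

lemma J1_le_J2:
  assumes p: "1 \<le> p" and q: "1 \<le> q" and adm: "admissible s r k"
  shows "\<exists>C>0. \<forall>f :: real ^ 'n \<Rightarrow> real. integrable lborel f \<and> has_weak_derivs r f \<longrightarrow> besov_J1 r k s p q f \<le> ennreal C * besov_J2 r k s p q f"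
proof -
  define \<sigma> where "\<sigma> = s - real r"
  have \<sigma>: "0 < \<sigma>" "\<sigma> < real k" using adm by (auto simp: admissible_def \<sigma>_def)
  then have k: "1 \<le> k" by (cases k) auto
  from modulus_le_series[OF p k, of r, where ?'n = 'n] obtain C0 where C00: "0 \<le> C0 \<and> (\<forall>\<eta>. 0 < \<eta> \<and> \<eta> \<le> 1 \<and> C0 * \<eta> ^ k < 1 \<longrightarrow> (\<exists>C1\<ge>0. \<forall>(f :: real ^ 'n \<Rightarrow> real) n t0.
      integrable lborel f \<and> has_weak_derivs r f \<and> mi_order n = r \<and> 0 < t0 \<longrightarrow>
      modulus k p (weak_deriv n f) t0 \<le> (\<Sum>i. ennreal (C0 ^ i * C1) * dir_deriv_modulus r k p f (\<eta> ^ i * t0))))" ..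
  note C0 = C00[THEN conjunct1]
  \<comment> \<open>Solves \<open>\<eta> powr \<sigma> = 1 / (4 * (C0 + 1))\<close>, the smallness
    that the Hardy inequality requires. As \<open>\<sigma> < k\<close> and
    \<open>\<eta> \<le> 1\<close>, also \<open>C0 * \<eta> ^ k < 1\<close>, which the iteration
    requires.\<close>
  define \<eta> where "\<eta> = (1 / (4 * (C0 + 1))) powr (1 / \<sigma>)"
  have base: "0 < 1 / (4 * (C0 + 1))" "1 / (4 * (C0 + 1)) \<le> 1" using C0 by (auto simp: field_simps)
  have \<eta>0: "0 < \<eta>" using base by (simp add: \<eta>_def)
  have \<eta>1: "\<eta> \<le> 1" unfolding \<eta>_def using base \<sigma> by (intro powr_le1) auto
  have \<eta>\<sigma>: "\<eta> powr \<sigma> = 1 / (4 * (C0 + 1))" unfolding \<eta>_def using base \<sigma> by (simp add: powr_powr)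
  have small: "4 * (C0 * \<eta> powr \<sigma>) \<le> 1" unfolding \<eta>\<sigma> using C0 by (simp add: field_simps)
  have "\<eta> ^ k = \<eta> powr real k" using \<eta>0 by (simp add: powr_realpow)
  also have "\<dots> \<le> \<eta> powr \<sigma>" using \<eta>0 \<eta>1 \<sigma> by (intro powr_mono') auto
  finally have "C0 * \<eta> ^ k \<le> C0 * \<eta> powr \<sigma>" using C0 by (intro mult_left_mono)
  also have "\<dots> < 1" using small by linarith
  finally have "0 < \<eta> \<and> \<eta> \<le> 1 \<and> C0 * \<eta> ^ k < 1" using \<eta>0 \<eta>1 by blast
  from C00[THEN conjunct2, THEN spec, THEN mp, OF this] obtain C1 where C1: "0 \<le> C1 \<and> (\<forall>(f :: real ^ 'n \<Rightarrow> real) n t0.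
      integrable lborel f \<and> has_weak_derivs r f \<and> mi_order n = r \<and> 0 < t0 \<longrightarrow>
      modulus k p (weak_deriv n f) t0 \<le> (\<Sum>i. ennreal (C0 ^ i * C1) * dir_deriv_modulus r k p f (\<eta> ^ i * t0)))" ..
  define K where "K = real (card (mis r :: ('n \<Rightarrow> nat) set)) * (4 * C1)"
  have "besov_J1 r k s p q f \<le> ennreal (K + 1) * besov_J2 r k s p q f" if f: "integrable lborel f" and wd: "has_weak_derivs r f" for f :: "real ^ 'n \<Rightarrow> real"
  proof -
    have "besov_J1 r k s p q f \<le> (\<Sum>n\<in>(mis r :: ('n \<Rightarrow> nat) set). ennreal (4 * C1) * besov_J2 r k s p q f)"
      unfolding besov_J1_def mis_def[symmetric] besov_J2_def \<sigma>_def[symmetric]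
    proof (intro sum_mono besov_geometric_sum[OF q \<eta>0 C0 _ small dir_deriv_modulus_borel])
      show "0 \<le> C1" using C1 by simp
      fix n :: "'n \<Rightarrow> nat" and t :: real assume "n \<in> mis r" "0 < t"
      then show "modulus k p (weak_deriv n f) t \<le> (\<Sum>i. ennreal (C0 ^ i * C1) * dir_deriv_modulus r k p f (\<eta> ^ i * t))"
        using C1 f wd by (simp add: mis_def)
    qed
    also have "\<dots> = ennreal K * besov_J2 r k s p q f"
      using C1 unfolding K_def by (simp add: ennreal_mult ennreal_of_nat_eq_real_of_nat mult.assoc)
    also have "\<dots> \<le> ennreal (K + 1) * besov_J2 r k s p q f" by (intro mult_right_mono ennreal_leI) auto
    finally show ?thesis .
  qed
  moreover have "0 < K + 1" using C1 by (auto simp: K_def intro!: add_nonneg_pos)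
  ultimately show ?thesis by blast
qed

section \<open>Marginals\<close>

interpretation lborel_prod: product_sigma_finite "\<lambda>_ :: 'i. lborel :: real measure"
  by standard

lemma vec_lambda_measurable: "(\<lambda>y. \<chi> i. y i) \<in> (\<Pi>\<^sub>M i\<in>(UNIV :: 'n::finite set). (lborel :: real measure)) \<rightarrow>\<^sub>M (borel :: (real ^ 'n) measure)"
proof -
  have eq: "(\<lambda>y. \<chi> i. y i) = (\<lambda>y. \<Sum>i\<in>UNIV. y i *\<^sub>R axis i (1::real))"
    using vec_expand[of "\<chi> i. _ i"] by (auto simp: fun_eq_iff)
  show ?thesis unfolding eq
    by (intro borel_measurable_sum borel_measurable_scaleR borel_measurable_const)
      (use measurable_component_singleton in \<open>auto simp: measurable_lborel1\<close>)
qed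

text \<open>Lebesgue measure is determined by its values on boxes, which are products of lengths.
  The identification makes Tonelli's theorem available coordinate by coordinate.\<close>

lemma lborel_vec_eq: "(lborel :: (real ^ 'n) measure) = distr (\<Pi>\<^sub>M i\<in>(UNIV :: 'n set). lborel) borel (\<lambda>y. \<chi> i. y i)"
proof (rule lborel_eqI)
  fix l u :: "real ^ 'n" assume lu: "\<And>b. b \<in> Basis \<Longrightarrow> l \<bullet> b \<le> u \<bullet> b"
  have c: "l $ i \<le> u $ i" for i using lu[of "axis i 1"] by (simp add: inner_axis)
  have "emeasure (distr (\<Pi>\<^sub>M i\<in>(UNIV :: 'n set). lborel) borel (\<lambda>y. \<chi> i. y i)) (box l u)
      = emeasure (\<Pi>\<^sub>M i\<in>(UNIV :: 'n set). lborel) (PiE UNIV (\<lambda>i. {l $ i<..<u $ i}))"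
    by (subst emeasure_distr[OF vec_lambda_measurable]) (auto intro!: arg_cong[where f = "emeasure _"] simp: mem_box_cart space_PiM PiE_def Pi_def)
  also have "\<dots> = (\<Prod>i\<in>UNIV. emeasure lborel {l $ i<..<u $ i})"
    by (rule lborel_prod.emeasure_PiM) auto
  also have "\<dots> = ennreal (\<Prod>i\<in>UNIV. u $ i - l $ i)" using c by (simp add: prod_ennreal)
  also have "(\<Prod>i\<in>UNIV. u $ i - l $ i) = (\<Prod>b\<in>Basis. (u - l) \<bullet> b)"
  proof -
    have inj: "inj (\<lambda>i :: 'n. axis i (1::real))" by (auto simp: inj_def axis_eq_axis)
    have Beq: "(Basis :: (real ^ 'n) set) = range (\<lambda>i :: 'n. axis i (1::real))" by (auto simp: Basis_vec_def)
    show ?thesis unfolding Beq by (subst prod.reindex[OF inj]) (simp add: inner_axis)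
  qed
  finally show "emeasure (distr (\<Pi>\<^sub>M i\<in>(UNIV :: 'n set). lborel) borel (\<lambda>y. \<chi> i. y i)) (box l u) = ennreal (\<Prod>b\<in>Basis. (u - l) \<bullet> b)" .
qed simp

lemma nn_integral_vec:
  assumes "f \<in> borel_measurable borel"
  shows "(\<integral>\<^sup>+ x. f x \<partial>(lborel :: (real ^ 'n) measure)) = (\<integral>\<^sup>+ y. f (\<chi> i. y i) \<partial>(\<Pi>\<^sub>M i\<in>(UNIV :: 'n set). lborel))"
  by (subst lborel_vec_eq) (simp add: nn_integral_distr vec_lambda_measurable assms)

abbreviation slice :: "'n \<Rightarrow> real \<Rightarrow> ('n \<Rightarrow> real) \<Rightarrow> real ^ 'n" where
  "slice l t y \<equiv> (\<chi> i. if i = l then t else y i)"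

lemma slice_upd: "(\<chi> i. (y(l := t)) i) = slice l t y"
  by (auto simp: vec_eq_iff)

lemma slice_measurable:
  "(\<lambda>(t, y). slice l t y) \<in> (lborel \<Otimes>\<^sub>M (\<Pi>\<^sub>M i\<in>- {l :: 'n::finite}. (lborel :: real measure))) \<rightarrow>\<^sub>M borel"
proof -
  have "(\<lambda>(y, t). y(l := t)) \<in> (\<Pi>\<^sub>M i\<in>- {l}. (lborel :: real measure)) \<Otimes>\<^sub>M lborel \<rightarrow>\<^sub>M (\<Pi>\<^sub>M i\<in>insert l (- {l}). lborel)"
    by (rule measurable_add_dim)
  moreover have "insert l (- {l}) = (UNIV :: 'n set)" by auto
  ultimately have "(\<lambda>(y, t). y(l := t)) \<in> (\<Pi>\<^sub>M i\<in>- {l}. (lborel :: real measure)) \<Otimes>\<^sub>M lborel \<rightarrow>\<^sub>M (\<Pi>\<^sub>M i\<in>UNIV. lborel)" by simp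
  from measurable_compose[OF measurable_compose[OF measurable_pair_swap' this] vec_lambda_measurable]
  show ?thesis by (simp add: case_prod_unfold comp_def slice_upd del: fun_upd_apply)
qed

lemma slice_measurable_left:
  assumes [measurable]: "f \<in> borel_measurable borel"
  shows "(\<lambda>y. f (slice l t y)) \<in> borel_measurable (\<Pi>\<^sub>M i\<in>- {l :: 'n::finite}. (lborel :: real measure))"
proof -
  note [measurable] = slice_measurable[of l]
  have "(\<lambda>y. f ((\<lambda>(t, y). slice l t y) (t, y))) \<in> borel_measurable (\<Pi>\<^sub>M i\<in>- {l :: 'n::finite}. (lborel :: real measure))" by measurable
  then show ?thesis by simp
qed

lemma nn_integral_slice:
  fixes f :: "real ^ 'n \<Rightarrow> ennreal"
  assumes f: "f \<in> borel_measurable borel"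
  shows "(\<integral>\<^sup>+ x. f x \<partial>lborel) = (\<integral>\<^sup>+ y. \<integral>\<^sup>+ t. f (slice l t y) \<partial>lborel \<partial>(\<Pi>\<^sub>M i\<in>- {l}. lborel))"
    and "(\<integral>\<^sup>+ x. f x \<partial>lborel) = (\<integral>\<^sup>+ t. \<integral>\<^sup>+ y. f (slice l t y) \<partial>(\<Pi>\<^sub>M i\<in>- {l}. lborel) \<partial>lborel)"
proof -
  have U: "insert l (- {l}) = (UNIV :: 'n set)" by auto
  have m: "(\<lambda>y. f (\<chi> i. y i)) \<in> borel_measurable (\<Pi>\<^sub>M i\<in>insert l (- {l}). lborel)"
    unfolding U by (rule measurable_compose[OF vec_lambda_measurable f])
  have "(\<integral>\<^sup>+ x. f x \<partial>lborel) = (\<integral>\<^sup>+ y. f (\<chi> i. y i) \<partial>(\<Pi>\<^sub>M i\<in>insert l (- {l}). lborel))"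
    unfolding U by (rule nn_integral_vec[OF f])
  then show "(\<integral>\<^sup>+ x. f x \<partial>lborel) = (\<integral>\<^sup>+ y. \<integral>\<^sup>+ t. f (slice l t y) \<partial>lborel \<partial>(\<Pi>\<^sub>M i\<in>- {l}. lborel))"
    "(\<integral>\<^sup>+ x. f x \<partial>lborel) = (\<integral>\<^sup>+ t. \<integral>\<^sup>+ y. f (slice l t y) \<partial>(\<Pi>\<^sub>M i\<in>- {l}. lborel) \<partial>lborel)"
    using lborel_prod.product_nn_integral_insert[OF _ _ m] lborel_prod.product_nn_integral_insert_rev[OF _ _ m]
    by (simp_all add: slice_upd del: fun_upd_apply)
qed

lemma nn_integral_prod_vec:
  fixes G :: "'n::finite \<Rightarrow> real \<Rightarrow> ennreal"
  assumes "\<And>i. G i \<in> borel_measurable borel"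
  shows "(\<integral>\<^sup>+ x. (\<Prod>i\<in>UNIV. G i (x $ i)) \<partial>(lborel :: (real ^ 'n) measure)) = (\<Prod>i\<in>UNIV. \<integral>\<^sup>+ t. G i t \<partial>lborel)"
proof -
  have "(\<lambda>x. \<Prod>i\<in>UNIV. G i (x $ i)) \<in> borel_measurable (borel :: (real ^ 'n) measure)"
  proof -
    note assms[measurable]
    show ?thesis by measurable
  qed
  from nn_integral_vec[OF this] show ?thesis
    using lborel_prod.product_nn_integral_prod[of UNIV G] assms by simp
qed

lemma marginal_borel:
  assumes [measurable]: "g \<in> borel_measurable borel" shows "marginal l g \<in> borel_measurable borel"
proof -
  interpret sigma_finite_measure "\<Pi>\<^sub>M i\<in>- {l}. (lborel :: real measure)"
    by (rule lborel_prod.sigma_finite) simp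
  note [measurable] = slice_measurable[of l]
  have "(\<lambda>(t, y). g ((\<lambda>(t, y). slice l t y) (t, y))) \<in> borel_measurable (lborel \<Otimes>\<^sub>M (\<Pi>\<^sub>M i\<in>- {l}. lborel))"
    by measurable
  from borel_measurable_lebesgue_integral[OF this] show ?thesis
    unfolding marginal_def[abs_def] by simp
qed

lemma marginal_nonneg: "(\<And>x. 0 \<le> g x) \<Longrightarrow> 0 \<le> marginal l g t"
  unfolding marginal_def by (rule integral_nonneg_AE) simp

text \<open>On integrable slices the two sides agree; on the others the Bochner integral is 0 by
  convention.\<close>

lemma marginal_le_nn_integral:
  assumes g: "\<And>x. 0 \<le> g x"
  shows "ennreal (marginal l g t) \<le> (\<integral>\<^sup>+ y. ennreal (g (slice l t y)) \<partial>(\<Pi>\<^sub>M i\<in>- {l}. lborel))"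
proof (cases "integrable (\<Pi>\<^sub>M i\<in>- {l}. (lborel :: real measure)) (\<lambda>y. g (slice l t y))")
  case True
  then show ?thesis unfolding marginal_def using g by (subst nn_integral_eq_integral) auto
next
  case False
  then show ?thesis by (simp add: marginal_def not_integrable_integral_eq)
qed

text \<open>Tonelli's theorem factorises the integral of the \<open>P\<close>-th power. For
  \<open>p = \<infinity>\<close> the exceptional set of each factor is a cylinder over a null set,
  hence null.\<close>

lemma Lp_norm_prod_finite:
  fixes G :: "'n::finite \<Rightarrow> real \<Rightarrow> real"
  assumes p: "1 \<le> p" and b: "\<And>i. G i \<in> borel_measurable borel" and fin: "\<And>i. Lp_norm p (G i) < \<infinity>"
  shows "Lp_norm p (\<lambda>x :: real ^ 'n. \<Prod>i\<in>UNIV. G i (x $ i)) < \<infinity>"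
proof (cases "p = \<infinity>")
  case False
  define P where "P = enn2real p"
  have P: "1 \<le> P" using finite_exponent[OF p False] by (simp add: P_def)
  note b[measurable]
  have f: "(\<integral>\<^sup>+ t. ennreal (\<bar>G i t\<bar> powr P) \<partial>lborel) < top" for i
    using fin[of i] unfolding Lp_norm_finite[OF False] P_def[symmetric] by (auto simp: epowr_def less_top split: if_splits)
  have "(\<integral>\<^sup>+ x. ennreal (\<bar>\<Prod>i\<in>UNIV. G i (x $ i)\<bar> powr P) \<partial>(lborel :: (real ^ 'n) measure))
      = (\<integral>\<^sup>+ x. (\<Prod>i\<in>UNIV. ennreal (\<bar>G i (x $ i)\<bar> powr P)) \<partial>(lborel :: (real ^ 'n) measure))"
    by (simp add: abs_prod prod_ennreal prod_powr_distrib)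
  also have "\<dots> = (\<Prod>i\<in>UNIV. \<integral>\<^sup>+ t. ennreal (\<bar>G i t\<bar> powr P) \<partial>lborel)"
    by (rule nn_integral_prod_vec) measurable
  also have "\<dots> < top" using f by (simp add: less_top[symmetric] ennreal_prod_eq_top)
  finally show ?thesis unfolding Lp_norm_finite[OF False] P_def[symmetric] by (simp add: epowr_def less_top[symmetric])
next
  case True
  note b[measurable]
  define M where "M i = enn2real (Lp_norm p (G i))" for i
  have M: "Lp_norm p (G i) = ennreal (M i)" "0 \<le> M i" for i using fin[of i] by (auto simp: M_def less_top)
  have ae: "AE x in (lborel :: (real ^ 'n) measure). \<bar>G i (x $ i)\<bar> \<le> M i" for i
  proof -
    have "AE t in lborel. \<bar>G i t\<bar> \<le> M i"
      using esssup_AE[of "\<lambda>t. ennreal \<bar>G i t\<bar>" lborel] M[of i] unfolding True Lp_norm_infinite by auto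
    then have z: "(\<integral>\<^sup>+ t. indicator {t. M i < \<bar>G i t\<bar>} t \<partial>lborel) = 0"
      by (subst nn_integral_0_iff_AE) (auto simp: not_less)
    have "(\<integral>\<^sup>+ x. indicator {t. M i < \<bar>G i t\<bar>} (x $ i) \<partial>(lborel :: (real ^ 'n) measure)) = 0"
      by (subst nn_integral_slice(1)[of _ i]) (use z in simp_all)
    then have "AE x in (lborel :: (real ^ 'n) measure). indicator {t. M i < \<bar>G i t\<bar>} (x $ i) = (0 :: ennreal)"
      by (subst (asm) nn_integral_0_iff_AE) auto
    then show ?thesis by eventually_elim (auto simp: indicator_def not_less split: if_splits)
  qed
  have "AE x in (lborel :: (real ^ 'n) measure). \<forall>i. \<bar>G i (x $ i)\<bar> \<le> M i" using ae by (simp add: AE_all_countable)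
  then have "AE x in (lborel :: (real ^ 'n) measure). ennreal \<bar>\<Prod>i\<in>UNIV. G i (x $ i)\<bar> \<le> ennreal (\<Prod>i\<in>UNIV. M i)"
    by eventually_elim (auto simp: abs_prod intro!: ennreal_leI prod_mono)
  then have "Lp_norm p (\<lambda>x :: real ^ 'n. \<Prod>i\<in>UNIV. G i (x $ i)) \<le> ennreal (\<Prod>i\<in>UNIV. M i)"
    unfolding True Lp_norm_infinite by (intro esssup_I) auto
  then show ?thesis by (rule le_less_trans) simp
qed

text \<open>The change of variables contributes a root of \<open>1 / |a|\<close>. The maximum with 1
  gives a bound free of the exponent and of the shift \<open>c\<close>.\<close>

lemma dual_norm_affine_le:
  fixes \<psi> :: "real \<Rightarrow> real"
  assumes p: "1 \<le> p" and a: "a \<noteq> 0" and [measurable]: "\<psi> \<in> borel_measurable borel"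
  shows "dual_norm p (\<lambda>t. \<psi> (c + a * t)) \<le> ennreal (max 1 (1 / \<bar>a\<bar>)) * dual_norm p \<psi>"
proof (cases "p = 1")
  case True
  have "(SUP t. ennreal \<bar>\<psi> (c + a * t)\<bar>) \<le> 1 * (SUP t. ennreal \<bar>\<psi> t\<bar>)" by (auto intro!: SUP_least SUP_upper)
  also have "\<dots> \<le> ennreal (max 1 (1 / \<bar>a\<bar>)) * (SUP t. ennreal \<bar>\<psi> t\<bar>)"
    using ennreal_leI[of 1 "max 1 (1 / \<bar>a\<bar>)"] by (intro mult_right_mono) auto
  finally show ?thesis using True by (simp add: dual_norm_def)
next
  case False
  define e where "e = dual_exponent p"
  have e: "1 \<le> e" using dual_exponent_ge_1[OF p False] by (simp add: e_def)
  have "(\<integral>\<^sup>+ t. ennreal (\<bar>\<psi> t\<bar> powr e) \<partial>lborel) = ennreal \<bar>a\<bar> * (\<integral>\<^sup>+ t. ennreal (\<bar>\<psi> (c + a * t)\<bar> powr e) \<partial>lborel)"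
    by (rule nn_integral_real_affine) (use a in auto)
  then have "ennreal (1 / \<bar>a\<bar>) * (\<integral>\<^sup>+ t. ennreal (\<bar>\<psi> t\<bar> powr e) \<partial>lborel)
      = (ennreal (1 / \<bar>a\<bar>) * ennreal \<bar>a\<bar>) * (\<integral>\<^sup>+ t. ennreal (\<bar>\<psi> (c + a * t)\<bar> powr e) \<partial>lborel)"
    by (simp add: mult.assoc)
  also have "ennreal (1 / \<bar>a\<bar>) * ennreal \<bar>a\<bar> = 1" using a by (simp add: ennreal_mult[symmetric])
  finally have eq: "(\<integral>\<^sup>+ t. ennreal (\<bar>\<psi> (c + a * t)\<bar> powr e) \<partial>lborel) = ennreal (1 / \<bar>a\<bar>) * (\<integral>\<^sup>+ t. ennreal (\<bar>\<psi> t\<bar> powr e) \<partial>lborel)" by simp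
  have "(1 / \<bar>a\<bar>) powr (1 / e) \<le> max 1 (1 / \<bar>a\<bar>) powr (1 / e)" using e by (intro powr_mono2) auto
  also have "\<dots> \<le> max 1 (1 / \<bar>a\<bar>) powr 1" using e by (intro powr_mono) auto
  finally have "(1 / \<bar>a\<bar>) powr (1 / e) \<le> max 1 (1 / \<bar>a\<bar>)" by simp
  then show ?thesis using False e unfolding dual_norm_def e_def[symmetric] eq
    by (simp add: epowr_mult epowr_ennreal ennreal_leI mult_right_mono)
qed

text \<open>The masses of the factors multiply to the total mass 1, which excludes 0 and infinity
  for each of them.\<close>

lemma product_density_factors:
  fixes f :: "real ^ 'n \<Rightarrow> real"
  assumes f: "product_density f"
  shows "marginal l f \<in> borel_measurable borel" "0 \<le> marginal l f t"
    "f x = (\<Prod>i\<in>UNIV. marginal i f (x $ i))"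
    "0 < (\<integral>\<^sup>+ t. ennreal (marginal l f t) \<partial>lborel)" "(\<integral>\<^sup>+ t. ennreal (marginal l f t) \<partial>lborel) < \<infinity>"
proof -
  have fb: "f \<in> borel_measurable borel" and f0: "\<And>x. 0 \<le> f x" and f1: "(\<integral>\<^sup>+ x. ennreal (f x) \<partial>lborel) = 1"
    and prod: "\<And>x. f x = (\<Prod>i\<in>UNIV. marginal i f (x $ i))"
    using f by (auto simp: product_density_def prob_density_def marginal_product_def)
  show mb: "marginal l f \<in> borel_measurable borel" for l by (rule marginal_borel[OF fb])
  show m0: "0 \<le> marginal l f t" for l t by (rule marginal_nonneg[OF f0])
  show "f x = (\<Prod>i\<in>UNIV. marginal i f (x $ i))" by (rule prod)
  let ?c = "\<lambda>i. \<integral>\<^sup>+ t. ennreal (marginal i f t) \<partial>lborel"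
  note mb[measurable]
  have "(\<integral>\<^sup>+ x. ennreal (f x) \<partial>lborel) = (\<integral>\<^sup>+ x. (\<Prod>i\<in>UNIV. ennreal (marginal i f (x $ i))) \<partial>(lborel :: (real ^ 'n) measure))"
    by (subst prod) (simp add: prod_ennreal m0)
  also have "\<dots> = (\<Prod>i\<in>UNIV. ?c i)" by (rule nn_integral_prod_vec) measurable
  finally have c: "(\<Prod>i\<in>UNIV. ?c i) = 1" using f1 by simp
  have nz: "?c i \<noteq> 0" for i
  proof
    assume "?c i = 0"
    then have "(\<Prod>i\<in>UNIV. ?c i) = 0" by (intro prod_zero) auto
    then show False using c by simp
  qed
  then show "0 < ?c l" by (simp add: zero_less_iff_neq_zero)
  have "?c l \<noteq> \<infinity>"
  proof
    assume "?c l = \<infinity>"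
    then have "(\<Prod>i\<in>UNIV. ?c i) = \<infinity>" using nz by (auto simp: ennreal_prod_eq_top)
    then show False using c by simp
  qed
  then show "?c l < \<infinity>" by (simp add: less_top)
qed

lemma prod_split_coord:
  fixes F :: "'n::finite \<Rightarrow> real \<Rightarrow> real"
  shows "(\<Prod>i\<in>UNIV. F i (slice j t y $ i)) = F j t * (\<Prod>i\<in>- {j}. F i (y i))"
proof -
  have "(\<Prod>i\<in>UNIV. F i (slice j t y $ i)) = F j (slice j t y $ j) * (\<Prod>i\<in>UNIV - {j}. F i (slice j t y $ i))"
    by (rule prod.remove) auto
  moreover have "(\<Prod>i\<in>UNIV - {j}. F i (slice j t y $ i)) = (\<Prod>i\<in>- {j}. F i (y i))"
    by (rule prod.cong) auto
  ultimately show ?thesis by simp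
qed

lemma nn_integral_prod_compl:
  fixes G :: "'n::finite \<Rightarrow> real \<Rightarrow> ennreal"
  assumes "\<And>i. G i \<in> borel_measurable borel"
  shows "(\<integral>\<^sup>+ y. (\<Prod>i\<in>- {j}. G i (y i)) \<partial>(\<Pi>\<^sub>M i\<in>- {j}. lborel)) = (\<Prod>i\<in>- {j}. \<integral>\<^sup>+ t. G i t \<partial>lborel)"
  using lborel_prod.product_nn_integral_prod[of "- {j}" G] assms by simp

lemma prod_compl_measurable:
  fixes G :: "'n::finite \<Rightarrow> real \<Rightarrow> ennreal"
  assumes "\<And>i. G i \<in> borel_measurable borel"
  shows "(\<lambda>y. \<Prod>i\<in>- {j}. G i (y i)) \<in> borel_measurable (\<Pi>\<^sub>M i\<in>- {j}. lborel)"
proof (rule borel_measurable_prod_ennreal)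
  fix i assume "i \<in> - {j}"
  then have "(\<lambda>y. y i) \<in> (\<Pi>\<^sub>M i\<in>- {j}. lborel) \<rightarrow>\<^sub>M (lborel :: real measure)" by (rule measurable_component_singleton)
  from measurable_compose[OF this, of "G i" borel] show "(\<lambda>y. G i (y i)) \<in> borel_measurable (\<Pi>\<^sub>M i\<in>- {j}. lborel)"
    using assms[of i] by simp
qed

text \<open>Countably many bounded intervals exhaust the line, so a nonnegative function without
  mass on any of them vanishes almost everywhere.\<close>

lemma finite_mass_on_interval:
  assumes F: "F \<in> borel_measurable borel" and F0: "\<And>t. 0 \<le> F t" and pos: "0 < (\<integral>\<^sup>+ t. ennreal (F t) \<partial>lborel)"
  shows "\<exists>N::nat. 0 < (\<integral>\<^sup>+ t. ennreal (F t) * indicator {- real N..real N} t \<partial>lborel)"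
proof (rule ccontr)
  note F[measurable]
  assume "\<not> ?thesis"
  then have "(\<integral>\<^sup>+ t. ennreal (F t) * indicator {- real N..real N} t \<partial>lborel) = 0" for N by (auto simp: not_less)
  then have "AE t in lborel. ennreal (F t) * indicator {- real N..real N} t = 0" for N
    by (subst (asm) nn_integral_0_iff_AE) auto
  then have "AE t in lborel. \<forall>N::nat. ennreal (F t) * indicator {- real N..real N} t = 0"
    unfolding AE_all_countable by blast
  then have "AE t in lborel. ennreal (F t) = 0"
  proof eventually_elim
    case (elim t)
    obtain N where N: "\<bar>t\<bar> \<le> real N" using real_arch_simple by blast
    then show ?case using elim[rule_format, of N] by (auto simp: indicator_def abs_le_iff)
  qed
  then have "(\<integral>\<^sup>+ t. ennreal (F t) \<partial>lborel) = 0" by (subst nn_integral_0_iff_AE) auto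
  then show False using pos by simp
qed

text \<open>Lifts test functions of one variable to \<open>real ^ 'n\<close>. Tensoring with the
  indicator of a box multiplies the dual norm by the power \<open>1 / e\<close> of the volume of the
  box and does not increase the supremum norm.\<close>

lemma dual_norm_tensor_le:
  fixes \<psi> :: "real \<Rightarrow> real" and N :: "'n::finite \<Rightarrow> nat"
  assumes p: "1 \<le> p"
  shows "\<exists>K\<ge>0. \<forall>\<psi>. \<psi> \<in> borel_measurable borel \<longrightarrow>
    dual_norm p (\<lambda>x :: real ^ 'n. \<psi> (x $ l) * (\<Prod>i\<in>- {l}. indicat_real {- real (N i)..real (N i)} (x $ i))) \<le> ennreal K * dual_norm p \<psi>"
proof (cases "p = 1")
  case True
  have "dual_norm p (\<lambda>x :: real ^ 'n. \<psi> (x $ l) * (\<Prod>i\<in>- {l}. indicat_real {- real (N i)..real (N i)} (x $ i))) \<le> ennreal 1 * dual_norm p \<psi>" for \<psi>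
    using True unfolding dual_norm_def
  proof (simp, intro SUP_least)
    fix x :: "real ^ 'n"
    have "\<bar>\<Prod>i\<in>- {l}. indicat_real {- real (N i)..real (N i)} (x $ i)\<bar> \<le> 1"
      unfolding abs_prod by (intro prod_le_1) (auto simp: indicator_def)
    then have "\<bar>\<psi> (x $ l) * (\<Prod>i\<in>- {l}. indicat_real {- real (N i)..real (N i)} (x $ i))\<bar> \<le> \<bar>\<psi> (x $ l)\<bar>"
      unfolding abs_mult by (intro mult_left_le) auto
    then have "ennreal \<bar>\<psi> (x $ l) * (\<Prod>i\<in>- {l}. indicat_real {- real (N i)..real (N i)} (x $ i))\<bar> \<le> ennreal \<bar>\<psi> (x $ l)\<bar>" by (rule ennreal_leI)
    also have "\<dots> \<le> (SUP t. ennreal \<bar>\<psi> t\<bar>)" by (rule SUP_upper) simp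
    finally show "ennreal \<bar>\<psi> (x $ l) * (\<Prod>i\<in>- {l}. indicat_real {- real (N i)..real (N i)} (x $ i))\<bar> \<le> (SUP t. ennreal \<bar>\<psi> t\<bar>)" .
  qed
  then show ?thesis by (intro exI[of _ 1]) auto
next
  case False
  define e where "e = dual_exponent p"
  have e: "1 \<le> e" using dual_exponent_ge_1[OF p False] by (simp add: e_def)
  define V where "V = (\<Prod>i\<in>- {l}. 2 * real (N i))"
  have V0: "0 \<le> V" unfolding V_def by (intro prod_nonneg) auto
  have "dual_norm p (\<lambda>x :: real ^ 'n. \<psi> (x $ l) * (\<Prod>i\<in>- {l}. indicat_real {- real (N i)..real (N i)} (x $ i))) \<le> ennreal (V powr (1 / e)) * dual_norm p \<psi>"
    if [measurable]: "\<psi> \<in> borel_measurable borel" for \<psi>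
  proof -
    define G where "G i = (if i = l then (\<lambda>t. ennreal (\<bar>\<psi> t\<bar> powr e)) else indicator {- real (N i)..real (N i)})" for i
    have Gb: "G i \<in> borel_measurable borel" for i unfolding G_def by (cases "i = l") simp_all
    have "(\<integral>\<^sup>+ x. ennreal (\<bar>\<psi> (x $ l) * (\<Prod>i\<in>- {l}. indicat_real {- real (N i)..real (N i)} (x $ i))\<bar> powr e) \<partial>(lborel :: (real ^ 'n) measure))
        = (\<integral>\<^sup>+ x. (\<Prod>i\<in>UNIV. G i (x $ i)) \<partial>lborel)"
    proof (rule nn_integral_cong)
      fix x :: "real ^ 'n"
      have ind: "(\<Prod>i\<in>- {l}. indicat_real {- real (N i)..real (N i)} (x $ i)) \<in> {0, 1}"
        by (induction "- {l}" rule: infinite_finite_induct) (auto simp: indicator_def)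
      obtain z where z: "(\<Prod>i\<in>- {l}. indicat_real {- real (N i)..real (N i)} (x $ i)) = z" by blast
      have "(\<Prod>i\<in>UNIV. G i (x $ i)) = G l (x $ l) * (\<Prod>i\<in>UNIV - {l}. G i (x $ i))" by (rule prod.remove) auto
      also have "(\<Prod>i\<in>UNIV - {l}. G i (x $ i)) = (\<Prod>i\<in>- {l}. ennreal (indicat_real {- real (N i)..real (N i)} (x $ i)))"
        by (intro prod.cong) (auto simp: G_def ennreal_indicator)
      also have "\<dots> = ennreal (\<Prod>i\<in>- {l}. indicat_real {- real (N i)..real (N i)} (x $ i))" by (rule prod_ennreal) auto
      finally show "ennreal (\<bar>\<psi> (x $ l) * (\<Prod>i\<in>- {l}. indicat_real {- real (N i)..real (N i)} (x $ i))\<bar> powr e) = (\<Prod>i\<in>UNIV. G i (x $ i))"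
        using ind unfolding z by (auto simp: G_def)
    qed
    also have "\<dots> = (\<Prod>i\<in>UNIV. \<integral>\<^sup>+ t. G i t \<partial>lborel)" by (rule nn_integral_prod_vec[OF Gb])
    also have "\<dots> = (\<integral>\<^sup>+ t. G l t \<partial>lborel) * (\<Prod>i\<in>UNIV - {l}. \<integral>\<^sup>+ t. G i t \<partial>lborel)" by (rule prod.remove) auto
    also have "(\<Prod>i\<in>UNIV - {l}. \<integral>\<^sup>+ t. G i t \<partial>lborel) = (\<Prod>i\<in>- {l}. ennreal (2 * real (N i)))"
      by (intro prod.cong) (auto simp: G_def)
    also have "\<dots> = ennreal V" unfolding V_def by (rule prod_ennreal) auto
    finally show ?thesis using False e V0 unfolding dual_norm_def e_def[symmetric]
      by (simp add: epowr_mult epowr_ennreal G_def mult.commute)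
  qed
  then show ?thesis by (intro exI[of _ "V powr (1 / e)"]) auto
qed

text \<open>The density is paired with \<open>\<psi>\<close> in coordinate \<open>l\<close> times
  the indicator of a box in the others. This pairing factorises into that of the factor with
  \<open>\<psi>\<close> and the mass of the other factors on the box, and dividing by the mass
  bounds the former.\<close>

lemma Lp_factor:
  fixes f :: "real ^ 'n \<Rightarrow> real"
  assumes p: "1 \<le> p" and f: "product_density f" and fp: "Lp_norm p f < \<infinity>"
  shows "Lp_norm p (marginal l f) < \<infinity>"
proof -
  note F = product_density_factors[OF f]
  let ?F = "\<lambda>i. marginal i f"
  note F(1)[measurable]
  have fb [measurable]: "f \<in> borel_measurable borel" using f by (simp add: product_density_def prob_density_def)
  \<comment> \<open>The box must carry positive mass of the other factors, since the estimate is
    divided by it, and must be bounded for the tensor to have a finite dual norm.\<close>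
  have "\<forall>i. \<exists>N::nat. 0 < (\<integral>\<^sup>+ t. ennreal (?F i t) * indicator {- real N..real N} t \<partial>lborel)"
    using finite_mass_on_interval[OF F(1) F(2) F(4)] by blast
  from choice[OF this] obtain N where N: "\<And>i. 0 < (\<integral>\<^sup>+ t. ennreal (?F i t) * indicator {- real (N i)..real (N i)} t \<partial>lborel)" by blast
  obtain K where K: "0 \<le> K" "\<And>\<psi>. \<psi> \<in> borel_measurable borel \<Longrightarrow>
      dual_norm p (\<lambda>x :: real ^ 'n. \<psi> (x $ l) * (\<Prod>i\<in>- {l}. indicat_real {- real (N i)..real (N i)} (x $ i))) \<le> ennreal K * dual_norm p \<psi>"
    using dual_norm_tensor_le[OF p, where l = l and N = N] by blast
  define m where "m = (\<Prod>i\<in>- {l}. \<integral>\<^sup>+ t. ennreal (?F i t) * indicator {- real (N i)..real (N i)} t \<partial>lborel)"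
  have m0: "m \<noteq> 0" unfolding m_def using N by (simp add: zero_less_iff_neq_zero)
  have "(\<integral>\<^sup>+ t. ennreal (?F i t) * indicator {- real (N i)..real (N i)} t \<partial>lborel) \<le> (\<integral>\<^sup>+ t. ennreal (?F i t) \<partial>lborel)" for i
    by (rule nn_integral_mono) (auto simp: indicator_def)
  then have "(\<integral>\<^sup>+ t. ennreal (?F i t) * indicator {- real (N i)..real (N i)} t \<partial>lborel) \<noteq> top" for i
    using F(5)[of i] by (metis infinity_ennreal_def le_less_trans less_irrefl)
  then have "m \<noteq> top" unfolding m_def by (simp add: ennreal_prod_eq_top)
  then obtain m' where m': "m = ennreal m'" "0 < m'" using m0 by (cases m) (auto simp: less_le)
  obtain L where L: "Lp_norm p f = ennreal L" "0 \<le> L" using fp by (cases "Lp_norm p f") auto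
  have "Lp_norm p (?F l) \<le> ennreal (L * K / m')"
  proof (rule Lp_norm_dual[OF p F(1)])
    show "0 \<le> L * K / m'" using L K m' by simp
    fix \<psi> :: "real \<Rightarrow> real" and M R
    assume [measurable]: "\<psi> \<in> borel_measurable borel" and \<psi>: "\<And>x. 0 \<le> \<psi> x"
    define \<Psi> where "\<Psi> x = \<psi> (x $ l) * (\<Prod>i\<in>- {l}. indicat_real {- real (N i)..real (N i)} (x $ i))" for x :: "real ^ 'n"
    define G where "G i t = (if i = l then ennreal (?F l t * \<psi> t) else ennreal (?F i t) * indicator {- real (N i)..real (N i)} t)" for i t
    have Gb: "G i \<in> borel_measurable borel" for i unfolding G_def[abs_def] by (cases "i = l") simp_all
    have \<Psi>b: "\<Psi> \<in> borel_measurable borel" unfolding \<Psi>_def by measurable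
    have "(\<integral>\<^sup>+ x. ennreal (\<bar>f x\<bar> * \<bar>\<Psi> x\<bar>) \<partial>lborel) = (\<integral>\<^sup>+ x. (\<Prod>i\<in>UNIV. G i (x $ i)) \<partial>(lborel :: (real ^ 'n) measure))"
    proof (rule nn_integral_cong)
      fix x :: "real ^ 'n"
      have "f x = ?F l (x $ l) * (\<Prod>i\<in>UNIV - {l}. ?F i (x $ i))" unfolding F(3)[of x] by (rule prod.remove) auto
      moreover have "UNIV - {l} = - {l}" by auto
      ultimately have fx: "f x = ?F l (x $ l) * (\<Prod>i\<in>- {l}. ?F i (x $ i))" by simp
      have "(\<Prod>i\<in>UNIV. G i (x $ i)) = G l (x $ l) * (\<Prod>i\<in>UNIV - {l}. G i (x $ i))" by (rule prod.remove) auto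
      also have "(\<Prod>i\<in>UNIV - {l}. G i (x $ i)) = (\<Prod>i\<in>- {l}. ennreal (?F i (x $ i) * indicat_real {- real (N i)..real (N i)} (x $ i)))"
        by (intro prod.cong) (auto simp: G_def ennreal_mult F(2) ennreal_indicator)
      also have "\<dots> = ennreal (\<Prod>i\<in>- {l}. ?F i (x $ i) * indicat_real {- real (N i)..real (N i)} (x $ i))"
        by (rule prod_ennreal) (auto simp: F(2))
      also have "G l (x $ l) * \<dots> = ennreal ((?F l (x $ l) * \<psi> (x $ l)) * (\<Prod>i\<in>- {l}. ?F i (x $ i) * indicat_real {- real (N i)..real (N i)} (x $ i)))"
        unfolding G_def by (simp add: F(2) \<psi> ennreal_mult prod_nonneg)
      also have "(?F l (x $ l) * \<psi> (x $ l)) * (\<Prod>i\<in>- {l}. ?F i (x $ i) * indicat_real {- real (N i)..real (N i)} (x $ i)) = f x * \<Psi> x"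
        unfolding fx \<Psi>_def by (simp add: prod.distrib mult_ac)
      finally show "ennreal (\<bar>f x\<bar> * \<bar>\<Psi> x\<bar>) = (\<Prod>i\<in>UNIV. G i (x $ i))"
        unfolding fx \<Psi>_def by (simp add: abs_mult F(2) \<psi> prod_nonneg abs_of_nonneg)
    qed
    also have "\<dots> = (\<Prod>i\<in>UNIV. \<integral>\<^sup>+ t. G i t \<partial>lborel)" by (rule nn_integral_prod_vec[OF Gb])
    also have "\<dots> = (\<integral>\<^sup>+ t. G l t \<partial>lborel) * (\<Prod>i\<in>UNIV - {l}. \<integral>\<^sup>+ t. G i t \<partial>lborel)" by (rule prod.remove) auto
    also have "(\<Prod>i\<in>UNIV - {l}. \<integral>\<^sup>+ t. G i t \<partial>lborel) = m" unfolding m_def by (intro prod.cong) (auto simp: G_def)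
    finally have "(\<integral>\<^sup>+ t. ennreal (?F l t * \<psi> t) \<partial>lborel) * m \<le> Lp_norm p f * (ennreal K * dual_norm p \<psi>)"
      using Hoelder[OF p fb \<Psi>b] mult_left_mono[OF K(2)[of \<psi>], of "Lp_norm p f"] unfolding \<Psi>_def[symmetric]
      by (simp add: G_def \<Psi>_def[symmetric])
    then have "ennreal (1 / m') * ((\<integral>\<^sup>+ t. ennreal (?F l t * \<psi> t) \<partial>lborel) * m) \<le> ennreal (1 / m') * (Lp_norm p f * (ennreal K * dual_norm p \<psi>))"
      by (rule mult_left_mono) simp
    moreover have "ennreal (1 / m') * ((\<integral>\<^sup>+ t. ennreal (?F l t * \<psi> t) \<partial>lborel) * m) = (\<integral>\<^sup>+ t. ennreal (\<bar>?F l t\<bar> * \<psi> t) \<partial>lborel)"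
    proof -
      have "ennreal (1 / m') * m = 1" using m' by (simp add: ennreal_mult[symmetric])
      then show ?thesis by (simp add: F(2) mult.left_commute[of "ennreal (1 / m')"])
    qed
    moreover have "ennreal (1 / m') * (Lp_norm p f * (ennreal K * dual_norm p \<psi>)) = ennreal (L * K / m') * dual_norm p \<psi>"
    proof -
      have "ennreal (L * K / m') = ennreal (1 / m') * (ennreal L * ennreal K)"
        using L K m' by (simp add: ennreal_mult[symmetric])
      then show ?thesis unfolding L(1) by (simp add: mult.assoc)
    qed
    ultimately show "(\<integral>\<^sup>+ t. ennreal (\<bar>?F l t\<bar> * \<psi> t) \<partial>lborel) \<le> ennreal (L * K / m') * dual_norm p \<psi>" by simp
  qed
  then show ?thesis by (rule le_less_trans) simp
qed

text \<open>The marginal of the mixed density is dominated by an average of translates of a rescaled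
  factor of the original one, so Hoelder's inequality bounds its pairing with any test function.\<close>

lemma Lp_mixed_marginal:
  fixes f :: "real ^ 'n \<Rightarrow> real"
  assumes p: "1 \<le> p" and f: "product_density f" and A: "invertible A" and Fp: "\<And>i. Lp_norm p (marginal i f) < \<infinity>"
  shows "Lp_norm p (marginal l (mixed_density A f)) < \<infinity>"
proof -
  note F = product_density_factors[OF f]
  let ?F = "\<lambda>i. marginal i f"
  note F(1)[measurable]
  have fb [measurable]: "f \<in> borel_measurable borel" and f0: "\<And>x. 0 \<le> f x"
    using f by (auto simp: product_density_def prob_density_def)
  define B where "B = matrix_inv A"
  have BA: "A ** B = mat 1" "B ** A = mat 1"
    using someI_ex[OF A[unfolded invertible_def]] unfolding B_def matrix_inv_def by auto
  then have Bi: "invertible B" unfolding invertible_def by blast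
  define \<kappa> where "\<kappa> = \<bar>det B\<bar>"
  have g: "mixed_density A f = (\<lambda>x. \<kappa> * f (B *v x))" by (auto simp: mixed_density_def B_def \<kappa>_def)
  note [measurable] = linear_measurable_vec
  have gb [measurable]: "mixed_density A f \<in> borel_measurable borel" unfolding g by measurable
  have g0: "0 \<le> mixed_density A f x" for x unfolding g using f0 by (simp add: \<kappa>_def)
  \<comment> \<open>A row of an invertible matrix has a nonzero entry. Along coordinate
    \<open>j\<close> the map \<open>(A *v x) $ l\<close> is therefore an affine bijection of the
    line.\<close>
  obtain j where j: "A $ l $ j \<noteq> 0"
  proof (rule ccontr)
    assume "\<not> thesis"
    then have "A $ l $ j = 0" for j using that by blast
    then have "(A ** B) $ l $ l = 0" by (simp add: matrix_matrix_mult_def)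
    then show False unfolding BA by (simp add: mat_def)
  qed
  define a where "a = A $ l $ j"
  define m where "m = (\<Prod>i\<in>- {j}. \<integral>\<^sup>+ t. ennreal (?F i t) \<partial>lborel)"
  have "m \<noteq> top" unfolding m_def using F(5) by (simp add: ennreal_prod_eq_top less_top[symmetric])
  then obtain m' where m': "m = ennreal m'" "0 \<le> m'" by (cases m) auto
  obtain L where L: "Lp_norm p (?F j) = ennreal L" "0 \<le> L" using Fp[of j] by (cases "Lp_norm p (?F j)") auto
  define K where "K = max 1 (1 / \<bar>a\<bar>)"
  have K0: "0 \<le> K" by (simp add: K_def)
  define C where "C = \<kappa> * lin_scale B * (L * K * m')"
  have ls: "0 < lin_scale B" by (rule lin_scale_pos[OF Bi])
  have "Lp_norm p (marginal l (mixed_density A f)) \<le> ennreal C"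
  proof (rule Lp_norm_dual[OF p marginal_borel[OF gb]])
    show "0 \<le> C" using ls L K0 m' by (simp add: C_def \<kappa>_def)
    fix \<psi> :: "real \<Rightarrow> real" and M R
    assume [measurable]: "\<psi> \<in> borel_measurable borel" and \<psi>: "\<And>x. 0 \<le> \<psi> x"
    have "(\<lambda>x :: real ^ 'n. \<psi> ((A *v x) $ l)) \<in> borel_measurable borel"
      by (rule measurable_compose[OF linear_measurable_vec[of A], of "\<lambda>x. \<psi> (x $ l)"]) measurable
    then have H: "(\<lambda>x. ennreal (f x) * ennreal (\<psi> ((A *v x) $ l))) \<in> borel_measurable borel"
      by measurable
    let ?P = "\<Pi>\<^sub>M i\<in>- {l}. (lborel :: real measure)" and ?Q = "\<Pi>\<^sub>M i\<in>- {j}. (lborel :: real measure)"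
    have "(\<integral>\<^sup>+ t. ennreal (\<bar>marginal l (mixed_density A f) t\<bar> * \<psi> t) \<partial>lborel)
        \<le> (\<integral>\<^sup>+ t. \<integral>\<^sup>+ y. ennreal (mixed_density A f (slice l t y)) * ennreal (\<psi> (slice l t y $ l)) \<partial>?P \<partial>lborel)"
    proof (rule nn_integral_mono)
      fix t :: real
      have "ennreal (\<bar>marginal l (mixed_density A f) t\<bar> * \<psi> t) = ennreal (marginal l (mixed_density A f) t) * ennreal (\<psi> t)"
        using marginal_nonneg[of "mixed_density A f" l t, OF g0] \<psi>[of t] by (simp add: ennreal_mult)
      also have "\<dots> \<le> (\<integral>\<^sup>+ y. ennreal (mixed_density A f (slice l t y)) \<partial>?P) * ennreal (\<psi> t)"
        by (intro mult_right_mono marginal_le_nn_integral g0) simp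
      also have "\<dots> = (\<integral>\<^sup>+ y. ennreal (mixed_density A f (slice l t y)) * ennreal (\<psi> (slice l t y $ l)) \<partial>?P)"
        by (subst nn_integral_multc[symmetric]) (auto intro!: slice_measurable_left[of "\<lambda>x. ennreal (mixed_density A f x)"])
      finally show "ennreal (\<bar>marginal l (mixed_density A f) t\<bar> * \<psi> t)
          \<le> (\<integral>\<^sup>+ y. ennreal (mixed_density A f (slice l t y)) * ennreal (\<psi> (slice l t y $ l)) \<partial>?P)" .
    qed
    also have "\<dots> = (\<integral>\<^sup>+ x. ennreal (mixed_density A f x) * ennreal (\<psi> (x $ l)) \<partial>lborel)"
      by (rule nn_integral_slice(2)[symmetric]) measurable
    also have "\<dots> = (\<integral>\<^sup>+ x. ennreal \<kappa> * (ennreal (f (B *v x)) * ennreal (\<psi> ((A *v (B *v x)) $ l))) \<partial>lborel)"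
      unfolding g matrix_vector_mul_assoc BA by (simp add: ennreal_mult f0 \<kappa>_def mult.assoc)
    also have "\<dots> = ennreal \<kappa> * (\<integral>\<^sup>+ x. ennreal (f (B *v x)) * ennreal (\<psi> ((A *v (B *v x)) $ l)) \<partial>lborel)"
      using H measurable_compose[OF linear_measurable_vec[of B] H] by (subst nn_integral_cmult) auto
    also have "(\<integral>\<^sup>+ x. ennreal (f (B *v x)) * ennreal (\<psi> ((A *v (B *v x)) $ l)) \<partial>lborel)
        = ennreal (lin_scale B) * (\<integral>\<^sup>+ x. ennreal (f x) * ennreal (\<psi> ((A *v x) $ l)) \<partial>lborel)"
      by (rule nn_integral_linear[OF Bi, of "\<lambda>x. ennreal (f x) * ennreal (\<psi> ((A *v x) $ l))"]) (rule H)
    also have "(\<integral>\<^sup>+ x. ennreal (f x) * ennreal (\<psi> ((A *v x) $ l)) \<partial>lborel)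
        = (\<integral>\<^sup>+ y. \<integral>\<^sup>+ t. ennreal (f (slice j t y)) * ennreal (\<psi> ((A *v slice j t y) $ l)) \<partial>lborel \<partial>?Q)"
      by (rule nn_integral_slice(1)[OF H])
    also have "\<dots> \<le> (\<integral>\<^sup>+ y. (\<Prod>i\<in>- {j}. ennreal (?F i (y i))) * (ennreal L * (ennreal K * dual_norm p \<psi>)) \<partial>?Q)"
    proof (rule nn_integral_mono)
      fix y :: "'n \<Rightarrow> real"
      \<comment> \<open>The other coordinates enter the argument of \<open>\<psi>\<close> only
        through this shift, on which the dual norm bound does not depend.\<close>
      define c where "c = (\<Sum>i\<in>- {j}. A $ l $ i * y i)"
      have Av: "(A *v slice j t y) $ l = c + a * t" for t
      proof -
        have "(A *v slice j t y) $ l = (\<Sum>i\<in>UNIV. A $ l $ i * (slice j t y $ i))" by (simp add: matrix_vector_mult_def)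
        also have "\<dots> = A $ l $ j * (slice j t y $ j) + (\<Sum>i\<in>UNIV - {j}. A $ l $ i * (slice j t y $ i))" by (rule sum.remove) auto
        also have "(\<Sum>i\<in>UNIV - {j}. A $ l $ i * (slice j t y $ i)) = c" unfolding c_def by (rule sum.cong) auto
        finally show ?thesis by (simp add: a_def)
      qed
      have fs: "f (slice j t y) = ?F j t * (\<Prod>i\<in>- {j}. ?F i (y i))" for t unfolding F(3)[of "slice j t y"] by (rule prod_split_coord)
      have "(\<integral>\<^sup>+ t. ennreal (f (slice j t y)) * ennreal (\<psi> ((A *v slice j t y) $ l)) \<partial>lborel)
          = (\<integral>\<^sup>+ t. (\<Prod>i\<in>- {j}. ennreal (?F i (y i))) * ennreal (\<bar>?F j t\<bar> * \<bar>\<psi> (c + a * t)\<bar>) \<partial>lborel)"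
        unfolding fs Av by (simp add: prod_ennreal F(2) \<psi> prod_nonneg ennreal_mult mult_ac)
      also have "\<dots> = (\<Prod>i\<in>- {j}. ennreal (?F i (y i))) * (\<integral>\<^sup>+ t. ennreal (\<bar>?F j t\<bar> * \<bar>\<psi> (c + a * t)\<bar>) \<partial>lborel)"
        by (rule nn_integral_cmult) measurable
      also have "\<dots> \<le> (\<Prod>i\<in>- {j}. ennreal (?F i (y i))) * (Lp_norm p (?F j) * dual_norm p (\<lambda>t. \<psi> (c + a * t)))"
        by (intro mult_left_mono Hoelder[OF p]) auto
      also have "\<dots> \<le> (\<Prod>i\<in>- {j}. ennreal (?F i (y i))) * (ennreal L * (ennreal K * dual_norm p \<psi>))"
        unfolding L(1) K_def using j by (intro mult_left_mono dual_norm_affine_le[OF p]) (auto simp: a_def)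
      finally show "(\<integral>\<^sup>+ t. ennreal (f (slice j t y)) * ennreal (\<psi> ((A *v slice j t y) $ l)) \<partial>lborel)
          \<le> (\<Prod>i\<in>- {j}. ennreal (?F i (y i))) * (ennreal L * (ennreal K * dual_norm p \<psi>))" .
    qed
    also have "\<dots> = m * (ennreal L * (ennreal K * dual_norm p \<psi>))"
      using prod_compl_measurable[of "\<lambda>i t. ennreal (?F i t)" j] nn_integral_prod_compl[of "\<lambda>i t. ennreal (?F i t)" j]
      by (simp add: nn_integral_multc m_def)
    finally have "(\<integral>\<^sup>+ t. ennreal (\<bar>marginal l (mixed_density A f) t\<bar> * \<psi> t) \<partial>lborel)
        \<le> ennreal \<kappa> * (ennreal (lin_scale B) * (m * (ennreal L * (ennreal K * dual_norm p \<psi>))))"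
      by (simp add: mult_left_mono)
    also have "\<dots> = ennreal C * dual_norm p \<psi>"
    proof -
      have "ennreal C = ennreal \<kappa> * (ennreal (lin_scale B) * (ennreal m' * (ennreal L * ennreal K)))"
        unfolding C_def using ls L(2) K0 m'(2) by (simp add: ennreal_mult[symmetric] \<kappa>_def mult_ac)
      then show ?thesis unfolding m'(1) by (simp add: mult.assoc)
    qed
    finally show "(\<integral>\<^sup>+ t. ennreal (\<bar>marginal l (mixed_density A f) t\<bar> * \<psi> t) \<partial>lborel) \<le> ennreal C * dual_norm p \<psi>" .
  qed
  then show ?thesis by (rule le_less_trans) simp
qed

section \<open>Product densities under invertible linear maps\<close>

theorem proposition3p3:
  fixes A :: "real ^ 'n ^ 'n" and s :: real and p q :: ennreal
  assumes "s > 0" and "1 \<le> p" and "1 \<le> q" and "invertible A"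
  shows
    "(\<forall>f :: real ^ 'n \<Rightarrow> real.
        product_density f \<and> (f \<in> Lp_space p \<or> (\<forall>l. marginal l f \<in> Lp_space p)) \<longrightarrow>
          mixed_density A f \<in> Lp_space p \<and> marginal_product (mixed_density A f) \<in> Lp_space p)
     \<and>
     (\<forall>r k. admissible s r k \<longrightarrow>
        (\<exists>C::real. C > 0 \<and> (\<forall>f :: real ^ 'n \<Rightarrow> real. product_density f \<longrightarrow>
           (has_weak_derivs r f \<longleftrightarrow> has_weak_derivs r (mixed_density A f)) \<and>
           (has_weak_derivs r f \<longrightarrow>
              besov_J1 r k s p q (mixed_density A f) \<le> ennreal C * besov_J1 r k s p q f \<and>
              besov_J1 r k s p q f \<le> ennreal C * besov_J1 r k s p q (mixed_density A f) \<and>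
              besov_J2 r k s p q (mixed_density A f) \<le> ennreal C * besov_J2 r k s p q f \<and>
              besov_J2 r k s p q f \<le> ennreal C * besov_J2 r k s p q (mixed_density A f)))))
     \<and>
     (\<forall>r k. admissible s r k \<longrightarrow>
        (\<forall>f :: real ^ 'n \<Rightarrow> real. product_density f \<longrightarrow>
           (f \<in> besov_space r k s p q \<longleftrightarrow> mixed_density A f \<in> besov_space r k s p q)))"
proof -
  note p = assms(2) and q = assms(3) and A = assms(4)
  define B where "B = matrix_inv A"
  have AB: "A ** B = mat 1" and BA: "B ** A = mat 1"
    using someI_ex[OF A[unfolded invertible_def]] unfolding B_def matrix_inv_def by auto
  then have B: "invertible B" unfolding invertible_def by auto
  define \<kappa> where "\<kappa> = \<bar>det B\<bar>"
  have \<kappa>: "0 < \<kappa>" using B by (simp add: \<kappa>_def invertible_det_nz)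
  have g: "mixed_density A f = (\<lambda>x. \<kappa> * f (B *v x))" for f
    by (simp add: fun_eq_iff mixed_density_def B_def \<kappa>_def)
  \<comment> \<open>\<open>f\<close> arises from its mixed density through the inverse matrix and a
    scalar, so each estimate for linear maps also applies in the opposite direction.\<close>
  have f_eq: "f = (\<lambda>x. (1 / \<kappa>) * mixed_density A f (A *v x))" for f :: "real ^ 'n \<Rightarrow> real"
    unfolding g matrix_vector_mul_assoc BA using \<kappa> by simp
  have borel_lin: "(\<lambda>x. c * f (M *v x)) \<in> borel_measurable borel"
    if "f \<in> borel_measurable borel" for c and f :: "real ^ 'n \<Rightarrow> real" and M :: "real ^ 'n ^ 'n"
    using that linear_measurable_vec[of M] by measurable
  have Lp_lin: "(\<lambda>x. c * f (M *v x)) \<in> Lp_space p"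
    if f: "f \<in> Lp_space p" and M: "invertible M" for c and f :: "real ^ 'n \<Rightarrow> real" and M :: "real ^ 'n ^ 'n"
  proof -
    have fb: "f \<in> borel_measurable borel" and fp: "Lp_norm p f < \<infinity>" using f by (auto simp: Lp_space_def)
    have "Lp_norm p (\<lambda>x. c * f (M *v x)) \<le> ennreal \<bar>c\<bar> * Lp_norm p (\<lambda>x. f (M *v x))"
      using Lp_norm_cmult_le[OF p, of "\<lambda>x. f (M *v x)" c] borel_lin[OF fb, of 1 M] by simp
    also have "\<dots> \<le> ennreal \<bar>c\<bar> * (ennreal (max 1 (lin_scale M)) * Lp_norm p f)"
      by (intro mult_left_mono Lp_norm_linear_le[OF p M fb]) simp
    also have "\<dots> < \<infinity>" using fp by (simp add: ennreal_mult_less_top)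
    finally show ?thesis using borel_lin[OF fb] by (simp add: Lp_space_def)
  qed
  have Lp_iff: "f \<in> Lp_space p \<longleftrightarrow> mixed_density A f \<in> Lp_space p" for f
    using Lp_lin[OF _ B, of f \<kappa>] Lp_lin[OF _ A, of "mixed_density A f" "1 / \<kappa>"] f_eq[of f] unfolding g by metis
  have weak_iff: "has_weak_derivs r f \<longleftrightarrow> has_weak_derivs r (mixed_density A f)" for r f
    using has_weak_derivs_linear[OF B, of r f \<kappa>] has_weak_derivs_linear[OF A, of r "mixed_density A f" "1 / \<kappa>"] f_eq[of f]
    unfolding g by metis
  \<comment> \<open>Integrability of both densities is what \<open>J1_le_J2\<close> asks
    for.\<close>
  have int: "integrable lborel f" "integrable lborel (mixed_density A f)" if "product_density f" for f
  proof -
    have f: "f \<in> borel_measurable borel" "\<And>x. 0 \<le> f x" "(\<integral>\<^sup>+ x. ennreal (f x) \<partial>lborel) = 1"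
      using that by (auto simp: product_density_def prob_density_def)
    show *: "integrable lborel f" by (rule integrableI_nonneg) (use f in auto)
    show "integrable lborel (mixed_density A f)"
      unfolding g using integrable_linear_vec[OF B *] by simp
  qed
  have part_a: "mixed_density A f \<in> Lp_space p \<and> marginal_product (mixed_density A f) \<in> Lp_space p"
    if f: "product_density f" and fp: "f \<in> Lp_space p \<or> (\<forall>l. marginal l f \<in> Lp_space p)" for f
  proof -
    note F = product_density_factors[OF f]
    have fb: "f \<in> borel_measurable borel" using f by (simp add: product_density_def prob_density_def)
    \<comment> \<open>Both alternatives of the hypothesis lead to factors with finite norm: the
      second directly, the first through pairings with tensors.\<close>
    have Fp: "Lp_norm p (marginal l f) < \<infinity>" for l
      using fp Lp_factor[OF p f, of l] by (auto simp: Lp_space_def)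
    have "Lp_norm p f < \<infinity>"
      using Lp_norm_prod_finite[of p "\<lambda>l. marginal l f", OF p F(1) Fp] F(3)[symmetric] by simp
    then have "mixed_density A f \<in> Lp_space p"
      using fb Lp_iff[of f] by (simp add: Lp_space_def)
    moreover have gb: "mixed_density A f \<in> borel_measurable borel" unfolding g by (rule borel_lin[OF fb])
    note [measurable] = marginal_borel[OF gb]
    have "(\<lambda>x. \<Prod>l\<in>UNIV. marginal l (mixed_density A f) (x $ l)) \<in> borel_measurable borel" by measurable
    then have "marginal_product (mixed_density A f) \<in> Lp_space p"
      using Lp_norm_prod_finite[of p "\<lambda>l. marginal l (mixed_density A f)", OF p marginal_borel[OF gb] Lp_mixed_marginal[OF p f A Fp]]
      by (simp add: Lp_space_def marginal_product_def[abs_def])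
    ultimately show ?thesis by simp
  qed
  have part_b: "\<exists>C>0. \<forall>f. product_density f \<and> has_weak_derivs r f \<longrightarrow>
      besov_J1 r k s p q (mixed_density A f) \<le> ennreal C * besov_J1 r k s p q f \<and>
      besov_J1 r k s p q f \<le> ennreal C * besov_J1 r k s p q (mixed_density A f) \<and>
      besov_J2 r k s p q (mixed_density A f) \<le> ennreal C * besov_J2 r k s p q f \<and>
      besov_J2 r k s p q f \<le> ennreal C * besov_J2 r k s p q (mixed_density A f)"
    if adm: "admissible s r k" for r k
  proof -
    let ?J = "besov_J1 r k s p q :: (real ^ 'n \<Rightarrow> real) \<Rightarrow> ennreal" and ?K = "besov_J2 r k s p q :: (real ^ 'n \<Rightarrow> real) \<Rightarrow> ennreal"
    obtain C1 where C1: "0 < C1" "\<And>f. has_weak_derivs r f \<Longrightarrow> ?J (\<lambda>x. \<kappa> * f (B *v x)) \<le> ennreal C1 * ?J f"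
      using J1_linear_le[OF p q B, of r k s \<kappa>] by blast
    obtain C2 where C2: "0 < C2" "\<And>f. has_weak_derivs r f \<Longrightarrow> ?J (\<lambda>x. (1 / \<kappa>) * f (A *v x)) \<le> ennreal C2 * ?J f"
      using J1_linear_le[OF p q A, of r k s "1 / \<kappa>"] by blast
    obtain C3 where C3: "0 < C3" "\<And>f. has_weak_derivs r f \<Longrightarrow> ?K f \<le> ennreal C3 * ?J f"
      using J2_le_J1[OF p q, of r k s, where ?'n = 'n] by blast
    obtain C4 where C4: "0 < C4" "\<And>f. integrable lborel f \<Longrightarrow> has_weak_derivs r f \<Longrightarrow> ?J f \<le> ennreal C4 * ?K f"
      using J1_le_J2[OF p q adm, where ?'n = 'n] by blast
    \<comment> \<open>One constant for all four inequalities. Those for \<open>J''\<close> pass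
      through \<open>J'\<close>: \<open>C4\<close> leads from \<open>J''\<close> to
      \<open>J'\<close> of one function, \<open>C1\<close> or \<open>C2\<close> to \<open>J'\<close>
      of the other, and \<open>C3\<close> back to \<open>J''\<close>.\<close>
    define C where "C = C1 + C2 + C3 * (C1 * C4) + C3 * (C2 * C4)"
    have nn: "0 \<le> C3 * (C1 * C4)" "0 \<le> C3 * (C2 * C4)" using C1 C2 C3 C4 by auto
    have C: "0 < C" "C1 \<le> C" "C2 \<le> C" "C3 * (C1 * C4) \<le> C" "C3 * (C2 * C4) \<le> C"
      using C1(1) C2(1) nn by (auto simp: C_def)
    have weaken: "x \<le> ennreal C * y" if "x \<le> ennreal D * y" "D \<le> C" for x y D
      using that by (meson ennreal_leI mult_right_mono order_trans zero_le)
    have "?J (mixed_density A f) \<le> ennreal C * ?J f \<and> ?J f \<le> ennreal C * ?J (mixed_density A f) \<and>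
        ?K (mixed_density A f) \<le> ennreal C * ?K f \<and> ?K f \<le> ennreal C * ?K (mixed_density A f)"
      if f: "product_density f" and wf: "has_weak_derivs r f" for f
    proof (intro conjI)
      have wg: "has_weak_derivs r (mixed_density A f)" using wf weak_iff by simp
      have 1: "?J (mixed_density A f) \<le> ennreal C1 * ?J f" using C1(2)[OF wf] by (simp add: g)
      have 2: "?J f \<le> ennreal C2 * ?J (mixed_density A f)" using C2(2)[OF wg] f_eq[of f] by simp
      have 3: "?J f \<le> ennreal C4 * ?K f" by (rule C4(2)[OF int(1)[OF f] wf])
      have 4: "?J (mixed_density A f) \<le> ennreal C4 * ?K (mixed_density A f)" by (rule C4(2)[OF int(2)[OF f] wg])
      show "?J (mixed_density A f) \<le> ennreal C * ?J f" by (rule weaken[OF 1 C(2)])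
      show "?J f \<le> ennreal C * ?J (mixed_density A f)" by (rule weaken[OF 2 C(3)])
      have "?K (mixed_density A f) \<le> ennreal C3 * (ennreal C1 * (ennreal C4 * ?K f))"
        by (rule order_trans[OF C3(2)[OF wg]]) (intro mult_left_mono order_trans[OF 1] 3; simp)
      also have "\<dots> = ennreal (C3 * (C1 * C4)) * ?K f"
        using C1 C3 C4 by (simp add: ennreal_mult mult.assoc)
      finally show "?K (mixed_density A f) \<le> ennreal C * ?K f" by (rule weaken[OF _ C(4)])
      have "?K f \<le> ennreal C3 * (ennreal C2 * (ennreal C4 * ?K (mixed_density A f)))"
        by (rule order_trans[OF C3(2)[OF wf]]) (intro mult_left_mono order_trans[OF 2] 4; simp)
      also have "\<dots> = ennreal (C3 * (C2 * C4)) * ?K (mixed_density A f)"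
        using C2 C3 C4 by (simp add: ennreal_mult mult.assoc)
      finally show "?K f \<le> ennreal C * ?K (mixed_density A f)" by (rule weaken[OF _ C(5)])
    qed
    then show ?thesis using C(1) by blast
  qed
  \<comment> \<open>Membership asks for one of the two semi-norms to be finite, and each of them is
    transferred separately.\<close>
  have part_c: "f \<in> besov_space r k s p q \<longleftrightarrow> mixed_density A f \<in> besov_space r k s p q"
    if adm: "admissible s r k" and f: "product_density f" for r k f
  proof -
    obtain C where "has_weak_derivs r f \<Longrightarrow>
      besov_J1 r k s p q (mixed_density A f) \<le> ennreal C * besov_J1 r k s p q f \<and>
      besov_J1 r k s p q f \<le> ennreal C * besov_J1 r k s p q (mixed_density A f) \<and>
      besov_J2 r k s p q (mixed_density A f) \<le> ennreal C * besov_J2 r k s p q f \<and>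
      besov_J2 r k s p q f \<le> ennreal C * besov_J2 r k s p q (mixed_density A f)"
      using part_b[OF adm] f by blast
    moreover have "x < \<infinity>" if "x \<le> ennreal C * y" "y < \<infinity>" for x y
      using that by (auto simp: ennreal_mult_less_top intro: le_less_trans)
    ultimately show ?thesis unfolding besov_space_def mem_Collect_eq using Lp_iff[of f] weak_iff[of r f] by blast
  qed
  show ?thesis
  proof (intro conjI allI impI)
    fix f :: "real ^ 'n \<Rightarrow> real"
    assume "product_density f \<and> (f \<in> Lp_space p \<or> (\<forall>l. marginal l f \<in> Lp_space p))"
    then show "mixed_density A f \<in> Lp_space p" "marginal_product (mixed_density A f) \<in> Lp_space p"
      using part_a by blast+
  next
    fix r k assume "admissible s r k"
    from part_b[OF this] obtain C where C: "0 < C" "\<forall>f. product_density f \<and> has_weak_derivs r f \<longrightarrow>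
      besov_J1 r k s p q (mixed_density A f) \<le> ennreal C * besov_J1 r k s p q f \<and>
      besov_J1 r k s p q f \<le> ennreal C * besov_J1 r k s p q (mixed_density A f) \<and>
      besov_J2 r k s p q (mixed_density A f) \<le> ennreal C * besov_J2 r k s p q f \<and>
      besov_J2 r k s p q f \<le> ennreal C * besov_J2 r k s p q (mixed_density A f)"
      by blast
    show "\<exists>C>0. \<forall>f. product_density f \<longrightarrow>
       (has_weak_derivs r f \<longleftrightarrow> has_weak_derivs r (mixed_density A f)) \<and>
       (has_weak_derivs r f \<longrightarrow>
          besov_J1 r k s p q (mixed_density A f) \<le> ennreal C * besov_J1 r k s p q f \<and>
          besov_J1 r k s p q f \<le> ennreal C * besov_J1 r k s p q (mixed_density A f) \<and>
          besov_J2 r k s p q (mixed_density A f) \<le> ennreal C * besov_J2 r k s p q f \<and>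
          besov_J2 r k s p q f \<le> ennreal C * besov_J2 r k s p q (mixed_density A f))"
      by (rule exI[of _ C]) (use C weak_iff in simp)
  next
    fix r k and f :: "real ^ 'n \<Rightarrow> real" assume "admissible s r k" "product_density f"
    then show "f \<in> besov_space r k s p q \<longleftrightarrow> mixed_density A f \<in> besov_space r k s p q"
      by (rule part_c)
  qed
qed

end
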